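(* Let $\phi\in H^4(\mathcal{T}^*(\mathbb{Q}))$ be the unique class such that $\phi^\sharp(M)=p_1(M)$ (the first rational Pontrjagin class) for every manifold $M$; it generates $H^4(\mathcal{T}^*(\mathbb{Q}))\cong\mathbb{Q}$. Let $f\in\mathcal{T}^4(\mathbb{Q})$ be an arbitrary local formula representing $\phi$. Then the number $\mathrm{den}_l(f)$ is divisible by the least common multiple of the numbers $1,2,3,\ldots,l-3$ for every even $l\ge 10$.
   Context: All manifolds are closed piecewise linear (PL) manifolds (not necessarily orientable), and all triangulations are PL. A $k$-dimensional PL sphere is a simplicial complex PL homeomorphic to the boundary of a $(k+1)$-simplex; an $m$-dimensional combinatorial manifold is a finite simplicial complex in which the link of every $k$-simplex is an $(m-k-1)$-dimensional PL sphere. Isomorphisms of oriented complexes preserve orientation. For $n\ge 1$ let $\mathcal{T}_n$ be the set of isomorphism classes of oriented $(n-1)$-dimensional PL spheres; $-L$ denotes $L$ with the opposite orientation. For an abelian group $G$ and $n\ge1$, $\mathcal{T}^n(G)$ is the group of all functions $f:\mathcal{T}_n\to G$ with $f(-L)=-f(L)$ for all $L$; $\mathcal{T}^0(G)=G$ and $\mathcal{T}^{n}(G)=0$ for $n<0$. The differential $\delta:\mathcal{T}^n(G)\to\mathcal{T}^{n+1}(G)$ is $(\delta f)(L)=\sum_{v} f(\mathrm{Lk}\,v)$, the sum over all vertices $v$ of $L$, where $\mathrm{Lk}\,v$ has the orientation induced from $L$ (for $n=0$, $\delta=0$). A local formula is a cocycle of $\mathcal{T}^*(G)$. Let $K$ be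 an $m$-dimensional combinatorial manifold and $\widehat{G}$ the local system on $|K|$ with fiber $G$ twisted by the orientation. A coorientation of a simplex $\Delta$ is an orientation of $\mathrm{Lk}\,\Delta$; $m$-simplices are positively cooriented. $\widehat{C}_*(K;G)$ is the complex of cooriented simplicial chains, in which the incidence coefficient of $\tau^{k-1}\subset\sigma^k$ is $+1$ iff the orientation of $\mathrm{Lk}\,\sigma^k$ is induced by that of $\mathrm{Lk}\,\tau^{k-1}$; its homology is $H_*(|K|;\widehat{G})$. For $f\in\mathcal{T}^n(G)$ put $f_\sharp(K)=\sum_{\Delta^{m-n}\in K}f(\mathrm{Lk}\,\Delta^{m-n})\,\Delta^{m-n}$. If $f$ is a cocycle, $f_\sharp(K)$ is a cycle whose homology class depends only on $\psi=[f]$ and on $M=|K|$; $\psi^\sharp(M)\in H^n(M;G)$ denotes its Poincaré dual. $\mathcal{T}_{n,l}$ denotes the set of all oriented $(n-1)$-dimensional PL spheres (up to isomorphism) with not more than $l$ vertices. For a local formula $f\in\mathcal{T}^n(\mathbb{Q})$, $\mathrm{den}_l(f)$ is the least common multiple of the denominators (in lowest terms) of the values $f(L)$, $L\in\mathcal{T}_{n,l}$. *)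

theory Defs
  imports "HOL-Homology.Homology"
begin

section \<open>Complexes and PL topology\<close>

text \<open>
  Complexes are abstract, and the empty simplex belongs to each of them, so that links of facets
  are complexes: the link of a facet is \<open>{{}}\<close>, the sphere of dimension \<open>-1\<close>.
\<close>

definition finite_complex :: "'a set set \<Rightarrow> bool" where
  "finite_complex K \<longleftrightarrow>
     finite K \<and> {} \<in> K \<and> (\<forall>\<sigma>\<in>K. finite \<sigma> \<and> (\<forall>\<tau>. \<tau> \<subseteq> \<sigma> \<longrightarrow> \<tau> \<in> K))"

definition link :: "'a set set \<Rightarrow> 'a set \<Rightarrow> 'a set set" where
  "link K \<sigma> = {\<tau>. \<tau> \<inter> \<sigma> = {} \<and> \<tau> \<union> \<sigma> \<in> K}"

definition realization :: "'a set set \<Rightarrow> ('a \<Rightarrow> real) set" where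
  "realization K =
     {x. {v. x v \<noteq> 0} \<in> K \<and> (\<forall>v. 0 \<le> x v) \<and> (\<Sum>v | x v \<noteq> 0. x v) = 1}"

text \<open>
  A map on a compact polyhedron \<open>X\<close> is PL if \<open>X\<close> is a finite union of convex hulls of finite
  point sets on each of which the map is affine. (Function spaces carry no vector space
  structure in the library, hence the explicit coordinates.)
\<close>

definition weights :: "'p set \<Rightarrow> ('p \<Rightarrow> real) set" where
  "weights P = {t. (\<forall>p\<in>P. 0 \<le> t p) \<and> (\<Sum>p\<in>P. t p) = 1}"

definition combination :: "'p set \<Rightarrow> ('p \<Rightarrow> real) \<Rightarrow> ('p \<Rightarrow> 'b \<Rightarrow> real) \<Rightarrow> 'b \<Rightarrow> real" where
  "combination P t h = (\<lambda>i. \<Sum>p\<in>P. t p * h p i)"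

definition pl_map :: "('a \<Rightarrow> real) set \<Rightarrow> (('a \<Rightarrow> real) \<Rightarrow> ('b \<Rightarrow> real)) \<Rightarrow> bool" where
  "pl_map X h \<longleftrightarrow>
     (\<exists>\<P>. finite \<P> \<and> (\<forall>P\<in>\<P>. finite P) \<and>
        X = (\<Union>P\<in>\<P>. {combination P t (\<lambda>p. p) | t. t \<in> weights P}) \<and>
        (\<forall>P\<in>\<P>. \<forall>t\<in>weights P. h (combination P t (\<lambda>p. p)) = combination P t h))"

text \<open>The inverse of a bijective PL map between compact polyhedra is automatically PL.\<close>

definition pl_homeomorphic :: "'a set set \<Rightarrow> 'b set set \<Rightarrow> bool" where
  "pl_homeomorphic K L \<longleftrightarrow>
     (\<exists>h. pl_map (realization K) h \<and> bij_betw h (realization K) (realization L))"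

text \<open>PL spheres of dimension \<open>n - 1\<close>, with \<open>n = 0\<close> allowed.\<close>

definition pl_sphere :: "nat \<Rightarrow> nat set set \<Rightarrow> bool" where
  "pl_sphere n L \<longleftrightarrow> finite_complex L \<and> pl_homeomorphic L {\<sigma>. \<sigma> \<subset> {..n}}"

text \<open>A \<open>k\<close>-simplex has \<open>k + 1\<close> vertices and its link has dimension \<open>m - k - 1\<close>.\<close>

definition combinatorial_manifold :: "nat \<Rightarrow> nat set set \<Rightarrow> bool" where
  "combinatorial_manifold m K \<longleftrightarrow>
     finite_complex K \<and>
     (\<forall>\<sigma>\<in>K. \<sigma> \<noteq> {} \<longrightarrow> card \<sigma> \<le> m + 1 \<and> pl_sphere (m + 1 - card \<sigma>) (link K \<sigma>))"

section \<open>Orientations\<close>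

text \<open>
  An orientation of an \<open>(n - 1)\<close>-dimensional complex assigns a sign to every ordering
  \<open>v\<^sub>1, \<dots>, v\<^sub>n\<close> of every \<open>(n - 1)\<close>-simplex. It is alternating, and simplices with a common
  \<open>(n - 2)\<close>-face are oriented coherently: they induce opposite orientations on that face.
  For \<open>n = 0\<close> it is a sign attached to the empty list.
\<close>

type_synonym orient = "nat list \<Rightarrow> int"

definition orientation :: "nat \<Rightarrow> nat set set \<Rightarrow> orient \<Rightarrow> bool" where
  "orientation n L \<omega> \<longleftrightarrow>
     (\<forall>xs. \<omega> xs \<in> {-1, 0, 1}) \<and>
     (\<forall>xs. \<omega> xs \<noteq> 0 \<longleftrightarrow> length xs = n \<and> distinct xs \<and> set xs \<in> L) \<and>
     (\<forall>xs a b ys. \<omega> (xs @ a # b # ys) = - \<omega> (xs @ b # a # ys)) \<and>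
     (\<forall>a b xs. a \<noteq> b \<longrightarrow> \<omega> (a # xs) \<noteq> 0 \<longrightarrow> \<omega> (b # xs) \<noteq> 0 \<longrightarrow> \<omega> (b # xs) = - \<omega> (a # xs))"

definition opposite :: "orient \<Rightarrow> orient" where
  "opposite \<omega> = (\<lambda>xs. - \<omega> xs)"

definition induced :: "orient \<Rightarrow> nat \<Rightarrow> orient" where
  "induced \<omega> v = (\<lambda>xs. \<omega> (v # xs))"

type_synonym ocomplex = "nat set set \<times> orient"

definition oriented_sphere :: "nat \<Rightarrow> ocomplex \<Rightarrow> bool" where
  "oriented_sphere n L \<longleftrightarrow> pl_sphere n (fst L) \<and> orientation n (fst L) (snd L)"

definition oriented_iso :: "ocomplex \<Rightarrow> ocomplex \<Rightarrow> bool" where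
  "oriented_iso L L' \<longleftrightarrow>
     (\<exists>g. inj_on g (\<Union>(fst L)) \<and> fst L' = (\<lambda>\<sigma>. g ` \<sigma>) ` fst L \<and>
          (\<forall>xs. set xs \<subseteq> \<Union>(fst L) \<longrightarrow> snd L' (map g xs) = snd L xs))"

section \<open>Local formulae\<close>

text \<open>
  A function on isomorphism classes is an isomorphism-invariant function on oriented spheres,
  extended by \<open>0\<close> to all other arguments. For \<open>n = 0\<close> the oriented spheres are \<open>{{}}\<close> with
  either sign, which gives the group \<open>G\<close> itself, and the differential defined below vanishes in
  this degree.
\<close>

definition local_cochains :: "nat \<Rightarrow> (ocomplex \<Rightarrow> 'g::ab_group_add) set" where
  "local_cochains n =
     {f. (\<forall>L. \<not> oriented_sphere n L \<longrightarrow> f L = 0) \<and>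
         (\<forall>L L'. oriented_sphere n L \<and> oriented_sphere n L' \<and> oriented_iso L L' \<longrightarrow> f L = f L') \<and>
         (\<forall>L \<omega>. oriented_sphere n (L, \<omega>) \<longrightarrow> f (L, opposite \<omega>) = - f (L, \<omega>))}"

definition local_delta :: "nat \<Rightarrow> (ocomplex \<Rightarrow> 'g::ab_group_add) \<Rightarrow> ocomplex \<Rightarrow> 'g" where
  "local_delta n f L =
     (if oriented_sphere (Suc n) L
      then \<Sum>v\<in>\<Union>(fst L). f (link (fst L) {v}, induced (snd L) v) else 0)"

definition local_formulae :: "nat \<Rightarrow> (ocomplex \<Rightarrow> 'g::ab_group_add) set" where
  "local_formulae n = {f \<in> local_cochains n. local_delta n f = (\<lambda>_. 0)}"

definition local_coboundaries :: "nat \<Rightarrow> (ocomplex \<Rightarrow> 'g::ab_group_add) set" where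
  "local_coboundaries n =
     insert (\<lambda>_. 0) {local_delta k g | k g. n = Suc k \<and> g \<in> local_cochains k}"

definition local_cohomology :: "nat \<Rightarrow> (ocomplex \<Rightarrow> 'g::ab_group_add) set set" where
  "local_cohomology n =
     local_formulae n //
       {(f, f'). f \<in> local_formulae n \<and> f' \<in> local_formulae n \<and>
                 (\<lambda>L. f' L - f L) \<in> local_coboundaries n}"

definition den :: "nat \<Rightarrow> nat \<Rightarrow> (ocomplex \<Rightarrow> rat) \<Rightarrow> int" where
  "den n l f = Lcm {snd (quotient_of (f L)) | L. oriented_sphere n L \<and> card (\<Union>(fst L)) \<le> l}"

section \<open>Cooriented simplicial chains\<close>

text \<open>
  Chains on an \<open>m\<close>-dimensional combinatorial manifold are indexed by the codimension \<open>n\<close> of the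
  simplices. The coefficient of a simplex changes sign with its coorientation. The simplices of
  dimension \<open>m\<close> have link \<open>{{}}\<close> and are positively cooriented by the sign \<open>+1\<close>.
\<close>

definition cooriented_cell :: "nat \<Rightarrow> nat set set \<Rightarrow> nat \<Rightarrow> nat set \<times> orient \<Rightarrow> bool" where
  "cooriented_cell m K n c \<longleftrightarrow>
     fst c \<in> K \<and> fst c \<noteq> {} \<and> card (fst c) + n = m + 1 \<and>
     orientation n (link K (fst c)) (snd c)"

definition cooriented_chains ::
    "nat \<Rightarrow> nat set set \<Rightarrow> nat \<Rightarrow> (nat set \<times> orient \<Rightarrow> 'g::ab_group_add) set" where
  "cooriented_chains m K n =
     {z. (\<forall>c. \<not> cooriented_cell m K n c \<longrightarrow> z c = 0) \<and>
         (\<forall>\<sigma> \<omega>. cooriented_cell m K n (\<sigma>, \<omega>) \<longrightarrow> z (\<sigma>, opposite \<omega>) = - z (\<sigma>, \<omega>))}"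

text \<open>
  The boundary of a chain of codimension \<open>n\<close>: the coefficient of \<open>\<tau>\<close> cooriented by \<open>\<omega>\<close> is the
  sum of the coefficients of the simplices \<open>\<tau> \<union> {v}\<close>, whose link is the link of \<open>v\<close> in the link
  of \<open>\<tau>\<close>, with the coorientations induced by \<open>\<omega>\<close>.
\<close>

definition cooriented_boundary ::
    "nat \<Rightarrow> nat set set \<Rightarrow> nat \<Rightarrow> (nat set \<times> orient \<Rightarrow> 'g::ab_group_add)
       \<Rightarrow> nat set \<times> orient \<Rightarrow> 'g" where
  "cooriented_boundary m K n z c =
     (if cooriented_cell m K (Suc n) c
      then \<Sum>v\<in>\<Union>(link K (fst c)). z (insert v (fst c), induced (snd c) v) else 0)"

definition cooriented_cycles ::
    "nat \<Rightarrow> nat set set \<Rightarrow> nat \<Rightarrow> (nat set \<times> orient \<Rightarrow> 'g::ab_group_add) set" where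
  "cooriented_cycles m K n =
     {z \<in> cooriented_chains m K n. cooriented_boundary m K n z = (\<lambda>_. 0)}"

definition cooriented_boundaries ::
    "nat \<Rightarrow> nat set set \<Rightarrow> nat \<Rightarrow> (nat set \<times> orient \<Rightarrow> 'g::ab_group_add) set" where
  "cooriented_boundaries m K n =
     insert (\<lambda>_. 0)
       {cooriented_boundary m K k b | k b. n = Suc k \<and> b \<in> cooriented_chains m K k}"

definition cooriented_class ::
    "nat \<Rightarrow> nat set set \<Rightarrow> nat \<Rightarrow> (nat set \<times> orient \<Rightarrow> 'g::ab_group_add)
       \<Rightarrow> (nat set \<times> orient \<Rightarrow> 'g) set" where
  "cooriented_class m K n z =
     {z' \<in> cooriented_cycles m K n. (\<lambda>c. z' c - z c) \<in> cooriented_boundaries m K n}"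

definition sharp ::
    "nat \<Rightarrow> nat set set \<Rightarrow> nat \<Rightarrow> (ocomplex \<Rightarrow> 'g::ab_group_add) \<Rightarrow> nat set \<times> orient \<Rightarrow> 'g" where
  "sharp m K n f c = (if cooriented_cell m K n c then f (link K (fst c), snd c) else 0)"

text \<open>
  The homology class of \<open>sharp m K n f\<close> is the same for all representatives \<open>f\<close> of a class in
  \<open>local_cohomology n\<close>, so the union is this single homology class.
\<close>

definition sharp_class ::
    "nat \<Rightarrow> nat set set \<Rightarrow> nat \<Rightarrow> (ocomplex \<Rightarrow> 'g::ab_group_add) set
       \<Rightarrow> (nat set \<times> orient \<Rightarrow> 'g) set" where
  "sharp_class m K n \<psi> = (\<Union>f\<in>\<psi>. cooriented_class m K n (sharp m K n f))"

section \<open>Rational singular cohomology and Poincare duality\<close>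

type_synonym 'a scochain = "((nat \<Rightarrow> real) \<Rightarrow> 'a) \<Rightarrow> rat"

text \<open>Only the values of a cochain on singular simplices of the relevant dimension matter.\<close>

definition eval_cochain :: "'a scochain \<Rightarrow> 'a chain \<Rightarrow> rat" where
  "eval_cochain c x =
     (\<Sum>s\<in>Poly_Mapping.keys x. of_int (Poly_Mapping.lookup x s) * c s)"

definition singular_cocycles :: "nat \<Rightarrow> 'a topology \<Rightarrow> 'a scochain set" where
  "singular_cocycles n X =
     {c. \<forall>s. singular_simplex (Suc n) X s \<longrightarrow>
           eval_cochain c (chain_boundary (Suc n) (frag_of s)) = 0}"

definition singular_coboundaries :: "nat \<Rightarrow> 'a topology \<Rightarrow> 'a scochain set" where
  "singular_coboundaries n X =
     {c. \<exists>b. \<forall>s. singular_simplex n X s \<longrightarrow>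
           c s = eval_cochain b (chain_boundary n (frag_of s))}"

definition singular_cohomology :: "nat \<Rightarrow> 'a topology \<Rightarrow> 'a scochain set set" where
  "singular_cohomology n X =
     singular_cocycles n X //
       {(c, c'). c \<in> singular_cocycles n X \<and> c' \<in> singular_cocycles n X \<and>
                 (\<lambda>s. c' s - c s) \<in> singular_coboundaries n X}"

definition polyhedron :: "nat set set \<Rightarrow> (nat \<Rightarrow> real) topology" where
  "polyhedron K = subtopology (powertop_real UNIV) (realization K)"

definition barycenter :: "nat set \<Rightarrow> nat \<Rightarrow> real" where
  "barycenter \<sigma> = (\<lambda>v. if v \<in> \<sigma> then 1 / real (card \<sigma>) else 0)"

text \<open>
  The \<open>n\<close>-cell dual to a simplex of codimension \<open>n\<close> is the cone, with apex the barycenter of the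
  simplex, over the barycentric subdivision of the link. A coorientation \<open>\<omega>\<close> orients it (apex
  first). As a singular chain it is the sum, over all orderings \<open>v\<^sub>1, \<dots>, v\<^sub>n\<close> of facets of the
  link, of \<open>\<omega> [v\<^sub>1, \<dots>, v\<^sub>n]\<close> times the simplex spanned by the barycenters of
  \<open>\<sigma>, \<sigma> \<union> {v\<^sub>1}, \<dots>, \<sigma> \<union> {v\<^sub>1, \<dots>, v\<^sub>n}\<close>.
\<close>

definition dual_cell :: "nat \<Rightarrow> nat set \<times> orient \<Rightarrow> (nat \<Rightarrow> real) chain" where
  "dual_cell n c =
     (\<Sum>xs | snd c xs \<noteq> 0. frag_cmul (snd c xs)
        (frag_of (oriented_simplex n (\<lambda>j. barycenter (fst c \<union> set (take j xs))))))"

text \<open>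
  The boundary of the dual cell of \<open>(\<tau>, \<omega>)\<close> is the sum over the vertices \<open>v\<close> of the link of \<open>\<tau>\<close>
  of the dual cells of \<open>(\<tau> \<union> {v}, induced \<omega> v)\<close>. Hence restricting cochains to dual cells is a
  chain map (without signs) from singular cochains of degree \<open>n\<close> to cooriented chains of
  codimension \<open>n\<close>. The Poincare duality isomorphism \<open>H\<^sup>n(M) \<cong> H\<^sub>m\<^sub>-\<^sub>n(M)\<close>, with
  orientation-twisted coefficients on the right, is the map induced on homology.
\<close>

definition dual_restriction ::
    "nat \<Rightarrow> nat set set \<Rightarrow> nat \<Rightarrow> (nat \<Rightarrow> real) scochain \<Rightarrow> nat set \<times> orient \<Rightarrow> rat" where
  "dual_restriction m K n c d =
     (if cooriented_cell m K n d then eval_cochain c (dual_cell n d) else 0)"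

definition poincare_dual ::
    "nat \<Rightarrow> nat set set \<Rightarrow> nat \<Rightarrow> (nat \<Rightarrow> real) scochain set
       \<Rightarrow> (nat set \<times> orient \<Rightarrow> rat) set \<Rightarrow> bool" where
  "poincare_dual m K n u z \<longleftrightarrow>
     u \<in> singular_cohomology n (polyhedron K) \<and>
     (\<forall>c\<in>u. cooriented_class m K n (dual_restriction m K n c) = z)"

section \<open>The signature of an oriented 4-manifold\<close>

definition simplicial_cocycle2 :: "nat set set \<Rightarrow> (nat set \<Rightarrow> rat) \<Rightarrow> bool" where
  "simplicial_cocycle2 N a \<longleftrightarrow>
     (\<forall>v0 v1 v2 v3. v0 < v1 \<and> v1 < v2 \<and> v2 < v3 \<and> {v0, v1, v2, v3} \<in> N \<longrightarrow>
        a {v1, v2, v3} - a {v0, v2, v3} + a {v0, v1, v3} - a {v0, v1, v2} = 0)"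

text \<open>The cup square of \<open>a\<close>, by the front-face, back-face formula, on the fundamental cycle.\<close>

definition cup_square :: "nat set set \<Rightarrow> orient \<Rightarrow> (nat set \<Rightarrow> rat) \<Rightarrow> rat" where
  "cup_square N \<omega> a =
     (\<Sum>xs | length xs = 5 \<and> sorted_wrt (<) xs \<and> set xs \<in> N.
        of_int (\<omega> xs) * a (set (take 3 xs)) * a (set (drop 2 xs)))"

text \<open>
  The positive index of inertia: the largest number of cocycles spanning a subspace on which
  the form is positive definite. Coboundaries lie in the radical of the form, so that cocycles
  give the same index as cohomology classes. Reversing the orientation negates the form.
\<close>

definition positive_index :: "nat set set \<Rightarrow> orient \<Rightarrow> nat" where
  "positive_index N \<omega> =
     Max {p. \<exists>c. (\<forall>i<p. simplicial_cocycle2 N (c i)) \<and>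
               (\<forall>t. (\<exists>i<p. t i \<noteq> 0) \<longrightarrow> 0 < cup_square N \<omega> (\<lambda>\<sigma>. \<Sum>i<p. t i * c i \<sigma>))}"

definition signature :: "nat set set \<Rightarrow> orient \<Rightarrow> int" where
  "signature N \<omega> = int (positive_index N \<omega>) - int (positive_index N (opposite \<omega>))"

section \<open>The first rational Pontrjagin class of a PL manifold\<close>

definition vertex_point :: "nat \<Rightarrow> nat \<Rightarrow> real" where
  "vertex_point v = (\<lambda>i. if i = v then 1 else 0)"

definition fundamental_cycle :: "nat \<Rightarrow> nat set set \<Rightarrow> orient \<Rightarrow> (nat \<Rightarrow> real) chain" where
  "fundamental_cycle n N \<omega> =
     (\<Sum>xs | length xs = Suc n \<and> sorted_wrt (<) xs \<and> set xs \<in> N.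
        frag_cmul (\<omega> xs) (frag_of (oriented_simplex n (\<lambda>j. vertex_point (xs ! j)))))"

text \<open>
  Products live in \<open>nat + nat \<Rightarrow> real\<close>; the spaces \<open>\<real>\<^sup>k\<close> and \<open>D\<^sup>r = [-1, 1]\<^sup>r\<close> consist of
  sequences vanishing from the \<open>k\<close>-th, resp. \<open>r\<close>-th, entry on.
\<close>

definition product_space :: "(nat \<Rightarrow> real) set \<Rightarrow> (nat \<Rightarrow> real) set \<Rightarrow> (nat + nat \<Rightarrow> real) set" where
  "product_space X Y = {case_sum x y | x y. x \<in> X \<and> y \<in> Y}"

definition real_space :: "nat \<Rightarrow> (nat \<Rightarrow> real) set" where
  "real_space k = {y. \<forall>i\<ge>k. y i = 0}"

definition unit_cube :: "nat \<Rightarrow> (nat \<Rightarrow> real) set" where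
  "unit_cube r = {y \<in> real_space r. \<forall>i<r. -1 \<le> y i \<and> y i \<le> 1}"

text \<open>
  PL embeddings \<open>N \<times> D\<^sup>r \<rightarrow> |K| \<times> \<real>\<^sup>k\<close> of codimension \<open>0\<close>, that is, framed 4-dimensional
  submanifolds of \<open>|K| \<times> \<real>\<^sup>k\<close>.
\<close>

definition framed_embedding ::
    "nat \<Rightarrow> nat set set \<Rightarrow> nat \<Rightarrow> nat set set \<Rightarrow> nat \<Rightarrow> ((nat + nat \<Rightarrow> real) \<Rightarrow> (nat + nat \<Rightarrow> real)) \<Rightarrow> bool"
  where
  "framed_embedding m K k N r e \<longleftrightarrow>
     r + 4 = m + k \<and>
     pl_map (product_space (realization N) (unit_cube r)) e \<and>
     inj_on e (product_space (realization N) (unit_cube r)) \<and>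
     e ` product_space (realization N) (unit_cube r) \<subseteq> product_space (realization K) (real_space k)"

definition core_map :: "((nat + nat \<Rightarrow> real) \<Rightarrow> (nat + nat \<Rightarrow> real)) \<Rightarrow> (nat \<Rightarrow> real) \<Rightarrow> (nat \<Rightarrow> real)"
  where
  "core_map e x = (\<lambda>v. e (case_sum x (\<lambda>_. 0)) (Inl v))"

text \<open>
  The definition of Thom and of Rokhlin and Schwarz, with \<open>p\<^sub>1 = 3 L\<^sub>1\<close>: the value of \<open>L\<^sub>1\<close> on
  the image of \<open>[N]\<close> under \<open>N \<subseteq> |K| \<times> \<real>\<^sup>k \<rightarrow> |K|\<close> is the signature of \<open>N\<close>, for every closed
  oriented framed 4-dimensional submanifold \<open>N\<close>. The factor \<open>\<real>\<^sup>k\<close> makes the classes obtained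
  in this way span \<open>H\<^sub>4(|K|; \<rat>)\<close> in every dimension \<open>m\<close> (Serre; for nonorientable \<open>|K|\<close>
  apply this to the orientation double covering, whose rational homology maps onto that of
  \<open>|K|\<close>), so that at most one class \<open>u\<close> satisfies the condition.
\<close>

definition first_pontrjagin_class ::
    "nat \<Rightarrow> nat set set \<Rightarrow> (nat \<Rightarrow> real) scochain set \<Rightarrow> bool" where
  "first_pontrjagin_class m K u \<longleftrightarrow>
     u \<in> singular_cohomology 4 (polyhedron K) \<and>
     (\<forall>N \<omega> k r e.
        combinatorial_manifold 4 N \<and> orientation 5 N \<omega> \<and> framed_embedding m K k N r e \<longrightarrow>
        (\<forall>c\<in>u. eval_cochain c (chain_map 4 (core_map e) (fundamental_cycle 4 N \<omega>))
               = 3 * of_int (signature N \<omega>)))"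

end

theory Submission
  imports Defs "HOL-Library.Multiset"
begin

text \<open>
  A local formula \<open>f\<close> for the first Pontrjagin class is constrained in two ways: the values of \<open>f\<close>
  on the vertex links of an oriented 4-sphere add up to \<open>0\<close>, and those on the vertex links of an
  oriented 4-manifold to three times its signature. The first kind of relation determines, up to one
  scalar factor, the values of \<open>f\<close> on a family of 3-spheres with few vertices; the second kind fixes
  the factor; and then the denominators of these values are large.

  The family: join a circle with \<open>n = p + q\<close> vertices to the boundary of a triangle with vertices
  \<open>0, 1, 2\<close>. Choose two edges of the circle that divide it into arcs with \<open>p\<close> and \<open>q\<close> vertices and
  subdivide the simplices that the first edge spans with \<open>0\<close> and the second with \<open>0, 1\<close>. Let
  \<open>\<rho>(p, q)\<close> be the value of \<open>f\<close> on this sphere with \<open>n + 5\<close> vertices (\<open>two_arcs\<close>, \<open>rho\<close>). Reversing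
  the circle shows \<open>\<rho>(q, p) = - \<rho>(p, q)\<close>. To obtain relations, join the circle to the boundary of a
  tetrahedron \<open>0, 1, 2, 3\<close> and subdivide at three edges of the circle, together with \<open>0\<close>, with
  \<open>0, 1\<close> and with \<open>0, 1, 2\<close>. In this 4-sphere (\<open>starred4\<close>) all links outside the tetrahedron have an
  automorphism that reverses the orientation, hence value \<open>0\<close> (\<open>lk_starred4_zero\<close>). The links of \<open>0\<close>
  and \<open>3\<close> belong to the family. The links of \<open>1\<close> and \<open>2\<close> do not, but two different orders of the
  three edges share the link of \<open>1\<close>, and the difference of the two relations, summed cyclically over
  the three arcs, cancels the links of \<open>2\<close> as well. What remains is
  \<open>\<Sum> \<rho>(p, q + r + 1) = \<Sum> \<rho>(p, q + r)\<close>, where both sums run over the cyclic permutations of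
  \<open>p, q, r \<ge> 1\<close> (\<open>rho_cyclic\<close>). With the antisymmetry this forces
  \<open>\<rho>(p, n - p) = 210 \<rho>(2, 3) (n - 2 p) / (n (n + 1) (n + 2))\<close> for \<open>2 \<le> p \<le> n - 2\<close> (\<open>rho_formula\<close>).

  The factor: eleven explicit 4-spheres with at most eleven vertices give linear relations by which
  \<open>140 \<rho>(2, 3)\<close> equals, up to sign, the value of \<open>f\<close> on the vertex link of the triangulation of the
  complex projective plane with nine vertices. All vertex links of this triangulation are isomorphic
  and its signature is \<open>1\<close>, so that this value is \<open>3 / 9\<close> and \<open>\<rho>(2, 3) = \<plusminus> 1 / 420\<close>.

  Conclusion: for odd \<open>n = 2 p + 1\<close> one finds \<open>\<rho>(p, p + 1) = \<plusminus> 1 / (2 n (n + 1) (n + 2))\<close>. Hence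
  \<open>2 n (n + 1) (n + 2)\<close> divides \<open>den 4 l f\<close> for all odd \<open>n\<close> with \<open>5 \<le> n \<le> l - 5\<close>, and, \<open>l\<close> being
  even, each of \<open>1, \<dots>, l - 3\<close> divides one of these numbers.

  Two tools make this rigorous. All spheres in the proof arise from the boundary of a simplex by
  stellar subdivisions and their inverses, which do not change the PL type
  (\<open>pl_homeomorphic_stellar\<close>); they are represented by lists of signed ordered facets, on which
  subdivision, links and isomorphisms are computable. And for a closed oriented 4-manifold the sum
  of the cells dual to all vertices is homologous to the fundamental cycle, which turns the
  hypothesis on \<open>p\<^sub>1\<close> into the statement on the sum over the vertices
  (\<open>sum_over_vertices_signature\<close>).
\<close>

section \<open>Polytopes of nonnegative solutions\<close>

definition hull_of :: "('a \<Rightarrow> real) set \<Rightarrow> ('a \<Rightarrow> real) set" where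
  "hull_of P = {combination P t (\<lambda>p. p) | t. t \<in> weights P}"

text \<open>
  Weights on \<open>E\<close> are transported along \<open>\<phi>\<close>; fibres are summed, since \<open>\<phi>\<close> need not be injective.
\<close>

definition push :: "'e set \<Rightarrow> ('e \<Rightarrow> 'r) \<Rightarrow> ('e \<Rightarrow> real) \<Rightarrow> 'r \<Rightarrow> real" where
  "push E \<phi> u = (\<lambda>r. \<Sum>e\<in>{e\<in>E. \<phi> e = r}. u e)"

lemma push_weights:
  assumes "finite E" "u \<in> weights E"
  shows "push E \<phi> u \<in> weights (\<phi> ` E)"
  using assms sum.image_gen[of E u \<phi>]
  by (auto simp: weights_def push_def intro!: sum_nonneg)

lemma combination_push:
  assumes fin: "finite E"
  shows "combination (\<phi> ` E) (push E \<phi> u) h = combination E u (\<lambda>e. h (\<phi> e))"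
proof
  fix i
  have "combination E u (\<lambda>e. h (\<phi> e)) i = (\<Sum>e\<in>E. u e * h (\<phi> e) i)"
    by (simp add: combination_def)
  also have "\<dots> = (\<Sum>r\<in>\<phi> ` E. \<Sum>e\<in>{e\<in>E. \<phi> e = r}. u e * h (\<phi> e) i)"
    by (rule sum.image_gen[OF fin])
  also have "\<dots> = (\<Sum>r\<in>\<phi> ` E. push E \<phi> u r * h r i)"
    by (intro sum.cong) (auto simp: push_def sum_distrib_right)
  finally show "combination (\<phi> ` E) (push E \<phi> u) h i = combination E u (\<lambda>e. h (\<phi> e)) i"
    by (simp add: combination_def)
qed

text \<open>
  For a set \<open>S\<close> of solutions of linear equations in nonnegative unknowns these are the vertices of
  the polytope \<open>S\<close>: the solutions of minimal support.
\<close>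

definition basic_solutions :: "('i \<Rightarrow> real) set \<Rightarrow> ('i \<Rightarrow> real) set" where
  "basic_solutions S = {x\<in>S. \<forall>y\<in>S. {i. y i \<noteq> 0} \<subseteq> {i. x i \<noteq> 0} \<longrightarrow> y = x}"

definition nonneg_solutions :: "'i set \<Rightarrow> ('j \<Rightarrow> 'i \<Rightarrow> real) \<Rightarrow> ('j \<Rightarrow> real) \<Rightarrow> ('i \<Rightarrow> real) set" where
  "nonneg_solutions I a b =
     {x. (\<forall>i\<in>I. 0 \<le> x i) \<and> (\<forall>i. i \<notin> I \<longrightarrow> x i = 0) \<and> (\<forall>j. (\<Sum>i\<in>I. a j i * x i) = b j)}"

text \<open>
  A basic solution is determined by its support.
\<close>

lemma finite_basic_solutions:
  assumes "finite I"
  shows "finite (basic_solutions (nonneg_solutions I a b))"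
proof (rule finite_imageD)
  let ?s = "\<lambda>x::'i \<Rightarrow> real. {i. x i \<noteq> 0}"
  show "inj_on ?s (basic_solutions (nonneg_solutions I a b))"
    by (auto simp: inj_on_def basic_solutions_def)
  have "?s ` basic_solutions (nonneg_solutions I a b) \<subseteq> Pow I"
    by (auto simp: basic_solutions_def nonneg_solutions_def)
  then show "finite (?s ` basic_solutions (nonneg_solutions I a b))"
    using assms finite_subset by blast
qed

text \<open>
  Moving along a direction with a negative entry until the first coordinate vanishes.
\<close>

lemma step_to_boundary:
  fixes x d :: "'i \<Rightarrow> real"
  assumes fin: "finite I" and x: "x \<in> nonneg_solutions I a b"
    and d0: "\<And>i. x i = 0 \<Longrightarrow> d i = 0"
    and dj: "\<And>j. (\<Sum>i\<in>I. a j i * d i) = 0"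
    and neg: "d k < 0"
  obtains s where "0 < s" "(\<lambda>i. x i + s * d i) \<in> nonneg_solutions I a b"
    "{i. x i + s * d i \<noteq> 0} \<subset> {i. x i \<noteq> 0}"
proof -
  let ?N = "{i\<in>I. d i < 0}"
  have out: "\<And>i. i \<notin> I \<Longrightarrow> x i = 0" and nn: "\<And>i. i \<in> I \<Longrightarrow> 0 \<le> x i"
    and eq: "\<And>j. (\<Sum>i\<in>I. a j i * x i) = b j"
    using x by (auto simp: nonneg_solutions_def)
  have "k \<in> I"
  proof (rule ccontr)
    assume "k \<notin> I"
    then have "d k = 0" using d0 out by blast
    then show False using neg by simp
  qed
  then have kI: "k \<in> ?N" using neg by simp
  have finN: "finite ?N" using fin by simp
  define s where "s = Min ((\<lambda>i. x i / - d i) ` ?N)"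
  have "s \<in> (\<lambda>i. x i / - d i) ` ?N"
    unfolding s_def using finN kI by (intro Min_in) auto
  then obtain m where m: "m \<in> ?N" "s = x m / - d m" by auto
  have le: "s \<le> x i / - d i" if "i \<in> ?N" for i
    unfolding s_def using finN that by (intro Min_le) auto
  have "0 < x m" using m d0[of m] nn[of m] by fastforce
  then have s0: "0 < s" using m by (simp add: divide_pos_neg)
  have pos: "0 \<le> x i + s * d i" if i: "i \<in> I" for i
  proof (cases "d i < 0")
    case True
    then have "s \<le> x i / - d i" using le i by blast
    then have "s * - d i \<le> x i" using pos_le_divide_eq[of "- d i" s "x i"] True by linarith
    then show ?thesis by simp
  next
    case False then show ?thesis using nn[OF i] s0 by simp
  qed
  show ?thesis
  proof
    show "0 < s" by fact
    show "(\<lambda>i. x i + s * d i) \<in> nonneg_solutions I a b"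
    proof -
      have "(\<Sum>i\<in>I. a j i * (x i + s * d i)) = b j" for j
      proof -
        have "(\<Sum>i\<in>I. a j i * (x i + s * d i)) = (\<Sum>i\<in>I. a j i * x i) + s * (\<Sum>i\<in>I. a j i * d i)"
          by (simp add: algebra_simps sum.distrib sum_distrib_left)
        then show ?thesis using eq dj by simp
      qed
      then show ?thesis using pos out d0 by (auto simp: nonneg_solutions_def)
    qed
    have "x m + s * d m = 0" using m by (simp add: field_simps)
    moreover have "x m \<noteq> 0" using \<open>0 < x m\<close> by simp
    moreover have "{i. x i + s * d i \<noteq> 0} \<subseteq> {i. x i \<noteq> 0}" using d0 by auto
    ultimately show "{i. x i + s * d i \<noteq> 0} \<subset> {i. x i \<noteq> 0}" by blast
  qed
qed

lemma combination_mix: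
  "combination E (\<lambda>e. \<alpha> * u e + \<beta> * w e) h = (\<lambda>i. \<alpha> * combination E u h i + \<beta> * combination E w h i)"
  by (rule ext) (simp add: combination_def sum.distrib sum_distrib_left algebra_simps)

text \<open>
  Bounded polytopes are spanned by their vertices. A solution that is not basic can be moved in two
  opposite directions until its support shrinks, and it lies between the two end points. The
  equation \<open>j0\<close>, which makes all solutions have the same coordinate sum, provides boundedness.
\<close>

lemma solution_combination:
  fixes a :: "'j \<Rightarrow> 'i \<Rightarrow> real"
  assumes fin: "finite I" and one: "\<And>i. i \<in> I \<Longrightarrow> a j0 i = 1"
    and x: "x \<in> nonneg_solutions I a b"
  shows "\<exists>u\<in>weights (basic_solutions (nonneg_solutions I a b)).
           x = combination (basic_solutions (nonneg_solutions I a b)) u (\<lambda>y. y)"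
  using x
proof (induction "card {i. x i \<noteq> 0}" arbitrary: x rule: less_induct)
  case less
  let ?S = "nonneg_solutions I a b" let ?E = "basic_solutions ?S"
  have finE: "finite ?E" by (rule finite_basic_solutions[OF fin])
  show ?case
  proof (cases "x \<in> ?E")
    case True
    let ?u = "\<lambda>y. if y = x then 1 else (0::real)"
    have "?u \<in> weights ?E" using True finE by (auto simp: weights_def)
    moreover have "combination ?E ?u (\<lambda>y. y) = x"
    proof
      fix i
      have "(\<Sum>y\<in>?E. ?u y * y i) = (\<Sum>y\<in>?E. if y = x then x i else 0)"
        by (intro sum.cong) auto
      then show "combination ?E ?u (\<lambda>y. y) i = x i"
        using True finE by (simp add: combination_def)
    qed
    ultimately show ?thesis by (intro bexI[of _ ?u]) simp_all
  next
    case False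
    then obtain y where y: "y \<in> ?S" "{i. y i \<noteq> 0} \<subseteq> {i. x i \<noteq> 0}" "y \<noteq> x"
      using less.prems by (auto simp: basic_solutions_def)
    define d where "d = (\<lambda>i. y i - x i)"
    have xI: "{i. x i \<noteq> 0} \<subseteq> I" using less.prems by (auto simp: nonneg_solutions_def)
    then have finx: "finite {i. x i \<noteq> 0}" using fin finite_subset by blast
    have d0: "\<And>i. x i = 0 \<Longrightarrow> d i = 0" using y by (auto simp: d_def)
    have dj: "(\<Sum>i\<in>I. a j i * d i) = 0" for j
      using less.prems y(1) by (simp add: d_def right_diff_distrib sum_subtractf nonneg_solutions_def)
    have dI: "\<And>i. i \<notin> I \<Longrightarrow> d i = 0" using less.prems y(1) by (auto simp: d_def nonneg_solutions_def)
    have sd: "(\<Sum>i\<in>I. d i) = 0" using dj[of j0] one by (simp cong: sum.cong)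
    obtain k where k: "d k \<noteq> 0" using y(3) by (auto simp: d_def fun_eq_iff)
    have kI: "k \<in> I" using k dI by blast
    have "\<exists>k. d k < 0"
    proof (rule ccontr)
      assume "\<not> ?thesis" then have "\<forall>i\<in>I. 0 \<le> d i" by (auto simp: not_less)
      then have "\<forall>i\<in>I. d i = 0" using sd fin sum_nonneg_eq_0_iff[of I d] by auto
      then show False using k kI by auto
    qed
    then obtain k1 where k1: "d k1 < 0" ..
    have "\<exists>k. 0 < d k"
    proof (rule ccontr)
      assume "\<not> ?thesis" then have "\<forall>i\<in>I. d i \<le> 0" by (auto simp: not_less)
      then have "\<forall>i\<in>I. - d i = 0" using sd fin sum_nonneg_eq_0_iff[of I "\<lambda>i. - d i"]
        by (auto simp: sum_negf)
      then show False using k kI by auto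
    qed
    then obtain k2 where k2: "0 < d k2" ..
    obtain s where s: "0 < s" "(\<lambda>i. x i + s * d i) \<in> ?S"
      "{i. x i + s * d i \<noteq> 0} \<subset> {i. x i \<noteq> 0}"
      using step_to_boundary[OF fin less.prems d0 dj k1] by blast
    obtain t where t: "0 < t" "(\<lambda>i. x i + t * - d i) \<in> ?S"
      "{i. x i + t * - d i \<noteq> 0} \<subset> {i. x i \<noteq> 0}"
    proof (rule step_to_boundary[OF fin less.prems, of "\<lambda>i. - d i" k2])
      show "- d i = 0" if "x i = 0" for i using d0 that by simp
      show "(\<Sum>i\<in>I. a j i * - d i) = 0" for j using dj[of j] by (simp add: sum_negf)
      show "- d k2 < 0" using k2 by simp
    qed blast
    obtain u where u: "u \<in> weights ?E" "(\<lambda>i. x i + s * d i) = combination ?E u (\<lambda>y. y)"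
      using less.hyps[OF _ s(2)] psubset_card_mono[OF finx s(3)] by auto
    obtain w where w: "w \<in> weights ?E" "(\<lambda>i. x i + t * - d i) = combination ?E w (\<lambda>y. y)"
      using less.hyps[OF _ t(2)] psubset_card_mono[OF finx t(3)] by auto
    let ?v = "\<lambda>e. t / (s + t) * u e + s / (s + t) * w e"
    have st: "s + t > 0" using s t by simp
    have "(\<Sum>e\<in>?E. ?v e) = t / (s + t) * (\<Sum>e\<in>?E. u e) + s / (s + t) * (\<Sum>e\<in>?E. w e)"
      by (simp only: sum.distrib sum_distrib_left)
    also have "\<dots> = 1" using u(1) w(1) st by (simp add: weights_def add_divide_distrib[symmetric])
    finally have "?v \<in> weights ?E"
      using u(1) w(1) s(1) t(1) by (simp add: weights_def)
    moreover have "combination ?E ?v (\<lambda>y. y) = x"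
    proof
      fix i
      have "combination ?E ?v (\<lambda>y. y) i = t / (s + t) * (x i + s * d i) + s / (s + t) * (x i + t * - d i)"
        unfolding combination_mix u(2)[symmetric] w(2)[symmetric] ..
      also have "\<dots> = (t * (x i + s * d i) + s * (x i + t * - d i)) / (s + t)"
        by (simp add: add_divide_distrib)
      also have "t * (x i + s * d i) + s * (x i + t * - d i) = (s + t) * x i"
        by (simp add: algebra_simps)
      also have "(s + t) * x i / (s + t) = x i" using st by simp
      finally show "combination ?E ?v (\<lambda>y. y) i = x i" .
    qed
    ultimately show ?thesis by (intro bexI[of _ ?v]) simp_all
  qed
qed

section \<open>Composition and inversion of PL maps\<close>

lemma pl_map_alt:
  "pl_map X h \<longleftrightarrow> (\<exists>\<P>. finite \<P> \<and> (\<forall>P\<in>\<P>. finite P) \<and> X = (\<Union>P\<in>\<P>. hull_of P) \<and>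
     (\<forall>P\<in>\<P>. \<forall>t\<in>weights P. h (combination P t (\<lambda>p. p)) = combination P t h))"
  by (simp add: pl_map_def hull_of_def)

lemma combination_nested:
  assumes "finite P"
  shows "combination R w (\<lambda>r. combination P (t r) h) = combination P (\<lambda>p. \<Sum>r\<in>R. w r * t r p) h"
proof
  fix i
  have "(\<Sum>r\<in>R. w r * (\<Sum>p\<in>P. t r p * h p i)) = (\<Sum>p\<in>P. \<Sum>r\<in>R. w r * t r p * h p i)"
    by (subst sum.swap) (simp add: sum_distrib_left mult.assoc)
  then show "combination R w (\<lambda>r. combination P (t r) h) i
      = combination P (\<lambda>p. \<Sum>r\<in>R. w r * t r p) h i"
    by (simp add: combination_def sum_distrib_right)
qed

lemma weights_nested:
  assumes fin: "finite P" and w: "w \<in> weights R" and t: "\<And>r. r \<in> R \<Longrightarrow> t r \<in> weights P"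
  shows "(\<lambda>p. \<Sum>r\<in>R. w r * t r p) \<in> weights P"
proof -
  have "(\<Sum>p\<in>P. \<Sum>r\<in>R. w r * t r p) = (\<Sum>r\<in>R. w r * (\<Sum>p\<in>P. t r p))"
    by (subst sum.swap) (simp add: sum_distrib_left)
  also have "\<dots> = (\<Sum>r\<in>R. w r * 1)" using t by (intro sum.cong) (auto simp: weights_def)
  also have "\<dots> = 1" using w by (simp add: weights_def)
  finally show ?thesis using w t by (auto simp: weights_def intro!: sum_nonneg)
qed

text \<open>
  The part of a linear piece that is mapped into a linear piece of the next map is again the hull of
  finitely many points: pairs of weight vectors \<open>(t, s)\<close> on \<open>P\<close> and \<open>Q\<close> with the same image point
  form a polytope of nonnegative solutions, and its vertices yield the points \<open>R\<close>.
\<close>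

lemma pl_map_compose_piece:
  fixes P :: "('a \<Rightarrow> real) set" and Q :: "('b \<Rightarrow> real) set"
    and h :: "('a \<Rightarrow> real) \<Rightarrow> 'b \<Rightarrow> real" and g :: "('b \<Rightarrow> real) \<Rightarrow> 'c \<Rightarrow> real"
  assumes finP: "finite P" and finQ: "finite Q"
    and h: "\<And>t. t \<in> weights P \<Longrightarrow> h (combination P t (\<lambda>p. p)) = combination P t h"
    and g: "\<And>t. t \<in> weights Q \<Longrightarrow> g (combination Q t (\<lambda>p. p)) = combination Q t g"
  shows "\<exists>R. finite R \<and> hull_of R = {x \<in> hull_of P. h x \<in> hull_of Q} \<and>
     (\<forall>w\<in>weights R. g (h (combination R w (\<lambda>p. p))) = combination R w (\<lambda>x. g (h x)))"
proof -
  define I where "I = Inl ` P \<union> Inr ` Q"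
  \<comment> \<open>The equations: \<open>Inl\<close> for equality of the image points, \<open>Some\<close> for weights of sum \<open>1\<close> on \<open>P\<close> and \<open>Q\<close>,
    \<open>None\<close> for the resulting sum \<open>2\<close> of all unknowns.\<close>
  define a :: "'b + bool option \<Rightarrow> ('a \<Rightarrow> real) + ('b \<Rightarrow> real) \<Rightarrow> real" where
    "a = (\<lambda>j i. case j of Inl k \<Rightarrow> (case i of Inl p \<Rightarrow> h p k | Inr q \<Rightarrow> - q k)
            | Inr None \<Rightarrow> 1
            | Inr (Some True) \<Rightarrow> (case i of Inl p \<Rightarrow> 1 | Inr q \<Rightarrow> 0)
            | Inr (Some False) \<Rightarrow> (case i of Inl p \<Rightarrow> 0 | Inr q \<Rightarrow> 1))"
  define b :: "'b + bool option \<Rightarrow> real" where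
    "b = (\<lambda>j. case j of Inl k \<Rightarrow> 0 | Inr None \<Rightarrow> 2 | Inr (Some _) \<Rightarrow> 1)"
  define E where "E = basic_solutions (nonneg_solutions I a b)"
  have finI: "finite I" using finP finQ by (simp add: I_def)
  have finE: "finite E" unfolding E_def by (rule finite_basic_solutions[OF finI])
  have split: "(\<Sum>i\<in>I. F i) = (\<Sum>p\<in>P. F (Inl p)) + (\<Sum>q\<in>Q. F (Inr q))"
    for F :: "('a \<Rightarrow> real) + ('b \<Rightarrow> real) \<Rightarrow> real"
    unfolding I_def using finP finQ by (subst sum.union_disjoint) (auto simp: sum.reindex inj_on_def)
  have sol: "x \<in> nonneg_solutions I a b \<longleftrightarrow>
      (\<lambda>p. x (Inl p)) \<in> weights P \<and> (\<lambda>q. x (Inr q)) \<in> weights Q \<and> (\<forall>i. i \<notin> I \<longrightarrow> x i = 0) \<and>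
      combination P (\<lambda>p. x (Inl p)) h = combination Q (\<lambda>q. x (Inr q)) (\<lambda>q. q)" (is "?l \<longleftrightarrow> ?r") for x
  proof
    assume ?l
    then have nn: "\<forall>i\<in>I. 0 \<le> x i" and out: "\<forall>i. i \<notin> I \<longrightarrow> x i = 0"
      and eq: "\<And>j. (\<Sum>i\<in>I. a j i * x i) = b j" by (auto simp: nonneg_solutions_def)
    have "(\<Sum>p\<in>P. x (Inl p)) = 1" using eq[of "Inr (Some True)"] by (simp add: split a_def b_def)
    moreover have "(\<Sum>p\<in>Q. x (Inr p)) = 1" using eq[of "Inr (Some False)"] by (simp add: split a_def b_def)
    moreover have "(\<Sum>p\<in>P. x (Inl p) * h p k) = (\<Sum>q\<in>Q. x (Inr q) * q k)" for k
      using eq[of "Inl k"] by (simp add: split a_def b_def sum_negf mult.commute)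
    ultimately show ?r using nn out by (auto simp: weights_def combination_def I_def)
  next
    assume r: ?r
    then have e: "(\<Sum>p\<in>P. x (Inl p) * h p k) = (\<Sum>q\<in>Q. x (Inr q) * q k)" for k
      by (simp add: combination_def fun_eq_iff)
    have "(\<Sum>i\<in>I. a j i * x i) = b j" for j
    proof (cases j)
      case (Inl k)
      then show ?thesis using e[of k] by (simp add: split a_def b_def sum_negf mult.commute)
    next
      case (Inr v)
      consider "v = None" | "v = Some True" | "v = Some False" by (metis option.exhaust)
      then show ?thesis
        by cases (use r Inr in \<open>simp_all add: split a_def b_def weights_def\<close>)
    qed
    then show ?l using r by (auto simp: nonneg_solutions_def weights_def I_def)
  qed
  define \<phi> where "\<phi> = (\<lambda>x::('a \<Rightarrow> real) + ('b \<Rightarrow> real) \<Rightarrow> real. combination P (\<lambda>p. x (Inl p)) (\<lambda>p. p))"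
  have ES: "x \<in> nonneg_solutions I a b" if "x \<in> E" for x
    using that by (simp add: E_def basic_solutions_def)
  define R where "R = \<phi> ` E"
  have finR: "finite R" by (simp add: R_def finE)
  have "\<forall>r\<in>R. \<exists>e\<in>E. \<phi> e = r" by (auto simp: R_def)
  then obtain c where c: "\<And>r. r \<in> R \<Longrightarrow> c r \<in> E" "\<And>r. r \<in> R \<Longrightarrow> \<phi> (c r) = r" by metis
  have cP: "(\<lambda>p. c r (Inl p)) \<in> weights P" and cQ: "(\<lambda>q. c r (Inr q)) \<in> weights Q"
    and ceq: "combination P (\<lambda>p. c r (Inl p)) h = combination Q (\<lambda>q. c r (Inr q)) (\<lambda>q. q)" if "r \<in> R" for r
    using ES[OF c(1)[OF that]] unfolding sol by blast+
  have hr: "h r = combination Q (\<lambda>q. c r (Inr q)) (\<lambda>q. q)" if "r \<in> R" for r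
    using h[OF cP[OF that]] c(2)[OF that] ceq[OF that] by (simp add: \<phi>_def)
  have key: "combination R w (\<lambda>p. p) \<in> hull_of P"
    "h (combination R w (\<lambda>p. p)) \<in> hull_of Q"
    "g (h (combination R w (\<lambda>p. p))) = combination R w (\<lambda>x. g (h x))" if w: "w \<in> weights R" for w
  proof -
    let ?t = "\<lambda>p. \<Sum>r\<in>R. w r * c r (Inl p)" and ?s = "\<lambda>q. \<Sum>r\<in>R. w r * c r (Inr q)"
    have t: "?t \<in> weights P" by (rule weights_nested[OF finP w cP])
    have s: "?s \<in> weights Q" by (rule weights_nested[OF finQ w cQ])
    have "combination R w (\<lambda>p. p) = combination R w (\<lambda>r. combination P (\<lambda>p. c r (Inl p)) (\<lambda>p. p))"
      unfolding combination_def[of R] using c(2) by (intro ext sum.cong) (simp_all add: \<phi>_def)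
    also have "\<dots> = combination P ?t (\<lambda>p. p)" by (rule combination_nested[OF finP])
    finally have 1: "combination R w (\<lambda>p. p) = combination P ?t (\<lambda>p. p)" .
    then show "combination R w (\<lambda>p. p) \<in> hull_of P" using t by (auto simp: hull_of_def)
    have "h (combination R w (\<lambda>p. p)) = combination P ?t h" using h[OF t] 1 by simp
    also have "\<dots> = combination R w (\<lambda>r. combination P (\<lambda>p. c r (Inl p)) h)"
      by (rule combination_nested[OF finP, symmetric])
    also have "\<dots> = combination R w (\<lambda>r. combination Q (\<lambda>q. c r (Inr q)) (\<lambda>q. q))"
      unfolding combination_def[of R] using ceq by (intro ext sum.cong) simp_all
    also have "\<dots> = combination Q ?s (\<lambda>q. q)" by (rule combination_nested[OF finQ])
    finally have 2: "h (combination R w (\<lambda>p. p)) = combination Q ?s (\<lambda>q. q)" .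
    then show "h (combination R w (\<lambda>p. p)) \<in> hull_of Q" using s by (auto simp: hull_of_def)
    have "g (h (combination R w (\<lambda>p. p))) = combination Q ?s g" using g[OF s] 2 by simp
    also have "\<dots> = combination R w (\<lambda>r. combination Q (\<lambda>q. c r (Inr q)) g)"
      by (rule combination_nested[OF finQ, symmetric])
    also have "\<dots> = combination R w (\<lambda>r. g (h r))"
      unfolding combination_def[of R] using hr g[OF cQ] by (intro ext sum.cong) simp_all
    finally show "g (h (combination R w (\<lambda>p. p))) = combination R w (\<lambda>x. g (h x))" .
  qed
  have "x \<in> hull_of R" if x: "x \<in> hull_of P" "h x \<in> hull_of Q" for x
  proof -
    obtain t where t: "t \<in> weights P" "x = combination P t (\<lambda>p. p)" using x by (auto simp: hull_of_def)
    obtain s where s: "s \<in> weights Q" "h x = combination Q s (\<lambda>q. q)" using x by (auto simp: hull_of_def)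
    define z where "z = (\<lambda>i. if i \<in> I then (case i of Inl p \<Rightarrow> t p | Inr q \<Rightarrow> s q) else 0)"
    have zt: "combination P (\<lambda>p. z (Inl p)) k = combination P t k" for k :: "('a \<Rightarrow> real) \<Rightarrow> 'd \<Rightarrow> real"
      by (auto simp: combination_def z_def I_def intro!: sum.cong)
    have zt': "combination P (\<lambda>p. z (Inl p)) k = combination P t k" for k :: "('a \<Rightarrow> real) \<Rightarrow> 'b \<Rightarrow> real"
      by (auto simp: combination_def z_def I_def intro!: sum.cong)
    have zs: "combination Q (\<lambda>p. z (Inr p)) k = combination Q s k" for k :: "('b \<Rightarrow> real) \<Rightarrow> 'b \<Rightarrow> real"
      by (auto simp: combination_def z_def I_def intro!: sum.cong)
    have zw: "(\<lambda>p. z (Inl p)) \<in> weights P" "(\<lambda>p. z (Inr p)) \<in> weights Q"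
      using t(1) s(1) by (auto simp: weights_def z_def I_def cong: sum.cong)
    have "z \<in> nonneg_solutions I a b"
      unfolding sol using zw zt' zs h[OF t(1)] t(2) s(2) by (auto simp: z_def)
    then obtain u where u: "u \<in> weights E" "z = combination E u (\<lambda>y. y)"
      using solution_combination[OF finI, of a "Inr None" z b] by (auto simp: a_def E_def)
    have "x = combination P (\<lambda>p. \<Sum>e\<in>E. u e * e (Inl p)) (\<lambda>p. p)"
    proof -
      have "(\<lambda>p. z (Inl p)) = (\<lambda>p. \<Sum>e\<in>E. u e * e (Inl p))"
        by (subst u(2)) (simp add: combination_def)
      moreover have "x = combination P (\<lambda>p. z (Inl p)) (\<lambda>p. p)"
        unfolding t(2) by (auto simp: combination_def z_def I_def intro!: sum.cong)
      ultimately show ?thesis by simp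
    qed
    also have "\<dots> = combination E u \<phi>"
      unfolding \<phi>_def by (rule combination_nested[OF finP, symmetric])
    also have "\<dots> = combination R (push E \<phi> u) (\<lambda>p. p)"
      unfolding R_def by (rule combination_push[OF finE, symmetric])
    finally show ?thesis using push_weights[OF finE u(1)] by (auto simp: hull_of_def R_def)
  qed
  then have "hull_of R = {x \<in> hull_of P. h x \<in> hull_of Q}"
    using key(1,2) by (auto simp: hull_of_def) 
  then show ?thesis using finR key(3) by blast
qed

lemma pl_map_compose:
  assumes h: "pl_map X h" and g: "pl_map Y g" and sub: "h ` X \<subseteq> Y"
  shows "pl_map X (\<lambda>x. g (h x))"
proof -
  obtain \<P> where P: "finite \<P>" "\<And>P. P \<in> \<P> \<Longrightarrow> finite P" "X = (\<Union>P\<in>\<P>. hull_of P)"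
    "\<And>P t. P \<in> \<P> \<Longrightarrow> t \<in> weights P \<Longrightarrow> h (combination P t (\<lambda>p. p)) = combination P t h"
    using h unfolding pl_map_alt by blast
  obtain \<Q> where Q: "finite \<Q>" "\<And>P. P \<in> \<Q> \<Longrightarrow> finite P" "Y = (\<Union>P\<in>\<Q>. hull_of P)"
    "\<And>P t. P \<in> \<Q> \<Longrightarrow> t \<in> weights P \<Longrightarrow> g (combination P t (\<lambda>p. p)) = combination P t g"
    using g unfolding pl_map_alt by blast
  have "\<forall>z\<in>\<P> \<times> \<Q>. \<exists>R. finite R \<and> hull_of R = {x \<in> hull_of (fst z). h x \<in> hull_of (snd z)} \<and>
     (\<forall>w\<in>weights R. g (h (combination R w (\<lambda>p. p))) = combination R w (\<lambda>x. g (h x)))"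
  proof
    fix z assume "z \<in> \<P> \<times> \<Q>"
    then have z: "fst z \<in> \<P>" "snd z \<in> \<Q>" by auto
    show "\<exists>R. finite R \<and> hull_of R = {x \<in> hull_of (fst z). h x \<in> hull_of (snd z)} \<and>
        (\<forall>w\<in>weights R. g (h (combination R w (\<lambda>p. p))) = combination R w (\<lambda>x. g (h x)))"
      by (rule pl_map_compose_piece[OF P(2)[OF z(1)] Q(2)[OF z(2)] P(4)[OF z(1)] Q(4)[OF z(2)]])
  qed
  then obtain R where R0: "\<forall>z\<in>\<P> \<times> \<Q>. finite (R z) \<and>
     hull_of (R z) = {x \<in> hull_of (fst z). h x \<in> hull_of (snd z)} \<and>
     (\<forall>w\<in>weights (R z). g (h (combination (R z) w (\<lambda>p. p))) = combination (R z) w (\<lambda>x. g (h x)))"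
    by (drule_tac bchoice) (erule exE)
  have Rz: "finite (R z) \<and> hull_of (R z) = {x \<in> hull_of (fst z). h x \<in> hull_of (snd z)} \<and>
      (\<forall>w\<in>weights (R z). g (h (combination (R z) w (\<lambda>p. p))) = combination (R z) w (\<lambda>x. g (h x)))"
    if "z \<in> \<P> \<times> \<Q>" for z
    using R0 that by (rule bspec)
  note R = Rz[THEN conjunct1] Rz[THEN conjunct2, THEN conjunct1]
    Rz[THEN conjunct2, THEN conjunct2, THEN bspec]
  have "X = (\<Union>P\<in>R ` (\<P> \<times> \<Q>). hull_of P)"
  proof (intro equalityI subsetI)
    fix x assume x: "x \<in> X"
    then have "h x \<in> Y" using sub by blast
    then obtain A B where AB: "A \<in> \<P>" "x \<in> hull_of A" "B \<in> \<Q>" "h x \<in> hull_of B"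
      using x P(3) Q(3) by blast
    then have "x \<in> hull_of (R (A, B))" using R(2)[of "(A, B)"] by simp
    then show "x \<in> (\<Union>P\<in>R ` (\<P> \<times> \<Q>). hull_of P)" using AB by blast
  next
    fix x assume "x \<in> (\<Union>P\<in>R ` (\<P> \<times> \<Q>). hull_of P)"
    then obtain z where z: "z \<in> \<P> \<times> \<Q>" "x \<in> hull_of (R z)" by blast
    then have "x \<in> hull_of (fst z)" using R(2)[OF z(1)] by simp
    then show "x \<in> X" using z(1) P(3) by auto
  qed
  then show ?thesis
    unfolding pl_map_alt using P(1) Q(1) R(1,3)
    by (intro exI[of _ "R ` (\<P> \<times> \<Q>)"] conjI ballI) (auto simp del: split_paired_All)
qed

text \<open>
  On each piece the inverse is affine on the image of the piece, which is the hull of the images of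
  the generating points.
\<close>

lemma pl_map_inverse:
  assumes h: "pl_map X h" and inj: "inj_on h X"
  shows "pl_map (h ` X) (inv_into X h)"
proof -
  obtain \<P> where P: "finite \<P>" "\<And>P. P \<in> \<P> \<Longrightarrow> finite P" "X = (\<Union>P\<in>\<P>. hull_of P)"
    "\<And>P t. P \<in> \<P> \<Longrightarrow> t \<in> weights P \<Longrightarrow> h (combination P t (\<lambda>p. p)) = combination P t h"
    using h unfolding pl_map_alt by blast
  have PX: "p \<in> X" if "P \<in> \<P>" "p \<in> P" for P p
  proof -
    let ?t = "\<lambda>q. if q = p then 1 else (0::real)"
    have "?t \<in> weights P" using that P(2) by (auto simp: weights_def)
    moreover have "combination P ?t (\<lambda>p. p) = p"
    proof
      fix i
      have "(\<Sum>q\<in>P. ?t q * q i) = (\<Sum>q\<in>P. if q = p then p i else 0)" by (intro sum.cong) auto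
      then show "combination P ?t (\<lambda>p. p) i = p i" using that P(2) by (simp add: combination_def)
    qed
    ultimately have "p \<in> hull_of P" unfolding hull_of_def by force
    then show ?thesis using P(3) that by auto
  qed
  have img': "combination (h ` P) w k = combination P (\<lambda>p. w (h p)) (\<lambda>p. k (h p))"
    if "P \<in> \<P>" for P w and k :: "('b \<Rightarrow> real) \<Rightarrow> 'b \<Rightarrow> real"
  proof -
    have "inj_on h P" using inj PX[OF that] by (auto simp: inj_on_def)
    then show ?thesis by (auto simp: combination_def sum.reindex)
  qed
  have img'': "combination (h ` P) w k = combination P (\<lambda>p. w (h p)) (\<lambda>p. k (h p))"
    if "P \<in> \<P>" for P w and k :: "('b \<Rightarrow> real) \<Rightarrow> 'a \<Rightarrow> real"
  proof -
    have "inj_on h P" using inj PX[OF that] by (auto simp: inj_on_def)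
    then show ?thesis by (auto simp: combination_def sum.reindex)
  qed
  have wts: "(\<lambda>p. w (h p)) \<in> weights P \<longleftrightarrow> w \<in> weights (h ` P)" if "P \<in> \<P>" for P w
  proof -
    have "inj_on h P" using inj PX[OF that] by (auto simp: inj_on_def)
    then show ?thesis by (auto simp: weights_def sum.reindex)
  qed
  have hull: "hull_of (h ` P) = h ` hull_of P" if PP: "P \<in> \<P>" for P
  proof
    show "hull_of (h ` P) \<subseteq> h ` hull_of P"
    proof
      fix y assume "y \<in> hull_of (h ` P)"
      then obtain w where w: "w \<in> weights (h ` P)" "y = combination (h ` P) w (\<lambda>p. p)"
        by (auto simp: hull_of_def)
      have t: "(\<lambda>p. w (h p)) \<in> weights P" using w(1) wts[OF PP] by simp
      have "y = h (combination P (\<lambda>p. w (h p)) (\<lambda>p. p))"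
        unfolding w(2) img'[OF PP] P(4)[OF PP t] ..
      then show "y \<in> h ` hull_of P" using t unfolding hull_of_def by blast
    qed
    show "h ` hull_of P \<subseteq> hull_of (h ` P)"
    proof
      fix y assume "y \<in> h ` hull_of P"
      then obtain t where t: "t \<in> weights P" "y = h (combination P t (\<lambda>p. p))"
        unfolding hull_of_def by blast
      then have "y = combination P t h" using P(4)[OF PP] by simp
      then have "y = combination (h ` P) (push P h t) (\<lambda>p. p)"
        by (simp add: combination_push[OF P(2)[OF PP]])
      then show "y \<in> hull_of (h ` P)"
        using push_weights[OF P(2)[OF PP] t(1), of h] unfolding hull_of_def by blast
    qed
  qed
  have "inv_into X h (combination (h ` P) w (\<lambda>p. p)) = combination (h ` P) w (inv_into X h)"
    if PP: "P \<in> \<P>" and w: "w \<in> weights (h ` P)" for P w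
  proof -
    let ?t = "\<lambda>p. w (h p)"
    have t: "?t \<in> weights P" using w wts[OF PP] by simp
    have "combination P ?t (\<lambda>p. p) \<in> X" using t P(3) PP by (auto simp: hull_of_def)
    then have "inv_into X h (h (combination P ?t (\<lambda>p. p))) = combination P ?t (\<lambda>p. p)"
      by (rule inv_into_f_f[OF inj])
    then have "inv_into X h (combination (h ` P) w (\<lambda>p. p)) = combination P ?t (\<lambda>p. p)"
      unfolding P(4)[OF PP t] img'[OF PP] .
    also have "\<dots> = combination P ?t (\<lambda>p. inv_into X h (h p))"
      using inj PX[OF PP] by (auto simp: combination_def inv_into_f_f intro!: sum.cong)
    also have "\<dots> = combination (h ` P) w (inv_into X h)" by (rule img''[OF PP, symmetric])
    finally show ?thesis .
  qed
  moreover have "h ` X = (\<Union>P\<in>(`) h ` \<P>. hull_of P)" using hull P(3) by auto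
  ultimately show ?thesis
    unfolding pl_map_alt using P(1,2)
    by (intro exI[of _ "(`) h ` \<P>"] conjI ballI) auto
qed

lemma pl_homeomorphic_sym: "pl_homeomorphic K L \<Longrightarrow> pl_homeomorphic L K"
  unfolding pl_homeomorphic_def by (metis bij_betw_def bij_betw_inv_into pl_map_inverse)

lemma pl_homeomorphic_trans:
  assumes "pl_homeomorphic K L" "pl_homeomorphic L M"
  shows "pl_homeomorphic K M"
proof -
  obtain h g where h: "pl_map (realization K) h" "bij_betw h (realization K) (realization L)"
    and g: "pl_map (realization L) g" "bij_betw g (realization L) (realization M)"
    using assms unfolding pl_homeomorphic_def by blast
  have "pl_map (realization K) (\<lambda>x. g (h x))"
    using pl_map_compose[OF h(1) g(1)] h(2) by (auto simp: bij_betw_def)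
  moreover have "bij_betw (\<lambda>x. g (h x)) (realization K) (realization M)"
    using bij_betw_trans[OF h(2) g(2)] by (simp add: comp_def)
  ultimately show ?thesis unfolding pl_homeomorphic_def by blast
qed

section \<open>Stellar subdivisions and PL type\<close>

lemma finite_complexD:
  assumes "finite_complex K"
  shows "finite K" "{} \<in> K" "\<And>\<sigma>. \<sigma> \<in> K \<Longrightarrow> finite \<sigma>" "\<And>\<sigma> \<tau>. \<sigma> \<in> K \<Longrightarrow> \<tau> \<subseteq> \<sigma> \<Longrightarrow> \<tau> \<in> K"
    "finite (\<Union>K)"
  using assms by (auto simp: finite_complex_def)

lemma sum_support:
  fixes x :: "'a \<Rightarrow> real"
  assumes "finite S" "{v. x v \<noteq> 0} \<subseteq> S"
  shows "(\<Sum>v | x v \<noteq> 0. x v) = sum x S"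
  using assms by (intro sum.mono_neutral_left) auto

lemma realizationI:
  assumes "finite_complex K" "\<sigma> \<in> K" "{v. x v \<noteq> 0} \<subseteq> \<sigma>" "\<And>v. 0 \<le> x v" "sum x \<sigma> = 1"
  shows "x \<in> realization K"
  using assms finite_complexD(3,4)[OF assms(1)] sum_support[of \<sigma> x]
  by (auto simp: realization_def)

lemma realizationD:
  assumes "finite_complex K" "x \<in> realization K"
  shows "{v. x v \<noteq> 0} \<in> K" "\<And>v. 0 \<le> x v" "\<And>S. finite S \<Longrightarrow> {v. x v \<noteq> 0} \<subseteq> S \<Longrightarrow> sum x S = 1"
proof -
  have x: "{v. x v \<noteq> 0} \<in> K" "\<forall>v. 0 \<le> x v" "(\<Sum>v | x v \<noteq> 0. x v) = 1"
    using assms(2) by (simp_all add: realization_def)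
  show "{v. x v \<noteq> 0} \<in> K" "\<And>v. 0 \<le> x v" using x by auto
  show "sum x S = 1" if "finite S" "{v. x v \<noteq> 0} \<subseteq> S" for S
    using sum_support[OF that] x(3) by simp
qed

lemma realization_hulls:
  assumes K: "finite_complex K"
  shows "realization K = (\<Union>\<sigma>\<in>K. hull_of (vertex_point ` \<sigma>))"
proof -
  have inj: "inj_on vertex_point S" for S
    by (rule inj_onI) (auto simp: vertex_point_def fun_eq_iff split: if_splits)
  have val: "combination (vertex_point ` \<sigma>) t (\<lambda>p. p) = (\<lambda>v. if v \<in> \<sigma> then t (vertex_point v) else 0)"
    if "finite \<sigma>" for \<sigma> t
  proof
    fix v
    have "combination (vertex_point ` \<sigma>) t (\<lambda>p. p) v = (\<Sum>u\<in>\<sigma>. t (vertex_point u) * vertex_point u v)"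
      by (simp add: combination_def sum.reindex[OF inj])
    also have "\<dots> = (\<Sum>u\<in>\<sigma>. if u = v then t (vertex_point v) else 0)"
      by (intro sum.cong) (auto simp: vertex_point_def)
    finally show "combination (vertex_point ` \<sigma>) t (\<lambda>p. p) v = (if v \<in> \<sigma> then t (vertex_point v) else 0)"
      using that by simp
  qed
  show ?thesis
  proof (intro equalityI subsetI)
    fix x assume x: "x \<in> realization K"
    let ?\<sigma> = "{v. x v \<noteq> 0}"
    note xD = realizationD[OF K x]
    have fin: "finite ?\<sigma>" using finite_complexD(3)[OF K xD(1)] .
    define t where "t = (\<lambda>p. x (inv_into ?\<sigma> vertex_point p))"
    have t: "t (vertex_point v) = x v" if "v \<in> ?\<sigma>" for v
      using that by (simp add: t_def inv_into_f_f[OF inj])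
    have "t \<in> weights (vertex_point ` ?\<sigma>)"
      using xD(2) xD(3)[OF fin] t by (auto simp: weights_def sum.reindex[OF inj])
    moreover have "x = combination (vertex_point ` ?\<sigma>) t (\<lambda>p. p)"
      unfolding val[OF fin] using t by (auto simp: fun_eq_iff)
    ultimately have "x \<in> hull_of (vertex_point ` ?\<sigma>)" unfolding hull_of_def by blast
    then show "x \<in> (\<Union>\<sigma>\<in>K. hull_of (vertex_point ` \<sigma>))" using xD(1) by blast
  next
    fix x assume "x \<in> (\<Union>\<sigma>\<in>K. hull_of (vertex_point ` \<sigma>))"
    then obtain \<sigma> t where st: "\<sigma> \<in> K" "t \<in> weights (vertex_point ` \<sigma>)"
      "x = combination (vertex_point ` \<sigma>) t (\<lambda>p. p)" by (auto simp: hull_of_def)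
    have fin: "finite \<sigma>" using finite_complexD(3)[OF K st(1)] .
    have x: "x = (\<lambda>v. if v \<in> \<sigma> then t (vertex_point v) else 0)" using st(3) val[OF fin] by simp
    show "x \<in> realization K"
    proof (rule realizationI[OF K st(1)])
      show "{v. x v \<noteq> 0} \<subseteq> \<sigma>" by (auto simp: x)
      show "0 \<le> x v" for v using st(2) by (auto simp: x weights_def)
      show "sum x \<sigma> = 1" using st(2) by (simp add: x weights_def sum.reindex[OF inj])
    qed
  qed
qed

lemma pl_map_linear:
  fixes K :: "nat set set"
  assumes K: "finite_complex K"
    and h: "\<And>P t. finite P \<Longrightarrow> h (combination P t (\<lambda>p. p)) = combination P t h"
  shows "pl_map (realization K) h"
  unfolding pl_map_alt
proof (intro exI[of _ "(\<lambda>\<sigma>. vertex_point ` \<sigma>) ` K"] conjI ballI)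
  show "finite ((\<lambda>\<sigma>. vertex_point ` \<sigma>) ` K)" using finite_complexD(1)[OF K] by simp
  show "realization K = \<Union> (hull_of ` (\<lambda>\<sigma>. vertex_point ` \<sigma>) ` K)"
    using realization_hulls[OF K] by auto
  fix P assume "P \<in> (\<lambda>\<sigma>. vertex_point ` \<sigma>) ` K"
  then show "finite P" using finite_complexD(3)[OF K] by auto
  then show "h (combination P t (\<lambda>p. p)) = combination P t h" for t by (rule h)
qed

lemma pl_homeomorphic_refl:
  fixes K :: "nat set set"
  assumes "finite_complex K" shows "pl_homeomorphic K K"
proof -
  have "pl_map (realization K) (\<lambda>x. x)" by (rule pl_map_linear[OF assms]) simp
  then show ?thesis unfolding pl_homeomorphic_def by (intro exI[of _ "\<lambda>x. x"]) (simp add: bij_betw_def)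
qed

lemma finite_complex_image:
  assumes "finite_complex K" shows "finite_complex ((`) g ` K)"
proof -
  have "\<tau> \<in> (`) g ` K" if s: "\<sigma> \<in> K" and t: "\<tau> \<subseteq> g ` \<sigma>" for \<sigma> \<tau>
  proof -
    obtain \<rho> where "\<rho> \<subseteq> \<sigma>" "\<tau> = g ` \<rho>" using t by (meson subset_imageE)
    then show ?thesis using finite_complexD(4)[OF assms s] by blast
  qed
  then show ?thesis using assms by (auto simp: finite_complex_def)
qed

lemma pl_homeomorphic_image:
  fixes K :: "nat set set" and g :: "nat \<Rightarrow> nat"
  assumes K: "finite_complex K" and g: "inj_on g (\<Union>K)"
  shows "pl_homeomorphic ((`) g ` K) K"
proof -
  let ?V = "\<Union>K" and ?L = "(`) g ` K"
  have L: "finite_complex ?L" by (rule finite_complex_image[OF K])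
  let ?h = "\<lambda>y v. if v \<in> ?V then y (g v) else (0::real)"
  let ?k = "\<lambda>z w. if w \<in> g ` ?V then z (inv_into ?V g w) else (0::real)"
  have kg: "inv_into ?V g (g v) = v" if "v \<in> ?V" for v using inv_into_f_f[OF g that] .
  have gsum: "sum y (g ` \<sigma>) = sum (\<lambda>v. y (g v)) \<sigma>" if "\<sigma> \<in> K" for \<sigma> and y :: "nat \<Rightarrow> real"
  proof -
    have "inj_on g \<sigma>" using that by (intro inj_on_subset[OF g]) auto
    then show ?thesis by (simp add: sum.reindex)
  qed
  have "bij_betw ?h (realization ?L) (realization K)"
  proof (rule bij_betw_byWitness[of _ ?k])
    have sup: "\<exists>\<sigma>\<in>K. {w. y w \<noteq> 0} = g ` \<sigma>" if "y \<in> realization ?L" for y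
      using realizationD(1)[OF L that] by auto
    show "\<forall>y\<in>realization ?L. ?k (?h y) = y"
    proof
      fix y assume "y \<in> realization ?L"
      then obtain \<sigma> where s: "\<sigma> \<in> K" "{w. y w \<noteq> 0} = g ` \<sigma>" using sup by blast
      have out: "y w = 0" if "w \<notin> g ` ?V" for w using s that by blast
      show "?k (?h y) = y"
      proof
        fix w
        show "?k (?h y) w = y w"
        proof (cases "w \<in> g ` ?V")
          case True
          then obtain v where v: "v \<in> ?V" "w = g v" by blast
          then show ?thesis using kg[OF v(1)] by simp
        qed (simp add: out)
      qed
    qed
    have sup0: "z v = 0" if "z \<in> realization K" "v \<notin> ?V" for z v
      using realizationD(1)[OF K that(1)] that(2) by auto
    show "\<forall>z\<in>realization K. ?h (?k z) = z"
      using sup0 kg by (auto simp: fun_eq_iff)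
    show "?h ` realization ?L \<subseteq> realization K"
    proof (rule image_subsetI)
      fix y assume y: "y \<in> realization ?L"
      then obtain \<sigma> where s: "\<sigma> \<in> K" "{w. y w \<noteq> 0} = g ` \<sigma>" using sup by blast
      have fin: "finite \<sigma>" using finite_complexD(3)[OF K s(1)] .
      show "?h y \<in> realization K"
      proof (rule realizationI[OF K s(1)])
        show "{v. ?h y v \<noteq> 0} \<subseteq> \<sigma>"
        proof
          fix v assume "v \<in> {v. ?h y v \<noteq> 0}"
          then have v: "v \<in> ?V" "y (g v) \<noteq> 0" by (auto split: if_splits)
          then obtain u where "u \<in> \<sigma>" "g v = g u" using s(2) by blast
          then show "v \<in> \<sigma>" using g v(1) s(1) by (auto simp: inj_on_def)
        qed
        show "0 \<le> ?h y v" for v using realizationD(2)[OF L y] by simp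
        have "sum (?h y) \<sigma> = sum (\<lambda>v. y (g v)) \<sigma>" using s(1) by (intro sum.cong) auto
        then show "sum (?h y) \<sigma> = 1"
          using gsum[OF s(1), of y] realizationD(3)[OF L y, of "g ` \<sigma>"] s(2) fin by simp
      qed
    qed
    show "?k ` realization K \<subseteq> realization ?L"
    proof (rule image_subsetI)
      fix z assume z: "z \<in> realization K"
      let ?\<sigma> = "{v. z v \<noteq> 0}"
      have s: "?\<sigma> \<in> K" by (rule realizationD(1)[OF K z])
      have fin: "finite ?\<sigma>" using finite_complexD(3)[OF K s] .
      show "?k z \<in> realization ?L"
      proof (rule realizationI[OF L, of "g ` ?\<sigma>"])
        show "g ` ?\<sigma> \<in> ?L" using s by blast
        show "{w. ?k z w \<noteq> 0} \<subseteq> g ` ?\<sigma>"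
        proof
          fix w assume "w \<in> {w. ?k z w \<noteq> 0}"
          then have w: "w \<in> g ` ?V" "z (inv_into ?V g w) \<noteq> 0" by (simp_all split: if_splits)
          have "g (inv_into ?V g w) = w" by (rule f_inv_into_f[OF w(1)])
          then show "w \<in> g ` ?\<sigma>" using w(2) by (metis (mono_tags) imageI mem_Collect_eq)
        qed
        show "0 \<le> ?k z v" for v using realizationD(2)[OF K z] by simp
        have "sum (?k z) (g ` ?\<sigma>) = sum z ?\<sigma>"
          unfolding gsum[OF s]
        proof (rule sum.cong)
          fix v assume "v \<in> ?\<sigma>"
          then have v: "v \<in> ?V" using s by blast
          then show "?k z (g v) = z v" unfolding kg[OF v] by simp
        qed simp
        then show "sum (?k z) (g ` ?\<sigma>) = 1" using realizationD(3)[OF K z fin] by simp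
      qed
    qed
  qed
  moreover have "pl_map (realization ?L) ?h"
    by (rule pl_map_linear[OF L]) (auto simp: combination_def fun_eq_iff)
  ultimately show ?thesis unfolding pl_homeomorphic_def by blast
qed

lemma pl_sphere_image:
  assumes "pl_sphere n K" "inj_on g (\<Union>K)"
  shows "pl_sphere n ((`) g ` K)"
proof -
  have K: "finite_complex K" "pl_homeomorphic K {\<sigma>. \<sigma> \<subset> {..n}}" using assms(1) by (simp_all add: pl_sphere_def)
  show ?thesis
    unfolding pl_sphere_def
    by (rule conjI[OF finite_complex_image[OF K(1)]
          pl_homeomorphic_trans[OF pl_homeomorphic_image[OF K(1) assms(2)] K(2)]])
qed

lemma finite_complex_proper_subsets: "finite V \<Longrightarrow> V \<noteq> {} \<Longrightarrow> finite_complex {\<sigma>. \<sigma> \<subset> V}"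
  by (auto simp: finite_complex_def finite_subset intro: rev_finite_subset[of "Pow V"])

lemma image_proper_subsets:
  assumes "inj_on g V" shows "(`) g ` {\<sigma>. \<sigma> \<subset> V} = {\<sigma>. \<sigma> \<subset> g ` V}"
proof (intro equalityI subsetI)
  fix \<tau> assume "\<tau> \<in> (`) g ` {\<sigma>. \<sigma> \<subset> V}"
  then obtain \<sigma> where s: "\<sigma> \<subset> V" "\<tau> = g ` \<sigma>" by auto
  then have "g ` \<sigma> \<noteq> g ` V" using inj_on_image_eq_iff[OF assms, of \<sigma> V] by auto
  then show "\<tau> \<in> {\<sigma>. \<sigma> \<subset> g ` V}" using s by blast
next
  fix \<tau> assume "\<tau> \<in> {\<sigma>. \<sigma> \<subset> g ` V}"
  then have t: "\<tau> \<subseteq> g ` V" "\<tau> \<noteq> g ` V" by auto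
  then obtain \<sigma> where "\<sigma> \<subseteq> V" "\<tau> = g ` \<sigma>" by (meson subset_imageE)
  then show "\<tau> \<in> (`) g ` {\<sigma>. \<sigma> \<subset> V}" using t by blast
qed

lemma pl_sphere_simplex_boundary:
  assumes "finite V" "card V = Suc n"
  shows "pl_sphere n {\<sigma>. \<sigma> \<subset> V}"
proof -
  have "card {..n} = card V" using assms by simp
  then obtain g where "bij_betw g {..n} V" using assms(1) by (meson finite_atMost finite_same_card_bij)
  then have g: "inj_on g {..n}" "g ` {..n} = V" by (auto simp: bij_betw_def)
  have fc: "finite_complex {\<sigma>. \<sigma> \<subset> {..n}}" by (rule finite_complex_proper_subsets) auto
  have "pl_sphere n {\<sigma>. \<sigma> \<subset> {..n}}"
    unfolding pl_sphere_def using fc pl_homeomorphic_refl[OF fc] by simp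
  moreover have "inj_on g (\<Union>{\<sigma>. \<sigma> \<subset> {..n}})" by (rule inj_on_subset[OF g(1)]) auto
  ultimately have "pl_sphere n ((`) g ` {\<sigma>. \<sigma> \<subset> {..n}})" by (rule pl_sphere_image)
  then show ?thesis using image_proper_subsets[OF g(1)] g(2) by simp
qed

text \<open>
  Stellar subdivision: the open star of \<open>A\<close> is replaced by the open cone with apex \<open>x\<close> over its
  frontier.
\<close>

definition stellar :: "'a set set \<Rightarrow> 'a set \<Rightarrow> 'a \<Rightarrow> 'a set set" where
  "stellar K A x = {\<tau>\<in>K. \<not> A \<subseteq> \<tau>} \<union> {insert x \<tau> | \<tau>. \<not> A \<subseteq> \<tau> \<and> \<tau> \<union> A \<in> K}"

lemma stellarI1: "\<tau> \<in> K \<Longrightarrow> \<not> A \<subseteq> \<tau> \<Longrightarrow> \<tau> \<in> stellar K A x"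
  and stellarI2: "\<tau> \<union> A \<in> K \<Longrightarrow> \<not> A \<subseteq> \<tau> \<Longrightarrow> insert x \<tau> \<in> stellar K A x"
  by (auto simp: stellar_def)

lemma stellarE:
  assumes "\<sigma> \<in> stellar K A x"
  obtains "\<sigma> \<in> K" "\<not> A \<subseteq> \<sigma>" | \<tau> where "\<sigma> = insert x \<tau>" "\<not> A \<subseteq> \<tau>" "\<tau> \<union> A \<in> K"
  using assms unfolding stellar_def by blast

lemma finite_complex_stellar:
  assumes K: "finite_complex K" and A: "A \<in> K" "A \<noteq> {}" and x: "x \<notin> \<Union>K"
  shows "finite_complex (stellar K A x)"
  unfolding finite_complex_def
proof (intro conjI ballI allI impI)
  note KD = finite_complexD[OF K]
  have "stellar K A x \<subseteq> Pow (insert x (\<Union>K))" by (auto simp: stellar_def)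
  then show "finite (stellar K A x)"
    by (rule finite_subset) (simp add: KD(5))
  show "{} \<in> stellar K A x" using A KD(2) by (intro stellarI1) auto
  fix \<sigma> assume s: "\<sigma> \<in> stellar K A x"
  then show "finite \<sigma>"
  proof (cases rule: stellarE)
    case (2 \<tau>)
    then show ?thesis using KD(3)[OF 2(3)] by simp
  qed (rule KD(3))
  fix \<rho> assume r: "\<rho> \<subseteq> \<sigma>"
  from s show "\<rho> \<in> stellar K A x"
  proof (cases rule: stellarE)
    case 1
    then show ?thesis using r KD(4)[OF 1(1) r] by (intro stellarI1) auto
  next
    case (2 \<tau>)
    have xA: "x \<notin> A" using x A by blast
    let ?\<tau> = "\<rho> - {x}"
    have sub: "?\<tau> \<subseteq> \<tau>" using 2(1) r by blast
    then have nA: "\<not> A \<subseteq> ?\<tau>" using 2(2) by blast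
    have K1: "?\<tau> \<union> A \<in> K" by (rule KD(4)[OF 2(3)]) (use sub in blast)
    have K2: "?\<tau> \<in> K" by (rule KD(4)[OF 2(3)]) (use sub in blast)
    show ?thesis
    proof (cases "x \<in> \<rho>")
      case True
      then show ?thesis using stellarI2[OF K1 nA, of x] by (simp add: insert_absorb)
    next
      case False
      then show ?thesis using stellarI1[OF K2 nA, of x] by simp
    qed
  qed
qed

text \<open>
  The homeomorphism \<open>h\<close> is linear: it sends \<open>x\<close> to the barycenter of \<open>A\<close>. Its inverse \<open>g\<close> subtracts
  from the coordinates in \<open>A\<close> their minimum.
\<close>

lemma pl_homeomorphic_stellar:
  fixes K :: "nat set set"
  assumes K: "finite_complex K" and A: "A \<in> K" "A \<noteq> {}" and x: "x \<notin> \<Union>K"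
  shows "pl_homeomorphic (stellar K A x) K"
proof -
  let ?L = "stellar K A x"
  let ?c = "real (card A)"
  have L: "finite_complex ?L" by (rule finite_complex_stellar[OF assms])
  have finA: "finite A" using finite_complexD(3)[OF K A(1)] .
  have c0: "?c > 0" using finA A(2) by (simp add: card_gt_0_iff)
  have xA: "x \<notin> A" using x A by blast
  define h :: "(nat \<Rightarrow> real) \<Rightarrow> nat \<Rightarrow> real" where
    "h = (\<lambda>y v. if v = x then 0 else if v \<in> A then y v + y x / ?c else y v)"
  define \<alpha> :: "(nat \<Rightarrow> real) \<Rightarrow> real" where "\<alpha> = (\<lambda>z. Min (z ` A))"
  define g :: "(nat \<Rightarrow> real) \<Rightarrow> nat \<Rightarrow> real" where
    "g = (\<lambda>z v. if v = x then ?c * \<alpha> z else if v \<in> A then z v - \<alpha> z else z v)"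
  have \<alpha>_le: "\<alpha> z \<le> z a" if "a \<in> A" for z a
    unfolding \<alpha>_def using finA that by (intro Min_le) auto
  have \<alpha>_in: "\<exists>a\<in>A. \<alpha> z = z a" for z
  proof -
    have "\<alpha> z \<in> z ` A" unfolding \<alpha>_def using finA A(2) by (intro Min_in) auto
    then show ?thesis by auto
  qed
  have \<alpha>_eq: "\<alpha> z = m" if "a \<in> A" "z a = m" "\<And>b. b \<in> A \<Longrightarrow> m \<le> z b" for z m a
    using \<alpha>_le[OF that(1), of z] \<alpha>_in[of z] that by force
  have suppL: "(y x = 0 \<and> {v. y v \<noteq> 0} \<in> K \<and> \<not> A \<subseteq> {v. y v \<noteq> 0}) \<or>
      (y x > 0 \<and> ({v. y v \<noteq> 0} - {x}) \<union> A \<in> K \<and> \<not> A \<subseteq> {v. y v \<noteq> 0})"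
    if y: "y \<in> realization ?L" for y
  proof -
    have "{v. y v \<noteq> 0} \<in> ?L" by (rule realizationD(1)[OF L y])
    then consider "{v. y v \<noteq> 0} \<in> K" "\<not> A \<subseteq> {v. y v \<noteq> 0}"
      | \<tau> where "{v. y v \<noteq> 0} = insert x \<tau>" "\<not> A \<subseteq> \<tau>" "\<tau> \<union> A \<in> K"
      by (auto simp: stellar_def)
    then show ?thesis
    proof cases
      case 1
      then have "y x = 0" using x by blast
      then show ?thesis using 1 by blast
    next
      case 2
      have "x \<notin> \<tau>" using 2(3) x by blast
      then have "{v. y v \<noteq> 0} - {x} = \<tau>" using 2(1) by blast
      moreover have "y x > 0" using 2(1) realizationD(2)[OF L y, of x] by (force simp: less_le)
      ultimately show ?thesis using 2 xA by auto
    qed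
  qed
  have "bij_betw h (realization ?L) (realization K)"
  proof (rule bij_betw_byWitness[of _ g])
    show "\<forall>y\<in>realization ?L. g (h y) = y"
    proof
      fix y assume y: "y \<in> realization ?L"
      note nn = realizationD(2)[OF L y]
      obtain a where a: "a \<in> A" "y a = 0" using suppL[OF y] by blast
      have ax: "v \<noteq> x" if "v \<in> A" for v using that xA by blast
      have "\<alpha> (h y) = y x / ?c"
        by (rule \<alpha>_eq[OF a(1)]) (use a ax nn in \<open>auto simp: h_def\<close>)
      then show "g (h y) = y" using c0 xA by (auto simp: g_def h_def fun_eq_iff)
    qed
    show "\<forall>z\<in>realization K. h (g z) = z"
    proof
      fix z assume z: "z \<in> realization K"
      have "z x = 0" using realizationD(1)[OF K z] x by blast
      then show "h (g z) = z" using c0 by (auto simp: g_def h_def fun_eq_iff)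
    qed
    show "h ` realization ?L \<subseteq> realization K"
    proof (rule image_subsetI)
      fix y assume y: "y \<in> realization ?L"
      note nn = realizationD(2)[OF L y]
      let ?\<sigma> = "{v. y v \<noteq> 0}"
      show "h y \<in> realization K"
      proof (cases "y x = 0")
        case True
        then have "h y = y" by (auto simp: h_def fun_eq_iff)
        moreover have "?\<sigma> \<in> K" using suppL[OF y] True by auto
        ultimately show ?thesis
          using realizationI[OF K, of ?\<sigma> y] nn realizationD(3)[OF L y, of ?\<sigma>] finite_complexD(3)[OF K]
          by auto
      next
        case False
        then have S: "(?\<sigma> - {x}) \<union> A \<in> K" using suppL[OF y] by auto
        let ?S = "(?\<sigma> - {x}) \<union> A"
        have finS: "finite ?S" by (rule finite_complexD(3)[OF K S])
        have xS: "x \<notin> ?S" using xA by blast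
        show ?thesis
        proof (rule realizationI[OF K S])
          show "{v. h y v \<noteq> 0} \<subseteq> ?S" by (auto simp: h_def split: if_splits)
          show "0 \<le> h y v" for v using nn c0 by (auto simp: h_def)
          have "sum (h y) ?S = (\<Sum>v\<in>?S. y v + (if v \<in> A then y x / ?c else 0))"
            using xS by (intro sum.cong) (auto simp: h_def)
          also have "\<dots> = sum y ?S + (\<Sum>v\<in>?S. if v \<in> A then y x / ?c else 0)"
            by (rule sum.distrib)
          also have "(\<Sum>v\<in>?S. if v \<in> A then y x / ?c else 0) = (\<Sum>v\<in>A. y x / ?c)"
            using finS by (subst sum.inter_restrict[symmetric]) (auto intro!: sum.cong)
          also have "\<dots> = y x" using c0 by simp
          also have "sum y ?S + y x = sum y (insert x ?S)" using finS xS by simp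
          also have "\<dots> = 1" by (rule realizationD(3)[OF L y]) (use finS in auto)
          finally show "sum (h y) ?S = 1" .
        qed
      qed
    qed
    show "g ` realization K \<subseteq> realization ?L"
    proof (rule image_subsetI)
      fix z assume z: "z \<in> realization K"
      note nn = realizationD(2)[OF K z]
      let ?\<rho> = "{v. z v \<noteq> 0}"
      have r: "?\<rho> \<in> K" by (rule realizationD(1)[OF K z])
      have finr: "finite ?\<rho>" by (rule finite_complexD(3)[OF K r])
      have zx: "z x = 0" using r x by blast
      show "g z \<in> realization ?L"
      proof (cases "A \<subseteq> ?\<rho>")
        case False
        then obtain a where "a \<in> A" "z a = 0" by blast
        then have "\<alpha> z = 0" using \<alpha>_eq[of a z 0] nn by auto
        then have "g z = z" using zx by (auto simp: g_def fun_eq_iff)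
        moreover have "?\<rho> \<in> ?L" using r False by (auto simp: stellar_def)
        ultimately show ?thesis
          using realizationI[OF L, of ?\<rho> z] nn realizationD(3)[OF K z finr] by auto
      next
        case True
        let ?\<tau> = "{v. v \<noteq> x \<and> g z v \<noteq> 0}"
        obtain a where a: "a \<in> A" "\<alpha> z = z a" using \<alpha>_in by blast
        have "a \<notin> ?\<tau>" using a by (auto simp: g_def)
        then have nA: "\<not> A \<subseteq> ?\<tau>" using a by blast
        have sub: "?\<tau> \<subseteq> ?\<rho>" using True by (auto simp: g_def split: if_splits)
        have "?\<tau> \<union> A \<in> K" using finite_complexD(4)[OF K r] sub True by blast
        then have tL: "insert x ?\<tau> \<in> ?L" using nA by (auto simp: stellar_def)
        have fint: "finite ?\<tau>" using sub finr finite_subset by blast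
        show ?thesis
        proof (rule realizationI[OF L tL])
          show "{v. g z v \<noteq> 0} \<subseteq> insert x ?\<tau>" by auto
          have "0 \<le> \<alpha> z" using a nn by simp
          then show "0 \<le> g z v" for v using nn \<alpha>_le[of v z] by (auto simp: g_def)
          have xr: "x \<notin> ?\<rho>" using zx by simp
          have "sum (g z) (insert x ?\<tau>) = sum (g z) (insert x ?\<rho>)"
            using sub finr by (intro sum.mono_neutral_left) auto
          also have "\<dots> = ?c * \<alpha> z + sum (g z) ?\<rho>" using finr xr by (simp add: g_def)
          also have "sum (g z) ?\<rho> = (\<Sum>v\<in>?\<rho>. z v - (if v \<in> A then \<alpha> z else 0))"
            using xr by (intro sum.cong) (auto simp: g_def)
          also have "\<dots> = sum z ?\<rho> - (\<Sum>v\<in>?\<rho>. if v \<in> A then \<alpha> z else 0)"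
            by (rule sum_subtractf)
          also have "(\<Sum>v\<in>?\<rho>. if v \<in> A then \<alpha> z else 0) = (\<Sum>v\<in>A. \<alpha> z)"
          proof -
            have "?\<rho> \<inter> A = A" using True by blast
            then show ?thesis using finr by (simp add: sum.inter_restrict[symmetric])
          qed
          also have "sum z ?\<rho> = 1" by (rule realizationD(3)[OF K z finr]) simp
          finally show "sum (g z) (insert x ?\<tau>) = 1" by simp
        qed
      qed
    qed
  qed
  moreover have "pl_map (realization ?L) h"
  proof (rule pl_map_linear[OF L])
    fix P :: "(nat \<Rightarrow> real) set" and t :: "(nat \<Rightarrow> real) \<Rightarrow> real"
    show "h (combination P t (\<lambda>p. p)) = combination P t h"
      by (auto simp: h_def combination_def fun_eq_iff sum.distrib sum_divide_distrib distrib_left)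
  qed
  ultimately show ?thesis unfolding pl_homeomorphic_def by blast
qed

lemma pl_sphere_stellar_iff:
  assumes "finite_complex K" "A \<in> K" "A \<noteq> {}" "x \<notin> \<Union>K"
  shows "pl_sphere n (stellar K A x) \<longleftrightarrow> pl_sphere n K"
proof -
  note h = pl_homeomorphic_stellar[OF assms]
  have "pl_homeomorphic (stellar K A x) M \<longleftrightarrow> pl_homeomorphic K M" for M :: "nat set set"
    using pl_homeomorphic_trans[OF h, of M] pl_homeomorphic_trans[OF pl_homeomorphic_sym[OF h], of M]
    by (rule iffI[rotated])
  then show ?thesis
    using finite_complex_stellar[OF assms] assms(1) by (simp add: pl_sphere_def)
qed

section \<open>Orientations of stellar subdivisions\<close>

text \<open>
  The sign of the permutation that sorts the list.
\<close>

fun psign :: "nat list \<Rightarrow> int" where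
  "psign [] = 1"
| "psign (x # xs) = (if even (length (filter (\<lambda>y. y < x) xs)) then psign xs else - psign xs)"

lemma psign_cases: "psign xs = 1 \<or> psign xs = -1"
  by (induction xs) auto

lemma psign_square [simp]: "psign xs * psign xs = 1"
  using psign_cases[of xs] by auto

lemma psign_swap:
  assumes "a \<noteq> b"
  shows "psign (xs @ a # b # ys) = - psign (xs @ b # a # ys)"
proof (induction xs)
  case Nil
  then show ?case using assms by (cases "a < b") auto
next
  case (Cons x xs)
  have "length (filter (\<lambda>y. y < x) (xs @ a # b # ys)) = length (filter (\<lambda>y. y < x) (xs @ b # a # ys))"
    by simp
  then show ?case using Cons by (simp only: append_Cons psign.simps if_distrib) simp
qed

text \<open>
  The orientation of the single simplex with vertices \<open>F\<close>, ordered as in \<open>F\<close>.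
\<close>

definition cell :: "nat list \<Rightarrow> orient" where
  "cell F xs = (if distinct F \<and> distinct xs \<and> set xs = set F then psign F * psign xs else 0)"

lemma cell_swap: "cell F (xs @ a # b # ys) = - cell F (xs @ b # a # ys)"
proof (cases "a = b")
  case True
  then show ?thesis by (simp add: cell_def)
next
  case False
  then show ?thesis using psign_swap[OF False, of xs ys] by (auto simp: cell_def)
qed

lemma cell_self: "distinct F \<Longrightarrow> cell F F = 1"
  by (simp add: cell_def)

lemma cell_sorted: "distinct F \<Longrightarrow> cell F xs = psign F * cell (sort F) xs"
proof -
  have "psign ys = 1" if "sorted ys" "distinct ys" for ys
    using that
  proof (induction ys)
    case (Cons a ys)
    then have "filter (\<lambda>y. y < a) ys = []" by (auto simp: filter_empty_conv not_less)
    then show ?case using Cons by simp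
  qed simp
  then show "distinct F \<Longrightarrow> cell F xs = psign F * cell (sort F) xs"
    by (auto simp: cell_def)
qed

text \<open>
  Permutations are compositions of transpositions of neighbours.
\<close>

lemma adjacent_swaps_induct:
  assumes "mset ys = mset zs" "P zs"
    and "\<And>xs a b ys. P (xs @ a # b # ys) \<Longrightarrow> P (xs @ b # a # ys)"
  shows "P ys"
  using assms
proof (induction ys arbitrary: zs P)
  case Nil
  show ?case using Nil.prems(1,2) by simp
next
  case (Cons y ys)
  have "y \<in> set zs" using Cons.prems(1) by (metis list.set_intros(1) set_mset_mset)
  then obtain us vs where zs: "zs = us @ y # vs" by (meson split_list)
  have front: "P (us' @ y # us'' @ vs) \<Longrightarrow> P (y # us' @ us'' @ vs)" for us' us''
  proof (induction us' arbitrary: us'' rule: rev_induct)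
    case (snoc u us')
    have "P (us' @ y # u # us'' @ vs)" using Cons.prems(3)[of us' u y "us'' @ vs"] snoc.prems by simp
    then show ?case using snoc.IH[of "u # us''"] by simp
  qed simp
  have "P (y # us @ vs)" using front[of us "[]"] Cons.prems(2) zs by simp
  moreover have "mset ys = mset (us @ vs)" using Cons.prems(1) zs by simp
  ultimately show ?case
    using Cons.IH[of "us @ vs" "\<lambda>l. P (y # l)"] Cons.prems(3)[of "y # _"] by simp
qed

lemma cell_map:
  assumes g: "inj_on g (set F)" and xs: "set xs \<subseteq> set F"
  shows "cell (map g F) (map g xs) = cell F xs"
proof (cases "distinct F \<and> distinct xs \<and> set xs = set F")
  case False
  have "inj_on g (set xs)" using inj_on_subset[OF g xs] .
  moreover have "g ` set xs = g ` set F \<longleftrightarrow> set xs = set F"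
    using inj_on_image_eq_iff[OF g xs] by simp
  ultimately show ?thesis using False g by (auto simp: cell_def distinct_map)
next
  case True
  then have ms: "mset xs = mset F" using set_eq_iff_mset_eq_distinct by blast
  have "set xs = set F \<longrightarrow> distinct xs \<longrightarrow> cell (map g F) (map g xs) = cell F xs"
    using ms
  proof (rule adjacent_swaps_induct)
    show "set F = set F \<longrightarrow> distinct F \<longrightarrow> cell (map g F) (map g F) = cell F F"
      using g by (simp add: cell_self distinct_map)
    fix us a b vs
    assume "set (us @ a # b # vs) = set F \<longrightarrow> distinct (us @ a # b # vs) \<longrightarrow>
       cell (map g F) (map g (us @ a # b # vs)) = cell F (us @ a # b # vs)"
    then show "set (us @ b # a # vs) = set F \<longrightarrow> distinct (us @ b # a # vs) \<longrightarrow>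
       cell (map g F) (map g (us @ b # a # vs)) = cell F (us @ b # a # vs)"
      using cell_swap[of F us b a vs] cell_swap[of "map g F" "map g us" "g b" "g a" "map g vs"]
      by (auto simp: insert_commute)
  qed
  then show ?thesis using True by simp
qed

text \<open>
  An oriented complex is represented by its facets, each with an order of its vertices and a sign.
\<close>

type_synonym ochain = "(int \<times> nat list) list"

definition faces_of :: "ochain \<Rightarrow> nat set set" where
  "faces_of c = {\<sigma>. \<exists>(s, F)\<in>set c. \<sigma> \<subseteq> set F}"

definition orient_of :: "ochain \<Rightarrow> orient" where
  "orient_of c xs = (\<Sum>(s, F)\<leftarrow>c. s * cell F xs)"

lemma orient_of_Nil [simp]: "orient_of [] xs = 0"
  and orient_of_Cons [simp]: "orient_of ((s, F) # c) xs = s * cell F xs + orient_of c xs"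
  and orient_of_append [simp]: "orient_of (c @ d) xs = orient_of c xs + orient_of d xs"
  by (simp_all add: orient_of_def)

lemma orient_of_swap: "orient_of c (xs @ a # b # ys) = - orient_of c (xs @ b # a # ys)"
  by (induction c) (auto simp: cell_swap[of _ xs a b ys])

text \<open>
  A simplex \<open>\<tau> \<union> {x}\<close> of the subdivision is oriented like the simplex of the original complex that
  contains it, which is obtained by replacing \<open>x\<close> by the one vertex \<open>a\<close> of \<open>A\<close> missing in \<open>\<tau>\<close>.
\<close>

definition stellar_orient :: "nat set \<Rightarrow> nat \<Rightarrow> orient \<Rightarrow> orient" where
  "stellar_orient A x \<omega> xs =
     (if x \<in> set xs then
        if \<exists>a. A - set xs = {a}
        then \<omega> (map (\<lambda>v. if v = x then the_elem (A - set xs) else v) xs) else 0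
      else if A \<subseteq> set xs then 0 else \<omega> xs)"

lemma swap_distant:
  assumes "\<And>xs a b ys. \<omega> (xs @ a # b # ys) = - (\<omega> (xs @ b # a # ys) :: int)"
  shows "\<omega> (xs @ a # us @ b # ys) = - \<omega> (xs @ b # us @ a # ys)"
proof (induction us arbitrary: xs)
  case Nil
  show ?case using assms[of xs a b ys] by simp
next
  case (Cons u us)
  have "\<omega> (xs @ a # u # us @ b # ys) = - \<omega> (xs @ u # a # us @ b # ys)" by (rule assms)
  also have "\<dots> = \<omega> (xs @ u # b # us @ a # ys)" using Cons[of "xs @ [u]"] by simp
  also have "\<dots> = - \<omega> (xs @ b # u # us @ a # ys)" by (rule assms)
  finally show ?case by simp
qed

text \<open>
  Coherence is the point: two facets of the subdivision with a common ridge either come from facets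
  with a common ridge, or from the same facet, where they differ in the vertex of \<open>A\<close> that \<open>x\<close>
  replaces.
\<close>

lemma orientation_stellar:
  assumes or: "orientation n K \<omega>" and K: "finite_complex K" and A: "A \<in> K" "A \<noteq> {}" and x: "x \<notin> \<Union>K"
    and dim: "\<And>\<sigma>. \<sigma> \<in> K \<Longrightarrow> card \<sigma> \<le> n"
  shows "orientation n (stellar K A x) (stellar_orient A x \<omega>)"
proof -
  let ?S = "stellar_orient A x \<omega>"
  let ?r = "\<lambda>a xs. map (\<lambda>v. if v = x then a else v) xs"
  have vals: "\<omega> xs \<in> {-1, 0, 1}" for xs using or unfolding orientation_def by blast
  have supp: "\<omega> xs \<noteq> 0 \<longleftrightarrow> length xs = n \<and> distinct xs \<and> set xs \<in> K" for xs
    using or unfolding orientation_def by blast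
  have alt: "\<omega> (xs @ a # b # ys) = - \<omega> (xs @ b # a # ys)" for xs a b ys
    using or unfolding orientation_def by blast
  have coh: "\<omega> (b # xs) = - \<omega> (a # xs)" if "a \<noteq> b" "\<omega> (a # xs) \<noteq> 0" "\<omega> (b # xs) \<noteq> 0" for a b xs
    using or that unfolding orientation_def by blast
  have xA: "x \<notin> A" using x A by blast
  have S1: "?S xs = \<omega> (?r a xs)" if "x \<in> set xs" "A - set xs = {a}" for xs a
    using that(1) unfolding stellar_orient_def that(2) the_elem_eq by simp
  have S0: "?S xs = 0" if "x \<in> set xs" "\<nexists>a. A - set xs = {a}" for xs
    using that by (simp add: stellar_orient_def)
  have S2: "?S xs = (if A \<subseteq> set xs then 0 else \<omega> xs)" if "x \<notin> set xs" for xs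
    using that by (simp add: stellar_orient_def)
  have rset: "set (?r a xs) = insert a (set xs - {x})" if "x \<in> set xs" for a xs
    using that by auto
  have rdist: "distinct (?r a xs) \<longleftrightarrow> distinct xs" if "a \<notin> set xs" for a xs
    using that by (auto simp: distinct_map inj_on_def)
  have Sx: "\<exists>a. A - set xs = {a} \<and> ?S xs = \<omega> (?r a xs)" if "?S xs \<noteq> 0" "x \<in> set xs" for xs
    using that S0 S1 by blast
  have V: "?S xs \<in> {-1, 0, 1}" for xs
    unfolding stellar_orient_def using vals by simp
  have Z: "?S xs \<noteq> 0 \<longleftrightarrow> length xs = n \<and> distinct xs \<and> set xs \<in> stellar K A x" for xs
  proof (cases "x \<in> set xs")
    case False
    have "set xs \<in> stellar K A x \<longleftrightarrow> set xs \<in> K \<and> \<not> A \<subseteq> set xs" (is "?l \<longleftrightarrow> ?r")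
    proof
      assume ?l then show ?r
      proof (cases rule: stellarE)
        case 2
        then show ?thesis using False by simp
      qed simp
    qed (simp add: stellarI1)
    then show ?thesis unfolding S2[OF False] using supp[of xs] by simp
  next
    case True
    show ?thesis
    proof
      assume "?S xs \<noteq> 0"
      then obtain a where a: "A - set xs = {a}" "\<omega> (?r a xs) \<noteq> 0" using Sx[OF _ True] by metis
      have ax: "a \<notin> set xs" "a \<in> A" using a(1) by blast+
      have "length (?r a xs) = n \<and> distinct (?r a xs) \<and> set (?r a xs) \<in> K"
        by (rule iffD1[OF supp a(2)])
      then have xs: "length xs = n" "distinct xs" "insert a (set xs - {x}) \<in> K"
        unfolding rdist[OF ax(1)] rset[OF True] by simp_all
      have "(set xs - {x}) \<union> A = insert a (set xs - {x})" using a(1) xA ax by blast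
      then have "insert x (set xs - {x}) \<in> stellar K A x"
        using xs(3) ax by (intro stellarI2) auto
      then show "length xs = n \<and> distinct xs \<and> set xs \<in> stellar K A x"
        using xs(1,2) True by (simp add: insert_absorb)
    next
      assume xs: "length xs = n \<and> distinct xs \<and> set xs \<in> stellar K A x"
      then have "set xs \<in> stellar K A x" by simp
      then obtain \<tau> where t: "set xs = insert x \<tau>" "\<not> A \<subseteq> \<tau>" "\<tau> \<union> A \<in> K"
      proof (cases rule: stellarE)
        case 1
        then have "x \<in> \<Union>K" using True by (rule_tac UnionI)
        then show thesis using x by simp
      next
        case (2 \<tau>)
        then show thesis by (rule that)
      qed
      have xt: "x \<notin> \<tau>"
      proof
        assume "x \<in> \<tau>"
        then have "x \<in> \<Union>K" using t(3) by (intro UnionI[of "\<tau> \<union> A"]) auto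
        then show False using x by simp
      qed
      have fin: "finite \<tau>" "finite A" using finite_complexD(3)[OF K t(3)] by auto
      have "card (set xs) = n" using xs distinct_card by blast
      then have "Suc (card \<tau>) = n" using t(1) xt fin(1) by simp
      moreover have "card (\<tau> \<union> A) = card \<tau> + card (A - \<tau>)"
        using card_Un_disjoint[of \<tau> "A - \<tau>"] fin by simp
      ultimately have le: "card (A - \<tau>) \<le> Suc 0" using dim[OF t(3)] by linarith
      obtain a where a: "a \<in> A" "a \<notin> \<tau>" using t(2) by blast
      have "\<forall>b\<in>A - \<tau>. \<forall>c\<in>A - \<tau>. b = c"
        by (rule iffD1[OF card_le_Suc0_iff_eq[OF finite_Diff[OF fin(2)]] le])
      then have "b = a" if "b \<in> A - \<tau>" for b using a that by blast
      then have A0: "A - \<tau> = {a}" using a by blast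
      have "A - set xs = A - \<tau>" using t(1) xA by auto
      then have A1: "A - set xs = {a}" using A0 by simp
      have "set xs - {x} = \<tau>" "insert a \<tau> = \<tau> \<union> A" using t(1) xt A0 by auto
      then have "set (?r a xs) = \<tau> \<union> A" unfolding rset[OF True] by simp
      moreover have ax: "a \<notin> set xs" using A1 by blast
      ultimately have "length (?r a xs) = n \<and> distinct (?r a xs) \<and> set (?r a xs) \<in> K"
        unfolding rdist[OF ax] using xs t(3) by simp
      then have "\<omega> (?r a xs) \<noteq> 0" by (rule iffD2[OF supp])
      then show "?S xs \<noteq> 0" unfolding S1[OF True A1] .
    qed
  qed
  have W: "?S (xs @ a # b # ys) = - ?S (xs @ b # a # ys)" for xs a b ys
  proof -
    have e: "set (xs @ a # b # ys) = set (xs @ b # a # ys)" by auto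
    define f where "f = (\<lambda>v. if v = x then the_elem (A - set (xs @ b # a # ys)) else v)"
    have m: "\<omega> (map f (xs @ a # b # ys)) = - \<omega> (map f (xs @ b # a # ys))"
      unfolding map_append list.map by (rule alt)
    show ?thesis unfolding stellar_orient_def e f_def[symmetric] m alt[of xs a b ys] by simp
  qed
  have C: "?S (b # xs) = - ?S (a # xs)"
    if ab: "a \<noteq> b" and na: "?S (a # xs) \<noteq> 0" and nb: "?S (b # xs) \<noteq> 0" for a b xs
  proof -
    have first: "?S (b # xs) = - ?S (x # xs)"
      if bx: "b \<noteq> x" and nx: "?S (x # xs) \<noteq> 0" and nb: "?S (b # xs) \<noteq> 0" for b
    proof -
      obtain c where c: "A - set (x # xs) = {c}" "?S (x # xs) = \<omega> (?r c (x # xs))"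
        using Sx[OF nx] by auto
      have cs: "c \<in> A" "c \<notin> set (x # xs)" using c(1) by blast+
      have "x \<notin> set xs" using nx c cs supp rdist[OF cs(2)] by auto
      then have "?r c (x # xs) = c # xs" by (auto intro!: map_idI)
      moreover have "x \<notin> set (b # xs)" using bx \<open>x \<notin> set xs\<close> by simp
      then have sb: "?S (b # xs) = \<omega> (b # xs)" "\<not> A \<subseteq> set (b # xs)"
        using S2[of "b # xs"] nb by (auto split: if_splits)
      moreover have "c \<noteq> b" using c(1) sb(2) xA by auto
      ultimately show ?thesis using coh[of c b xs] c(2) nx nb by simp
    qed
    show ?thesis
    proof (cases "a = x \<or> b = x")
      case True
      then show ?thesis using first[of a] first[of b] ab na nb by auto
    next
      case False
      show ?thesis
      proof (cases "x \<in> set xs")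
        case nx: False
        then show ?thesis using coh[OF ab] na nb False S2[of "a # xs"] S2[of "b # xs"]
          by (auto split: if_splits)
      next
        case True
        obtain c where c: "A - set (a # xs) = {c}" "?S (a # xs) = \<omega> (?r c (a # xs))"
          using Sx[OF na] True by auto
        obtain d where d: "A - set (b # xs) = {d}" "?S (b # xs) = \<omega> (?r d (b # xs))"
          using Sx[OF nb] True by auto
        have ra: "?r e (a # xs) = a # ?r e xs" and rb: "?r e (b # xs) = b # ?r e xs" for e
          using False by auto
        have dist: "distinct (a # xs)" "distinct (b # xs)"
          using na nb c d supp rdist[of c "a # xs"] rdist[of d "b # xs"] by auto
        show ?thesis
        proof (cases "c = d")
          case True
          show ?thesis using coh[OF ab, of "?r c xs"] na nb
            unfolding c(2) d(2)[folded True] ra rb by blast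
        next
          case cd: False
          then have "c = b" "d = a" using c(1) d(1) by auto
          obtain us vs where xs: "xs = us @ x # vs" using True by (meson split_list)
          then have nin: "x \<notin> set us" "x \<notin> set vs" using dist by auto
          have rx: "?r e xs = us @ e # vs" for e using nin by (auto simp: xs intro!: map_idI)
          show ?thesis
            using swap_distant[of \<omega> "[]" b us a vs, OF alt] c(2) d(2) \<open>c = b\<close> \<open>d = a\<close>
            unfolding ra rb rx by simp
        qed
      qed
    qed
  qed
  show ?thesis
    unfolding orientation_def
  proof (intro conjI allI impI)
    show "?S xs \<in> {-1, 0, 1}" for xs by (rule V)
    show "?S xs \<noteq> 0 \<longleftrightarrow> length xs = n \<and> distinct xs \<and> set xs \<in> stellar K A x" for xs by (rule Z)
    show "?S (xs @ a # b # ys) = - ?S (xs @ b # a # ys)" for xs a b ys by (rule W)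
    show "?S (b # xs) = - ?S (a # xs)" if "a \<noteq> b" "?S (a # xs) \<noteq> 0" "?S (b # xs) \<noteq> 0" for a b xs
      using that by (rule C)
  qed
qed

section \<open>Complexes given by signed facets\<close>

text \<open>
  Each facet that contains \<open>A\<close> is replaced by the facets in which \<open>x\<close> takes the place of one vertex
  of \<open>A\<close>. Position and sign are kept, so that the orientation is inherited.
\<close>

definition star_chain :: "nat list \<Rightarrow> nat \<Rightarrow> ochain \<Rightarrow> ochain" where
  "star_chain A x c = concat (map (\<lambda>(s, F).
     if set A \<subseteq> set F then map (\<lambda>a. (s, map (\<lambda>v. if v = a then x else v) F)) (filter (\<lambda>a. a \<in> set A) F)
     else [(s, F)]) c)"

lemma star_chain_Nil [simp]: "star_chain A x [] = []"
  and star_chain_Cons: "star_chain A x ((s, F) # c) =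
     (if set A \<subseteq> set F then map (\<lambda>a. (s, map (\<lambda>v. if v = a then x else v) F)) (filter (\<lambda>a. a \<in> set A) F)
     else [(s, F)]) @ star_chain A x c"
  and star_chain_append [simp]: "star_chain A x (c @ d) = star_chain A x c @ star_chain A x d"
  by (simp_all add: star_chain_def)

lemma cell_eq_0: "set xs \<noteq> set F \<Longrightarrow> cell F xs = 0"
  by (simp add: cell_def)

lemma map_replace_back:
  assumes "a \<notin> set xs"
  shows "map (\<lambda>v. if v = a then x else v) (map (\<lambda>v. if v = x then a else v) xs) = xs"
  using assms by (auto intro!: map_idI)

text \<open>
  This is the orientation of a subdivided simplex: the facets in which \<open>x\<close> replaces a vertex of \<open>A\<close>
  inherit the sign of the simplex.
\<close>

lemma stellar_cell:
  assumes F: "distinct F" "x \<notin> set F" and A: "A \<noteq> {}" "x \<notin> A"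
  shows "stellar_orient A x (cell F) xs =
    (if A \<subseteq> set F then \<Sum>a\<leftarrow>filter (\<lambda>a. a \<in> A) F. cell (map (\<lambda>v. if v = a then x else v) F) xs
     else cell F xs)"
proof (cases "A \<subseteq> set F")
  case True
  have setg: "set (map (\<lambda>v. if v = a then x else v) F) = insert x (set F - {a})" if "a \<in> set F" for a
    using that by auto
  have sum: "(\<Sum>a\<leftarrow>filter (\<lambda>a. a \<in> A) F. cell (map (\<lambda>v. if v = a then x else v) F) xs) =
      (\<Sum>a\<in>A. cell (map (\<lambda>v. if v = a then x else v) F) xs)"
  proof -
    have "set (filter (\<lambda>a. a \<in> A) F) = A" using True by auto
    then show ?thesis using F(1) by (simp add: sum_list_distinct_conv_sum_set)
  qed
  show ?thesis
  proof (cases "x \<in> set xs")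
    case False
    have "cell (map (\<lambda>v. if v = a then x else v) F) xs = 0" if "a \<in> A" for a
      using that True False setg[of a] by (intro cell_eq_0) auto
    then have "(\<Sum>a\<in>A. cell (map (\<lambda>v. if v = a then x else v) F) xs) = 0" by simp
    moreover have "stellar_orient A x (cell F) xs = 0"
      using False True by (auto simp: stellar_orient_def cell_def)
    ultimately show ?thesis using True sum by simp
  next
    case xin: True
    have zero: "cell (map (\<lambda>v. if v = a then x else v) F) xs = 0" if "a \<in> A" "A - set xs \<noteq> {a}" for a
    proof (rule cell_eq_0, rule notI)
      assume "set xs = set (map (\<lambda>v. if v = a then x else v) F)"
      then have "set xs = insert x (set F - {a})" using setg[of a] that(1) True by auto
      then have "A - set xs = {a}" using that(1) True F(2) by auto
      then show False using that(2) by simp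
    qed
    show ?thesis
    proof (cases "\<exists>a. A - set xs = {a}")
      case False
      then have "(\<Sum>a\<in>A. cell (map (\<lambda>v. if v = a then x else v) F) xs) = 0"
        using zero by (intro sum.neutral) auto
      then show ?thesis using xin False True sum by (simp add: stellar_orient_def)
    next
      case True
      then obtain a where a: "A - set xs = {a}" by blast
      then have aA: "a \<in> A" and an: "a \<notin> set xs" by blast+
      let ?g = "\<lambda>v. if v = a then x else v" and ?r = "map (\<lambda>v. if v = x then a else v) xs"
      have finA: "finite A" using \<open>A \<subseteq> set F\<close> finite_subset by blast
      have "(\<Sum>b\<in>A. cell (map (\<lambda>v. if v = b then x else v) F) xs) = cell (map ?g F) xs +
          (\<Sum>b\<in>A - {a}. cell (map (\<lambda>v. if v = b then x else v) F) xs)"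
        by (rule sum.remove[OF finA aA])
      also have "(\<Sum>b\<in>A - {a}. cell (map (\<lambda>v. if v = b then x else v) F) xs) = 0"
        using a zero by (intro sum.neutral) auto
      finally have s: "(\<Sum>b\<in>A. cell (map (\<lambda>v. if v = b then x else v) F) xs) = cell (map ?g F) xs" by simp
      have "cell (map ?g F) xs = cell F ?r"
      proof (cases "set ?r \<subseteq> set F")
        case True
        have "inj_on ?g (set F)" using F(2) by (auto simp: inj_on_def)
        from cell_map[OF this True] show ?thesis by (simp only: map_replace_back[OF an])
      next
        case False
        have "set xs \<noteq> set (map ?g F)"
        proof
          assume "set xs = set (map ?g F)"
          then have "set xs = insert x (set F - {a})" using setg[of a] aA \<open>A \<subseteq> set F\<close> by auto
          then have "set ?r \<subseteq> insert a (set F)" by auto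
          then show False using False aA \<open>A \<subseteq> set F\<close> by auto
        qed
        moreover have "set ?r \<noteq> set F" using False by blast
        ultimately show ?thesis by (simp add: cell_eq_0)
      qed
      moreover have "stellar_orient A x (cell F) xs = cell F ?r"
        using xin unfolding stellar_orient_def a the_elem_eq by simp
      ultimately show ?thesis using \<open>A \<subseteq> set F\<close> sum s by simp
    qed
  qed
next
  case False
  show ?thesis
  proof (cases "x \<in> set xs")
    case nx: False
    then show ?thesis using False by (auto simp: stellar_orient_def cell_def)
  next
    case True
    have "set xs \<noteq> set F" using True F(2) by blast
    moreover have "stellar_orient A x (cell F) xs = 0"
    proof (cases "\<exists>a. A - set xs = {a}")
      case ex: True
      then obtain a where a: "A - set xs = {a}" by blast
      have "A \<subseteq> set (map (\<lambda>v. if v = x then a else v) xs)"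
      proof
        fix b assume b: "b \<in> A"
        show "b \<in> set (map (\<lambda>v. if v = x then a else v) xs)"
        proof (cases "b = a")
          case True
          then show ?thesis using \<open>x \<in> set xs\<close> unfolding set_map by (intro image_eqI[of _ _ x]) auto
        next
          case False
          then have "b \<in> set xs" "b \<noteq> x" using a b A(2) by blast+
          then show ?thesis unfolding set_map by (intro image_eqI[of _ _ b]) auto
        qed
      qed
      then have "set (map (\<lambda>v. if v = x then a else v) xs) \<noteq> set F" using False by blast
      then have "cell F (map (\<lambda>v. if v = x then a else v) xs) = 0" by (rule cell_eq_0)
      then show ?thesis using \<open>x \<in> set xs\<close> unfolding stellar_orient_def a the_elem_eq by simp
    qed (simp add: stellar_orient_def True)
    ultimately show ?thesis using False by (simp add: cell_eq_0)
  qed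
qed

lemma stellar_orient_add:
  "stellar_orient A x (\<lambda>xs. s * \<omega> xs + \<omega>' xs) xs = s * stellar_orient A x \<omega> xs + stellar_orient A x \<omega>' xs"
  by (simp add: stellar_orient_def)

lemma orient_of_star_chain:
  assumes "\<And>s F. (s, F) \<in> set c \<Longrightarrow> distinct F \<and> x \<notin> set F" "set A \<noteq> {}" "x \<notin> set A"
  shows "orient_of (star_chain A x c) = stellar_orient (set A) x (orient_of c)"
  using assms(1)
proof (induction c)
  case Nil
  have "orient_of [] = (\<lambda>_. 0)" by (simp add: fun_eq_iff)
  then show ?case by (simp add: stellar_orient_def fun_eq_iff)
next
  case (Cons p c)
  obtain s F where p: "p = (s, F)" by (cases p)
  have F: "distinct F" "x \<notin> set F" using Cons.prems[of s F] p by auto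
  have IH: "orient_of (star_chain A x c) = stellar_orient (set A) x (orient_of c)"
    using Cons by auto
  have eq: "orient_of (p # c) = (\<lambda>xs. s * cell F xs + orient_of c xs)"
    by (simp add: p fun_eq_iff)
  have sl: "orient_of (map (\<lambda>a. (s, h a)) as) xs = s * (\<Sum>a\<leftarrow>as. cell (h a) xs)" for h as xs
    by (induction as) (auto simp: algebra_simps)
  show ?case
    unfolding eq p star_chain_Cons
    by (rule ext) (simp add: stellar_orient_add stellar_cell[OF F assms(2,3)] sl IH)
qed

lemma faces_of_Nil [simp]: "faces_of [] = {}"
  and faces_of_Cons [simp]: "faces_of ((s, F) # c) = Pow (set F) \<union> faces_of c"
  and faces_of_append [simp]: "faces_of (c @ d) = faces_of c \<union> faces_of d"
  by (auto simp: faces_of_def)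

lemma faces_of_iff: "\<sigma> \<in> faces_of c \<longleftrightarrow> (\<exists>s F. (s, F) \<in> set c \<and> \<sigma> \<subseteq> set F)"
  by (auto simp: faces_of_def)

lemma Union_faces_of: "\<Union>(faces_of c) = (\<Union>(s, F)\<in>set c. set F)"
  by (auto simp: faces_of_def)

lemma finite_complex_faces_of:
  assumes "c \<noteq> []" shows "finite_complex (faces_of c)"
  unfolding finite_complex_def
proof (intro conjI ballI allI impI)
  have "faces_of c = (\<Union>(s, F)\<in>set c. Pow (set F))" by (auto simp: faces_of_def)
  then show "finite (faces_of c)" by auto
  obtain s F where "(s, F) \<in> set c" using assms by (cases c) auto
  then show "{} \<in> faces_of c" unfolding faces_of_iff by blast
  fix \<sigma> assume "\<sigma> \<in> faces_of c"
  then obtain s F where F: "(s, F) \<in> set c" "\<sigma> \<subseteq> set F" unfolding faces_of_iff by blast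
  show "finite \<sigma>" by (rule finite_subset[OF F(2)]) simp
  show "\<tau> \<in> faces_of c" if "\<tau> \<subseteq> \<sigma>" for \<tau> using F that unfolding faces_of_iff by blast
qed

lemma stellar_Un: "stellar (K \<union> L) A x = stellar K A x \<union> stellar L A x"
  by (auto simp: stellar_def)

lemma stellar_Pow:
  assumes "A \<noteq> {}" "x \<notin> F"
  shows "stellar (Pow F) A x = (if A \<subseteq> F then (\<Union>a\<in>A. Pow (insert x (F - {a}))) else Pow F)"
proof (cases "A \<subseteq> F")
  case False
  then show ?thesis by (auto simp: stellar_def)
next
  case True
  have "\<tau> \<in> stellar (Pow F) A x \<longleftrightarrow> (\<exists>a\<in>A. \<tau> \<subseteq> insert x (F - {a}))" for \<tau>
  proof
    assume "\<tau> \<in> stellar (Pow F) A x"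
    then show "\<exists>a\<in>A. \<tau> \<subseteq> insert x (F - {a})"
      by (cases rule: stellarE) auto
  next
    assume "\<exists>a\<in>A. \<tau> \<subseteq> insert x (F - {a})"
    then obtain a where a: "a \<in> A" "\<tau> \<subseteq> insert x (F - {a})" by blast
    have nA: "\<not> A \<subseteq> \<tau> - {x}" using a assms(2) True by blast
    have sub: "\<tau> - {x} \<subseteq> F" using a by blast
    show "\<tau> \<in> stellar (Pow F) A x"
    proof (cases "x \<in> \<tau>")
      case x: True
      have "insert x (\<tau> - {x}) \<in> stellar (Pow F) A x"
        using nA sub True by (intro stellarI2) auto
      then show ?thesis using x by (simp add: insert_absorb)
    next
      case False
      then show ?thesis using nA sub by (intro stellarI1) auto
    qed
  qed
  then show ?thesis using True by auto
qed

lemma faces_of_star_chain: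
  assumes "\<And>s F. (s, F) \<in> set c \<Longrightarrow> x \<notin> set F" "set A \<noteq> {}"
  shows "faces_of (star_chain A x c) = stellar (faces_of c) (set A) x"
  using assms(1)
proof (induction c)
  case Nil
  then show ?case by (simp add: stellar_def)
next
  case (Cons p c)
  obtain s F where p: "p = (s, F)" by (cases p)
  have F: "x \<notin> set F" using Cons.prems[of s F] p by auto
  have IH: "faces_of (star_chain A x c) = stellar (faces_of c) (set A) x" using Cons by auto
  have fm: "faces_of (map (\<lambda>a. (s, h a)) as) = (\<Union>a\<in>set as. Pow (set (h a)))" for h :: "nat \<Rightarrow> nat list" and as
    by (auto simp: faces_of_def)
  have "faces_of (if set A \<subseteq> set F then map (\<lambda>a. (s, map (\<lambda>v. if v = a then x else v) F)) (filter (\<lambda>a. a \<in> set A) F)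
     else [(s, F)]) = stellar (Pow (set F)) (set A) x"
  proof (cases "set A \<subseteq> set F")
    case True
    have "set (map (\<lambda>v. if v = a then x else v) F) = insert x (set F - {a})" if "a \<in> set A" for a
      using that True by auto
    moreover have "set (filter (\<lambda>a. a \<in> set A) F) = set A" using True by auto
    ultimately show ?thesis using True by (simp add: fm stellar_Pow[OF assms(2) F])
  next
    case False
    then show ?thesis by (simp add: stellar_Pow[OF assms(2) F])
  qed
  then show ?case using IH by (simp add: p star_chain_Cons stellar_Un)
qed

definition wf_chain :: "nat \<Rightarrow> ochain \<Rightarrow> bool" where
  "wf_chain n c \<longleftrightarrow> c \<noteq> [] \<and> (\<forall>(s, F)\<in>set c. distinct F \<and> length F = n)"

lemma wf_chainD:
  assumes "wf_chain n c" "(s, F) \<in> set c"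
  shows "distinct F" "length F = n"
  using assms by (auto simp: wf_chain_def)

lemma card_faces_of:
  assumes "wf_chain n c" "\<sigma> \<in> faces_of c" shows "card \<sigma> \<le> n"
proof -
  obtain s F where "(s, F) \<in> set c" "\<sigma> \<subseteq> set F" using assms(2) by (auto simp: faces_of_iff)
  then have "card \<sigma> \<le> card (set F)" by (intro card_mono) auto
  also have "\<dots> = n" using wf_chainD[OF assms(1) \<open>(s, F) \<in> set c\<close>] by (simp add: distinct_card)
  finally show ?thesis .
qed

definition sph :: "nat \<Rightarrow> ochain \<Rightarrow> bool" where
  "sph n c \<longleftrightarrow> wf_chain n c \<and> oriented_sphere n (faces_of c, orient_of c)"

lemma wf_star_chain:
  assumes "wf_chain n c" "set A \<noteq> {}" "\<And>s F. (s, F) \<in> set c \<Longrightarrow> x \<notin> set F"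
  shows "wf_chain n (star_chain A x c)"
proof -
  have "distinct (map (\<lambda>v. if v = a then x else v) F)" if "(s, F) \<in> set c" for s F a
    using wf_chainD(1)[OF assms(1) that] assms(3)[OF that] by (auto simp: distinct_map inj_on_def)
  moreover have "star_chain A x c \<noteq> []"
  proof -
    obtain p c' where c: "c = p # c'" using assms(1) by (cases c) (auto simp: wf_chain_def)
    obtain s F where p: "p = (s, F)" by (cases p)
    have "\<exists>a. a \<in> set A" using assms(2) by (rule iffD2[OF ex_in_conv])
    then obtain a where "a \<in> set A" ..
    then have "set A \<subseteq> set F \<Longrightarrow> a \<in> set (filter (\<lambda>a. a \<in> set A) F)" by auto
    then have "set A \<subseteq> set F \<Longrightarrow> filter (\<lambda>a. a \<in> set A) F \<noteq> []" by (metis empty_iff list.set(1))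
    then show ?thesis by (auto simp: c p star_chain_Cons)
  qed
  ultimately show ?thesis
    using assms(1) by (auto simp: wf_chain_def star_chain_def split: if_splits)
qed

lemma stellar_sph:
  assumes c: "sph n c" and A: "set A \<in> faces_of c" "set A \<noteq> {}" and x: "\<And>s F. (s, F) \<in> set c \<Longrightarrow> x \<notin> set F"
  shows "sph n (star_chain A x c)"
proof -
  have wf: "wf_chain n c" and or: "orientation n (faces_of c) (orient_of c)" and pl: "pl_sphere n (faces_of c)"
    using c by (auto simp: sph_def oriented_sphere_def)
  have fc: "finite_complex (faces_of c)" using wf finite_complex_faces_of by (auto simp: wf_chain_def)
  have xU: "x \<notin> \<Union>(faces_of c)" unfolding Union_faces_of using x by blast
  have xA: "x \<notin> set A" using xU A(1) by blast
  have d: "distinct F \<and> x \<notin> set F" if "(s, F) \<in> set c" for s F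
    using wf_chainD(1)[OF wf that] x[OF that] by simp
  have f: "faces_of (star_chain A x c) = stellar (faces_of c) (set A) x"
    by (rule faces_of_star_chain[OF x A(2)])
  have o: "orient_of (star_chain A x c) = stellar_orient (set A) x (orient_of c)"
    by (rule orient_of_star_chain[OF d A(2) xA])
  show ?thesis
    unfolding sph_def oriented_sphere_def fst_conv snd_conv f o
    using wf_star_chain[OF wf A(2) x] pl_sphere_stellar_iff[OF fc A xU, of n] pl
      orientation_stellar[OF or fc A xU card_faces_of[OF wf]] by simp
qed

text \<open>
  Moving \<open>v\<close> to the front of a facet and deleting it there changes the sign by the number of
  vertices before \<open>v\<close>.
\<close>

definition lk :: "nat \<Rightarrow> ochain \<Rightarrow> ochain" where
  "lk v c = map (\<lambda>(s, F). (if even (length (takeWhile (\<lambda>w. w \<noteq> v) F)) then s else - s, remove1 v F))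
     (filter (\<lambda>(s, F). v \<in> set F) c)"

lemma lk_Nil [simp]: "lk v [] = []"
  and lk_Cons: "lk v ((s, F) # c) = (if v \<in> set F then
      [(if even (length (takeWhile (\<lambda>w. w \<noteq> v) F)) then s else - s, remove1 v F)] else []) @ lk v c"
  and lk_append [simp]: "lk v (c @ d) = lk v c @ lk v d"
  by (simp_all add: lk_def)

lemma psign_front: "v \<notin> set us \<Longrightarrow> psign (us @ v # vs) = (-1) ^ length us * psign (v # us @ vs)"
proof (induction us arbitrary: vs rule: rev_induct)
  case Nil
  then show ?case by (simp del: psign.simps)
next
  case (snoc u us)
  have "psign ((us @ [u]) @ v # vs) = - psign (us @ v # u # vs)"
    using psign_swap[of u v us vs] snoc.prems by (simp del: psign.simps)
  also have "psign (us @ v # u # vs) = (-1) ^ length us * psign (v # us @ u # vs)"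
    using snoc by (simp del: psign.simps)
  finally show ?case by (simp del: psign.simps)
qed

lemma takeWhile_front: "v \<notin> set us \<Longrightarrow> takeWhile (\<lambda>w. w \<noteq> v) (us @ v # vs) = us"
  by (induction us) auto

lemma cell_Cons_same: "v \<notin> set G \<Longrightarrow> cell (v # G) (v # xs) = cell G xs"
proof -
  assume v: "v \<notin> set G"
  show ?thesis
  proof (cases "distinct G \<and> distinct xs \<and> set xs = set G")
    case True
    then have "mset xs = mset G" using set_eq_iff_mset_eq_distinct by blast
    then have "mset (filter P xs) = mset (filter P G)" for P by simp
    then have "length (filter P xs) = length (filter P G)" for P by (metis size_mset)
    then show ?thesis using True v by (auto simp: cell_def)
  next
    case False
    have "\<not> (distinct (v # G) \<and> distinct (v # xs) \<and> set (v # xs) = set (v # G))"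
      using False v by auto
    then have "cell (v # G) (v # xs) = 0" unfolding cell_def by (rule if_not_P)
    moreover have "cell G xs = 0" unfolding cell_def using False by (rule if_not_P)
    ultimately show ?thesis by simp
  qed
qed

lemma cell_link:
  assumes "distinct F" "v \<in> set F"
  shows "cell F (v # xs) = (if even (length (takeWhile (\<lambda>w. w \<noteq> v) F)) then 1 else -1) * cell (remove1 v F) xs"
proof -
  obtain us vs where F: "F = us @ v # vs" "v \<notin> set us" using split_list_first[OF assms(2)] by blast
  have v: "v \<notin> set (us @ vs)" "distinct (us @ vs)" using assms(1) F by auto
  have "takeWhile (\<lambda>w. w \<noteq> v) F = us" unfolding F(1) by (rule takeWhile_front[OF F(2)])
  moreover have "remove1 v F = us @ vs" using F by (simp add: remove1_append)
  moreover have "cell F (v # xs) = (-1) ^ length us * cell (v # us @ vs) (v # xs)"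
    using assms(1) F psign_front[OF F(2), of vs] by (auto simp: cell_def)
  ultimately show ?thesis using cell_Cons_same[OF v(1)] by (simp add: uminus_power_if)
qed

lemma induced_orient_of:
  assumes "\<And>s F. (s, F) \<in> set c \<Longrightarrow> distinct F"
  shows "induced (orient_of c) v = orient_of (lk v c)"
  using assms
proof (induction c)
  case Nil
  then show ?case by (simp add: induced_def fun_eq_iff)
next
  case (Cons p c)
  obtain s F where p: "p = (s, F)" by (cases p)
  have F: "distinct F" using Cons.prems[of s F] p by auto
  have IH: "orient_of c (v # xs) = orient_of (lk v c) xs" for xs
  proof -
    have "induced (orient_of c) v = orient_of (lk v c)"
      by (rule Cons.IH) (rule Cons.prems, rule list.set_intros(2))
    then show ?thesis by (metis induced_def)
  qed
  have out: "cell F (v # xs) = 0" if "v \<notin> set F" for xs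
    by (rule cell_eq_0) (use that in auto)
  show ?case
  proof
    fix xs
    show "induced (orient_of (p # c)) v xs = orient_of (lk v (p # c)) xs"
    proof (cases "v \<in> set F")
      case True
      then show ?thesis by (simp add: induced_def p lk_Cons IH cell_link[OF F True])
    next
      case False
      then show ?thesis by (simp add: induced_def p lk_Cons IH out[OF False])
    qed
  qed
qed

lemma link_Un: "link (K \<union> L) \<sigma> = link K \<sigma> \<union> link L \<sigma>"
  by (auto simp: link_def)

lemma link_Pow: "link (Pow F) {v} = (if v \<in> F then Pow (F - {v}) else {})"
  by (auto simp: link_def)

lemma link_faces_of:
  assumes "\<And>s F. (s, F) \<in> set c \<Longrightarrow> distinct F"
  shows "link (faces_of c) {v} = faces_of (lk v c)"
  using assms
proof (induction c)
  case Nil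
  then show ?case by (simp add: link_def)
next
  case (Cons p c)
  obtain s F where p: "p = (s, F)" by (cases p)
  have d: "distinct F" using Cons.prems[of s F] p by auto
  have IH: "link (faces_of c) {v} = faces_of (lk v c)"
    by (rule Cons.IH) (rule Cons.prems, rule list.set_intros(2))
  show ?case
    unfolding p faces_of_Cons link_Un link_Pow IH lk_Cons faces_of_append
    by (simp add: set_remove1_eq[OF d])
qed

text \<open>
  Signed facets with sorted vertices: two lists of signed facets with the same normal form, up to
  order, describe the same oriented complex.
\<close>

definition nrm :: "ochain \<Rightarrow> ochain" where
  "nrm c = map (\<lambda>(s, F). (s * psign F, sort F)) c"

lemma faces_of_nrm: "faces_of (nrm c) = faces_of c"
  by (force simp: faces_of_def nrm_def)

lemma orient_of_nrm:
  assumes "\<And>s F. (s, F) \<in> set c \<Longrightarrow> distinct F"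
  shows "orient_of (nrm c) = orient_of c"
  using assms
proof (induction c)
  case Nil
  then show ?case by (simp add: nrm_def)
next
  case (Cons p c)
  obtain s F where p: "p = (s, F)" by (cases p)
  have d: "distinct F" using Cons.prems[of s F] p by auto
  have IH: "orient_of (nrm c) = orient_of c"
    by (rule Cons.IH) (rule Cons.prems, rule list.set_intros(2))
  have n: "nrm ((s, F) # c) = (s * psign F, sort F) # nrm c" by (simp add: nrm_def)
  have cs: "s * psign F * cell (sort F) xs = s * cell F xs" for xs
    unfolding cell_sorted[OF d, of xs] by (rule mult.assoc)
  show ?case
    unfolding p n by (rule ext) (simp only: orient_of_Cons cs IH)
qed

lemma orient_of_mset: "mset c = mset d \<Longrightarrow> orient_of c = orient_of d"
proof
  fix xs assume "mset c = mset d"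
  then have "mset (map (\<lambda>(s, F). s * cell F xs) c) = mset (map (\<lambda>(s, F). s * cell F xs) d)" by simp
  then show "orient_of c xs = orient_of d xs"
    unfolding orient_of_def by (metis sum_mset_sum_list)
qed

lemma faces_of_set: "set c = set d \<Longrightarrow> faces_of c = faces_of d"
  by (simp add: faces_of_def)

definition eqv :: "ochain \<Rightarrow> ochain \<Rightarrow> bool" where
  "eqv c d \<longleftrightarrow> faces_of c = faces_of d \<and> orient_of c = orient_of d"

lemma eqvI:
  assumes "mset (nrm c) = mset (nrm d)"
    and "\<And>s F. (s, F) \<in> set c \<Longrightarrow> distinct F" "\<And>s F. (s, F) \<in> set d \<Longrightarrow> distinct F"
  shows "eqv c d"
  unfolding eqv_def
  using faces_of_set[OF mset_eq_setD[OF assms(1)]] orient_of_mset[OF assms(1)]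
  by (simp add: faces_of_nrm orient_of_nrm[OF assms(2)] orient_of_nrm[OF assms(3)])

lemma eqv_refl: "eqv c c" and eqv_sym: "eqv c d \<Longrightarrow> eqv d c" and eqv_trans: "eqv c d \<Longrightarrow> eqv d e \<Longrightarrow> eqv c e"
  by (auto simp: eqv_def)

section \<open>Local formulae on signed facets\<close>

definition map_chain :: "(nat \<Rightarrow> nat) \<Rightarrow> ochain \<Rightarrow> ochain" where
  "map_chain g c = map (\<lambda>(s, F). (s, map g F)) c"

definition neg_chain :: "ochain \<Rightarrow> ochain" where
  "neg_chain c = map (\<lambda>(s, F). (- s, F)) c"

definition val :: "(ocomplex \<Rightarrow> 'g::ab_group_add) \<Rightarrow> ochain \<Rightarrow> 'g" where
  "val f c = f (faces_of c, orient_of c)"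

lemma val_eqv: "eqv c d \<Longrightarrow> val f c = val f d"
  by (simp add: eqv_def val_def)

lemma map_chain_Nil [simp]: "map_chain g [] = []"
  and map_chain_Cons [simp]: "map_chain g ((s, F) # c) = (s, map g F) # map_chain g c"
  and map_chain_append [simp]: "map_chain g (c @ d) = map_chain g c @ map_chain g d"
  by (simp_all add: map_chain_def)

lemma neg_chain_Nil [simp]: "neg_chain [] = []"
  and neg_chain_Cons [simp]: "neg_chain ((s, F) # c) = (- s, F) # neg_chain c"
  and neg_chain_append [simp]: "neg_chain (c @ d) = neg_chain c @ neg_chain d"
  by (simp_all add: neg_chain_def)

lemma faces_of_map_chain: "faces_of (map_chain g c) = (`) g ` faces_of c"
proof (induction c)
  case (Cons p c)
  obtain s F where p: "p = (s, F)" by (cases p)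
  have "Pow (g ` set F) = (`) g ` Pow (set F)" by (simp add: image_Pow_surj)
  then show ?case using Cons by (simp add: p image_Un)
qed simp

lemma faces_of_neg_chain: "faces_of (neg_chain c) = faces_of c"
  by (induction c) auto

lemma orient_of_neg_chain: "orient_of (neg_chain c) = opposite (orient_of c)"
proof
  show "orient_of (neg_chain c) xs = opposite (orient_of c) xs" for xs
    by (induction c) (auto simp: opposite_def)
qed

lemma cell_map_eq:
  assumes g: "inj_on g V" and F: "set F \<subseteq> V" and xs: "set xs \<subseteq> V"
  shows "cell (map g F) (map g xs) = cell F xs"
proof (cases "set xs \<subseteq> set F")
  case True
  then show ?thesis using cell_map[OF inj_on_subset[OF g F]] by blast
next
  case False
  then have "set xs \<noteq> set F" by blast
  moreover have "set (map g xs) \<noteq> set (map g F)"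
    using inj_on_image_eq_iff[OF g xs F] \<open>set xs \<noteq> set F\<close> by simp
  ultimately show ?thesis using cell_eq_0 by metis
qed

lemma orient_of_map_chain:
  assumes g: "inj_on g V" and V: "\<Union>(faces_of c) \<subseteq> V" and xs: "set xs \<subseteq> V"
  shows "orient_of (map_chain g c) (map g xs) = orient_of c xs"
  using V
proof (induction c)
  case (Cons p c)
  obtain s F where p: "p = (s, F)" by (cases p)
  have "set F \<subseteq> V" using Cons.prems p by auto
  then show ?case using Cons cell_map_eq[OF g _ xs] by (simp add: p)
qed simp

lemma orient_of_outside: "\<not> set xs \<subseteq> \<Union>(faces_of c) \<Longrightarrow> orient_of c xs = 0"
proof (induction c)
  case (Cons p c)
  obtain s F where p: "p = (s, F)" by (cases p)
  have "set xs \<noteq> set F" using Cons.prems p by auto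
  moreover have "\<not> set xs \<subseteq> \<Union>(faces_of c)" using Cons.prems p by auto
  ultimately show ?case using Cons.IH cell_eq_0 by (simp add: p)
qed simp

lemma orientation_opposite:
  assumes "orientation n K \<omega>" shows "orientation n K (opposite \<omega>)"
proof -
  have vals: "\<omega> xs \<in> {-1, 0, 1}" for xs using assms unfolding orientation_def by blast
  have supp: "\<omega> xs \<noteq> 0 \<longleftrightarrow> length xs = n \<and> distinct xs \<and> set xs \<in> K" for xs
    using assms unfolding orientation_def by blast
  have alt: "\<omega> (xs @ a # b # ys) = - \<omega> (xs @ b # a # ys)" for xs a b ys
    using assms unfolding orientation_def by blast
  have coh: "\<omega> (b # xs) = - \<omega> (a # xs)" if "a \<noteq> b" "\<omega> (a # xs) \<noteq> 0" "\<omega> (b # xs) \<noteq> 0" for a b xs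
    using assms that unfolding orientation_def by blast
  show ?thesis
    unfolding orientation_def opposite_def
  proof (intro conjI allI impI)
    show "- \<omega> xs \<in> {-1, 0, 1}" for xs using vals[of xs] by auto
    show "- \<omega> xs \<noteq> 0 \<longleftrightarrow> length xs = n \<and> distinct xs \<and> set xs \<in> K" for xs using supp[of xs] by simp
    show "- \<omega> (xs @ a # b # ys) = - (- \<omega> (xs @ b # a # ys))" for xs a b ys using alt[of xs a b ys] by simp
    show "- \<omega> (b # xs) = - (- \<omega> (a # xs))" if "a \<noteq> b" "- \<omega> (a # xs) \<noteq> 0" "- \<omega> (b # xs) \<noteq> 0" for a b xs
      using coh[of a b xs] that by simp
  qed
qed

lemma oriented_sphere_opposite:
  "oriented_sphere n (K, opposite \<omega>) \<longleftrightarrow> oriented_sphere n (K, \<omega>)"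
proof -
  have "opposite (opposite \<omega>) = \<omega>" by (simp add: opposite_def)
  then show ?thesis using orientation_opposite[of n K \<omega>] orientation_opposite[of n K "opposite \<omega>"]
    by (auto simp: oriented_sphere_def)
qed

lemma orientation_map_chain:
  assumes or: "orientation n (faces_of c) (orient_of c)" and g: "inj_on g (\<Union>(faces_of c))"
  shows "orientation n (faces_of (map_chain g c)) (orient_of (map_chain g c))"
proof -
  let ?V = "\<Union>(faces_of c)" and ?w = "orient_of (map_chain g c)" and ?\<omega> = "orient_of c"
  have vals: "?\<omega> xs \<in> {-1, 0, 1}" for xs using or unfolding orientation_def by blast
  have supp: "?\<omega> xs \<noteq> 0 \<longleftrightarrow> length xs = n \<and> distinct xs \<and> set xs \<in> faces_of c" for xs
    using or unfolding orientation_def by blast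
  have coh: "?\<omega> (b # xs) = - ?\<omega> (a # xs)" if "a \<noteq> b" "?\<omega> (a # xs) \<noteq> 0" "?\<omega> (b # xs) \<noteq> 0" for a b xs
    using or that unfolding orientation_def by blast
  have UV: "\<Union>(faces_of (map_chain g c)) = g ` ?V" unfolding faces_of_map_chain by blast
  have lift: "\<exists>ys. set ys \<subseteq> ?V \<and> xs = map g ys" if "set xs \<subseteq> g ` ?V" for xs
  proof -
    have "xs = map g (map (inv_into ?V g) xs)"
      using that by (auto simp: f_inv_into_f subset_iff intro!: map_idI[symmetric])
    moreover have "set (map (inv_into ?V g) xs) \<subseteq> ?V" unfolding set_map using that by (blast intro: inv_into_into)
    ultimately show ?thesis by blast
  qed
  have eq: "?w (map g ys) = ?\<omega> ys" if "set ys \<subseteq> ?V" for ys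
    by (rule orient_of_map_chain[OF g order_refl that])
  have out: "?w xs = 0" if "\<not> set xs \<subseteq> g ` ?V" for xs
    using orient_of_outside[of xs "map_chain g c"] that unfolding UV by blast
  have memb: "g ` \<sigma> \<in> faces_of (map_chain g c) \<longleftrightarrow> \<sigma> \<in> faces_of c" if "\<sigma> \<subseteq> ?V" for \<sigma>
  proof
    assume "g ` \<sigma> \<in> faces_of (map_chain g c)"
    then obtain \<tau> where t: "\<tau> \<in> faces_of c" "g ` \<sigma> = g ` \<tau>" unfolding faces_of_map_chain by blast
    have "\<tau> \<subseteq> ?V" using t(1) by blast
    then have "\<sigma> = \<tau>" using iffD1[OF inj_on_image_eq_iff[OF g that] t(2)] by simp
    then show "\<sigma> \<in> faces_of c" using t(1) by simp
  qed (auto simp: faces_of_map_chain)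
  show ?thesis
    unfolding orientation_def
  proof (intro conjI allI impI)
    show "?w xs \<in> {-1, 0, 1}" for xs
    proof (cases "set xs \<subseteq> g ` ?V")
      case True
      then obtain ys where "set ys \<subseteq> ?V" "xs = map g ys" using lift by blast
      then show ?thesis using eq vals by simp
    qed (use out in simp)
    show "?w xs \<noteq> 0 \<longleftrightarrow> length xs = n \<and> distinct xs \<and> set xs \<in> faces_of (map_chain g c)" for xs
    proof (cases "set xs \<subseteq> g ` ?V")
      case True
      then obtain ys where ys: "set ys \<subseteq> ?V" "xs = map g ys" using lift by blast
      have "distinct xs \<longleftrightarrow> distinct ys" using inj_on_subset[OF g ys(1)] by (simp add: ys(2) distinct_map)
      moreover have "set xs = g ` set ys" by (simp add: ys(2))
      ultimately show ?thesis using eq[OF ys(1)] supp[of ys] memb[OF ys(1)] ys(2) by simp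
    next
      case False
      have "set xs \<notin> faces_of (map_chain g c)"
      proof
        assume "set xs \<in> faces_of (map_chain g c)"
        then have "set xs \<subseteq> \<Union>(faces_of (map_chain g c))" by (rule Union_upper)
        then show False using False unfolding UV by simp
      qed
      then show ?thesis using out[OF False] by simp
    qed
    show "?w (xs @ a # b # ys) = - ?w (xs @ b # a # ys)" for xs a b ys by (rule orient_of_swap)
    show "?w (b # xs) = - ?w (a # xs)" if ab: "a \<noteq> b" "?w (a # xs) \<noteq> 0" "?w (b # xs) \<noteq> 0" for a b xs
    proof -
      have "set (a # xs) \<subseteq> g ` ?V" "set (b # xs) \<subseteq> g ` ?V" using out ab by blast+
      then obtain a' b' ys where v: "a' \<in> ?V" "a = g a'" "b' \<in> ?V" "b = g b'" "set ys \<subseteq> ?V" "xs = map g ys"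
        using lift[of xs] by auto
      then have "?w (a # xs) = ?\<omega> (a' # ys)" "?w (b # xs) = ?\<omega> (b' # ys)"
        using eq[of "a' # ys"] eq[of "b' # ys"] by simp_all
      moreover have "a' \<noteq> b'" using ab v by auto
      ultimately show ?thesis using coh[of a' b' ys] ab by simp
    qed
  qed
qed

lemma oriented_sphere_map_chain:
  assumes "oriented_sphere n (faces_of c, orient_of c)" "inj_on g (\<Union>(faces_of c))"
  shows "oriented_sphere n (faces_of (map_chain g c), orient_of (map_chain g c))"
  using assms orientation_map_chain[of n c g] pl_sphere_image[of n "faces_of c" g]
  unfolding oriented_sphere_def fst_conv snd_conv faces_of_map_chain by blast

lemma map_chain_inverse:
  assumes g: "inj_on g V" and V: "\<Union>(faces_of c) \<subseteq> V"
  shows "map_chain (inv_into V g) (map_chain g c) = c"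
  using V
proof (induction c)
  case (Cons p c)
  obtain s F where p: "p = (s, F)" by (cases p)
  have "set F \<subseteq> V" using Cons.prems p by auto
  then have "map (inv_into V g) (map g F) = F"
    using g by (auto simp: inv_into_f_f subset_iff intro!: map_idI)
  then show ?case using Cons by (simp add: p)
qed simp

lemma val_map_chain:
  assumes f: "f \<in> local_cochains n" and g: "inj_on g (\<Union>(faces_of c))"
  shows "val f (map_chain g c) = val f c"
proof (cases "oriented_sphere n (faces_of c, orient_of c)")
  case True
  have "oriented_iso (faces_of c, orient_of c) (faces_of (map_chain g c), orient_of (map_chain g c))"
    unfolding oriented_iso_def fst_conv snd_conv
    using g faces_of_map_chain[of g c] orient_of_map_chain[OF g order_refl] by blast
  then show ?thesis
    using f True oriented_sphere_map_chain[OF True g] unfolding local_cochains_def val_def by simp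
next
  case False
  let ?V = "\<Union>(faces_of c)"
  have "\<not> oriented_sphere n (faces_of (map_chain g c), orient_of (map_chain g c))"
  proof
    assume a: "oriented_sphere n (faces_of (map_chain g c), orient_of (map_chain g c))"
    have "inj_on (inv_into ?V g) (\<Union>(faces_of (map_chain g c)))"
      unfolding faces_of_map_chain
      by (rule inj_on_subset[OF inj_on_inv_into[OF subset_refl]]) blast
    from oriented_sphere_map_chain[OF a this] show False
      using False map_chain_inverse[OF g order_refl] by simp
  qed
  then show ?thesis using f False unfolding local_cochains_def val_def by simp
qed

lemma val_neg_chain:
  assumes f: "f \<in> local_cochains n"
  shows "val f (neg_chain c) = - val f c"
proof (cases "oriented_sphere n (faces_of c, orient_of c)")
  case True
  then show ?thesis
    using f unfolding local_cochains_def val_def faces_of_neg_chain orient_of_neg_chain by simp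
next
  case False
  then have "\<not> oriented_sphere n (faces_of c, opposite (orient_of c))" by (simp add: oriented_sphere_opposite)
  then show ?thesis
    using f False unfolding local_cochains_def val_def faces_of_neg_chain orient_of_neg_chain by simp
qed

text \<open>
  In a group without 2-torsion a value that equals its negative vanishes.
\<close>

lemma val_reversible:
  fixes f :: "ocomplex \<Rightarrow> rat"
  assumes "f \<in> local_cochains n" "inj_on g (\<Union>(faces_of c))" "eqv (map_chain g c) (neg_chain c)"
  shows "val f c = 0"
  using val_map_chain[OF assms(1,2)] val_neg_chain[OF assms(1), of c] val_eqv[OF assms(3), of f] by simp

lemma local_formula_relation:
  assumes f: "f \<in> local_formulae n" and c: "sph (Suc n) c"
  shows "(\<Sum>v\<in>\<Union>(faces_of c). val f (lk v c)) = 0"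
proof -
  have "local_delta n f (faces_of c, orient_of c) = 0"
    using f by (simp add: local_formulae_def)
  moreover have "distinct F" if "(s, F) \<in> set c" for s F
    using c that wf_chainD(1) unfolding sph_def by blast
  ultimately show ?thesis
    using c link_faces_of[of c] induced_orient_of[of c]
    by (simp add: local_delta_def sph_def val_def)
qed

section \<open>Boundaries of simplices and commuting subdivisions\<close>

text \<open>
  The boundary of the simplex \<open>V\<close>: its facets are the links of the vertices in the full simplex.
\<close>

definition simplex_boundary :: "nat list \<Rightarrow> ochain" where
  "simplex_boundary V = concat (map (\<lambda>v. lk v [(1, V)]) V)"

lemma orient_of_concat: "orient_of (concat cs) xs = (\<Sum>c\<leftarrow>cs. orient_of c xs)"
  by (induction cs) auto

lemma orient_of_simplex_boundary:
  assumes "distinct V"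
  shows "orient_of (simplex_boundary V) xs = (\<Sum>v\<in>set V. cell V (v # xs))"
proof -
  have "orient_of (lk v [(1, V)]) xs = cell V (v # xs)" for v
    using induced_orient_of[of "[(1, V)]" v] assms by (simp add: induced_def fun_eq_iff)
  then show ?thesis
    using assms by (simp add: simplex_boundary_def orient_of_concat comp_def sum_list_distinct_conv_sum_set)
qed

lemma orient_of_simplex_boundary_missing:
  assumes V: "distinct V" and v: "set V - set xs = {v}"
  shows "orient_of (simplex_boundary V) xs = cell V (v # xs)"
proof -
  have "cell V (w # xs) = 0" if "w \<in> set V - {v}" for w
    by (rule cell_eq_0) (use that v in auto)
  then have "(\<Sum>w\<in>set V - {v}. cell V (w # xs)) = 0" by simp
  moreover have "v \<in> set V" using v by blast
  ultimately show ?thesis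
    using sum.remove[of "set V" v "\<lambda>w. cell V (w # xs)"] by (simp add: orient_of_simplex_boundary[OF V])
qed

lemma orientation_simplex_boundary:
  assumes V: "distinct V" "length V = Suc n"
  shows "orientation n {\<sigma>. \<sigma> \<subset> set V} (orient_of (simplex_boundary V))"
proof -
  let ?w = "orient_of (simplex_boundary V)"
  have nz: "\<exists>v. set V - set xs = {v} \<and> length xs = n \<and> distinct xs \<and> set xs \<subset> set V \<and> ?w xs = cell V (v # xs)"
    if wx: "?w xs \<noteq> 0" for xs
  proof -
    obtain v where v: "v \<in> set V" "cell V (v # xs) \<noteq> 0"
      using wx sum.neutral[of "set V" "\<lambda>v. cell V (v # xs)"] unfolding orient_of_simplex_boundary[OF V(1)] by blast
    then have d: "distinct (v # xs)" "set (v # xs) = set V" by (auto simp: cell_def split: if_splits)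
    have m: "set V - set xs = {v}" using d by auto
    have "length (v # xs) = Suc n" using d V by (metis distinct_card)
    moreover have "set xs \<subset> set V" using d by auto
    ultimately show ?thesis using m d orient_of_simplex_boundary_missing[OF V(1) m] by auto
  qed
  have nz': "?w xs = 1 \<or> ?w xs = -1" if xs: "length xs = n" "distinct xs" "set xs \<subset> set V" for xs
  proof -
    have "card (set V - set xs) = 1"
      using card_Diff_subset[of "set xs" "set V"] xs V by (simp add: distinct_card)
    then obtain v where v: "set V - set xs = {v}" by (auto simp: card_1_singleton_iff)
    then have "distinct (v # xs)" "set (v # xs) = set V" using xs by auto
    then show ?thesis
      using V psign_cases[of V] psign_cases[of "v # xs"]
      by (auto simp: orient_of_simplex_boundary_missing[OF V(1) v] cell_def simp del: psign.simps)
  qed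
  show ?thesis
    unfolding orientation_def
  proof (intro conjI allI impI)
    show "?w xs \<in> {-1, 0, 1}" for xs using nz[of xs] nz'[of xs] by auto
    show "?w xs \<noteq> 0 \<longleftrightarrow> length xs = n \<and> distinct xs \<and> set xs \<in> {\<sigma>. \<sigma> \<subset> set V}" for xs
    proof
      assume "?w xs \<noteq> 0"
      from nz[OF this] show "length xs = n \<and> distinct xs \<and> set xs \<in> {\<sigma>. \<sigma> \<subset> set V}" by blast
    next
      assume "length xs = n \<and> distinct xs \<and> set xs \<in> {\<sigma>. \<sigma> \<subset> set V}"
      then have "?w xs = 1 \<or> ?w xs = -1" by (intro nz') blast+
      then show "?w xs \<noteq> 0" by linarith
    qed
    show "?w (xs @ a # b # ys) = - ?w (xs @ b # a # ys)" for xs a b ys by (rule orient_of_swap)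
    show "?w (b # xs) = - ?w (a # xs)" if ab: "a \<noteq> b" "?w (a # xs) \<noteq> 0" "?w (b # xs) \<noteq> 0" for a b xs
    proof -
      obtain v where v: "set V - set (a # xs) = {v}" "distinct (a # xs)" "set (a # xs) \<subset> set V" "?w (a # xs) = cell V (v # a # xs)"
        using nz[OF ab(2)] by blast
      obtain w where w: "set V - set (b # xs) = {w}" "distinct (b # xs)" "set (b # xs) \<subset> set V" "?w (b # xs) = cell V (w # b # xs)"
        using nz[OF ab(3)] by blast
      have "b \<in> set V - set (a # xs)" "a \<in> set V - set (b # xs)" using v(2,3) w(2,3) ab(1) by auto
      then have "v = b" "w = a" unfolding v(1) w(1) by simp_all
      then show ?thesis using v(4) w(4) cell_swap[of V "[]" a b xs] by simp
    qed
  qed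
qed

lemma faces_of_simplex_boundary:
  assumes "distinct V" "2 \<le> length V" shows "faces_of (simplex_boundary V) = {\<sigma>. \<sigma> \<subset> set V}"
proof -
  have "faces_of (simplex_boundary V) = (\<Union>v\<in>set V. Pow (set V - {v}))"
    using assms(1) by (auto simp: simplex_boundary_def faces_of_def lk_def)
  also have "\<dots> = {\<sigma>. \<sigma> \<subset> set V}" by blast
  finally show ?thesis .
qed

lemma sph_simplex_boundary:
  assumes V: "distinct V" "length V = Suc n" "1 \<le> n" shows "sph n (simplex_boundary V)"
proof -
  have "wf_chain n (simplex_boundary V)"
  proof -
    have "simplex_boundary V \<noteq> []" using V by (cases V) (auto simp: simplex_boundary_def lk_Cons)
    then show ?thesis using V by (auto simp: wf_chain_def simplex_boundary_def lk_def length_remove1)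
  qed
  then show ?thesis
    using orientation_simplex_boundary[OF V(1,2)] pl_sphere_simplex_boundary[of "set V" n] V
    by (simp add: sph_def oriented_sphere_def faces_of_simplex_boundary distinct_card)
qed

lemma sph_eqv:
  assumes "sph n c" "eqv c d" "wf_chain n d" shows "sph n d"
  using assms by (simp add: sph_def eqv_def)

lemma wf_map_chain:
  assumes "wf_chain n c" "inj_on g (\<Union>(faces_of c))" shows "wf_chain n (map_chain g c)"
proof -
  have "inj_on g (set F)" if "(s, F) \<in> set c" for s F
    by (rule inj_on_subset[OF assms(2)]) (use that in \<open>auto simp: faces_of_def\<close>)
  then show ?thesis using assms(1) by (auto simp: wf_chain_def map_chain_def distinct_map)
qed

lemma sph_map_chain:
  assumes "sph n c" "inj_on g (\<Union>(faces_of c))" shows "sph n (map_chain g c)"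
  using assms wf_map_chain oriented_sphere_map_chain unfolding sph_def by blast

lemma star_chain_cong_set:
  assumes "set A = set B" shows "star_chain A x c = star_chain B x c"
  unfolding star_chain_def assms ..

lemma star_chain_neg: "star_chain A x (neg_chain c) = neg_chain (star_chain A x c)"
proof (induction c)
  case (Cons p c)
  obtain s F where "p = (s, F)" by (cases p)
  then show ?case using Cons by (auto simp: star_chain_Cons neg_chain_def)
qed simp

lemma lk_neg: "lk v (neg_chain c) = neg_chain (lk v c)"
proof (induction c)
  case (Cons p c)
  obtain s F where "p = (s, F)" by (cases p)
  then show ?case using Cons by (simp add: lk_Cons)
qed simp

lemma nochange_star: "(\<And>s F. (s, F) \<in> set c \<Longrightarrow> \<not> set A \<subseteq> set F) \<Longrightarrow> star_chain A x c = c"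
proof (induction c)
  case (Cons p c)
  obtain s F where p: "p = (s, F)" by (cases p)
  have "\<not> set A \<subseteq> set F" using Cons.prems[of s F] p by simp
  moreover have "star_chain A x c = c" by (rule Cons.IH) (rule Cons.prems, rule list.set_intros(2))
  ultimately show ?case by (simp add: p star_chain_Cons)
qed simp

lemma map_chain_star:
  assumes g: "inj_on g V" and V: "\<Union>(faces_of c) \<subseteq> V" "set A \<subseteq> V"
  shows "map_chain g (star_chain A x c) = star_chain (map g A) (g x) (map_chain g c)"
  using V(1)
proof (induction c)
  case (Cons p c)
  obtain s F where p: "p = (s, F)" by (cases p)
  have F: "set F \<subseteq> V" using Cons.prems p by auto
  have sub: "g ` set A \<subseteq> g ` set F \<longleftrightarrow> set A \<subseteq> set F" 
    using inj_on_image_mem_iff[OF g _ F] V(2) by blast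
  have mem: "g a \<in> g ` set A \<longleftrightarrow> a \<in> set A" if "a \<in> set F" for a
    by (rule inj_on_image_mem_iff[OF g _ V(2)]) (use that F in blast)
  have fil: "filter (\<lambda>a. a \<in> g ` set A) (map g F) = map g (filter (\<lambda>a. a \<in> set A) F)"
    using mem by (auto simp: filter_map comp_def cong: filter_cong)
  have rep: "map (\<lambda>v. if v = g a then g x else v) (map g F) = map g (map (\<lambda>v. if v = a then x else v) F)"
    if "a \<in> set F" for a
  proof -
    have e: "g w = g a \<longleftrightarrow> w = a" if w: "w \<in> set F" for w
      by (rule inj_on_eq_iff[OF g]) (use w \<open>a \<in> set F\<close> F in blast)+
    show ?thesis unfolding map_map comp_def by (rule map_cong) (simp_all add: e)
  qed
  have IH: "map_chain g (star_chain A x c) = star_chain (map g A) (g x) (map_chain g c)"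
    using Cons by (simp add: p)
  have "map_chain g (map (\<lambda>a. (s, map (\<lambda>v. if v = a then x else v) F)) (filter (\<lambda>a. a \<in> set A) F)) =
      map (\<lambda>a. (s, map (\<lambda>v. if v = a then g x else v) (map g F))) (filter (\<lambda>a. a \<in> set (map g A)) (map g F))"
    unfolding set_map fil using rep by (simp add: map_chain_def)
  then show ?case
    unfolding p map_chain_Cons star_chain_Cons map_chain_append IH set_map sub by simp
qed simp

lemma lk_empty: "(\<And>s F. (s, F) \<in> set c \<Longrightarrow> v \<notin> set F) \<Longrightarrow> lk v c = []"
  by (auto simp: lk_def filter_empty_conv)

lemma lk_star:
  assumes d: "\<And>s F. (s, F) \<in> set c \<Longrightarrow> distinct F" and A: "distinct A" and v: "v \<noteq> x"
  shows "lk v (star_chain A x c) = star_chain (remove1 v A) x (lk v c)"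
  using d
proof (induction c)
  case (Cons p c)
  obtain s F where p: "p = (s, F)" by (cases p)
  have F: "distinct F" using Cons.prems[of s F] p by simp
  have IH: "lk v (star_chain A x c) = star_chain (remove1 v A) x (lk v c)"
    by (rule Cons.IH) (rule Cons.prems, rule list.set_intros(2))
  let ?r = "\<lambda>a F. map (\<lambda>w. if w = a then x else w) F"
  have head: "lk v (if set A \<subseteq> set F then map (\<lambda>a. (s, ?r a F)) (filter (\<lambda>a. a \<in> set A) F) else [(s, F)]) =
     star_chain (remove1 v A) x (lk v [(s, F)])"
  proof (cases "v \<in> set F")
    case False
    have "v \<notin> set (?r a F)" for a using False v by auto
    then have "lk v (if set A \<subseteq> set F then map (\<lambda>a. (s, ?r a F)) (filter (\<lambda>a. a \<in> set A) F) else [(s, F)]) = []"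
      by (intro lk_empty) (use False v in \<open>auto split: if_splits\<close>)
    moreover have "lk v [(s, F)] = []" using False by (intro lk_empty) auto
    ultimately show ?thesis by simp
  next
    case True
    let ?t = "if even (length (takeWhile (\<lambda>w. w \<noteq> v) F)) then s else - s"
    have sub: "set (remove1 v A) \<subseteq> set (remove1 v F) \<longleftrightarrow> set A \<subseteq> set F"
      using True A F by auto
    have one: "lk v [(s, ?r a F)] = (if a = v then [] else [(?t, ?r a (remove1 v F))])" if "a \<in> set F" for a
    proof (cases "a = v")
      case True
      then have "v \<notin> set (?r a F)" using v by auto
      then show ?thesis using True by (simp add: lk_def)
    next
      case False
      obtain us vs where F: "F = us @ v # vs" "v \<notin> set us" using split_list_first[OF True] by blast
      have "?r a F = ?r a us @ v # ?r a vs" using F False by simp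
      moreover have "v \<notin> set (?r a us)" using F v by auto
      ultimately show ?thesis
        using F False v by (simp add: lk_Cons takeWhile_front remove1_append)
    qed
    have many: "lk v (map (\<lambda>a. (s, ?r a F)) as) = map (\<lambda>a. (?t, ?r a (remove1 v F))) (filter (\<lambda>a. a \<noteq> v) as)"
      if "set as \<subseteq> set F" for as
      using that
    proof (induction as)
      case (Cons a as)
      then show ?case using one[of a] lk_append[of v "[(s, ?r a F)]" "map (\<lambda>a. (s, ?r a F)) as"] by simp
    qed simp
    have fil: "filter (\<lambda>a. a \<noteq> v) (filter (\<lambda>a. a \<in> set A) F) = filter (\<lambda>a. a \<in> set (remove1 v A)) (remove1 v F)"
      using F A by (auto simp: distinct_remove1_removeAll removeAll_filter_not_eq intro!: filter_cong)
    have lkF: "lk v [(s, F)] = [(?t, remove1 v F)]" using True by (simp add: lk_Cons)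
    show ?thesis
    proof (cases "set A \<subseteq> set F")
      case sA: True
      have "lk v (map (\<lambda>a. (s, ?r a F)) (filter (\<lambda>a. a \<in> set A) F)) =
          map (\<lambda>a. (?t, ?r a (remove1 v F))) (filter (\<lambda>a. a \<in> set (remove1 v A)) (remove1 v F))"
        unfolding fil[symmetric] by (rule many) auto
      then show ?thesis using sA unfolding lkF star_chain_Cons sub by simp
    next
      case sA: False
      then show ?thesis unfolding lkF star_chain_Cons sub by (simp add: lkF)
    qed
  qed
  have "lk v (p # c) = lk v [(s, F)] @ lk v c" using lk_append[of v "[(s, F)]" c] by (simp add: p)
  then show ?case unfolding p star_chain_Cons lk_append head IH star_chain_append by simp
qed simp

lemma lk_drop:
  assumes v: "v \<noteq> x" and A: "\<And>s F. (s, F) \<in> set c \<Longrightarrow> v \<in> set F \<Longrightarrow> \<not> set A \<subseteq> set F"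
  shows "lk v (star_chain A x c) = lk v c"
  using A
proof (induction c)
  case (Cons p c)
  obtain s F where p: "p = (s, F)" by (cases p)
  have IH: "lk v (star_chain A x c) = lk v c"
    by (rule Cons.IH) (rule Cons.prems, auto)
  have "lk v (if set A \<subseteq> set F then map (\<lambda>a. (s, map (\<lambda>w. if w = a then x else w) F)) (filter (\<lambda>a. a \<in> set A) F) else [(s, F)])
     = lk v [(s, F)]"
  proof (cases "set A \<subseteq> set F")
    case True
    then have F: "v \<notin> set F" using Cons.prems[of s F] p by auto
    have "lk v (map (\<lambda>a. (s, map (\<lambda>w. if w = a then x else w) F)) (filter (\<lambda>a. a \<in> set A) F)) = []"
      by (intro lk_empty) (use F v in auto)
    moreover have "lk v [(s, F)] = []" using F by (intro lk_empty) auto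
    ultimately show ?thesis using True by simp
  qed simp
  then show ?case using lk_append[of v "[(s, F)]" c] by (simp add: p star_chain_Cons IH)
qed simp

text \<open>
  A facet affected by both subdivisions would contain both simplices.
\<close>

lemma star_star:
  assumes c: "\<And>s F. (s, F) \<in> set c \<Longrightarrow> \<not> (set A \<subseteq> set F \<and> set B \<subseteq> set F)"
    and x: "x \<notin> set B" and y: "y \<notin> set A"
  shows "star_chain A x (star_chain B y c) = star_chain B y (star_chain A x c)"
  using c
proof (induction c)
  case (Cons p c)
  obtain s F where p: "p = (s, F)" by (cases p)
  have IH: "star_chain A x (star_chain B y c) = star_chain B y (star_chain A x c)"
    by (rule Cons.IH) (rule Cons.prems, rule list.set_intros(2))
  have F: "\<not> (set A \<subseteq> set F \<and> set B \<subseteq> set F)" using Cons.prems[of s F] p by simp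
  have other: "star_chain A' x' (map (\<lambda>a. (s, map (\<lambda>w. if w = a then y' else w) F)) as) =
      map (\<lambda>a. (s, map (\<lambda>w. if w = a then y' else w) F)) as"
    if "\<not> set A' \<subseteq> set F" "y' \<notin> set A'" for A' x' y' as
    by (rule nochange_star) (use that in auto)
  show ?case
    using F other[of A y x] other[of B x y] IH x y
    by (cases "set A \<subseteq> set F"; cases "set B \<subseteq> set F") (simp_all add: p star_chain_Cons)
qed simp

lemma eqv_star:
  assumes "eqv c d" "\<And>s F. (s, F) \<in> set c \<Longrightarrow> distinct F \<and> x \<notin> set F"
    "\<And>s F. (s, F) \<in> set d \<Longrightarrow> distinct F \<and> x \<notin> set F" "set A \<noteq> {}" "x \<notin> set A"
  shows "eqv (star_chain A x c) (star_chain A x d)"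
proof -
  have "x \<notin> set F" if "(s, F) \<in> set c" for s F using assms(2)[OF that] by simp
  moreover have "x \<notin> set F" if "(s, F) \<in> set d" for s F using assms(3)[OF that] by simp
  ultimately show ?thesis
    using assms faces_of_star_chain[of c x A] faces_of_star_chain[of d x A]
      orient_of_star_chain[of c x A] orient_of_star_chain[of d x A]
    unfolding eqv_def by metis
qed

lemma eqv_lk:
  assumes "eqv c d" "\<And>s F. (s, F) \<in> set c \<Longrightarrow> distinct F" "\<And>s F. (s, F) \<in> set d \<Longrightarrow> distinct F"
  shows "eqv (lk v c) (lk v d)"
  using assms link_faces_of[of c v] link_faces_of[of d v] induced_orient_of[of c v] induced_orient_of[of d v]
  unfolding eqv_def by metis

lemma lk_map_chain:
  assumes g: "inj_on g V" and V: "\<Union>(faces_of c) \<subseteq> V" "v \<in> V"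
  shows "lk (g v) (map_chain g c) = map_chain g (lk v c)"
  using V(1)
proof (induction c)
  case (Cons p c)
  obtain s F where p: "p = (s, F)" by (cases p)
  have F: "set F \<subseteq> V" using Cons.prems p by auto
  have IH: "lk (g v) (map_chain g c) = map_chain g (lk v c)" using Cons by (simp add: p)
  have mem: "g v \<in> g ` set F \<longleftrightarrow> v \<in> set F" by (rule inj_on_image_mem_iff[OF g V(2) F])
  have ne: "g w = g v \<longleftrightarrow> w = v" if "w \<in> V" for w
    by (rule inj_on_eq_iff[OF g that V(2)])
  have tw: "length (takeWhile (\<lambda>w. w \<noteq> g v) (map g F)) = length (takeWhile (\<lambda>w. w \<noteq> v) F)"
    using F
  proof (induction F)
    case (Cons w F)
    then show ?case using ne[of w] by simp
  qed simp
  have rm: "remove1 (g v) (map g F) = map g (remove1 v F)"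
    using F
  proof (induction F)
    case (Cons w F)
    then show ?case using ne[of w] by (cases "w = v") auto
  qed simp
  show ?case unfolding p map_chain_Cons lk_Cons map_chain_append IH set_map mem tw rm by simp
qed simp

lemma val_lk_reversible:
  fixes f :: "ocomplex \<Rightarrow> rat"
  assumes f: "f \<in> local_cochains n" and c: "\<And>s F. (s, F) \<in> set c \<Longrightarrow> distinct F"
    and g: "inj g" "g v = v" and r: "eqv (map_chain g c) (neg_chain c)"
  shows "val f (lk v c) = 0"
proof (rule val_reversible[OF f])
  show "inj_on g (\<Union>(faces_of (lk v c)))" by (rule inj_on_subset[OF g(1)]) simp
  have d1: "distinct F" if "(s, F) \<in> set (map_chain g c)" for s F
    using that c inj_on_subset[OF g(1) subset_UNIV] by (auto simp: map_chain_def distinct_map)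
  have d2: "distinct F" if "(s, F) \<in> set (neg_chain c)" for s F
    using that c by (auto simp: neg_chain_def)
  have "eqv (lk (g v) (map_chain g c)) (lk v (neg_chain c))"
    unfolding g(2) by (rule eqv_lk[OF r d1 d2])
  then show "eqv (map_chain g (lk v c)) (neg_chain (lk v c))"
    unfolding lk_neg lk_map_chain[OF g(1) subset_UNIV UNIV_I] .
qed

section \<open>Joins with a circle\<close>

text \<open>
  The edges of the closed polygon \<open>us\<close>.
\<close>

definition cyc :: "nat list \<Rightarrow> (nat \<times> nat) list" where
  "cyc us = zip us (tl us) @ [(last us, hd us)]"

text \<open>
  The join of the simplex \<open>ds\<close> with the closed polygon \<open>us\<close>, with sign \<open>s\<close>.
\<close>

definition ring :: "int \<Rightarrow> nat list \<Rightarrow> nat list \<Rightarrow> ochain" where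
  "ring s ds us = map (\<lambda>(u, w). (s, ds @ [u, w])) (cyc us)"

lemma zip_tl_append: "P \<noteq> [] \<Longrightarrow> Q \<noteq> [] \<Longrightarrow>
    zip (P @ Q) (tl (P @ Q)) = zip P (tl P) @ [(last P, hd Q)] @ zip Q (tl Q)"
proof (induction P)
  case (Cons a P)
  then show ?case by (cases P; cases Q) auto
qed simp

lemma cyc_append: "P \<noteq> [] \<Longrightarrow> Q \<noteq> [] \<Longrightarrow>
    cyc (P @ Q) = zip P (tl P) @ [(last P, hd Q)] @ zip Q (tl Q) @ [(last Q, hd P)]"
  using zip_tl_append[of P Q] by (simp add: cyc_def)

lemma mset_cyc_rotate: "mset (cyc (P @ Q)) = mset (cyc (Q @ P))"
proof (cases "P = [] \<or> Q = []")
  case False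
  then show ?thesis by (simp add: cyc_append)
qed auto

lemma mset_ring_cong: "mset (cyc us) = mset (cyc ws) \<Longrightarrow> mset (ring s ds us) = mset (ring s ds ws)"
  by (simp add: ring_def)

lemma eqv_mset: "mset c = mset d \<Longrightarrow> eqv c d"
  using orient_of_mset[of c d] faces_of_set[OF mset_eq_setD[of c d]] by (simp add: eqv_def)

lemma eqv_append:
  assumes "eqv c c'" "eqv d d'" shows "eqv (c @ d) (c' @ d')"
  using assms by (auto simp: eqv_def fun_eq_iff)

lemma eqv_ring_rotate: "eqv (ring s ds (P @ Q)) (ring s ds (Q @ P))"
  by (rule eqv_mset[OF mset_ring_cong[OF mset_cyc_rotate]])

lemma map_fst_cyc: "us \<noteq> [] \<Longrightarrow> map fst (cyc us) = us"
proof (induction us)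
  case (Cons a us)
  then show ?case by (cases us) (auto simp: cyc_def)
qed simp

lemma map_snd_cyc: "us \<noteq> [] \<Longrightarrow> map snd (cyc us) = tl us @ [hd us]"
proof -
  assume a: "us \<noteq> []"
  have "map snd (zip us (tl us)) = tl us" by (cases us) (simp_all add: map_snd_zip_take)
  then show ?thesis by (simp add: cyc_def)
qed

lemma length_cyc: "us \<noteq> [] \<Longrightarrow> length (cyc us) = length us"
  using map_fst_cyc[of us] by (metis length_map)

lemma cyc_mem:
  assumes "e \<in> set (cyc us)" "us \<noteq> []" shows "fst e \<in> set us" "snd e \<in> set us"
proof -
  have "fst e \<in> set (map fst (cyc us))" using assms by simp
  then show "fst e \<in> set us" using map_fst_cyc[OF assms(2)] by simp
  have "snd e \<in> set (map snd (cyc us))" using assms(1) by simp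
  then have "snd e \<in> set (tl us @ [hd us])" unfolding map_snd_cyc[OF assms(2)] .
  moreover have "set (tl us @ [hd us]) \<subseteq> set us" using assms(2) by (cases us) auto
  ultimately show "snd e \<in> set us" by blast
qed

lemma cyc_inj_fst:
  assumes "distinct us" "us \<noteq> []" "e \<in> set (cyc us)" "e' \<in> set (cyc us)" "fst e = fst e'" shows "e = e'"
  using assms map_fst_cyc[of us] distinct_map[of fst "cyc us"] by (metis inj_onD)

lemma cyc_inj_snd:
  assumes "distinct us" "us \<noteq> []" "e \<in> set (cyc us)" "e' \<in> set (cyc us)" "snd e = snd e'" shows "e = e'"
proof -
  have "distinct (tl us @ [hd us])" using assms(1,2) by (cases us) auto
  then have "distinct (map snd (cyc us))" using map_snd_cyc[OF assms(2)] by simp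
  then show ?thesis using assms(3-5) unfolding distinct_map by (metis inj_onD)
qed

lemma cyc_nth:
  assumes "i < length us"
  shows "cyc us ! i = (us ! i, us ! (Suc i mod length us))"
proof (cases "Suc i < length us")
  case True
  then have "i < length (zip us (tl us))" by simp
  then have "cyc us ! i = zip us (tl us) ! i" by (simp add: cyc_def nth_append del: length_zip)
  then show ?thesis using True by (simp add: nth_tl)
next
  case False
  then have i: "i = length us - 1" "Suc i = length us" using assms by auto
  have "us \<noteq> []" using assms by auto
  then show ?thesis using i by (simp add: cyc_def nth_append last_conv_nth hd_conv_nth)
qed

lemma cyc_index:
  assumes "e \<in> set (cyc us)" "us \<noteq> []"
  obtains i where "i < length us" "e = (us ! i, us ! (Suc i mod length us))"
proof -
  obtain i where i: "i < length (cyc us)" "cyc us ! i = e" using assms(1) by (auto simp: in_set_conv_nth)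
  then show ?thesis using that[of i] cyc_nth[of i us] length_cyc[OF assms(2)] by simp
qed

lemma cyc_edge_unique:
  assumes us: "distinct us" "3 \<le> length us" and e: "e \<in> set (cyc us)" "e' \<in> set (cyc us)"
    and sub: "{fst e, snd e} \<subseteq> {fst e', snd e'}"
  shows "e = e'"
proof -
  let ?n = "length us"
  have ne: "us \<noteq> []" using us(2) by auto
  obtain i where i: "i < ?n" "e = (us ! i, us ! (Suc i mod ?n))"
    using cyc_index[OF e(1) ne] .
  obtain j where j: "j < ?n" "e' = (us ! j, us ! (Suc j mod ?n))"
    using cyc_index[OF e(2) ne] .
  have eq: "us ! a = us ! b \<longleftrightarrow> a = b" if "a < ?n" "b < ?n" for a b
    using nth_eq_iff_index_eq[OF us(1) that] .
  have m: "Suc k mod ?n < ?n" for k using ne by simp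
  have "i = j \<or> i = Suc j mod ?n" using sub i j eq[OF i(1) j(1)] eq[OF i(1) m[of j]] by auto
  then show ?thesis
  proof
    assume "i = j" then show ?thesis using i j by simp
  next
    assume a: "i = Suc j mod ?n"
    have "Suc i mod ?n = j \<or> Suc i mod ?n = Suc j mod ?n"
      using sub i j eq[OF m[of i] j(1)] eq[OF m[of i] m[of j]] by auto
    then show ?thesis
    proof
      assume b: "Suc i mod ?n = j"
      have "(j + 2) mod ?n = j mod ?n"
        using a b j(1) by (metis add_2_eq_Suc' mod_Suc_eq mod_less)
      then have "2 mod ?n = 0" using j(1)
        by (metis add.right_neutral add_diff_cancel_left' le_add1 mod_0 mod_eq_dvd_iff_nat dvd_imp_mod_0)
      then show ?thesis using us(2) by simp
    next
      assume "Suc i mod ?n = Suc j mod ?n"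
      then have "e = e'" using cyc_inj_snd[OF us(1) ne e] i j by simp
      then show ?thesis .
    qed
  qed
qed

lemma cell_swap_left: "cell (F @ a # b # G) xs = - cell (F @ b # a # G) xs"
proof (cases "a = b")
  case True
  then show ?thesis by (simp add: cell_def)
next
  case False
  then show ?thesis using psign_swap[OF False, of F G] by (auto simp: cell_def insert_commute)
qed

lemma orient_of_map_pair: "orient_of (map h es) xs = (\<Sum>e\<leftarrow>es. fst (h e) * cell (snd (h e)) xs)"
  by (induction es) (auto simp: case_prod_beta orient_of_def)

lemma faces_of_ring: "faces_of (ring s ds us) = (\<Union>(u, w)\<in>set (cyc us). Pow (set ds \<union> {u, w}))"
  unfolding ring_def faces_of_def by (auto simp: case_prod_beta)

lemma eqv_ring_swap: "eqv (ring s (F @ a # b # G) us) (ring (- s) (F @ b # a # G) us)"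
proof -
  have "orient_of (ring s (F @ a # b # G) us) xs = orient_of (ring (- s) (F @ b # a # G) us) xs" for xs
  proof -
    have "cell ((F @ a # b # G) @ [u, w]) xs = - cell ((F @ b # a # G) @ [u, w]) xs" for u w
      using cell_swap_left[of F a b "G @ [u, w]" xs] by simp
    then show ?thesis by (auto simp: ring_def orient_of_map_pair case_prod_beta intro!: arg_cong[of _ _ sum_list])
  qed
  then show ?thesis by (simp add: eqv_def fun_eq_iff faces_of_ring insert_commute)
qed

lemma cyc_rev: "us \<noteq> [] \<Longrightarrow> mset (cyc (rev us)) = mset (map prod.swap (cyc us))"
proof -
  assume ne: "us \<noteq> []"
  have z: "zip (rev us) (tl (rev us)) = rev (map prod.swap (zip us (tl us)))"
  proof (induction us)
    case (Cons a us)
    show ?case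
    proof (cases "us = []")
      case False
      then have "zip (rev us @ [a]) (tl (rev us @ [a])) = zip (rev us) (tl (rev us)) @ [(last (rev us), a)]"
        using zip_tl_append[of "rev us" "[a]"] by simp
      then show ?thesis using Cons False by (cases us) (auto simp: last_rev)
    qed simp
  qed simp
  show ?thesis using ne by (simp add: cyc_def z last_rev hd_rev)
qed

lemma eqv_ring_rev:
  assumes "us \<noteq> []" shows "eqv (ring s ds (rev us)) (ring (- s) ds us)"
proof -
  have m: "mset (ring s ds (rev us)) = mset (map (\<lambda>(u, w). (s, ds @ [w, u])) (cyc us))"
    unfolding ring_def mset_map cyc_rev[OF assms]
    by (simp add: image_mset.compositionality comp_def case_prod_beta')
  have "eqv (map (\<lambda>(u, w). (s, ds @ [w, u])) (cyc us)) (ring (- s) ds us)"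
  proof -
    have "orient_of (map (\<lambda>(u, w). (s, ds @ [w, u])) es) xs = orient_of (map (\<lambda>(u, w). (- s, ds @ [u, w])) es) xs"
      for es xs
    proof (induction es)
      case (Cons e es)
      obtain u w where "e = (u, w)" by (cases e)
      then show ?case using Cons cell_swap_left[of ds w u "[]" xs] by simp
    qed simp
    then have "orient_of (map (\<lambda>(u, w). (s, ds @ [w, u])) (cyc us)) xs = orient_of (ring (- s) ds us) xs" for xs
      by (simp add: ring_def)
    moreover have "faces_of (map (\<lambda>(u, w). (s, ds @ [w, u])) (cyc us)) = faces_of (ring (- s) ds us)"
      unfolding ring_def faces_of_def by (auto simp: case_prod_beta)
    ultimately show ?thesis by (simp add: eqv_def fun_eq_iff)
  qed
  then show ?thesis using eqv_mset[OF m] eqv_trans by blast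
qed

lemma star_ring:
  assumes us: "distinct us" "3 \<le> length us" and ds: "set ds \<inter> set us = {}"
  shows "eqv (star_chain [last us, hd us] x (ring s ds us)) (ring s ds (us @ [x]))"
proof -
  have ne: "us \<noteq> []" using us(2) by auto
  let ?h = "\<lambda>(u, w). (s, ds @ [u, w])"
  have e0: "(last us, hd us) \<in> set (cyc us)" by (simp add: cyc_def)
  have dz: "distinct (cyc us)" using map_fst_cyc[OF ne] us(1) by (metis distinct_map)
  have keep: "star_chain [last us, hd us] x (map ?h (zip us (tl us))) = map ?h (zip us (tl us))"
  proof (rule nochange_star, rule notI)
    fix t F assume tF: "(t, F) \<in> set (map ?h (zip us (tl us)))" and sub: "set [last us, hd us] \<subseteq> set F"
    obtain u w where uw: "(u, w) \<in> set (zip us (tl us))" "F = ds @ [u, w]" using tF by auto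
    have uwc: "(u, w) \<in> set (cyc us)" using uw(1) by (simp add: cyc_def)
    have "{last us, hd us} \<subseteq> {u, w}" using sub uw(2) ds ne by auto
    then have "(last us, hd us) = (u, w)" using cyc_edge_unique[OF us e0 uwc] by simp
    then show False using dz uw(1) by (simp add: cyc_def)
  qed
  have lh: "last us \<noteq> hd us" using us by (cases us) (auto simp: last_conv_nth split: if_splits)
  have lds: "last us \<notin> set ds" "hd us \<notin> set ds" using ds ne by auto
  have fil: "filter (\<lambda>a. a \<in> set [last us, hd us]) (ds @ [last us, hd us]) = [last us, hd us]"
    using lds by (auto simp: filter_empty_conv)
  have rep: "map (\<lambda>v. if v = a then x else v) ds = ds" if "a \<notin> set ds" for a
    using that by (auto intro!: map_idI)
  have new: "star_chain [last us, hd us] x [?h (last us, hd us)] = [(s, ds @ [x, hd us]), (s, ds @ [last us, x])]"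
    using fil lh rep lds by (simp add: star_chain_Cons)
  have "star_chain [last us, hd us] x (ring s ds us) = map ?h (zip us (tl us)) @ [(s, ds @ [x, hd us]), (s, ds @ [last us, x])]"
    unfolding ring_def cyc_def map_append star_chain_append keep list.map new ..
  moreover have "ring s ds (us @ [x]) = map ?h (zip us (tl us)) @ [(s, ds @ [last us, x]), (s, ds @ [x, hd us])]"
    using ne by (simp add: ring_def cyc_append)
  ultimately show ?thesis by (intro eqv_mset) simp
qed

lemma lk_ring:
  assumes "d \<notin> set us" "us \<noteq> []"
  shows "lk d (ring s ds us) = (if d \<in> set ds then
     ring (if even (length (takeWhile (\<lambda>w. w \<noteq> d) ds)) then s else - s) (remove1 d ds) us else [])"
proof -
  have mem: "u \<noteq> d \<and> w \<noteq> d" if "(u, w) \<in> set (cyc us)" for u w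
    using cyc_mem[OF that assms(2)] assms(1) by auto
  show ?thesis
  proof (cases "d \<in> set ds")
    case True
    obtain us' vs where F: "ds = us' @ d # vs" "d \<notin> set us'" using split_list_first[OF True] by blast
    show ?thesis
      using True mem F by (auto simp: ring_def lk_def filter_map comp_def case_prod_beta takeWhile_front
          remove1_append filter_True)
  next
    case False
    have "lk d (ring s ds us) = []"
    proof (rule lk_empty)
      fix t F assume "(t, F) \<in> set (ring s ds us)"
      then obtain u w where "(u, w) \<in> set (cyc us)" "F = ds @ [u, w]" by (auto simp: ring_def)
      then show "d \<notin> set F" using mem[of u w] False by auto
    qed
    then show ?thesis using False by simp
  qed
qed

lemma map_chain_ring: "us \<noteq> [] \<Longrightarrow> map_chain g (ring s ds us) = ring s (map g ds) (map g us)"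
proof -
  assume ne: "us \<noteq> []"
  have "cyc (map g us) = map (\<lambda>(u, w). (g u, g w)) (cyc us)"
    using ne by (auto simp: cyc_def last_map hd_map map_tl[symmetric] zip_map_map case_prod_beta)
  then show ?thesis by (auto simp: ring_def map_chain_def)
qed

lemma neg_chain_ring: "neg_chain (ring s ds us) = ring (- s) ds us"
  by (auto simp: ring_def neg_chain_def)

lemma wf_ring:
  assumes "distinct us" "2 \<le> length us" "distinct ds" "set ds \<inter> set us = {}"
  shows "wf_chain (length ds + 2) (ring s ds us)"
proof -
  have ne: "us \<noteq> []" using assms(2) by auto
  have "u \<noteq> w" if uw: "(u, w) \<in> set (cyc us)" for u w
  proof -
    obtain i where i: "i < length us" "(u, w) = (us ! i, us ! (Suc i mod length us))"
      using cyc_index[OF uw ne] .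
    have "Suc i mod length us \<noteq> i"
      using i(1) assms(2) by (cases "Suc i = length us") auto
    moreover have "Suc i mod length us < length us" using ne by simp
    ultimately show ?thesis using nth_eq_iff_index_eq[OF assms(1) i(1), of "Suc i mod length us"] i(2) by auto
  qed
  moreover have "u \<notin> set ds \<and> w \<notin> set ds" if "(u, w) \<in> set (cyc us)" for u w
    using cyc_mem[OF that ne] assms(4) by auto
  moreover have "cyc us \<noteq> []" by (simp add: cyc_def)
  ultimately show ?thesis using assms(3) by (fastforce simp: wf_chain_def ring_def)
qed

lemma wf_append: "wf_chain n c \<Longrightarrow> wf_chain n d \<Longrightarrow> wf_chain n (c @ d)"
  by (auto simp: wf_chain_def)

section \<open>Joins of a circle with the boundary of a simplex\<close>

text \<open>
  The join of the polygon \<open>us\<close> with the boundary of the triangle \<open>0, 1, 2\<close>; \<open>join4\<close> uses the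
  tetrahedron \<open>0, 1, 2, 3\<close>.
\<close>

definition join3 :: "nat list \<Rightarrow> ochain" where
  "join3 us = ring 1 [1, 2] us @ ring (-1) [0, 2] us @ ring 1 [0, 1] us"

definition join4 :: "nat list \<Rightarrow> ochain" where
  "join4 us = ring 1 [1, 2, 3] us @ ring (-1) [0, 2, 3] us @ ring 1 [0, 1, 3] us @ ring (-1) [0, 1, 2] us"

text \<open>
  The numbers below \<open>7\<close> are reserved: \<open>0, 1, 2, 3\<close> for the simplex joined to the circle and
  \<open>4, 5, 6\<close> for the vertices of the subdivisions.
\<close>

definition circle :: "nat list \<Rightarrow> bool" where
  "circle us \<longleftrightarrow> distinct us \<and> 3 \<le> length us \<and> (\<forall>u\<in>set us. 7 \<le> u)"

text \<open>
  Subdivision, with new vertex \<open>x\<close>, at the simplex spanned by an edge \<open>e\<close> of the circle and \<open>ds\<close>.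
\<close>

definition estar :: "nat \<times> nat \<Rightarrow> nat list \<Rightarrow> nat \<Rightarrow> ochain \<Rightarrow> ochain" where
  "estar e ds x c = star_chain ([fst e, snd e] @ ds) x c"

text \<open>
  Facets with vertices in \<open>W\<close> that meet the circle in a subset of one edge. This survives all
  subdivisions at edges of the circle, and makes subdivisions at different edges independent.
\<close>

definition near :: "nat list \<Rightarrow> nat set \<Rightarrow> ochain \<Rightarrow> bool" where
  "near us W c \<longleftrightarrow> (\<forall>(s, F)\<in>set c. distinct F \<and> set F \<subseteq> W \<and>
     (\<exists>e\<in>set (cyc us). set F \<inter> set us \<subseteq> {fst e, snd e}))"

lemma nearD:
  assumes "near us W c" "(s, F) \<in> set c"
  shows "distinct F" "set F \<subseteq> W" "\<exists>e\<in>set (cyc us). set F \<inter> set us \<subseteq> {fst e, snd e}"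
  using assms by (auto simp: near_def)

lemma near_append: "near us W (c @ d) \<longleftrightarrow> near us W c \<and> near us W d"
  unfolding near_def set_append ball_Un ..

lemma near_mono: "near us W c \<Longrightarrow> W \<subseteq> W' \<Longrightarrow> near us W' c"
  unfolding near_def by fast

lemma circle_ne: "circle us \<Longrightarrow> us \<noteq> []"
  by (auto simp: circle_def)

lemma circle_edge:
  assumes "circle us" "e \<in> set (cyc us)"
  shows "fst e \<in> set us" "snd e \<in> set us" "7 \<le> fst e" "7 \<le> snd e" "fst e \<noteq> snd e"
proof -
  note ne = circle_ne[OF assms(1)]
  show m: "fst e \<in> set us" "snd e \<in> set us" using cyc_mem[OF assms(2) ne] by auto
  then show "7 \<le> fst e" "7 \<le> snd e" using assms(1) by (auto simp: circle_def)
  have "wf_chain (Suc (Suc 0)) (ring 1 [] us)" using wf_ring[of us "[]" 1] assms(1) by (simp add: circle_def)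
  moreover have "(1, [fst e, snd e]) \<in> set (ring 1 [] us)" using assms(2) by (force simp: ring_def)
  ultimately have "distinct [fst e, snd e]" by (rule wf_chainD(1))
  then show "fst e \<noteq> snd e" by simp
qed

lemma near_ring:
  assumes us: "circle us" and ds: "distinct ds" "set ds \<subseteq> {..<7}"
  shows "near us (set ds \<union> set us) (ring s ds us)"
  unfolding near_def
proof (intro ballI, clarify)
  fix t F assume "(t, F) \<in> set (ring s ds us)"
  then obtain e where e: "e \<in> set (cyc us)" "F = ds @ [fst e, snd e]" by (auto simp: ring_def)
  note ce = circle_edge[OF us e(1)]
  have dis: "set ds \<inter> set us = {}" using us ds(2) by (force simp: circle_def)
  have "distinct F" using e(2) ds(1) ce dis by auto
  moreover have "set F \<subseteq> set ds \<union> set us" using e(2) ce by auto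
  moreover have "set F \<inter> set us \<subseteq> {fst e, snd e}" using e(2) dis by auto
  ultimately show "distinct F \<and> set F \<subseteq> set ds \<union> set us \<and>
      (\<exists>e\<in>set (cyc us). set F \<inter> set us \<subseteq> {fst e, snd e})" using e(1) by blast
qed

lemma near_star:
  assumes c: "near us W c" and x: "x \<notin> W" "x \<notin> set us"
  shows "near us (insert x W) (star_chain A x c)"
  unfolding near_def
proof (intro ballI, clarify)
  fix t F assume "(t, F) \<in> set (star_chain A x c)"
  then obtain G where G: "(t, G) \<in> set c" "F = G \<or> (\<exists>a\<in>set G. F = map (\<lambda>v. if v = a then x else v) G)"
    by (auto simp: star_chain_def split: if_splits)
  note g = nearD[OF c G(1)]
  have xG: "x \<notin> set G" using g(2) x(1) by blast
  have "distinct F" using G(2) g(1) xG by (auto simp: distinct_map inj_on_def)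
  moreover have sub: "set F \<subseteq> insert x (set G)" using G(2) by auto
  moreover have "set F \<inter> set us \<subseteq> set G \<inter> set us" using sub x(2) by blast
  ultimately show "distinct F \<and> set F \<subseteq> insert x W \<and>
      (\<exists>e\<in>set (cyc us). set F \<inter> set us \<subseteq> {fst e, snd e})" using g(2,3) by blast
qed

lemma near_sep:
  assumes us: "circle us" and c: "near us W c" and F: "(s, F) \<in> set c"
    and e: "e \<in> set (cyc us)" "e' \<in> set (cyc us)" and sub: "{fst e, snd e} \<subseteq> set F" "{fst e', snd e'} \<subseteq> set F"
  shows "e = e'"
proof -
  obtain h where h: "h \<in> set (cyc us)" "set F \<inter> set us \<subseteq> {fst h, snd h}" using nearD(3)[OF c F] by blast
  have u: "distinct us" "3 \<le> length us" using us by (auto simp: circle_def)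
  have "e = h" "e' = h"
    using cyc_edge_unique[OF u e(1) h(1)] cyc_edge_unique[OF u e(2) h(1)] sub h(2)
      circle_edge[OF us e(1)] circle_edge[OF us e(2)] by blast+
  then show ?thesis by simp
qed

text \<open>
  No facet contains two different edges of the circle.
\<close>

lemma estar_commute:
  assumes us: "circle us" and c: "near us W c" and e: "e \<in> set (cyc us)" "e' \<in> set (cyc us)" "e \<noteq> e'"
    and x: "x < 7" "x \<notin> set ds'" and y: "y < 7" "y \<notin> set ds"
  shows "estar e ds x (estar e' ds' y c) = estar e' ds' y (estar e ds x c)"
  unfolding estar_def
proof (rule star_star)
  show "\<not> (set ([fst e, snd e] @ ds) \<subseteq> set F \<and> set ([fst e', snd e'] @ ds') \<subseteq> set F)"
    if "(s, F) \<in> set c" for s F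
    using near_sep[OF us c that e(1,2)] e(3) by auto
  show "x \<notin> set ([fst e', snd e'] @ ds')" "y \<notin> set ([fst e, snd e] @ ds)"
    using circle_edge[OF us e(1)] circle_edge[OF us e(2)] x y by auto
qed

lemma lk_estar:
  assumes us: "circle us" and c: "near us W c" and e: "e \<in> set (cyc us)" and ds: "distinct ds" "set ds \<subseteq> {..<7}"
    and d: "d < 7" "d \<noteq> x"
  shows "lk d (estar e ds x c) = estar e (remove1 d ds) x (lk d c)"
proof -
  note ce = circle_edge[OF us e]
  have "distinct ([fst e, snd e] @ ds)" using ce ds by auto
  from lk_star[OF nearD(1)[OF c] this d(2)] show ?thesis
    using ce d(1) by (simp add: estar_def)
qed

lemma eqv_estar:
  assumes "eqv c d" "near us W c" "near us' W d" "x \<notin> W" "x \<notin> set ([fst e, snd e] @ ds)"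
  shows "eqv (estar e ds x c) (estar e ds x d)"
  unfolding estar_def
  using assms(1)
proof (rule eqv_star)
  show "distinct F \<and> x \<notin> set F" if "(s, F) \<in> set c" for s F using nearD[OF assms(2) that] assms(4) by blast
  show "distinct F \<and> x \<notin> set F" if "(s, F) \<in> set d" for s F using nearD[OF assms(3) that] assms(4) by blast
qed (use assms(5) in simp_all)

lemma near_join3: "circle us \<Longrightarrow> near us ({0, 1, 2} \<union> set us) (join3 us)"
  unfolding join3_def near_append by (intro conjI near_mono[OF near_ring]) auto

lemma near_join4: "circle us \<Longrightarrow> near us ({0, 1, 2, 3} \<union> set us) (join4 us)"
  unfolding join4_def near_append by (intro conjI near_mono[OF near_ring]) auto

lemma near_estar:
  assumes us: "circle us" and "near us W c" "x < 7" "x \<notin> W" shows "near us (insert x W) (estar e ds x c)"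
  unfolding estar_def using assms by (intro near_star) (auto simp: circle_def)

lemma eqv_blocks3:
  "eqv a a' \<Longrightarrow> eqv b b' \<Longrightarrow> eqv c c' \<Longrightarrow> eqv (a @ b @ c) (a' @ b' @ c')"
  by (intro eqv_append)

lemma eqv_blocks4:
  "eqv a a' \<Longrightarrow> eqv b b' \<Longrightarrow> eqv c c' \<Longrightarrow> eqv d d' \<Longrightarrow> eqv (a @ b @ c @ d) (a' @ b' @ c' @ d')"
  by (intro eqv_append)

lemma join3_rotate: "eqv (join3 (P @ Q)) (join3 (Q @ P))"
  unfolding join3_def by (intro eqv_blocks3 eqv_ring_rotate)

lemma join4_rotate: "eqv (join4 (P @ Q)) (join4 (Q @ P))"
  unfolding join4_def by (intro eqv_blocks4 eqv_ring_rotate)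

lemma circle_disjoint: "circle us \<Longrightarrow> set ds \<subseteq> {..<7} \<Longrightarrow> set ds \<inter> set us = {}"
  by (force simp: circle_def)

lemma star_join4:
  assumes "circle us" shows "eqv (star_chain [last us, hd us] x (join4 us)) (join4 (us @ [x]))"
  unfolding join4_def star_chain_append
  using assms circle_disjoint[OF assms] by (intro eqv_blocks4 star_ring) (auto simp: circle_def)

lemma star_join3:
  assumes "circle us" shows "eqv (star_chain [last us, hd us] x (join3 us)) (join3 (us @ [x]))"
  unfolding join3_def star_chain_append
  using assms circle_disjoint[OF assms] by (intro eqv_blocks3 star_ring) (auto simp: circle_def)

lemma wf_join4: "circle us \<Longrightarrow> wf_chain 5 (join4 us)"
proof -
  assume us: "circle us"
  have "wf_chain 5 (ring s ds us)" if "length ds = 3" "distinct ds" "set ds \<subseteq> {..<7}" for s ds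
    using wf_ring[of us ds s] us that circle_disjoint[OF us that(3)] by (auto simp: circle_def)
  then show ?thesis unfolding join4_def by (intro wf_append) auto
qed

lemma wf_join3: "circle us \<Longrightarrow> wf_chain 4 (join3 us)"
proof -
  assume us: "circle us"
  have "wf_chain 4 (ring s ds us)" if "length ds = 2" "distinct ds" "set ds \<subseteq> {..<7}" for s ds
    using wf_ring[of us ds s] us that circle_disjoint[OF us that(3)] by (auto simp: circle_def)
  then show ?thesis unfolding join3_def by (intro wf_append) auto
qed

lemma relabel_exists:
  assumes "distinct us" "distinct ws" "length us = length ws" "set us \<inter> C = {}" "set ws \<inter> C = {}"
  shows "\<exists>g. map g us = ws \<and> (\<forall>c\<in>C. g c = c) \<and> inj_on g (C \<union> set us)"
proof -
  define g where "g v = (case map_of (zip us ws) v of Some w \<Rightarrow> w | None \<Rightarrow> v)" for v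
  have nth: "g (us ! i) = ws ! i" if "i < length us" for i
    using that assms(1,3) by (simp add: g_def map_of_zip_nth)
  have out: "g c = c" if "c \<in> C" for c
  proof -
    have "c \<notin> set us" using that assms(4) by blast
    then have "map_of (zip us ws) c = None" using assms(3) by (simp add: map_of_zip_is_None)
    then show ?thesis by (simp add: g_def)
  qed
  have m: "map g us = ws" using nth assms(3) by (intro nth_equalityI) auto
  have "inj_on g (set us)" using assms(1,2) m by (metis distinct_map)
  moreover have "g ` set us = set ws" using m by (metis set_map)
  moreover have "inj_on g C" using out by (auto simp: inj_on_def)
  moreover have "g ` C = C" using out by force
  ultimately have "inj_on g (C \<union> set us)" using assms(5) by (auto simp: inj_on_Un)
  then show ?thesis using m out by blast
qed

lemma map_chain_join4: "us \<noteq> [] \<Longrightarrow> (\<forall>c\<in>{..<7}. g c = c) \<Longrightarrow> map_chain g (join4 us) = join4 (map g us)"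
  by (simp add: join4_def map_chain_ring)

lemma map_chain_join3: "us \<noteq> [] \<Longrightarrow> (\<forall>c\<in>{..<7}. g c = c) \<Longrightarrow> map_chain g (join3 us) = join3 (map g us)"
  by (simp add: join3_def map_chain_ring)

lemma Union_faces_near: "near us W c \<Longrightarrow> \<Union>(faces_of c) \<subseteq> W"
  unfolding Union_faces_of using nearD(2) by fast

lemma mset_nrm_eqvI:
  assumes "mset (nrm c) = mset (nrm d)" "wf_chain n c" "wf_chain n d" shows "eqv c d"
  using eqvI[OF assms(1)] wf_chainD(1)[OF assms(2)] wf_chainD(1)[OF assms(3)] by blast

text \<open>
  The join of two triangle boundaries, or of a triangle boundary and a tetrahedron boundary, is the
  subdivision of a simplex boundary at the triangle \<open>7, 8, 9\<close>.
\<close>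

lemma sph_joins_start: "sph 5 (join4 [7, 8, 9])" "sph 4 (join3 [7, 8, 9])"
proof -
  have c: "circle [7, 8, 9]" by (simp add: circle_def)
  have b: "sph 5 (simplex_boundary [0, 1, 2, 7, 8, 9])" "sph 4 (simplex_boundary [0, 1, 7, 8, 9])"
    by (rule sph_simplex_boundary; simp)+
  have f: "faces_of (simplex_boundary [0, 1, 2, 7, 8, 9]) = {\<sigma>. \<sigma> \<subset> {0, 1, 2, 7, 8, 9}}"
    "faces_of (simplex_boundary [0, 1, 7, 8, 9]) = {\<sigma>. \<sigma> \<subset> {0, 1, 7, 8, 9}}"
    by (subst faces_of_simplex_boundary; simp add: insert_commute)+
  have s1: "sph 5 (star_chain [7, 8, 9] 3 (simplex_boundary [0, 1, 2, 7, 8, 9]))"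
  proof (rule stellar_sph[OF b(1)])
    show "set [7, 8, 9] \<in> faces_of (simplex_boundary [0, 1, 2, 7, 8, 9])" unfolding f by auto
    show "3 \<notin> set F" if "(s, F) \<in> set (simplex_boundary [0, 1, 2, 7, 8, 9])" for s F
    proof -
      have "set F \<in> faces_of (simplex_boundary [0, 1, 2, 7, 8, 9])" using that by (auto simp: faces_of_def)
      then show ?thesis unfolding f by auto
    qed
  qed simp
  have s2: "sph 4 (star_chain [7, 8, 9] 2 (simplex_boundary [0, 1, 7, 8, 9]))"
  proof (rule stellar_sph[OF b(2)])
    show "set [7, 8, 9] \<in> faces_of (simplex_boundary [0, 1, 7, 8, 9])" unfolding f by auto
    show "2 \<notin> set F" if "(s, F) \<in> set (simplex_boundary [0, 1, 7, 8, 9])" for s F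
    proof -
      have "set F \<in> faces_of (simplex_boundary [0, 1, 7, 8, 9])" using that by (auto simp: faces_of_def)
      then show ?thesis unfolding f by auto
    qed
  qed simp
  have n1: "mset (nrm (star_chain [7, 8, 9] 3 (simplex_boundary [0, 1, 2, 7, 8, 9]))) = mset (nrm (join4 [7, 8, 9]))"
    by (simp add: nrm_def simplex_boundary_def lk_def star_chain_def join4_def ring_def cyc_def)
  have n2: "mset (nrm (star_chain [7, 8, 9] 2 (simplex_boundary [0, 1, 7, 8, 9]))) = mset (nrm (join3 [7, 8, 9]))"
    by (simp add: nrm_def simplex_boundary_def lk_def star_chain_def join3_def ring_def cyc_def)
  have w: "wf_chain 5 (star_chain [7, 8, 9] 3 (simplex_boundary [0, 1, 2, 7, 8, 9]))"
    "wf_chain 4 (star_chain [7, 8, 9] 2 (simplex_boundary [0, 1, 7, 8, 9]))"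
    using s1 s2 by (simp_all add: sph_def)
  show "sph 5 (join4 [7, 8, 9])"
    by (rule sph_eqv[OF s1 mset_nrm_eqvI[OF n1 w(1) wf_join4[OF c]] wf_join4[OF c]])
  show "sph 4 (join3 [7, 8, 9])"
    by (rule sph_eqv[OF s2 mset_nrm_eqvI[OF n2 w(2) wf_join3[OF c]] wf_join3[OF c]])
qed

text \<open>
  Longer circles arise by subdividing an edge of the circle.
\<close>

lemma sph_joins: "circle us \<Longrightarrow> sph 5 (join4 us) \<and> sph 4 (join3 us)"
proof (induction us rule: rev_induct)
  case Nil
  then show ?case by (simp add: circle_def)
next
  case (snoc x us)
  show ?case
  proof (cases "length us = 2")
    case True
    let ?u = "us @ [x]"
    have "\<exists>g. map g [7, 8, 9] = ?u \<and> (\<forall>c\<in>{..<7}. g c = c) \<and> inj_on g ({..<7} \<union> set [7, 8, 9])"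
      by (rule relabel_exists) (use snoc.prems True in \<open>auto simp: circle_def\<close>)
    then obtain g where g: "map g [7, 8, 9] = ?u" "\<forall>c\<in>{..<7}. g c = c" "inj_on g ({..<7} \<union> set [7, 8, 9])"
      by blast
    have c: "circle [7, 8, 9]" by (simp add: circle_def)
    have i4: "inj_on g (\<Union>(faces_of (join4 [7, 8, 9])))"
      by (rule inj_on_subset[OF g(3)]) (use Union_faces_near[OF near_join4[OF c]] in auto)
    have i3: "inj_on g (\<Union>(faces_of (join3 [7, 8, 9])))"
      by (rule inj_on_subset[OF g(3)]) (use Union_faces_near[OF near_join3[OF c]] in auto)
    show ?thesis
      using sph_map_chain[OF sph_joins_start(1) i4] sph_map_chain[OF sph_joins_start(2) i3]
        map_chain_join4[of "[7, 8, 9]" g, unfolded g(1)] map_chain_join3[of "[7, 8, 9]" g, unfolded g(1)] g(2) by simp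
  next
    case False
    then have us: "circle us" using snoc.prems by (auto simp: circle_def)
    have x: "x \<notin> set us" "7 \<le> x" using snoc.prems by (auto simp: circle_def)
    have ne: "us \<noteq> []" using circle_ne[OF us] .
    have edge: "(last us, hd us) \<in> set (cyc us)" by (simp add: cyc_def)
    have f4: "set [last us, hd us] \<in> faces_of (join4 us)"
      using edge by (auto simp: join4_def faces_of_ring)
    have f3: "set [last us, hd us] \<in> faces_of (join3 us)"
      using edge by (auto simp: join3_def faces_of_ring)
    have "sph 5 (star_chain [last us, hd us] x (join4 us))"
      by (rule stellar_sph) (use snoc.IH us f4 nearD(2)[OF near_join4[OF us]] x in \<open>fastforce+\<close>)
    moreover have "sph 4 (star_chain [last us, hd us] x (join3 us))"
      by (rule stellar_sph) (use snoc.IH us f3 nearD(2)[OF near_join3[OF us]] x in \<open>fastforce+\<close>)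
    ultimately show ?thesis
      using sph_eqv[OF _ star_join4[OF us] wf_join4[OF snoc.prems]] sph_eqv[OF _ star_join3[OF us] wf_join3[OF snoc.prems]]
      by blast
  qed
qed

section \<open>Subdivisions at edges of the circle\<close>

text \<open>
  The first subdivision involves the vertex \<open>0\<close>, the second \<open>0\<close> and \<open>1\<close>. These nested sets tell the
  vertices \<open>0, 1, 2\<close> apart; without them the sphere would have a reversing automorphism.
\<close>

definition starred3 :: "nat list \<Rightarrow> nat \<times> nat \<Rightarrow> nat \<times> nat \<Rightarrow> ochain" where
  "starred3 us e e' = estar e' [0, 1] 5 (estar e [0] 4 (join3 us))"

definition starred4 :: "nat list \<Rightarrow> nat \<times> nat \<Rightarrow> nat \<times> nat \<Rightarrow> nat \<times> nat \<Rightarrow> ochain" where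
  "starred4 us e e' e'' = estar e'' [0, 1, 2] 6 (estar e' [0, 1] 5 (estar e [0] 4 (join4 us)))"

lemma near_lk:
  assumes "near us W c" shows "near us W (lk v c)"
  unfolding near_def
proof (intro ballI, clarify)
  fix t F assume "(t, F) \<in> set (lk v c)"
  then obtain s G where G: "(s, G) \<in> set c" "F = remove1 v G" by (auto simp: lk_def)
  note g = nearD[OF assms G(1)]
  have sub: "set F \<subseteq> set G" using G(2) set_remove1_subset by metis
  have "distinct F" using g(1) G(2) by simp
  then show "distinct F \<and> set F \<subseteq> W \<and> (\<exists>e\<in>set (cyc us). set F \<inter> set us \<subseteq> {fst e, snd e})"
    using g(2,3) sub by blast
qed

lemma map_chain_estar:
  assumes "inj_on g V" "\<Union>(faces_of c) \<subseteq> V" "{fst e, snd e} \<union> set ds \<subseteq> V"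
  shows "map_chain g (estar e ds x c) = estar (g (fst e), g (snd e)) (map g ds) (g x) (map_chain g c)"
  unfolding estar_def using map_chain_star[OF assms(1,2), of "[fst e, snd e] @ ds" x] assms(3) by simp

lemma estar_cong_set: "set ds = set ds' \<Longrightarrow> {fst e, snd e} = {fst e', snd e'} \<Longrightarrow> estar e ds x c = estar e' ds' x c"
proof -
  assume a: "set ds = set ds'" "{fst e, snd e} = {fst e', snd e'}"
  have "set ([fst h, snd h] @ l) = {fst h, snd h} \<union> set l" for h :: "nat \<times> nat" and l by simp
  then have "set ([fst e, snd e] @ ds) = set ([fst e', snd e'] @ ds')" by (simp only: a)
  then show ?thesis unfolding estar_def by (rule star_chain_cong_set)
qed

lemma estar_neg: "estar e ds x (neg_chain c) = neg_chain (estar e ds x c)"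
  by (simp add: estar_def star_chain_neg)

lemma sph_estar:
  assumes us: "circle us" and near: "near us W c" and c: "sph n c" and A: "{fst e, snd e} \<union> set ds \<in> faces_of c"
    and x: "x \<notin> W"
  shows "sph n (estar e ds x c)"
  unfolding estar_def
proof (rule stellar_sph[OF c])
  show "x \<notin> set F" if "(s, F) \<in> set c" for s F using nearD(2)[OF near that] x by blast
qed (use A in auto)

lemma face_estar:
  assumes us: "circle us" and near: "near us W c" and e: "e \<in> set (cyc us)" "e' \<in> set (cyc us)" "e \<noteq> e'"
    and A: "{fst e', snd e'} \<union> D \<in> faces_of c" and x: "x \<notin> W"
  shows "{fst e', snd e'} \<union> D \<in> faces_of (estar e ds x c)"
proof -
  have "\<not> {fst e, snd e} \<subseteq> {fst e', snd e'} \<union> D"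
  proof
    assume s: "{fst e, snd e} \<subseteq> {fst e', snd e'} \<union> D"
    obtain t F where F: "(t, F) \<in> set c" "{fst e', snd e'} \<union> D \<subseteq> set F" using A by (auto simp: faces_of_iff)
    have "{fst e, snd e} \<subseteq> set F" "{fst e', snd e'} \<subseteq> set F" using s F(2) by blast+
    then show False using near_sep[OF us near F(1) e(1,2)] e(3) by blast
  qed
  then have n: "\<not> set ([fst e, snd e] @ ds) \<subseteq> {fst e', snd e'} \<union> D" by auto
  have "faces_of (estar e ds x c) = stellar (faces_of c) (set ([fst e, snd e] @ ds)) x"
    unfolding estar_def using nearD(2)[OF near] x by (intro faces_of_star_chain) auto
  then show ?thesis using stellarI1[OF A n] by simp
qed

lemma face_ring:
  assumes "e \<in> set (cyc us)" "D \<subseteq> set ds" shows "{fst e, snd e} \<union> D \<in> faces_of (ring s ds us)"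
  unfolding faces_of_ring using assms by (intro UN_I[OF assms(1)]) auto

lemma face_join3:
  assumes e: "e \<in> set (cyc us)" and D: "D \<subset> {0, 1, 2}"
  shows "{fst e, snd e} \<union> D \<in> faces_of (join3 us)"
proof -
  obtain d where d: "d \<in> {0, 1, 2}" "d \<notin> D" using D by (rule psubset_imp_ex_mem[THEN exE]) auto
  have D: "v \<in> {0, 1, 2}" if "v \<in> D" for v using D that by (rule psubset_imp_subset[THEN subsetD])
  consider "d = 0" | "d = 1" | "d = 2"
    using d(1) by (elim insertE emptyE)
  then show ?thesis
  proof cases
    case 1
    have "D \<subseteq> set [1, 2]"
    proof
      fix v assume v: "v \<in> D"
      have "v \<noteq> 0"
      proof
        assume "v = 0"
        then show False using v d(2) unfolding 1 by (simp only:)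
      qed
      with D[OF v] show "v \<in> set [1, 2]" by simp
    qed
    from face_ring[OF e this, of "1"] show ?thesis by (simp only: join3_def faces_of_append Un_iff simp_thms)
  next
    case 2
    have "D \<subseteq> set [0, 2]"
    proof
      fix v assume v: "v \<in> D"
      have "v \<noteq> 1"
      proof
        assume "v = 1"
        then show False using v d(2) unfolding 2 by (simp only:)
      qed
      with D[OF v] show "v \<in> set [0, 2]" by simp
    qed
    from face_ring[OF e this, of "-1"] show ?thesis by (simp only: join3_def faces_of_append Un_iff simp_thms)
  next
    case 3
    have "D \<subseteq> set [0, 1]"
    proof
      fix v assume v: "v \<in> D"
      have "v \<noteq> 2"
      proof
        assume "v = 2"
        then show False using v d(2) unfolding 3 by (simp only:)
      qed
      with D[OF v] show "v \<in> set [0, 1]" by simp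
    qed
    from face_ring[OF e this, of "1"] show ?thesis by (simp only: join3_def faces_of_append Un_iff simp_thms)
  qed
qed

lemma face_join4:
  assumes e: "e \<in> set (cyc us)" and D: "D \<subset> {0, 1, 2, 3}"
  shows "{fst e, snd e} \<union> D \<in> faces_of (join4 us)"
proof -
  obtain d where d: "d \<in> {0, 1, 2, 3}" "d \<notin> D" using D by (rule psubset_imp_ex_mem[THEN exE]) auto
  have D: "v \<in> {0, 1, 2, 3}" if "v \<in> D" for v using D that by (rule psubset_imp_subset[THEN subsetD])
  consider "d = 0" | "d = 1" | "d = 2" | "d = 3"
    using d(1) by (elim insertE emptyE)
  then show ?thesis
  proof cases
    case 1
    have "D \<subseteq> set [1, 2, 3]"
    proof
      fix v assume v: "v \<in> D"
      have "v \<noteq> 0"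
      proof
        assume "v = 0"
        then show False using v d(2) unfolding 1 by (simp only:)
      qed
      with D[OF v] show "v \<in> set [1, 2, 3]" by simp
    qed
    from face_ring[OF e this, of "1"] show ?thesis by (simp only: join4_def faces_of_append Un_iff simp_thms)
  next
    case 2
    have "D \<subseteq> set [0, 2, 3]"
    proof
      fix v assume v: "v \<in> D"
      have "v \<noteq> 1"
      proof
        assume "v = 1"
        then show False using v d(2) unfolding 2 by (simp only:)
      qed
      with D[OF v] show "v \<in> set [0, 2, 3]" by simp
    qed
    from face_ring[OF e this, of "-1"] show ?thesis by (simp only: join4_def faces_of_append Un_iff simp_thms)
  next
    case 3
    have "D \<subseteq> set [0, 1, 3]"
    proof
      fix v assume v: "v \<in> D"
      have "v \<noteq> 2"
      proof
        assume "v = 2"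
        then show False using v d(2) unfolding 3 by (simp only:)
      qed
      with D[OF v] show "v \<in> set [0, 1, 3]" by simp
    qed
    from face_ring[OF e this, of "1"] show ?thesis by (simp only: join4_def faces_of_append Un_iff simp_thms)
  next
    case 4
    have "D \<subseteq> set [0, 1, 2]"
    proof
      fix v assume v: "v \<in> D"
      have "v \<noteq> 3"
      proof
        assume "v = 3"
        then show False using v d(2) unfolding 4 by (simp only:)
      qed
      with D[OF v] show "v \<in> set [0, 1, 2]" by simp
    qed
    from face_ring[OF e this, of "-1"] show ?thesis by (simp only: join4_def faces_of_append Un_iff simp_thms)
  qed
qed

lemma core_notin: "circle us \<Longrightarrow> x < 7 \<Longrightarrow> x \<notin> set us"
  by (auto simp: circle_def)

lemma near_starred3_first:
  assumes us: "circle us" shows "near us ({0, 1, 2, 4} \<union> set us) (estar e [0] 4 (join3 us))"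
proof (rule near_mono[OF near_estar[OF us near_join3[OF us]]])
  show "4 \<notin> {0, 1, 2} \<union> set us" using core_notin[OF us, of 4] by auto
qed auto

lemma near_starred3:
  assumes us: "circle us" shows "near us ({0, 1, 2, 4, 5} \<union> set us) (starred3 us e e')"
  unfolding starred3_def
proof (rule near_mono[OF near_estar[OF us near_starred3_first[OF us]]])
  show "5 \<notin> {0, 1, 2, 4} \<union> set us" using core_notin[OF us, of 5] by auto
qed auto

lemma sph_starred3:
  assumes us: "circle us" and e: "e \<in> set (cyc us)" "e' \<in> set (cyc us)" "e \<noteq> e'"
  shows "sph 4 (starred3 us e e')"
  unfolding starred3_def
proof (rule sph_estar[OF us near_starred3_first[OF us]])
  note n = core_notin[OF us]
  have n4: "4 \<notin> {0, 1, 2} \<union> set us" using n[of 4] by auto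
  have s: "set [0] \<subset> {0, 1, 2 :: nat}" "set [0, 1] \<subset> {0, 1, 2 :: nat}" by (simp_all add: psubset_eq set_eq_subset)
  show "sph 4 (estar e [0] 4 (join3 us))"
    by (rule sph_estar[OF us near_join3[OF us] conjunct2[OF sph_joins[OF us]] face_join3[OF e(1) s(1)] n4])
  show "{fst e', snd e'} \<union> set [0, 1] \<in> faces_of (estar e [0] 4 (join3 us))"
    by (rule face_estar[OF us near_join3[OF us] e face_join3[OF e(2) s(2)] n4])
  show "5 \<notin> {0, 1, 2, 4} \<union> set us" using n[of 5] by auto
qed

lemma near_starred4_first:
  assumes us: "circle us" shows "near us ({0, 1, 2, 3, 4} \<union> set us) (estar e [0] 4 (join4 us))"
proof (rule near_mono[OF near_estar[OF us near_join4[OF us]]])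
  show "4 \<notin> {0, 1, 2, 3} \<union> set us" using core_notin[OF us, of 4] by auto
qed auto

lemma near_starred4_second:
  assumes us: "circle us"
  shows "near us ({0, 1, 2, 3, 4, 5} \<union> set us) (estar e' [0, 1] 5 (estar e [0] 4 (join4 us)))"
proof (rule near_mono[OF near_estar[OF us near_starred4_first[OF us]]])
  show "5 \<notin> {0, 1, 2, 3, 4} \<union> set us" using core_notin[OF us, of 5] by auto
qed auto

lemma near_starred4:
  assumes us: "circle us"
  shows "near us ({0, 1, 2, 3, 4, 5, 6} \<union> set us) (starred4 us e e' e'')"
  unfolding starred4_def
proof (rule near_mono[OF near_estar[OF us near_starred4_second[OF us]]])
  show "6 \<notin> {0, 1, 2, 3, 4, 5} \<union> set us" using core_notin[OF us, of 6] by auto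
qed auto

lemma sph_starred4:
  assumes us: "circle us" and e: "e \<in> set (cyc us)" "e' \<in> set (cyc us)" "e'' \<in> set (cyc us)"
    "e \<noteq> e'" "e \<noteq> e''" "e' \<noteq> e''"
  shows "sph 5 (starred4 us e e' e'')"
  unfolding starred4_def
proof (rule sph_estar[OF us near_starred4_second[OF us]])
  note n = core_notin[OF us]
  have n4: "4 \<notin> {0, 1, 2, 3} \<union> set us" using n[of 4] by auto
  have n5: "5 \<notin> {0, 1, 2, 3, 4} \<union> set us" using n[of 5] by auto
  have s: "set [0] \<subset> {0, 1, 2, 3 :: nat}" "set [0, 1] \<subset> {0, 1, 2, 3 :: nat}" "set [0, 1, 2] \<subset> {0, 1, 2, 3 :: nat}"
    by (simp_all add: psubset_eq set_eq_subset)
  have s1: "sph 5 (estar e [0] 4 (join4 us))"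
    by (rule sph_estar[OF us near_join4[OF us] conjunct1[OF sph_joins[OF us]] face_join4[OF e(1) s(1)] n4])
  have f1: "{fst e', snd e'} \<union> set [0, 1] \<in> faces_of (estar e [0] 4 (join4 us))"
    by (rule face_estar[OF us near_join4[OF us] e(1,2,4) face_join4[OF e(2) s(2)] n4])
  show "sph 5 (estar e' [0, 1] 5 (estar e [0] 4 (join4 us)))"
    by (rule sph_estar[OF us near_starred4_first[OF us] s1 f1 n5])
  have f2: "{fst e'', snd e''} \<union> set [0, 1, 2] \<in> faces_of (estar e [0] 4 (join4 us))"
    by (rule face_estar[OF us near_join4[OF us] e(1,3,5) face_join4[OF e(3) s(3)] n4])
  show "{fst e'', snd e''} \<union> set [0, 1, 2] \<in> faces_of (estar e' [0, 1] 5 (estar e [0] 4 (join4 us)))"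
    by (rule face_estar[OF us near_starred4_first[OF us] e(2,3,6) f2 n5])
  show "6 \<notin> {0, 1, 2, 3, 4, 5} \<union> set us" using n[of 6] by auto
qed

text \<open>
  A facet that contains an edge of the circle contains no other vertex of the circle.
\<close>

lemma lk_drop_circle:
  assumes us: "circle us" and near: "near us W c" and e: "e \<in> set (cyc us)" and u: "u \<in> set us" "u \<noteq> fst e" "u \<noteq> snd e"
    and x: "x < 7"
  shows "lk u (estar e ds x c) = lk u c"
  unfolding estar_def
proof (rule lk_drop)
  show "u \<noteq> x" using u(1) core_notin[OF us x] by blast
  fix s F assume F: "(s, F) \<in> set c" "u \<in> set F"
  obtain h where h: "h \<in> set (cyc us)" "set F \<inter> set us \<subseteq> {fst h, snd h}" using nearD(3)[OF near F(1)] by blast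
  show "\<not> set ([fst e, snd e] @ ds) \<subseteq> set F"
  proof
    assume "set ([fst e, snd e] @ ds) \<subseteq> set F"
    then have "{fst e, snd e} \<subseteq> {fst h, snd h}" using h(2) circle_edge(1,2)[OF us e] by auto
    then have "e = h" using cyc_edge_unique[OF _ _ e h(1)] us by (simp add: circle_def)
    then show False using u h(2) F(2) by auto
  qed
qed

text \<open>
  The facets at a vertex created on an edge contain no vertices of the circle outside this edge.
\<close>

lemma lk_drop_new:
  assumes us: "circle us" and near: "near us W c" and e: "e \<in> set (cyc us)" "e' \<in> set (cyc us)" "e \<noteq> e'"
    and x: "x < 7" "z < 7" "x \<notin> W" "x \<noteq> z"
  shows "lk x (estar e' ds' z (estar e ds x c)) = lk x (estar e ds x c)"
  unfolding estar_def
proof (rule lk_drop[OF x(4)])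
  fix s F assume F: "(s, F) \<in> set (star_chain ([fst e, snd e] @ ds) x c)" "x \<in> set F"
  then obtain G where G: "(s, G) \<in> set c" and
    g: "F = G \<or> set ([fst e, snd e] @ ds) \<subseteq> set G \<and> (\<exists>a\<in>set G. F = map (\<lambda>v. if v = a then x else v) G)"
    by (auto simp: star_chain_def split: if_splits)
  have xG: "x \<notin> set G" using nearD(2)[OF near G] x(3) by blast
  with g F(2) have g: "set ([fst e, snd e] @ ds) \<subseteq> set G" "set F \<subseteq> insert x (set G)" by auto
  show "\<not> set ([fst e', snd e'] @ ds') \<subseteq> set F"
  proof
    assume "set ([fst e', snd e'] @ ds') \<subseteq> set F"
    moreover have "x \<noteq> fst e'" "x \<noteq> snd e'" using circle_edge[OF us e(2)] x(1) by auto
    ultimately have "{fst e', snd e'} \<subseteq> set G" using g(2) by auto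
    then show False using near_sep[OF us near G e(1,2)] g(1) e(3) by auto
  qed
qed

text \<open>
  With only two subdivided edges, two of the vertices \<open>0, 1, 2, 3\<close> play the same role, and their
  transposition \<open>g\<close> reverses the orientation while it fixes all other vertices.
\<close>

lemma two_stars_reversible:
  fixes f :: "ocomplex \<Rightarrow> rat"
  assumes f: "f \<in> local_cochains n" and us: "circle us"
    and e: "e \<in> set (cyc us)" "e' \<in> set (cyc us)" and ds: "g ` set ds = set ds" "g ` set ds' = set ds'"
    and g: "inj g" "\<And>v. 4 \<le> v \<Longrightarrow> g v = v" "eqv (map_chain g (join4 us)) (neg_chain (join4 us))"
    and x: "4 \<le> x" "x < 7" "4 \<le> x'" "x' < 7" "x \<noteq> x'" "x \<notin> set ds" "x' \<notin> set ds'" and v: "4 \<le> v"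
  shows "val f (lk v (estar e ds x (estar e' ds' x' (join4 us)))) = 0"
proof -
  note n = core_notin[OF us]
  let ?W = "{0, 1, 2, 3} \<union> set us"
  have ok4: "near us ?W (join4 us)" by (rule near_join4[OF us])
  have x'W: "x' \<notin> ?W" using x n by auto
  have ok5: "near us (insert x' ?W) (estar e' ds' x' (join4 us))" by (rule near_estar[OF us ok4 x(4) x'W])
  have xW: "x \<notin> insert x' ?W" using x n by auto
  have ok6: "near us (insert x (insert x' ?W)) (estar e ds x (estar e' ds' x' (join4 us)))"
    by (rule near_estar[OF us ok5 x(2) xW])
  have gU: "g u = u" if "u \<in> set us" for u using that us g(2) by (auto simp: circle_def)
  have ge: "g (fst h) = fst h" "g (snd h) = snd h" if "h \<in> set (cyc us)" for h
    using gU circle_edge[OF us that] by auto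
  have m: "map_chain g (estar e ds x (estar e' ds' x' (join4 us))) = estar e ds x (estar e' ds' x' (map_chain g (join4 us)))"
  proof -
    have "map_chain g (estar e ds x (estar e' ds' x' (join4 us))) = estar (fst e, snd e) (map g ds) x (estar (fst e', snd e') (map g ds') x' (map_chain g (join4 us)))"
      using map_chain_estar[OF g(1), of _ e ds x] map_chain_estar[OF g(1), of _ e' ds' x'] ge[OF e(1)] ge[OF e(2)] g(2) x by simp
    also have "\<dots> = estar e ds x (estar e' ds' x' (map_chain g (join4 us)))"
      using estar_cong_set[of "map g ds" ds "(fst e, snd e)" e] estar_cong_set[of "map g ds'" ds' "(fst e', snd e')" e'] ds by simp
    finally show ?thesis .
  qed
  have okn: "near us W (neg_chain c) = near us W c" for W c by (auto simp: near_def neg_chain_def)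
  have mok: "near us ?W (map_chain g (join4 us))"
    unfolding near_def
  proof (intro ballI, clarify)
    fix t F assume F: "(t, F) \<in> set (map_chain g (join4 us))"
    have "faces_of (map_chain g (join4 us)) = faces_of (join4 us)" using g(3) by (simp add: eqv_def faces_of_neg_chain)
    moreover have "set F \<in> faces_of (map_chain g (join4 us))" using F by (auto simp: faces_of_iff)
    ultimately obtain s G where G: "(s, G) \<in> set (join4 us)" "set F \<subseteq> set G" by (auto simp: faces_of_iff)
    have "distinct F" using F nearD(1)[OF ok4] g(1) by (auto simp: map_chain_def distinct_map inj_on_def inj_def)
    then show "distinct F \<and> set F \<subseteq> ?W \<and> (\<exists>e\<in>set (cyc us). set F \<inter> set us \<subseteq> {fst e, snd e})"
      using nearD[OF ok4 G(1)] G(2) by blast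
  qed
  have nok: "near us ?W (neg_chain (join4 us))" unfolding okn by (rule ok4)
  have x'e: "x' \<notin> set ([fst e', snd e'] @ ds')" using circle_edge[OF us e(2)] x by auto
  have xe: "x \<notin> set ([fst e, snd e] @ ds)" using circle_edge[OF us e(1)] x by auto
  have "eqv (estar e' ds' x' (map_chain g (join4 us))) (estar e' ds' x' (neg_chain (join4 us)))"
    by (rule eqv_estar[OF g(3) mok _ x'W x'e, where us' = us]) (rule nok)
  moreover have "near us (insert x' ?W) (estar e' ds' x' (neg_chain (join4 us)))" unfolding estar_neg okn by (rule ok5)
  ultimately have "eqv (estar e ds x (estar e' ds' x' (map_chain g (join4 us)))) (estar e ds x (estar e' ds' x' (neg_chain (join4 us))))"
    by (rule eqv_estar[OF _ near_estar[OF us mok x(4) x'W] _ xW xe])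
  then have "eqv (map_chain g (estar e ds x (estar e' ds' x' (join4 us)))) (neg_chain (estar e ds x (estar e' ds' x' (join4 us))))"
    by (simp add: m estar_neg)
  note r = this
  show ?thesis
  proof (rule val_lk_reversible[OF f _ g(1) g(2)[OF v] r])
    show "distinct F" if "(s, F) \<in> set (estar e ds x (estar e' ds' x' (join4 us)))" for s F
      by (rule nearD(1)[OF ok6 that])
  qed
qed

section \<open>Links with an automorphism that reverses the orientation\<close>

lemma join4_swap:
  assumes us: "circle us"
  shows "eqv (map_chain (Transposition.transpose 2 3) (join4 us)) (neg_chain (join4 us))"
    and "eqv (map_chain (Transposition.transpose 1 2) (join4 us)) (neg_chain (join4 us))"
    and "eqv (map_chain (Transposition.transpose 0 1) (join4 us)) (neg_chain (join4 us))"
proof -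
  have fix1: "map (Transposition.transpose a b) us = us" if "a < 7" "b < 7" for a b
    by (rule map_idI) (use us that in \<open>auto simp: circle_def Transposition.transpose_def\<close>)
  have f: "map (Transposition.transpose 2 3) us = us" "map (Transposition.transpose 1 2) us = us" "map (Transposition.transpose 0 1) us = us"
    by (rule fix1; simp)+
  note ne = circle_ne[OF us]
  have sw: "eqv (ring s [a, b] us) (ring (- s) [b, a] us)" for s a b
    using eqv_ring_swap[of s "[]" a b "[]"] by simp
  have sw1: "eqv (ring s [a, b, c] us) (ring (- s) [b, a, c] us)" for s a b c
    using eqv_ring_swap[of s "[]" a b "[c]"] by simp
  have sw2: "eqv (ring s [a, b, c] us) (ring (- s) [a, c, b] us)" for s a b c
    using eqv_ring_swap[of s "[a]" b c "[]"] by simp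
  have m: "eqv (a @ b @ c @ d) e'" if "eqv a a'" "eqv b b'" "eqv c c'" "eqv d d'"
    "mset (a' @ b' @ c' @ d') = mset e'" for a b c d a' b' c' d' e'
    using eqv_trans[OF eqv_blocks4[OF that(1-4)] eqv_mset[OF that(5)]] .
  show "eqv (map_chain (Transposition.transpose 2 3) (join4 us)) (neg_chain (join4 us))"
    unfolding join4_def map_chain_append neg_chain_append map_chain_ring[OF ne] neg_chain_ring f
    by (simp add: Transposition.transpose_def, rule m[OF sw2 sw2 eqv_refl eqv_refl]) simp
  show "eqv (map_chain (Transposition.transpose 1 2) (join4 us)) (neg_chain (join4 us))"
    unfolding join4_def map_chain_append neg_chain_append map_chain_ring[OF ne] neg_chain_ring f
    by (simp add: Transposition.transpose_def, rule m[OF sw1 eqv_refl eqv_refl sw2]) simp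
  show "eqv (map_chain (Transposition.transpose 0 1) (join4 us)) (neg_chain (join4 us))"
    unfolding join4_def map_chain_append neg_chain_append map_chain_ring[OF ne] neg_chain_ring f
    by (simp add: Transposition.transpose_def, rule m[OF eqv_refl eqv_refl sw1 sw1]) simp
qed

text \<open>
  A vertex of the circle lies on at most two of the three edges, and a new vertex belongs to one of
  them. So one of the three subdivisions does not matter for the link. If the first is dropped, the
  transposition of \<open>0, 1\<close> reverses the orientation; for the second it is \<open>1, 2\<close>, for the third
  \<open>2, 3\<close>.
\<close>

lemma lk_starred4_zero:
  fixes f :: "ocomplex \<Rightarrow> rat"
  assumes f: "f \<in> local_cochains n" and us: "circle us"
    and e: "e \<in> set (cyc us)" "e' \<in> set (cyc us)" "e'' \<in> set (cyc us)" "e \<noteq> e'" "e \<noteq> e''" "e' \<noteq> e''"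
    and v: "v \<in> {4, 5, 6} \<union> set us"
  shows "val f (lk v (starred4 us e e' e'')) = 0"
proof -
  note n = core_notin[OF us]
  have v4: "4 \<le> v" using v us by (auto simp: circle_def)
  have tf: "inj (Transposition.transpose a b :: nat \<Rightarrow> nat)" "\<And>v. 4 \<le> v \<Longrightarrow> Transposition.transpose a b v = v" if "a < 4" "b < 4" for a b :: nat
    using that by (auto simp: Transposition.transpose_def Transposition.inj_transpose)
  note ok4 = near_join4[OF us]
  have nW: "4 \<notin> {0, 1, 2, 3} \<union> set us" "5 \<notin> {0, 1, 2, 3} \<union> set us" "6 \<notin> {0, 1, 2, 3} \<union> set us"
    using n[of 4] n[of 5] n[of 6] by auto
  have oky: "near us (insert 5 ({0, 1, 2, 3} \<union> set us)) (estar e' [0, 1] 5 (join4 us))"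
    by (rule near_estar[OF us ok4 _ nW(2)]) simp
  have oky': "near us (insert 4 ({0, 1, 2, 3} \<union> set us)) (estar e [0] 4 (join4 us))"
    by (rule near_estar[OF us ok4 _ nW(1)]) simp
  have xy: "estar e' [0, 1] 5 (estar e [0] 4 (join4 us)) = estar e [0] 4 (estar e' [0, 1] 5 (join4 us))"
    by (rule estar_commute[OF us ok4 e(2,1)]) (use e(4) in auto)
  have xz: "estar e'' [0, 1, 2] 6 (estar e [0] 4 (estar e' [0, 1] 5 (join4 us))) = estar e [0] 4 (estar e'' [0, 1, 2] 6 (estar e' [0, 1] 5 (join4 us)))"
    by (rule estar_commute[OF us oky e(3,1)]) (use e(5) in auto)
  have yz: "estar e'' [0, 1, 2] 6 (estar e' [0, 1] 5 (estar e [0] 4 (join4 us))) = estar e' [0, 1] 5 (estar e'' [0, 1, 2] 6 (estar e [0] 4 (join4 us)))"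
    by (rule estar_commute[OF us oky' e(3,2)]) (use e(6) in auto)
  have okz: "near us (insert 6 (insert 5 ({0, 1, 2, 3} \<union> set us))) (estar e'' [0, 1, 2] 6 (estar e' [0, 1] 5 (join4 us)))"
    by (rule near_estar[OF us oky]) (use n[of 6] in auto)
  have okz': "near us (insert 6 (insert 4 ({0, 1, 2, 3} \<union> set us))) (estar e'' [0, 1, 2] 6 (estar e [0] 4 (join4 us)))"
    by (rule near_estar[OF us oky']) (use n[of 6] in auto)
  consider (z) "lk v (starred4 us e e' e'') = lk v (estar e' [0, 1] 5 (estar e [0] 4 (join4 us)))"
    | (x) "lk v (starred4 us e e' e'') = lk v (estar e'' [0, 1, 2] 6 (estar e' [0, 1] 5 (join4 us)))"
    | (y) "lk v (starred4 us e e' e'') = lk v (estar e'' [0, 1, 2] 6 (estar e [0] 4 (join4 us)))"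
  proof -
    consider "v = 4" | "v = 5" | "v = 6" | "v \<in> set us" using v by blast
    then show ?thesis
    proof cases
      case 1
      have "lk v (starred4 us e e' e'') = lk v (estar e' [0, 1] 5 (estar e [0] 4 (join4 us)))"
        unfolding starred4_def xy 1
        by (rule lk_drop_new[OF us oky e(1,3,5)]) (use nW in auto)
      then show ?thesis by (rule z)
    next
      case 2
      have "lk v (starred4 us e e' e'') = lk v (estar e' [0, 1] 5 (estar e [0] 4 (join4 us)))"
        unfolding starred4_def 2
        by (rule lk_drop_new[OF us oky' e(2,3,6)]) (use nW in auto)
      then show ?thesis by (rule z)
    next
      case 3
      have "lk v (starred4 us e e' e'') = lk v (estar e'' [0, 1, 2] 6 (estar e' [0, 1] 5 (join4 us)))"
        unfolding starred4_def xy xz 3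
        by (rule lk_drop_new[OF us oky e(3,1)]) (use e(5) nW in auto)
      then show ?thesis by (rule x)
    next
      case 4
      have "\<not> (v \<in> {fst e, snd e} \<and> v \<in> {fst e', snd e'} \<and> v \<in> {fst e'', snd e''})"
      proof
        assume a: "v \<in> {fst e, snd e} \<and> v \<in> {fst e', snd e'} \<and> v \<in> {fst e'', snd e''}"
        have d: "distinct us" and ne: "us \<noteq> []" using us circle_ne by (auto simp: circle_def)
        have i: "fst a \<noteq> fst b" "snd a \<noteq> snd b" if "a \<in> set (cyc us)" "b \<in> set (cyc us)" "a \<noteq> b" for a b
          using cyc_inj_fst[OF d ne that(1,2)] cyc_inj_snd[OF d ne that(1,2)] that(3) by blast+
        show False using a i[OF e(1,2,4)] i[OF e(1,3,5)] i[OF e(2,3,6)] by auto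
      qed
      then consider "v \<noteq> fst e" "v \<noteq> snd e" | "v \<noteq> fst e'" "v \<noteq> snd e'" | "v \<noteq> fst e''" "v \<noteq> snd e''" by auto
      then show ?thesis
      proof cases
        case 1
        have "lk v (starred4 us e e' e'') = lk v (estar e'' [0, 1, 2] 6 (estar e' [0, 1] 5 (join4 us)))"
          unfolding starred4_def xy xz by (rule lk_drop_circle[OF us okz e(1) 4 1]) simp
        then show ?thesis by (rule x)
      next
        case 2
        have "lk v (starred4 us e e' e'') = lk v (estar e'' [0, 1, 2] 6 (estar e [0] 4 (join4 us)))"
          unfolding starred4_def yz by (rule lk_drop_circle[OF us okz' e(2) 4 2]) simp
        then show ?thesis by (rule y)
      next
        case 3
        have "lk v (starred4 us e e' e'') = lk v (estar e' [0, 1] 5 (estar e [0] 4 (join4 us)))"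
          unfolding starred4_def by (rule lk_drop_circle[OF us near_starred4_second[OF us] e(3) 4 3]) simp
        then show ?thesis by (rule z)
      qed
    qed
  qed
  then show ?thesis
  proof cases
    case z
    show ?thesis unfolding z
      by (rule two_stars_reversible[OF f us e(2,1), where g = "Transposition.transpose 2 3"])
        (use v4 join4_swap(1)[OF us] tf[of 2 3] in \<open>simp_all add: Transposition.transpose_def\<close>)
  next
    case x
    show ?thesis unfolding x
      by (rule two_stars_reversible[OF f us e(3,2), where g = "Transposition.transpose 0 1"])
        (use v4 join4_swap(3)[OF us] tf[of 0 1] in \<open>simp_all add: Transposition.transpose_def insert_commute\<close>)
  next
    case y
    show ?thesis unfolding y
      by (rule two_stars_reversible[OF f us e(3,1), where g = "Transposition.transpose 1 2"])
        (use v4 join4_swap(2)[OF us] tf[of 1 2] in \<open>simp_all add: Transposition.transpose_def insert_commute\<close>)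
  qed
qed

section \<open>Links of the tetrahedron vertices\<close>

lemma val_Nil: "f \<in> local_cochains n \<Longrightarrow> val f [] = 0"
proof -
  assume f: "f \<in> local_cochains n"
  have "\<not> oriented_sphere n (faces_of [], orient_of [])"
    by (simp add: oriented_sphere_def pl_sphere_def finite_complex_def)
  then show ?thesis using f by (auto simp: val_def local_cochains_def)
qed

text \<open>
  Summation over a superset is harmless, because a vertex outside the complex has the empty list as
  its link and \<open>f\<close> vanishes there.
\<close>

lemma local_formula_relation_over:
  assumes f: "f \<in> local_formulae n" and c: "sph (Suc n) c" and W: "finite W" "\<Union>(faces_of c) \<subseteq> W"
  shows "(\<Sum>v\<in>W. val f (lk v c)) = 0"
proof -
  have fc: "f \<in> local_cochains n" using f by (simp add: local_formulae_def)
  have "(\<Sum>v\<in>W. val f (lk v c)) = (\<Sum>v\<in>\<Union>(faces_of c). val f (lk v c))"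
  proof (rule sum.mono_neutral_right[OF W])
    show "\<forall>i\<in>W - \<Union>(faces_of c). val f (lk i c) = 0"
    proof
      fix i assume "i \<in> W - \<Union>(faces_of c)"
      then have "lk i c = []" by (intro lk_empty) (auto simp: Union_faces_of)
      then show "val f (lk i c) = 0" by (simp add: val_Nil[OF fc])
    qed
  qed
  then show ?thesis using local_formula_relation[OF f c] by simp
qed

lemma starred4_relation:
  fixes f :: "ocomplex \<Rightarrow> rat"
  assumes f: "f \<in> local_formulae 4" and us: "circle us"
    and e: "e \<in> set (cyc us)" "e' \<in> set (cyc us)" "e'' \<in> set (cyc us)" "e \<noteq> e'" "e \<noteq> e''" "e' \<noteq> e''"
  shows "val f (lk 0 (starred4 us e e' e'')) + val f (lk 1 (starred4 us e e' e'')) + val f (lk 2 (starred4 us e e' e'')) + val f (lk 3 (starred4 us e e' e'')) = 0"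
proof -
  let ?h = "\<lambda>v. val f (lk v (starred4 us e e' e''))"
  have fc: "f \<in> local_cochains 4" using f by (simp add: local_formulae_def)
  have s: "sph (Suc 4) (starred4 us e e' e'')" using sph_starred4[OF us e] by simp
  have z: "sum ?h ({4, 5, 6} \<union> set us) = 0"
    by (rule sum.neutral) (use lk_starred4_zero[OF fc us e] in blast)
  have d: "{0, 1, 2, 3} \<inter> ({4, 5, 6} \<union> set us) = {}" using us by (auto simp: circle_def)
  have "\<Union>(faces_of (starred4 us e e' e'')) \<subseteq> {0, 1, 2, 3} \<union> ({4, 5, 6} \<union> set us)"
    by (rule order_trans[OF Union_faces_near[OF near_starred4[OF us]]]) auto
  from local_formula_relation_over[OF f s _ this]
  have "sum ?h ({0, 1, 2, 3} \<union> ({4, 5, 6} \<union> set us)) = 0" by simp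
  moreover have "sum ?h ({0, 1, 2, 3} \<union> ({4, 5, 6} \<union> set us)) = sum ?h {0, 1, 2, 3} + sum ?h ({4, 5, 6} \<union> set us)"
    by (rule sum.union_disjoint[OF _ _ d]) simp_all
  ultimately have "sum ?h {0, 1, 2, 3} = 0" unfolding z by simp
  then show ?thesis by (simp add: add.assoc)
qed

lemma lk_starred4:
  assumes us: "circle us" and e: "e \<in> set (cyc us)" "e' \<in> set (cyc us)" "e'' \<in> set (cyc us)" and d: "d < 4"
  shows "lk d (starred4 us e e' e'') =
    estar e'' (remove1 d [0, 1, 2]) 6 (estar e' (remove1 d [0, 1]) 5 (estar e (remove1 d [0]) 4 (lk d (join4 us))))"
  unfolding starred4_def
  by (subst lk_estar[OF us near_starred4_second[OF us] e(3)] lk_estar[OF us near_starred4_first[OF us] e(2)] lk_estar[OF us near_join4[OF us] e(1)];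
      use d in simp)+

lemma lk_join4:
  assumes us: "circle us"
  shows "lk 0 (join4 us) = ring (- 1) [2, 3] us @ ring 1 [1, 3] us @ ring (- 1) [1, 2] us"
    "lk 1 (join4 us) = ring 1 [2, 3] us @ ring (- 1) [0, 3] us @ ring 1 [0, 2] us"
    "lk 2 (join4 us) = ring (- 1) [1, 3] us @ ring 1 [0, 3] us @ ring (- 1) [0, 1] us"
    "lk 3 (join4 us) = join3 us"
  unfolding join4_def join3_def lk_append
  using core_notin[OF us] circle_ne[OF us] by (simp_all add: lk_ring)

text \<open>
  The third subdivision is at a simplex with five vertices, too large for the link of \<open>3\<close>.
\<close>

lemma lk3_starred4:
  assumes us: "circle us" and e: "e \<in> set (cyc us)" "e' \<in> set (cyc us)" "e'' \<in> set (cyc us)" "e \<noteq> e'"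
  shows "lk 3 (starred4 us e e' e'') = starred3 us e e'"
proof -
  have "lk 3 (starred4 us e e' e'') = estar e'' [0, 1, 2] 6 (starred3 us e e')"
    by (subst lk_starred4[OF us e(1-3)]) (simp_all add: lk_join4[OF us] starred3_def)
  also have "\<dots> = starred3 us e e'"
    unfolding estar_def
  proof (rule nochange_star)
    fix s F assume F: "(s, F) \<in> set (starred3 us e e')"
    have w: "wf_chain 4 (starred3 us e e')" using sph_starred3[OF us e(1,2,4)] by (simp add: sph_def)
    have c: "card (set F) = 4" using wf_chainD[OF w F] by (simp add: distinct_card)
    have "distinct ([fst e'', snd e''] @ [0, 1, 2])" using circle_edge[OF us e(3)] by auto
    then have "card (set ([fst e'', snd e''] @ [0, 1, 2])) = length ([fst e'', snd e''] @ [0, 1, 2])"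
      by (rule distinct_card)
    then have "card (set ([fst e'', snd e''] @ [0, 1, 2])) = 5" by simp
    then show "\<not> set ([fst e'', snd e''] @ [0, 1, 2]) \<subseteq> set F"
      using card_mono[of "set F" "set ([fst e'', snd e''] @ [0, 1, 2])"] c by auto
  qed
  finally show ?thesis .
qed

text \<open>
  In the link of \<open>0\<close> the first subdivision only inserts a vertex into the circle, and the other two
  are shifted: \<open>1, 2, 3\<close> take the roles of \<open>0, 1, 2\<close>. The map \<open>g\<close> performs this renaming.
\<close>

lemma lk0_starred4:
  fixes f :: "ocomplex \<Rightarrow> rat"
  assumes f: "f \<in> local_cochains n" and us: "circle (us @ [x])" "circle us"
    and e: "e' \<in> set (cyc us)" "e'' \<in> set (cyc us)" "e' \<noteq> (last us, hd us)" "e'' \<noteq> (last us, hd us)"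
  shows "val f (lk 0 (starred4 us (last us, hd us) e' e'')) = - val f (starred3 (us @ [x]) e' e'')"
proof -
  let ?e = "(last us, hd us)"
  note n = core_notin[OF us(2)]
  have ein: "?e \<in> set (cyc us)" by (simp add: cyc_def)
  have x: "7 \<le> x" "x \<notin> set us" using us(1) by (auto simp: circle_def)
  define g where "g v = (if v < 3 \<or> v = 4 \<or> v = 5 then v + 1 else if v = x then 4 else v)" for v :: nat
  define c1 where "c1 = star_chain [last us, hd us] x (join3 us)"
  define c where "c = estar e'' [0, 1] 5 (estar e' [0] 4 c1)"
  let ?V = "{0, 1, 2, 4, 5, x} \<union> set us"
  have gu: "g u = u" if "u \<in> set us" for u using that us(2) x by (auto simp: g_def circle_def)
  have inj: "inj_on g ?V"
  proof -
    have "inj_on g {0, 1, 2, 4, 5, x}" using x(1) by (auto simp: inj_on_def g_def)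
    moreover have "inj_on g (set us)" using gu by (auto simp: inj_on_def)
    moreover have "g ` {0, 1, 2, 4, 5, x} \<subseteq> {..<7}" using x(1) by (auto simp: g_def)
    moreover have "g ` set us = set us" using gu by force
    moreover have "{..<7} \<inter> set us = {}" using us(2) by (auto simp: circle_def)
    ultimately show ?thesis unfolding inj_on_Un by blast
  qed
  have ok1: "near us ({0, 1, 2, x} \<union> set us) c1"
    unfolding c1_def by (rule near_mono[OF near_star[OF near_join3[OF us(2)]]]) (use x in auto)
  have ok2: "near us ({0, 1, 2, x, 4} \<union> set us) (estar e' [0] 4 c1)"
    by (rule near_mono[OF near_estar[OF us(2) ok1]]) (use x n[of 4] in auto)
  have ok3: "near us ?V c"
    unfolding c_def by (rule near_mono[OF near_estar[OF us(2) ok2]]) (use x n[of 5] in auto)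
  have mg: "map g us = us" by (rule map_idI) (rule gu)
  have gs: "g 0 = 1" "g 1 = 2" "g 2 = 3" by (simp_all add: g_def)
  have B: "lk 0 (join4 us) = neg_chain (map_chain g (join3 us))"
    unfolding lk_join4[OF us(2)] join3_def map_chain_append neg_chain_append neg_chain_ring
      map_chain_ring[OF circle_ne[OF us(2)]] mg list.map gs minus_minus ..
  have ge: "g (fst h) = fst h" "g (snd h) = snd h" if "h \<in> set (cyc us)" for h
    using gu circle_edge[OF us(2) that] by auto
  have fV: "{fst h, snd h} \<union> D \<subseteq> ?V" if "h \<in> set (cyc us)" "D \<subseteq> {0, 1}" for h D
    using circle_edge(1,2)[OF us(2) that(1)] that(2) by auto
  have m1: "map_chain g c1 = estar ?e [] 4 (map_chain g (join3 us))"
  proof -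
    have "map_chain g (estar ?e [] x (join3 us)) = estar (g (fst ?e), g (snd ?e)) (map g []) (g x) (map_chain g (join3 us))"
      by (rule map_chain_estar[OF inj]) (use fV[OF ein, of "{}"] Union_faces_near[OF near_join3[OF us(2)]] in auto)
    moreover have "g x = 4" using x(1) by (auto simp: g_def)
    ultimately show ?thesis using ge[OF ein] by (simp add: c1_def estar_def)
  qed
  have m2: "map_chain g (estar e' [0] 4 c1) = estar e' [1] 5 (map_chain g c1)"
  proof -
    have "map_chain g (estar e' [0] 4 c1) = estar (g (fst e'), g (snd e')) (map g [0]) (g 4) (map_chain g c1)"
      by (rule map_chain_estar[OF inj]) (use fV[OF e(1), of "{0}"] Union_faces_near[OF ok1] in auto)
    then show ?thesis using ge[OF e(1)] by (simp add: g_def)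
  qed
  have m3: "map_chain g c = estar e'' [1, 2] 6 (map_chain g (estar e' [0] 4 c1))"
  proof -
    have "map_chain g c = estar (g (fst e''), g (snd e'')) (map g [0, 1]) (g 5) (map_chain g (estar e' [0] 4 c1))"
      unfolding c_def
      by (rule map_chain_estar[OF inj]) (use fV[OF e(2), of "{0, 1}"] Union_faces_near[OF ok2] in auto)
    then show ?thesis using ge[OF e(2)] by (simp add: g_def numeral_2_eq_2)
  qed
  have "lk 0 (starred4 us ?e e' e'') = estar e'' [1, 2] 6 (estar e' [1] 5 (estar ?e [] 4 (lk 0 (join4 us))))"
    by (subst lk_starred4[OF us(2) ein e(1,2)]) simp_all
  also have "\<dots> = neg_chain (map_chain g c)"
    unfolding B estar_neg m3 m2 m1 ..
  finally have "val f (lk 0 (starred4 us ?e e' e'')) = - val f (map_chain g c)"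
    using val_neg_chain[OF f] by simp
  also have "val f (map_chain g c) = val f c"
    by (rule val_map_chain[OF f inj_on_subset[OF inj Union_faces_near[OF ok3]]])
  also have "val f c = val f (starred3 (us @ [x]) e' e'')"
  proof (rule val_eqv)
    have okx: "near (us @ [x]) ({0, 1, 2, x} \<union> set us) (join3 (us @ [x]))"
      by (rule near_mono[OF near_join3[OF us(1)]]) auto
    have n4: "4 \<notin> {0, 1, 2, x} \<union> set us" "5 \<notin> {0, 1, 2, x, 4} \<union> set us" using n[of 4] n[of 5] x by auto
    have okx2: "near (us @ [x]) ({0, 1, 2, x, 4} \<union> set us) (estar e' [0] 4 (join3 (us @ [x])))"
      by (rule near_mono[OF near_estar[OF us(1) okx]]) (use n4 in auto)
    have ne: "4 \<notin> set ([fst e', snd e'] @ [0])" "5 \<notin> set ([fst e'', snd e''] @ [0, 1])"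
      using circle_edge[OF us(2) e(1)] circle_edge[OF us(2) e(2)] by auto
    have "eqv c1 (join3 (us @ [x]))" unfolding c1_def by (rule star_join3[OF us(2)])
    from eqv_estar[OF eqv_estar[OF this ok1 okx n4(1) ne(1)] ok2 okx2 n4(2) ne(2)]
    show "eqv c (starred3 (us @ [x]) e' e'')" unfolding c_def starred3_def .
  qed
  finally show ?thesis .
qed

section \<open>The spheres with two arcs\<close>

text \<open>
  The edge from \<open>Q\<close> to \<open>P\<close> is subdivided first, then the edge from \<open>P\<close> to \<open>Q\<close>.
\<close>

definition two_arcs :: "nat list \<Rightarrow> nat list \<Rightarrow> ochain" where
  "two_arcs P Q = starred3 (P @ Q) (last Q, hd P) (last P, hd Q)"

definition rho :: "(ocomplex \<Rightarrow> rat) \<Rightarrow> nat \<Rightarrow> nat \<Rightarrow> rat" where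
  "rho f p q = val f (two_arcs [7..<7 + p] [7 + p..<7 + p + q])"

lemma map_chain_starred3:
  assumes us: "circle us" and e: "e \<in> set (cyc us)" "e' \<in> set (cyc us)"
    and g: "inj_on g ({..<7} \<union> set us)" "\<And>c. c < 7 \<Longrightarrow> g c = c"
  shows "map_chain g (starred3 us e e') = starred3 (map g us) (g (fst e), g (snd e)) (g (fst e'), g (snd e'))"
proof -
  have s1: "\<Union>(faces_of (join3 us)) \<subseteq> {..<7} \<union> set us"
    by (rule order_trans[OF Union_faces_near[OF near_join3[OF us]]]) auto
  have s2: "\<Union>(faces_of (estar e [0] 4 (join3 us))) \<subseteq> {..<7} \<union> set us"
    by (rule order_trans[OF Union_faces_near[OF near_starred3_first[OF us]]]) auto
  have V: "{fst e, snd e} \<union> set [0] \<subseteq> {..<7} \<union> set us" "{fst e', snd e'} \<union> set [0, 1] \<subseteq> {..<7} \<union> set us"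
    using circle_edge(1,2)[OF us e(1)] circle_edge(1,2)[OF us e(2)] by auto
  have "\<forall>c\<in>{..<7}. g c = c" using g(2) by simp
  note B = map_chain_join3[OF circle_ne[OF us] this]
  show ?thesis
    unfolding starred3_def map_chain_estar[OF g(1) s2 V(2)] map_chain_estar[OF g(1) s1 V(1)] B
    by (simp add: g(2))
qed

lemma two_arcs_edges:
  assumes "P \<noteq> []" "Q \<noteq> []" "circle (P @ Q)"
  shows "(last Q, hd P) \<in> set (cyc (P @ Q))" "(last P, hd Q) \<in> set (cyc (P @ Q))" "(last Q, hd P) \<noteq> (last P, hd Q)"
  using assms by (auto simp: cyc_append circle_def disjoint_iff) (metis last_in_set)

lemma val_two_arcs:
  fixes f :: "ocomplex \<Rightarrow> rat"
  assumes f: "f \<in> local_cochains n" and PQ: "P \<noteq> []" "Q \<noteq> []" "circle (P @ Q)"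
  shows "val f (two_arcs P Q) = rho f (length P) (length Q)"
proof -
  let ?P = "[7..<7 + length P]" and ?Q = "[7 + length P..<7 + length P + length Q]"
  let ?u = "[7..<7 + length P + length Q]"
  have u: "?u = ?P @ ?Q" by (metis le_add1 upt_add_eq_append add.assoc)
  have c: "circle ?u" using PQ(3) by (auto simp: circle_def)
  have "\<exists>g. map g ?u = P @ Q \<and> (\<forall>c\<in>{..<7}. g c = c) \<and> inj_on g ({..<7} \<union> set ?u)"
  proof (rule relabel_exists)
    show "distinct (P @ Q)" using PQ(3) unfolding circle_def by blast
    show "set (P @ Q) \<inter> {..<7} = {}" using core_notin[OF PQ(3)] by (auto simp del: set_append)
  qed auto
  then obtain g where g: "map g ?u = P @ Q" "\<forall>c\<in>{..<7}. g c = c" "inj_on g ({..<7} \<union> set ?u)" by blast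
  have m: "map g ?P = P" "map g ?Q = Q" using g(1) unfolding u by auto
  have ne: "?P \<noteq> []" "?Q \<noteq> []" using PQ(1,2) by auto
  have h: "g (hd ?P) = hd P" "g (hd ?Q) = hd Q" "g (last ?P) = last P" "g (last ?Q) = last Q"
    using m ne by (metis hd_map last_map)+
  note e = two_arcs_edges[OF ne, folded u, OF c]
  have "map_chain g (two_arcs ?P ?Q) = two_arcs P Q"
    unfolding two_arcs_def using map_chain_starred3[OF c e(1,2) g(3)] g(2) h g(1) unfolding u by simp
  moreover have "inj_on g (\<Union>(faces_of (two_arcs ?P ?Q)))"
  proof (rule inj_on_subset[OF g(3)])
    show "\<Union>(faces_of (two_arcs ?P ?Q)) \<subseteq> {..<7} \<union> set ?u"
      unfolding two_arcs_def u[symmetric] by (rule order_trans[OF Union_faces_near[OF near_starred3[OF c]]]) auto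
  qed
  ultimately show ?thesis using val_map_chain[OF f, of g "two_arcs ?P ?Q"] by (simp add: rho_def)
qed

lemma starred3_eqv:
  assumes us: "circle us" and ws: "circle ws" "set ws = set us" and B: "eqv (join3 us) (join3 ws)"
    and e: "e \<in> set (cyc us)" "e' \<in> set (cyc us)"
  shows "eqv (starred3 us e e') (starred3 ws e e')"
proof -
  note n = core_notin[OF us]
  have n4: "4 \<notin> {0, 1, 2} \<union> set us" "5 \<notin> {0, 1, 2, 4} \<union> set us" using n[of 4] n[of 5] by auto
  have ne: "4 \<notin> set ([fst e, snd e] @ [0])" "5 \<notin> set ([fst e', snd e'] @ [0, 1])"
    using circle_edge[OF us e(1)] circle_edge[OF us e(2)] by auto
  show ?thesis
    unfolding starred3_def
    by (rule eqv_estar[OF eqv_estar[OF B near_join3[OF us] near_join3[OF ws(1), unfolded ws(2)] n4(1) ne(1)]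
          near_starred3_first[OF us] near_starred3_first[OF ws(1), unfolded ws(2)] n4(2) ne(2)])
qed

lemma val_starred3:
  fixes f :: "ocomplex \<Rightarrow> rat"
  assumes f: "f \<in> local_cochains n" and us: "circle us" and PQ: "P \<noteq> []" "Q \<noteq> []" 
    and rot: "us = S @ T" "P @ Q = T @ S"
  shows "val f (starred3 us (last Q, hd P) (last P, hd Q)) = rho f (length P) (length Q)"
proof -
  have ws: "circle (P @ Q)" "set (P @ Q) = set us" using us unfolding rot by (auto simp: circle_def)
  have e: "(last Q, hd P) \<in> set (cyc us)" "(last P, hd Q) \<in> set (cyc us)"
    using two_arcs_edges(1,2)[OF PQ ws(1)] mset_cyc_rotate[of S T] unfolding rot by (metis mset_eq_setD)+
  have "eqv (join3 us) (join3 (P @ Q))" unfolding rot by (rule join3_rotate)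
  from val_eqv[OF starred3_eqv[OF us ws this e], of f] val_two_arcs[OF f PQ ws(1)] show ?thesis
    by (simp add: two_arcs_def)
qed

text \<open>
  Reversing the direction of the circle reverses the orientation and exchanges the arcs.
\<close>

lemma rho_swap:
  assumes f: "f \<in> local_cochains n" and pq: "1 \<le> p" "1 \<le> q" "3 \<le> p + q"
  shows "rho f q p = - rho f p q"
proof -
  let ?P = "[7..<7 + p]" and ?Q = "[7 + p..<7 + p + q]"
  let ?us = "?P @ ?Q"
  have us: "circle ?us" using pq by (auto simp: circle_def)
  have ws: "circle (rev ?us)" "set (rev ?us) = set ?us"
    using us unfolding circle_def set_rev length_rev distinct_rev by blast+
  have ne: "?P \<noteq> []" "?Q \<noteq> []" "rev ?P \<noteq> []" "rev ?Q \<noteq> []" using pq by auto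
  note e = two_arcs_edges[OF ne(1,2) us]
  have r: "last (rev ?P) = hd ?P" "hd (rev ?Q) = last ?Q" "last (rev ?Q) = hd ?Q" "hd (rev ?P) = last ?P"
    using ne by (simp_all add: last_rev hd_rev)
  have B: "eqv (join3 (rev ?us)) (neg_chain (join3 ?us))"
    unfolding join3_def neg_chain_append neg_chain_ring using circle_ne[OF us]
    by (intro eqv_blocks3 eqv_ring_rev) auto
  have okn: "near us W (neg_chain c) = near us W c" for us W c by (auto simp: near_def neg_chain_def)
  have E: "eqv (starred3 (rev ?us) (last ?Q, hd ?P) (last ?P, hd ?Q)) (neg_chain (starred3 ?us (last ?Q, hd ?P) (last ?P, hd ?Q)))"
  proof -
    note n = core_notin[OF us]
    have n4: "4 \<notin> {0, 1, 2} \<union> set ?us" "5 \<notin> {0, 1, 2, 4} \<union> set ?us" using n[of 4] n[of 5] by auto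
    have ne: "4 \<notin> set ([fst (last ?Q, hd ?P), snd (last ?Q, hd ?P)] @ [0])"
      "5 \<notin> set ([fst (last ?P, hd ?Q), snd (last ?P, hd ?Q)] @ [0, 1])"
      using circle_edge[OF us e(1)] circle_edge[OF us e(2)] by auto
    have o: "near ?us ({0, 1, 2} \<union> set ?us) (neg_chain (join3 ?us))" unfolding okn by (rule near_join3[OF us])
    have o': "near ?us ({0, 1, 2, 4} \<union> set ?us) (estar (last ?Q, hd ?P) [0] 4 (neg_chain (join3 ?us)))"
      unfolding estar_neg okn by (rule near_starred3_first[OF us])
    show ?thesis
      using eqv_estar[OF eqv_estar[OF B near_join3[OF ws(1), unfolded ws(2)] o n4(1) ne(1)]
          near_starred3_first[OF ws(1), unfolded ws(2)] o' n4(2) ne(2)]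
      unfolding starred3_def estar_neg .
  qed
  have L: "starred3 (rev ?us) (last ?Q, hd ?P) (last ?P, hd ?Q) = two_arcs (rev ?Q) (rev ?P)"
  proof -
    have estar_flip: "estar (a, b) ds x c = estar (b, a) ds x c" for a b ds x c
      by (rule estar_cong_set) auto
    show ?thesis unfolding two_arcs_def starred3_def rev_append r
      using estar_flip[of "last ?Q" "hd ?P"] estar_flip[of "last ?P" "hd ?Q"] by simp
  qed
  have "val f (two_arcs (rev ?Q) (rev ?P)) = - val f (two_arcs ?P ?Q)"
    using val_eqv[OF E, of f] unfolding L val_neg_chain[OF f] two_arcs_def[of ?P ?Q] .
  moreover have "val f (two_arcs (rev ?Q) (rev ?P)) = rho f (length (rev ?Q)) (length (rev ?P))"
    by (rule val_two_arcs[OF f ne(4,3) ws(1)[unfolded rev_append]])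
  moreover have "length (rev ?Q) = q" "length (rev ?P) = p" by simp_all
  ultimately show ?thesis unfolding rho_def[of f p q] by (simp only:)
qed

text \<open>
  In the link of \<open>1\<close> the first two subdivisions both involve exactly the vertex \<open>0\<close>, so that they
  can be exchanged by renaming \<open>4\<close> and \<open>5\<close>.
\<close>

lemma lk1_starred4_swap:
  fixes f :: "ocomplex \<Rightarrow> rat"
  assumes f: "f \<in> local_cochains n" and us: "circle us"
    and e: "e \<in> set (cyc us)" "e' \<in> set (cyc us)" "e'' \<in> set (cyc us)" "e \<noteq> e'" "e \<noteq> e''" "e' \<noteq> e''"
  shows "val f (lk 1 (starred4 us e' e e'')) = val f (lk 1 (starred4 us e e' e''))"
proof -
  let ?g = "Transposition.transpose 4 (5::nat)"
  let ?C = "lk 1 (join4 us)"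
  have gi: "inj_on ?g UNIV" by (rule inj_transpose)
  have g: "?g v = v" if "v \<noteq> 4" "v \<noteq> 5" for v using that by (simp add: Transposition.transpose_def)
  have ge: "?g (fst h) = fst h" "?g (snd h) = snd h" if "h \<in> set (cyc us)" for h
    using circle_edge[OF us that] g by simp_all
  have mu: "map ?g us = us" by (rule map_idI) (use us g in \<open>auto simp: circle_def\<close>)
  have mC: "map_chain ?g ?C = ?C"
    unfolding lk_join4[OF us] map_chain_append map_chain_ring[OF circle_ne[OF us]] mu by (simp add: g)
  note okC = near_lk[OF near_join4[OF us], of 1]
  have "map_chain ?g (lk 1 (starred4 us e e' e'')) =
      map_chain ?g (estar e'' [0, 2] 6 (estar e' [0] 5 (estar e [0] 4 ?C)))"
    by (subst lk_starred4[OF us e(1-3)]) simp_all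
  also have "\<dots> = estar e'' [0, 2] 6 (estar e' [0] 4 (estar e [0] 5 ?C))"
    using map_chain_estar[OF gi] by (simp add: ge[OF e(1)] ge[OF e(2)] ge[OF e(3)] mC[unfolded One_nat_def] g)
  also have "estar e' [0] 4 (estar e [0] 5 ?C) = estar e [0] 5 (estar e' [0] 4 ?C)"
    by (rule estar_commute[OF us okC e(2,1)]) (use e(4) in auto)
  also have "estar e'' [0, 2] 6 (estar e [0] 5 (estar e' [0] 4 ?C)) = lk 1 (starred4 us e' e e'')"
    by (subst lk_starred4[OF us e(2,1,3)]) simp_all
  finally show ?thesis
    using val_map_chain[OF f, of ?g "lk 1 (starred4 us e e' e'')"] inj_on_subset[OF gi] by simp
qed

text \<open>
  In the link of \<open>2\<close> this holds for the second and third subdivisions.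
\<close>

lemma lk2_starred4_swap:
  fixes f :: "ocomplex \<Rightarrow> rat"
  assumes f: "f \<in> local_cochains n" and us: "circle us"
    and e: "e \<in> set (cyc us)" "e' \<in> set (cyc us)" "e'' \<in> set (cyc us)" "e \<noteq> e'" "e \<noteq> e''" "e' \<noteq> e''"
  shows "val f (lk 2 (starred4 us e e'' e')) = val f (lk 2 (starred4 us e e' e''))"
proof -
  let ?g = "Transposition.transpose 5 (6::nat)"
  let ?C = "lk 2 (join4 us)"
  have gi: "inj_on ?g UNIV" by (rule inj_transpose)
  have g: "?g v = v" if "v \<noteq> 5" "v \<noteq> 6" for v using that by (simp add: Transposition.transpose_def)
  have ge: "?g (fst h) = fst h" "?g (snd h) = snd h" if "h \<in> set (cyc us)" for h
    using circle_edge[OF us that] g by simp_all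
  have mu: "map ?g us = us" by (rule map_idI) (use us g in \<open>auto simp: circle_def\<close>)
  have mC: "map_chain ?g ?C = ?C"
    unfolding lk_join4[OF us] map_chain_append map_chain_ring[OF circle_ne[OF us]] mu by (simp add: g)
  have n4: "4 \<notin> {0, 1, 2, 3} \<union> set us" using core_notin[OF us, of 4] by auto
  note okC = near_estar[OF us near_lk[OF near_join4[OF us], of 2] _ n4, of e "[0]"]
  have "map_chain ?g (lk 2 (starred4 us e e' e'')) =
      map_chain ?g (estar e'' [0, 1] 6 (estar e' [0, 1] 5 (estar e [0] 4 ?C)))"
    by (subst lk_starred4[OF us e(1-3)]) simp_all
  also have "\<dots> = estar e'' [0, 1] 5 (estar e' [0, 1] 6 (estar e [0] 4 ?C))"
    using map_chain_estar[OF gi] by (simp add: ge[OF e(1)] ge[OF e(2)] ge[OF e(3)] mC g)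
  also have "\<dots> = estar e' [0, 1] 6 (estar e'' [0, 1] 5 (estar e [0] 4 ?C))"
    by (rule estar_commute[OF us okC e(3,2)]) (use e(6) in auto)
  also have "\<dots> = lk 2 (starred4 us e e'' e')"
    by (subst lk_starred4[OF us e(1,3,2)]) simp_all
  finally show ?thesis
    using val_map_chain[OF f, of ?g "lk 2 (starred4 us e e' e'')"] inj_on_subset[OF gi] by simp
qed

lemma lk_starred4_rotate:
  assumes us: "circle (S @ T)" and d: "d < 4"
    and e: "e \<in> set (cyc (S @ T))" "e' \<in> set (cyc (S @ T))" "e'' \<in> set (cyc (S @ T))"
  shows "eqv (lk d (starred4 (S @ T) e e' e'')) (lk d (starred4 (T @ S) e e' e''))"
proof -
  have ws: "circle (T @ S)" using us by (auto simp: circle_def)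
  have sw: "set (T @ S) = set (S @ T)" by auto
  note n = core_notin[OF us]
  have n4: "4 \<notin> {0, 1, 2, 3} \<union> set (S @ T)" "5 \<notin> {0, 1, 2, 3, 4} \<union> set (S @ T)"
    "6 \<notin> {0, 1, 2, 3, 4, 5} \<union> set (S @ T)" using n[of 4] n[of 5] n[of 6] by auto
  have ne: "4 \<notin> set ([fst e, snd e] @ [0])" "5 \<notin> set ([fst e', snd e'] @ [0, 1])"
     "6 \<notin> set ([fst e'', snd e''] @ [0, 1, 2])"
    using circle_edge[OF us e(1)] circle_edge[OF us e(2)] circle_edge[OF us e(3)] by auto
  have "eqv (starred4 (S @ T) e e' e'') (starred4 (T @ S) e e' e'')"
    unfolding starred4_def
    by (rule eqv_estar[OF eqv_estar[OF eqv_estar[OF join4_rotate near_join4[OF us] near_join4[OF ws, unfolded sw] n4(1) ne(1)]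
          near_starred4_first[OF us] near_starred4_first[OF ws, unfolded sw] n4(2) ne(2)]
          near_starred4_second[OF us] near_starred4_second[OF ws, unfolded sw] n4(3) ne(3)])
  from eqv_lk[OF this nearD(1)[OF near_starred4[OF us]] nearD(1)[OF near_starred4[OF ws]]] show ?thesis .
qed

section \<open>The recursion for the spheres with two arcs\<close>

context
  fixes f :: "ocomplex \<Rightarrow> rat"
  assumes f: "f \<in> local_formulae 4"
begin

lemma fc: "f \<in> local_cochains 4"
  using f by (simp add: local_formulae_def)

text \<open>
  Together with \<open>lk2_value\<close> this is the unknown part of the relations.
\<close>

definition lk1_value :: "nat list \<Rightarrow> nat list \<Rightarrow> nat list \<Rightarrow> rat" where
  "lk1_value P Q R = val f (lk 1 (starred4 (P @ Q @ R) (last R, hd P) (last P, hd Q) (last Q, hd R)))"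

definition lk2_value :: "nat list \<Rightarrow> nat list \<Rightarrow> nat list \<Rightarrow> rat" where
  "lk2_value P Q R = val f (lk 2 (starred4 (P @ Q @ R) (last R, hd P) (last P, hd Q) (last Q, hd R)))"

lemma three_edges:
  assumes "P \<noteq> []" "Q \<noteq> []" "R \<noteq> []" "circle (P @ Q @ R)"
  shows "(last R, hd P) \<in> set (cyc (P @ Q @ R))" "(last P, hd Q) \<in> set (cyc (P @ Q @ R))"
    "(last Q, hd R) \<in> set (cyc (P @ Q @ R))"
    "(last R, hd P) \<noteq> (last P, hd Q)" "(last R, hd P) \<noteq> (last Q, hd R)" "(last P, hd Q) \<noteq> (last Q, hd R)"
proof -
  have c: "circle (P @ (Q @ R))" "circle (Q @ (R @ P))" "circle (R @ (P @ Q))" using assms(4) by (auto simp: circle_def)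
  have "mset (cyc (P @ (Q @ R))) = mset (cyc ((Q @ R) @ P))" by (rule mset_cyc_rotate)
  then have s: "set (cyc (Q @ R @ P)) = set (cyc (P @ Q @ R))" unfolding append_assoc by (metis mset_eq_setD)
  have l: "Q @ R \<noteq> []" "R @ P \<noteq> []" "P @ Q \<noteq> []" "last (Q @ R) = last R" "hd (Q @ R) = hd Q"
    "last (R @ P) = last P" "hd (R @ P) = hd R" "last (P @ Q) = last Q" "hd (P @ Q) = hd P"
    using assms(1-3) by simp_all
  note x = two_arcs_edges[OF assms(1) l(1) c(1), unfolded l]
  note y = two_arcs_edges[OF assms(2) l(2) c(2), unfolded l s]
  note z = two_arcs_edges(3)[OF assms(3) l(3) c(3), unfolded l]
  show "(last R, hd P) \<in> set (cyc (P @ Q @ R))" "(last P, hd Q) \<in> set (cyc (P @ Q @ R))" by (rule x(1,2))+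
  show "(last Q, hd R) \<in> set (cyc (P @ Q @ R))" by (rule y(2))
  show "(last R, hd P) \<noteq> (last P, hd Q)" by (rule x(3))
  show "(last R, hd P) \<noteq> (last Q, hd R)" by (rule z[symmetric])
  show "(last P, hd Q) \<noteq> (last Q, hd R)" by (rule y(3))
qed

lemma fresh_circle: "circle us \<Longrightarrow> \<exists>x. circle (us @ [x])"
proof
  assume us: "circle us"
  have "Max (set us) + 7 \<notin> set us" using Max_ge[of "set us" "Max (set us) + 7"] by auto
  then show "circle (us @ [Max (set us) + 7])" using us by (auto simp: circle_def)
qed

text \<open>
  The edges in the order in which they appear on the circle.
\<close>

lemma three_arcs_relation:
  assumes ne: "P \<noteq> []" "Q \<noteq> []" "R \<noteq> []" and us: "circle (P @ Q @ R)"
  shows "lk1_value P Q R + lk2_value P Q R + rho f (length P) (length Q + length R)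
    = rho f (length Q) (length R + 1 + length P)"
proof -
  let ?us = "P @ Q @ R"
  note e = three_edges[OF ne us]
  obtain x where x: "circle (?us @ [x])" using fresh_circle[OF us] by blast
  have l: "last ?us = last R" "hd ?us = hd P" using ne by simp_all
  have "val f (lk 0 (starred4 ?us (last R, hd P) (last P, hd Q) (last Q, hd R)))
      = - val f (starred3 (?us @ [x]) (last P, hd Q) (last Q, hd R))"
    by (rule lk0_starred4[OF fc x us e(2,3), unfolded l, OF e(4)[symmetric] e(5)[symmetric]])
  also have "val f (starred3 (?us @ [x]) (last P, hd Q) (last Q, hd R)) = rho f (length Q) (length (R @ [x] @ P))"
    using val_starred3[OF fc x ne(2), of "R @ [x] @ P" P "Q @ R @ [x]"] ne by simp
  finally have l0: "val f (lk 0 (starred4 ?us (last R, hd P) (last P, hd Q) (last Q, hd R))) = - rho f (length Q) (length R + 1 + length P)"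
    by simp
  have l3: "val f (lk 3 (starred4 ?us (last R, hd P) (last P, hd Q) (last Q, hd R))) = rho f (length P) (length Q + length R)"
    using val_starred3[OF fc us ne(1), of "Q @ R" "[]" "P @ Q @ R"] ne lk3_starred4[OF us e(1-4)] by simp
  show ?thesis
    using starred4_relation[OF f us e] unfolding l0 l3 lk1_value_def lk2_value_def by simp
qed

text \<open>
  The first two edges exchanged: the link of \<open>1\<close> keeps its value, and the link of \<open>2\<close> is that of the
  rotated arcs.
\<close>

lemma three_arcs_relation_swapped:
  assumes ne: "P \<noteq> []" "Q \<noteq> []" "R \<noteq> []" and us: "circle (P @ Q @ R)"
  shows "lk1_value P Q R + lk2_value Q R P + rho f (length Q + length R) (length P)
    = rho f (length P + 1 + length Q) (length R)"
proof -
  let ?us = "P @ Q @ R" and ?ws = "Q @ R @ P"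
  let ?e = "(last R, hd P)" and ?e' = "(last P, hd Q)" and ?e'' = "(last Q, hd R)"
  have ws: "circle ?ws" using us by (auto simp: circle_def)
  note e = three_edges[OF ne us]
  note h = three_edges[OF ne(2,3,1) ws]
  obtain x where x: "circle (?ws @ [x])" using fresh_circle[OF ws] by blast
  have l: "last ?ws = last P" "hd ?ws = hd Q" using ne by simp_all
  have "val f (lk 0 (starred4 ?ws ?e' ?e ?e'')) = - val f (starred3 (?ws @ [x]) ?e ?e'')"
    by (rule lk0_starred4[OF fc x ws h(3,2), unfolded l, OF h(5)[symmetric] h(4)[symmetric]])
  also have "val f (starred3 (?ws @ [x]) ?e ?e'') = rho f (length (P @ [x] @ Q)) (length R)"
    using val_starred3[OF fc x, of "P @ [x] @ Q" R "Q @ R" "P @ [x]"] ne by simp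
  finally have l0: "val f (lk 0 (starred4 ?ws ?e' ?e ?e'')) = - rho f (length P + 1 + length Q) (length R)"
    by simp
  have l3: "val f (lk 3 (starred4 ?ws ?e' ?e ?e'')) = rho f (length Q + length R) (length P)"
    using val_starred3[OF fc ws, of "Q @ R" P "[]" "Q @ R @ P"] ne lk3_starred4[OF ws h(1,3,2) h(5)] by simp
  have l1: "val f (lk 1 (starred4 ?ws ?e' ?e ?e'')) = lk1_value P Q R"
    unfolding lk1_value_def
    using lk1_starred4_swap[OF fc ws h(3,1,2) h(5)[symmetric] h(6)[symmetric] h(4)]
      val_eqv[OF lk_starred4_rotate[of P "Q @ R" 1 ?e ?e' ?e''], of f] us e by simp
  have l2: "val f (lk 2 (starred4 ?ws ?e' ?e ?e'')) = lk2_value Q R P"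
    unfolding lk2_value_def
    using lk2_starred4_swap[OF fc ws h(1,2,3) h(4,5,6)] by simp
  show ?thesis
    using starred4_relation[OF f ws h(1,3,2) h(5,4) h(6)[symmetric]] unfolding l0 l1 l2 l3 by simp
qed

text \<open>
  The cyclic sum of the differences of the two relations; the links of \<open>1\<close> cancel in each difference
  and the links of \<open>2\<close> in the sum.
\<close>

lemma rho_cyclic:
  assumes "1 \<le> p" "1 \<le> q" "1 \<le> r"
  shows "rho f p (q + r + 1) + rho f q (r + p + 1) + rho f r (p + q + 1)
    = rho f p (q + r) + rho f q (r + p) + rho f r (p + q)"
proof -
  let ?P = "[7..<7 + p]" and ?Q = "[7 + p..<7 + p + q]" and ?R = "[7 + p + q..<7 + p + q + r]"
  have ne: "?P \<noteq> []" "?Q \<noteq> []" "?R \<noteq> []" using assms by auto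
  have c: "circle (?P @ ?Q @ ?R)" "circle (?Q @ ?R @ ?P)" "circle (?R @ ?P @ ?Q)"
    using assms by (auto simp: circle_def)
  note sw = rho_swap[OF fc]
  have s: "rho f (q + r) p = - rho f p (q + r)" "rho f (r + p) q = - rho f q (r + p)" "rho f (p + q) r = - rho f r (p + q)"
    "rho f (p + 1 + q) r = - rho f r (p + q + 1)" "rho f (q + 1 + r) p = - rho f p (q + r + 1)" "rho f (r + 1 + p) q = - rho f q (r + p + 1)"
    using sw[of p "q + r"] sw[of q "r + p"] sw[of r "p + q"] sw[of r "p + 1 + q"] sw[of p "q + 1 + r"] sw[of q "r + 1 + p"] assms
    by (simp_all add: ac_simps)
  have t: "rho f q (r + 1 + p) = rho f q (r + p + 1)" "rho f r (p + 1 + q) = rho f r (p + q + 1)" "rho f p (q + 1 + r) = rho f p (q + r + 1)"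
    by (simp_all add: ac_simps)
  show ?thesis
    using three_arcs_relation[OF ne c(1)] three_arcs_relation[OF ne(2,3,1) c(2)] three_arcs_relation[OF ne(3,1,2) c(3)]
      three_arcs_relation_swapped[OF ne c(1)] three_arcs_relation_swapped[OF ne(2,3,1) c(2)] three_arcs_relation_swapped[OF ne(3,1,2) c(3)]
    unfolding length_upt by (simp only: diff_add_inverse s t)
qed

text \<open>
  By \<open>rho_cyclic\<close> the differences \<open>d p\<close> satisfy \<open>d p + d q + d r = 0\<close> whenever \<open>p + q + r = n\<close>. So
  \<open>d\<close> is an affine function of \<open>p\<close> that vanishes at \<open>p = n / 3\<close>.
\<close>

lemma rho_difference:
  assumes n: "5 \<le> n"
  shows "\<exists>a. \<forall>p. 1 \<le> p \<and> p + 2 \<le> n \<longrightarrow>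
    rho f p (n - p + 1) - rho f p (n - p) = a * (3 * of_nat p - of_nat n)"
proof -
  define d where "d p = rho f p (n - p + 1) - rho f p (n - p)" for p
  have sum0: "d p + d q + d r = 0" if "1 \<le> p" "1 \<le> q" "1 \<le> r" "p + q + r = n" for p q r
  proof -
    have "n - p = q + r" "n - q = r + p" "n - r = p + q" using that by auto
    then show ?thesis using rho_cyclic[OF that(1-3)] by (simp add: d_def)
  qed
  define b where "b = d 2 - d 1"
  have step: "d (p + 1) = d p + b" if "1 \<le> p" "p + 3 \<le> n" for p
  proof -
    define r where "r = n - (p + 2)"
    have r: "1 \<le> r" "p + 1 + 1 + r = n" "p + 2 + r = n" using that by (auto simp: r_def)
    show ?thesis using sum0[of "p + 1" 1 r] sum0[of p 2 r] that r by (simp add: b_def)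
  qed
  have lin: "d p = d 1 + b * (of_nat p - 1)" if "1 \<le> p" "p + 2 \<le> n" for p
    using that
  proof (induction p rule: nat_induct_at_least)
    case base
    then show ?case by simp
  next
    case (Suc p)
    then show ?case using step[of p] by (simp add: algebra_simps)
  qed
  have "d 1 + d 1 + d (n - 2) = 0" using sum0[of 1 1 "n - 2"] n by simp
  moreover have "d (n - 2) = d 1 + b * (of_nat n - 3)"
    using lin[of "n - 2"] n by (simp add: of_nat_diff algebra_simps)
  ultimately have d1: "d 1 = - b * (of_nat n - 3) / 3" by (simp add: field_simps)
  show ?thesis
  proof (intro exI allI impI)
    fix p assume "1 \<le> p \<and> p + 2 \<le> n"
    then have "d p = b / 3 * (3 * of_nat p - of_nat n)" using lin[of p] unfolding d1 by (simp add: field_simps)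
    then show "rho f p (n - p + 1) - rho f p (n - p) = b / 3 * (3 * of_nat p - of_nat n)" by (simp add: d_def)
  qed
qed

text \<open>
  By induction on \<open>n\<close>. Passing from \<open>n\<close> to \<open>n + 1\<close> leaves one free constant \<open>a\<close>, which antisymmetry
  at \<open>p = 3\<close> determines. The factor \<open>210\<close> normalizes the case \<open>n = 5, p = 2\<close>.
\<close>

lemma rho_formula:
  assumes "5 \<le> n" "2 \<le> p" "p + 2 \<le> n"
  shows "rho f p (n - p) = 210 * rho f 2 3 * (of_nat n - 2 * of_nat p) / (of_nat n * (of_nat n + 1) * (of_nat n + 2))"
  using assms
proof (induction n arbitrary: p rule: nat_induct_at_least)
  case base
  then have "p = 2 \<or> p = 3" by auto
  moreover have "rho f 3 2 = - rho f 2 3" using rho_swap[OF fc, of 2 3] by simp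
  ultimately show ?case by auto
next
  case (Suc n)
  define c where "c = 210 * rho f 2 3 / (of_nat n * (of_nat n + 1) * (of_nat n + 2))"
  have IH: "rho f p (n - p) = c * (of_nat n - 2 * of_nat p)" if "2 \<le> p" "p + 2 \<le> n" for p
    using Suc.IH[OF that] by (simp add: c_def)
  obtain a where a: "\<And>p. 1 \<le> p \<Longrightarrow> p + 2 \<le> n \<Longrightarrow> rho f p (n - p + 1) - rho f p (n - p) = a * (3 * of_nat p - of_nat n)"
    using rho_difference[OF Suc.hyps] by blast
  have nx: "rho f p (n - p + 1) = c * (of_nat n - 2 * of_nat p) + a * (3 * of_nat p - of_nat n)"
    if "2 \<le> p" "p + 2 \<le> n" for p
    using a[of p] IH[OF that] that by simp
  have n0: "(of_nat n + 3 :: rat) \<noteq> 0" "(of_nat n :: rat) \<noteq> 0" "(of_nat n + 1 :: rat) \<noteq> 0" "(of_nat n + 2 :: rat) \<noteq> 0"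
    using Suc.hyps of_nat_0_le_iff[of n, where 'a = rat] by linarith+
  have "rho f (n - 2) 3 = - rho f 3 (n - 2)" using rho_swap[OF fc, of 3 "n - 2"] Suc.hyps by simp
  moreover have "rho f (n - 2) 3 = c * (of_nat n - 2 * (of_nat n - 2)) + a * (3 * (of_nat n - 2) - of_nat n)"
    using nx[of "n - 2"] Suc.hyps by (simp add: of_nat_diff)
  moreover have "n - 3 + 1 = n - 2" using Suc.hyps by simp
  then have "rho f 3 (n - 2) = c * (of_nat n - 6) + a * (9 - of_nat n)"
    using nx[of 3] Suc.hyps by simp
  ultimately have "a * (of_nat n + 3) = 2 * c" by (simp add: algebra_simps)
  then have a_eq: "a = 2 * c / (of_nat n + 3)" using n0(1) by (simp add: field_simps)
  have main: "rho f p (Suc n - p) = c * of_nat n / (of_nat n + 3) * (of_nat (Suc n) - 2 * of_nat p)"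
    if p: "2 \<le> p" "p + 2 \<le> n" for p
  proof -
    have "Suc n - p = n - p + 1" using p by simp
    then have "rho f p (Suc n - p) = c * (of_nat n - 2 * of_nat p) + a * (3 * of_nat p - of_nat n)" using nx[OF p] by simp
    also have "\<dots> = c * of_nat n / (of_nat n + 3) * (of_nat (Suc n) - 2 * of_nat p)"
      unfolding a_eq using n0(1) by (simp add: field_simps)
    finally show ?thesis .
  qed
  have "rho f p (Suc n - p) = c * of_nat n / (of_nat n + 3) * (of_nat (Suc n) - 2 * of_nat p)"
  proof (cases "p + 2 \<le> n")
    case True
    then show ?thesis using main[OF Suc.prems(1)] by simp
  next
    case False
    \<comment> \<open>The last arc length follows from the first one by antisymmetry.\<close>
    then have p: "p = n - 1" "Suc n - p = 2" using Suc.prems Suc.hyps by auto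
    have "rho f (n - 1) 2 = - rho f 2 (n - 1)" using rho_swap[OF fc, of 2 "n - 1"] Suc.hyps by simp
    moreover have "Suc n - 2 = n - 1" by simp
    ultimately show ?thesis using main[of 2] Suc.hyps p n0 by (simp add: of_nat_diff field_simps)
  qed
  moreover have "c * of_nat n / (of_nat n + 3) = 210 * rho f 2 3 / ((of_nat n + 1) * (of_nat n + 2) * (of_nat n + 3))"
    using n0 by (simp add: c_def)
  moreover have "(of_nat (Suc n) :: rat) = of_nat n + 1" "(of_nat (Suc n) + 1 :: rat) = of_nat n + 2"
    "(of_nat (Suc n) + 2 :: rat) = of_nat n + 3" by simp_all
  ultimately show ?case by (simp only: times_divide_eq_left)
qed

text \<open>
  The cases with a short arc are not covered by \<open>rho_formula\<close>; these relations between them enter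
  the computation of \<open>\<rho>(2, 3)\<close>.
\<close>

lemma rho_small:
  shows "rho f 1 3 = rho f 1 2" "rho f 2 3 + 2 * rho f 1 4 - 2 * rho f 1 3 = 0"
proof -
  show "rho f 1 3 = rho f 1 2" using rho_cyclic[of 1 1 1] by (simp add: numeral_eq_Suc)
  have "rho f 2 2 = 0" using rho_swap[OF fc, of 2 2] by simp
  then show "rho f 2 3 + 2 * rho f 1 4 - 2 * rho f 1 3 = 0" using rho_cyclic[of 2 1 1] by (simp add: numeral_eq_Suc)
qed

end

section \<open>Spheres and links verified by computation\<close>

text \<open>
  Equality as multisets, in a form suited to evaluation by rewriting.
\<close>

fun same_entries :: "'a list \<Rightarrow> 'a list \<Rightarrow> bool" where
  "same_entries [] ys = (ys = [])"
| "same_entries (x # xs) ys = (List.member ys x \<and> same_entries xs (remove1 x ys))"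

lemma same_entries_mset: "same_entries xs ys \<Longrightarrow> mset xs = mset ys"
  by (induction xs arbitrary: ys) auto

text \<open>
  A bistellar move: the facets containing \<open>A\<close>, which must be \<open>A\<close> joined to the boundary of \<open>B\<close>, are
  replaced by the boundary of \<open>A\<close> joined to \<open>B\<close>. The new facets inherit position and sign from the
  one old facet that misses \<open>hd B\<close>. If \<open>B\<close> is a single new vertex, this is the stellar subdivision
  at \<open>A\<close>.
\<close>

definition flip_chain :: "nat list \<Rightarrow> nat list \<Rightarrow> ochain \<Rightarrow> ochain" where
  "flip_chain A B c = concat (map (\<lambda>(s, F).
     if list_all (\<lambda>a. List.member F a) A
     then (if List.member F (hd B) then [] else map (\<lambda>a. (s, map (\<lambda>v. if v = a then hd B else v) F)) A)
     else [(s, F)]) c)"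

definition faces_eq :: "ochain \<Rightarrow> ochain \<Rightarrow> bool" where
  "faces_eq c d \<longleftrightarrow> same_entries (map (\<lambda>p. sort (snd p)) c) (map (\<lambda>p. sort (snd p)) d)"

lemma faces_eqD: "faces_eq c d \<Longrightarrow> faces_of c = faces_of d"
proof -
  assume "faces_eq c d"
  then have "set (map (\<lambda>p. sort (snd p)) c) = set (map (\<lambda>p. sort (snd p)) d)"
    unfolding faces_eq_def by (intro mset_eq_setD same_entries_mset)
  then have "set ` set (map (\<lambda>p. sort (snd p)) c) = set ` set (map (\<lambda>p. sort (snd p)) d)" by simp
  then have e: "(\<lambda>p. set (snd p)) ` set c = (\<lambda>p. set (snd p)) ` set d" by (simp add: image_image)
  have f: "faces_of c = (\<Union>F\<in>(\<lambda>p. set (snd p)) ` set c. Pow F)" for c by (force simp: faces_of_def)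
  show ?thesis unfolding f[of c] f[of d] e ..
qed

text \<open>
  Instead of inspecting the link of \<open>A\<close>, compare the subdivisions of the two complexes at \<open>A\<close> and at
  \<open>B\<close> with a new vertex \<open>z\<close>: a bistellar move is a subdivision followed by the inverse of another
  one.
\<close>

definition flip_check :: "nat \<Rightarrow> nat list \<Rightarrow> nat list \<Rightarrow> ochain \<Rightarrow> ochain \<Rightarrow> bool" where
  "flip_check z A B c d \<longleftrightarrow> A \<noteq> [] \<and> B \<noteq> [] \<and>
     list_ex (\<lambda>p. list_all (\<lambda>a. List.member (snd p) a) A) c \<and>
     list_ex (\<lambda>p. list_all (\<lambda>a. List.member (snd p) a) B) d \<and>
     list_all (\<lambda>p. \<not> List.member (snd p) z) c \<and> list_all (\<lambda>p. \<not> List.member (snd p) z) d \<and>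
     faces_eq (star_chain A z c) (star_chain B z d)"

lemma flip_check_pl_sphere:
  assumes h: "flip_check z A B c d" and c: "pl_sphere n (faces_of c)"
  shows "pl_sphere n (faces_of d)"
proof -
  have ne: "set A \<noteq> {}" "set B \<noteq> {}" using h by (auto simp: flip_check_def)
  have z: "\<And>s F. (s, F) \<in> set c \<Longrightarrow> z \<notin> set F" "\<And>s F. (s, F) \<in> set d \<Longrightarrow> z \<notin> set F"
    using h by (fastforce simp: flip_check_def list_all_iff)+
  have A: "set A \<in> faces_of c" "set B \<in> faces_of d"
    using h by (fastforce simp: flip_check_def list_ex_iff list_all_iff faces_of_def)+
  have zU: "z \<notin> \<Union>(faces_of c)" "z \<notin> \<Union>(faces_of d)" using z unfolding Union_faces_of by blast+
  have "d \<noteq> []" using h by (auto simp: flip_check_def)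
  have "pl_sphere n (stellar (faces_of c) (set A) z)"
    using c pl_sphere_stellar_iff[OF _ A(1) ne(1) zU(1), of n] by (simp add: pl_sphere_def)
  also have "stellar (faces_of c) (set A) z = stellar (faces_of d) (set B) z"
  proof -
    have "faces_of (star_chain A z c) = faces_of (star_chain B z d)"
      using h by (intro faces_eqD) (simp add: flip_check_def)
    moreover have "faces_of (star_chain A z c) = stellar (faces_of c) (set A) z"
      by (rule faces_of_star_chain) (use z(1) ne(1) in auto)
    moreover have "faces_of (star_chain B z d) = stellar (faces_of d) (set B) z"
      by (rule faces_of_star_chain) (use z(2) ne(2) in auto)
    ultimately show ?thesis by simp
  qed
  finally show ?thesis
    using pl_sphere_stellar_iff[OF finite_complex_faces_of[OF \<open>d \<noteq> []\<close>] A(2) ne(2) zU(2), of n] by simp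
qed

fun moves_ok :: "nat \<Rightarrow> (nat list \<times> nat list) list \<Rightarrow> ochain \<Rightarrow> bool" where
  "moves_ok z [] c = True"
| "moves_ok z ((A, B) # ms) c = (flip_check z A B c (flip_chain A B c) \<and> moves_ok z ms (flip_chain A B c))"

fun apply_moves :: "(nat list \<times> nat list) list \<Rightarrow> ochain \<Rightarrow> ochain" where
  "apply_moves [] c = c"
| "apply_moves ((A, B) # ms) c = apply_moves ms (flip_chain A B c)"

lemma moves_ok_pl_sphere:
  "moves_ok z ms c \<Longrightarrow> pl_sphere n (faces_of c) \<Longrightarrow> pl_sphere n (faces_of (apply_moves ms c))"
  by (induction z ms c rule: moves_ok.induct) (auto intro: flip_check_pl_sphere)

definition ridges :: "ochain \<Rightarrow> ochain" where
  "ridges c = concat (map (\<lambda>p. concat (map (\<lambda>v. lk v [p]) (snd p))) c)"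

text \<open>
  Every ridge occurs exactly twice, with opposite signs.
\<close>

function paired :: "ochain \<Rightarrow> bool" where
  "paired [] = True"
| "paired ((s, r) # R) =
     (filter (\<lambda>p. snd p = r) R = [(- s, r)] \<and> paired (filter (\<lambda>p. snd p \<noteq> r) R))"
  by pat_completeness auto
termination by (relation "measure length") (auto simp: less_Suc_eq_le)

lemma paired_mset:
  "paired R \<Longrightarrow> (s, q) \<in> set R \<Longrightarrow> {#p \<in># mset R. snd p = q#} = {#(s, q), (- s, q)#}"
  unfolding mset_filter[symmetric]
proof (induction R rule: paired.induct)
  case (2 t r R)
  have h: "filter (\<lambda>p. snd p = r) R = [(- t, r)]" "paired (filter (\<lambda>p. snd p \<noteq> r) R)"
    using "2.prems"(1) by (simp_all only: paired.simps)
  show ?case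
  proof (cases "q = r")
    case True
    have e: "filter (\<lambda>p. snd p = r) ((t, r) # R) = [(t, r), (- t, r)]" by (simp add: h(1))
    have "(s, q) \<in> set (filter (\<lambda>p. snd p = r) ((t, r) # R))" using "2.prems"(2) True by auto
    then have "s = t \<or> s = - t" unfolding e by auto
    then show ?thesis unfolding True e by (auto simp: add_mset_commute)
  next
    case False
    have "(s, q) \<in> set (filter (\<lambda>p. snd p \<noteq> r) R)" using "2.prems"(2) False by auto
    from "2.IH"[OF h(2) this]
    have "mset (filter (\<lambda>p. snd p = q) (filter (\<lambda>p. snd p \<noteq> r) R)) = {#(s, q), (- s, q)#}" .
    moreover have "filter (\<lambda>p. snd p = q) (filter (\<lambda>p. snd p \<noteq> r) R) = filter (\<lambda>p. snd p = q) ((t, r) # R)"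
      using False by (auto intro!: filter_cong)
    ultimately show ?thesis by (simp only:)
  qed
qed simp

text \<open>
  A sufficient condition, on normal forms, for coherence and for the absence of a boundary.
\<close>

definition orient_check :: "nat \<Rightarrow> ochain \<Rightarrow> bool" where
  "orient_check n c \<longleftrightarrow> c \<noteq> [] \<and>
     list_all (\<lambda>(s, F). (s = 1 \<or> s = -1) \<and> length F = n \<and> distinct F) c \<and>
     distinct (map snd (nrm c)) \<and> paired (ridges (nrm c))"

lemma lk_single: "v \<in> set F \<Longrightarrow> lk v [(s, F)] = [(if even (length (takeWhile (\<lambda>w. w \<noteq> v) F)) then s else - s, remove1 v F)]"
  by (simp add: lk_def)

context
  fixes n :: nat and c :: ochain
  assumes ck: "orient_check n c"
begin

lemma checked_facet: "(s, F) \<in> set (nrm c) \<Longrightarrow> (s = 1 \<or> s = -1) \<and> length F = n \<and> distinct F \<and> sorted F"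
proof -
  assume "(s, F) \<in> set (nrm c)"
  then obtain t G where G: "(t, G) \<in> set c" "s = t * psign G" "F = sort G" by (auto simp: nrm_def)
  have "t = 1 \<or> t = -1" "length G = n" "distinct G" using ck G(1) by (auto simp: orient_check_def list_all_iff)
  then show ?thesis using G psign_cases[of G] by auto
qed

lemma checked_distinct: "(s, F) \<in> set c \<Longrightarrow> distinct F"
  using ck by (auto simp: orient_check_def list_all_iff)

lemma checked_orient: "orient_of c = orient_of (nrm c)" "faces_of c = faces_of (nrm c)"
  using orient_of_nrm[of c] checked_distinct faces_of_nrm[of c] by auto

lemma checked_unique: "(s, F) \<in> set (nrm c) \<Longrightarrow> (t, G) \<in> set (nrm c) \<Longrightarrow> set F = set G \<Longrightarrow> F = G \<and> s = t"
proof -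
  assume a: "(s, F) \<in> set (nrm c)" "(t, G) \<in> set (nrm c)" "set F = set G"
  have "F = G" using checked_facet[OF a(1)] checked_facet[OF a(2)] a(3) by (simp add: sorted_distinct_set_unique)
  moreover
  have "distinct (map snd (nrm c))" using ck by (simp add: orient_check_def)
  then have "inj_on snd (set (nrm c))" by (simp add: distinct_map)
  then have "(s, F) = (t, G)" if "F = G" using a(1,2) that inj_onD[of snd "set (nrm c)" "(s, F)" "(t, G)"] by simp
  ultimately show ?thesis by simp
qed

lemma checked_value:
  assumes F: "(s, F) \<in> set (nrm c)" "set xs = set F"
  shows "orient_of c xs = s * cell F xs"
proof -
  have d: "distinct (nrm c)" using ck by (auto simp: orient_check_def distinct_map)
  have "orient_of c xs = (\<Sum>p\<leftarrow>nrm c. fst p * cell (snd p) xs)"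
    unfolding checked_orient orient_of_def case_prod_unfold ..
  also have "\<dots> = (\<Sum>p\<in>set (nrm c). fst p * cell (snd p) xs)" using d by (simp add: sum_list_distinct_conv_sum_set)
  also have "\<dots> = (\<Sum>p\<in>{(s, F)}. fst p * cell (snd p) xs)"
  proof (rule sum.mono_neutral_right)
    show "{(s, F)} \<subseteq> set (nrm c)" using F by simp
    show "\<forall>i\<in>set (nrm c) - {(s, F)}. fst i * cell (snd i) xs = 0"
    proof
      fix i assume i: "i \<in> set (nrm c) - {(s, F)}"
      obtain t G where p: "i = (t, G)" by (cases i)
      have "set xs \<noteq> set G" using checked_unique[of s F t G] F i p by auto
      then show "fst i * cell (snd i) xs = 0" by (simp add: p cell_def)
    qed
  qed simp
  finally show ?thesis by simp
qed

lemma checked_zero: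
  assumes "\<And>s F. (s, F) \<in> set (nrm c) \<Longrightarrow> set xs \<noteq> set F"
  shows "orient_of c xs = 0"
proof -
  have "(\<Sum>p\<leftarrow>cs. fst p * cell (snd p) xs) = 0" if "\<And>s F. (s, F) \<in> set cs \<Longrightarrow> set xs \<noteq> set F" for cs
    using that
  proof (induction cs)
    case (Cons p cs)
    obtain s F where p: "p = (s, F)" by (cases p)
    then have "set xs \<noteq> set F" using Cons.prems[of s F] by simp
    moreover have pr: "\<And>s F. (s, F) \<in> set cs \<Longrightarrow> set xs \<noteq> set F" using Cons.prems by (meson list.set_intros(2))
    then have "(\<Sum>p\<leftarrow>cs. fst p * cell (snd p) xs) = 0" by (rule Cons.IH)
    ultimately show ?case by (simp add: p cell_eq_0)
  qed simp
  from this[OF assms] show ?thesis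
    unfolding checked_orient orient_of_def case_prod_unfold .
qed

lemma checked_nonzero_iff:
  "orient_of c xs \<noteq> 0 \<longleftrightarrow> length xs = n \<and> distinct xs \<and> set xs \<in> faces_of c"
proof
  assume nz: "orient_of c xs \<noteq> 0"
  then obtain s F where F: "(s, F) \<in> set (nrm c)" "set xs = set F" using checked_zero[of xs] by blast
  with nz checked_value[OF F] have d: "distinct xs" by (auto simp: cell_def split: if_splits)
  then have "length xs = n" using checked_facet[OF F(1)] F(2) by (metis distinct_card)
  moreover have "set xs \<in> faces_of c" using F checked_orient(2) by (auto simp: faces_of_iff)
  ultimately show "length xs = n \<and> distinct xs \<and> set xs \<in> faces_of c" using d by simp
next
  assume a: "length xs = n \<and> distinct xs \<and> set xs \<in> faces_of c"
  then obtain s F where F: "(s, F) \<in> set (nrm c)" "set xs \<subseteq> set F" unfolding checked_orient(2) by (auto simp: faces_of_iff)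
  note f = checked_facet[OF F(1)]
  have "card (set xs) = card (set F)" using a f by (simp add: distinct_card)
  then have e: "set xs = set F" using F(2) by (simp add: card_subset_eq)
  show "orient_of c xs \<noteq> 0"
    using checked_value[OF F(1) e] a f e psign_cases[of F] psign_cases[of xs] by (auto simp: cell_def)
qed

lemma checked_values: "orient_of c xs \<in> {-1, 0, 1}"
proof (cases "\<exists>s F. (s, F) \<in> set (nrm c) \<and> set xs = set F")
  case True
  then obtain s F where F: "(s, F) \<in> set (nrm c)" "set xs = set F" by blast
  then show ?thesis
    using checked_value[OF F] checked_facet[OF F(1)] psign_cases[of F] psign_cases[of xs] by (auto simp: cell_def)
next
  case False
  then have "orient_of c xs = 0" by (intro checked_zero) blast
  then show ?thesis by simp
qed

lemma checked_ridge:
  assumes F: "(s, F) \<in> set (nrm c)" and a: "a \<in> set F" and xs: "distinct xs" "set xs = set F - {a}"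
  shows "\<exists>u. (u, remove1 a F) \<in> set (lk a [(s, F)]) \<and> orient_of c (a # xs) = u * cell (remove1 a F) xs"
proof -
  note f = checked_facet[OF F]
  have "set (a # xs) = set F" using a xs by auto
  from checked_value[OF F this] cell_link[of F a xs] f a show ?thesis
    by (auto simp: lk_single)
qed

lemma checked_ridge_mem: "p \<in> set (nrm c) \<Longrightarrow> a \<in> set (snd p) \<Longrightarrow> e \<in> set (lk a [p]) \<Longrightarrow> e \<in> set (ridges (nrm c))"
  unfolding ridges_def by auto

lemma paired_ridges: "paired (ridges (nrm c))"
  using ck by (simp add: orient_check_def)

lemma lk_single_sub: "p \<in> set (nrm c) \<Longrightarrow> a \<in> set (snd p) \<Longrightarrow> mset (lk a [p]) \<subseteq># mset (concat (map (\<lambda>v. lk v [p]) (snd p)))"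
proof -
  assume "a \<in> set (snd p)"
  then obtain F1 F2 where "snd p = F1 @ a # F2" by (meson split_list)
  then show ?thesis by simp
qed

lemma two_of_ridges:
  assumes p: "p \<in> set (nrm c)" "q \<in> set (nrm c)" "p \<noteq> q" and a: "a \<in> set (snd p)" "b \<in> set (snd q)"
  shows "mset (lk a [p]) + mset (lk b [q]) \<subseteq># mset (ridges (nrm c))"
proof -
  define h where "h p = mset (concat (map (\<lambda>v. lk v [p]) (snd p)))" for p
  have m: "mset (ridges cs) = (\<Sum>p\<in>#mset cs. h p)" for cs
    by (induction cs) (simp_all add: ridges_def h_def)
  obtain M where M: "mset (nrm c) = add_mset p (add_mset q M)"
  proof -
    obtain M where M: "mset (nrm c) = add_mset p M" using p(1) by (metis mset_add set_mset_mset)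
    have "q \<in># mset (nrm c)" using p(2) by simp
    then have "q \<in># M" using p(3) unfolding M by auto
    then obtain M' where "M = add_mset q M'" by (metis mset_add)
    then show thesis using that M by simp
  qed
  have e: "mset (ridges (nrm c)) = (h p + h q) + (\<Sum>p\<in>#M. h p)"
    unfolding m M by (simp add: add.assoc)
  have "mset (lk a [p]) + mset (lk b [q]) \<subseteq># h p + h q"
    unfolding h_def by (rule subset_mset.add_mono[OF lk_single_sub[OF p(1) a(1)] lk_single_sub[OF p(2) a(2)]])
  then show ?thesis unfolding e by (rule subset_mset.order_trans) (rule mset_subset_eq_add_left)
qed

lemma checked_coherent:
  assumes ab: "a \<noteq> b" and nz: "orient_of c (a # xs) \<noteq> 0" "orient_of c (b # xs) \<noteq> 0"
  shows "orient_of c (b # xs) = - orient_of c (a # xs)"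
proof -
  have dd: "distinct (a # xs)" "distinct (b # xs)" using nz unfolding checked_nonzero_iff by auto
  obtain s F where F: "(s, F) \<in> set (nrm c)" "set (a # xs) = set F" using checked_zero nz(1) by blast
  obtain t G where G: "(t, G) \<in> set (nrm c)" "set (b # xs) = set G" using checked_zero nz(2) by blast
  have aF: "a \<in> set F" "set xs = set F - {a}" and bG: "b \<in> set G" "set xs = set G - {b}"
    using F(2) G(2) dd by auto
  obtain u where u: "(u, remove1 a F) \<in> set (lk a [(s, F)])" "orient_of c (a # xs) = u * cell (remove1 a F) xs"
    using checked_ridge[OF F(1) aF(1) _ aF(2)] dd by auto
  obtain w where w: "(w, remove1 b G) \<in> set (lk b [(t, G)])" "orient_of c (b # xs) = w * cell (remove1 b G) xs"
    using checked_ridge[OF G(1) bG(1) _ bG(2)] dd by auto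
  have r: "remove1 a F = remove1 b G"
    using checked_facet[OF F(1)] checked_facet[OF G(1)] aF bG
    by (intro sorted_distinct_set_unique) (auto simp: sorted_remove1)
  have ne: "(s, F) \<noteq> (t, G)"
  proof
    assume "(s, F) = (t, G)"
    then have "set (a # xs) = set (b # xs)" using F(2) G(2) by simp
    then show False using dd ab by auto
  qed
  let ?q = "remove1 a F"
  have l: "lk a [(s, F)] = [(u, ?q)]" "lk b [(t, G)] = [(w, ?q)]" using u(1) w(1) aF(1) bG(1) r by (auto simp: lk_single)
  have "{#(u, ?q), (w, ?q)#} \<subseteq># mset (ridges (nrm c))"
    using two_of_ridges[OF F(1) G(1) ne, of a b] aF(1) bG(1) unfolding l by (simp add: add_mset_commute)
  then have "{#p \<in># {#(u, ?q), (w, ?q)#}. snd p = ?q#} \<subseteq># {#p \<in># mset (ridges (nrm c)). snd p = ?q#}"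
    by (rule multiset_filter_mono)
  moreover have "(u, ?q) \<in> set (ridges (nrm c))" using checked_ridge_mem[OF F(1), of a "(u, ?q)"] aF(1) u(1) by simp
  ultimately have "{#(u, ?q), (w, ?q)#} \<subseteq># {#(u, ?q), (- u, ?q)#}"
    using paired_mset[OF paired_ridges, of u ?q] by simp
  then have "w = - u" by (simp add: insert_subset_eq_iff)
  then show ?thesis using u(2) w(2) r by simp
qed

lemma orientation_checked: "orientation n (faces_of c) (orient_of c)"
  unfolding orientation_def
proof (intro conjI allI impI)
  show "orient_of c xs \<in> {- 1, 0, 1}" for xs by (rule checked_values)
  show "(orient_of c xs \<noteq> 0) = (length xs = n \<and> distinct xs \<and> set xs \<in> faces_of c)" for xs by (rule checked_nonzero_iff)
  show "orient_of c (xs @ a # b # ys) = - orient_of c (xs @ b # a # ys)" for xs a b ys by (rule orient_of_swap)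
qed (rule checked_coherent)

lemma ridge_opposite:
  assumes "orient_of c (a # xs) \<noteq> 0"
  shows "\<exists>b. b \<noteq> a \<and> orient_of c (b # xs) \<noteq> 0"
proof -
  have d: "distinct (a # xs)" using assms unfolding checked_nonzero_iff by auto
  obtain s F where F: "(s, F) \<in> set (nrm c)" "set (a # xs) = set F" using checked_zero assms by blast
  have aF: "a \<in> set F" "set xs = set F - {a}" using F(2) d by auto
  obtain u where u: "(u, remove1 a F) \<in> set (lk a [(s, F)])" using checked_ridge[OF F(1) aF(1) _ aF(2)] d by auto
  let ?q = "remove1 a F"
  have "(u, ?q) \<in> set (ridges (nrm c))" using checked_ridge_mem[OF F(1), of a "(u, ?q)"] aF(1) u by simp
  from paired_mset[OF paired_ridges this]
  have "(- u, ?q) \<in># {#p \<in># mset (ridges (nrm c)). snd p = ?q#}" by simp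
  then have "(- u, ?q) \<in> set (ridges (nrm c))" by simp
  then obtain t G b where G: "(t, G) \<in> set (nrm c)" "b \<in> set G" "(- u, ?q) \<in> set (lk b [(t, G)])"
    unfolding ridges_def by auto
  then have r: "?q = remove1 b G" by (auto simp: lk_single)
  note f = checked_facet[OF F(1)] and g = checked_facet[OF G(1)]
  have xs: "set xs = set G - {b}" using aF(2) r f g by (metis set_remove1_eq)
  have "b \<noteq> a"
  proof
    assume "b = a"
    then have "set F = set G" using aF xs G(2) by auto
    then have "F = G \<and> s = t" using checked_unique[OF F(1) G(1)] by simp
    then have "lk b [(t, G)] = lk a [(s, F)]" using \<open>b = a\<close> by simp
    then have "u = - u" using u G(3) aF(1) by (auto simp: lk_single)
    moreover have "u \<noteq> 0" using u f aF(1) by (auto simp: lk_single split: if_splits)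
    ultimately show False by simp
  qed
  moreover have "orient_of c (b # xs) \<noteq> 0"
    unfolding checked_nonzero_iff
  proof (intro conjI)
    have "set (b # xs) = set G" using xs G(2) by auto
    then show "set (b # xs) \<in> faces_of c" using G(1) unfolding checked_orient(2) by (auto simp: faces_of_iff)
    show "distinct (b # xs)" using d xs by auto
    have "length (a # xs) = n" using assms unfolding checked_nonzero_iff by blast
    then show "length (b # xs) = n" by simp
  qed
  ultimately show ?thesis by blast
qed

lemma wf_checked: "wf_chain n c"
  using ck by (auto simp: orient_check_def wf_chain_def list_all_iff)

end

definition iso_check :: "(nat \<times> nat) list \<Rightarrow> bool \<Rightarrow> ochain \<Rightarrow> ochain \<Rightarrow> bool" where
  "iso_check m s c d \<longleftrightarrow> distinct (map fst m) \<and> distinct (map snd m) \<and>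
     list_all (\<lambda>p. distinct (snd p) \<and> list_all (\<lambda>v. List.member (map fst m) v) (snd p)) c \<and>
     list_all (\<lambda>p. distinct (snd p)) d \<and>
     same_entries (nrm (map_chain (\<lambda>v. the (map_of m v)) c)) (nrm (if s then d else neg_chain d))"

lemma iso_check_eqv:
  assumes "iso_check m s c d"
  shows "inj_on (\<lambda>v. the (map_of m v)) (\<Union>(faces_of c))"
    "eqv (map_chain (\<lambda>v. the (map_of m v)) c) (if s then d else neg_chain d)"
proof -
  let ?g = "\<lambda>v. the (map_of m v)"
  have dm: "distinct (map fst m)" "distinct (map snd m)" using assms by (auto simp: iso_check_def)
  have c: "\<And>s F. (s, F) \<in> set c \<Longrightarrow> distinct F \<and> set F \<subseteq> set (map fst m)"
    using assms by (fastforce simp: iso_check_def list_all_iff)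
  have d: "\<And>s F. (s, F) \<in> set d \<Longrightarrow> distinct F"
    using assms by (fastforce simp: iso_check_def list_all_iff)
  have val: "map_of m v = Some w \<longleftrightarrow> (v, w) \<in> set m" for v w using dm(1) by simp
  have inj: "inj_on ?g (set (map fst m))"
  proof (rule inj_onI)
    fix x y assume x: "x \<in> set (map fst m)" "y \<in> set (map fst m)" "?g x = ?g y"
    obtain u w where uw: "(x, u) \<in> set m" "(y, w) \<in> set m" using x(1,2) by auto
    then have "u = w" using x(3) val[of x u] val[of y w] by simp
    then have "(x, u) = (y, w)" using uw dm(2) inj_onD[of snd "set m" "(x, u)" "(y, w)"] by (simp add: distinct_map)
    then show "x = y" by simp
  qed
  have U: "\<Union>(faces_of c) \<subseteq> set (map fst m)" unfolding Union_faces_of using c by auto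
  show "inj_on ?g (\<Union>(faces_of c))" by (rule inj_on_subset[OF inj U])
  show "eqv (map_chain ?g c) (if s then d else neg_chain d)"
  proof (rule eqvI)
    show "mset (nrm (map_chain ?g c)) = mset (nrm (if s then d else neg_chain d))"
      using assms by (intro same_entries_mset) (simp add: iso_check_def)
    show "distinct F" if tF: "(t, F) \<in> set (map_chain ?g c)" for t F
    proof -
      obtain G where G: "(t, G) \<in> set c" "F = map ?g G" using tF by (auto simp: map_chain_def)
      then show ?thesis using c[OF G(1)] inj by (auto simp: distinct_map intro: inj_on_subset)
    qed
    show "distinct F" if "(t, F) \<in> set (if s then d else neg_chain d)" for t F
      using that d by (auto simp: neg_chain_def split: if_splits)
  qed
qed

lemma val_iso_check:
  fixes f :: "ocomplex \<Rightarrow> rat"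
  assumes f: "f \<in> local_cochains n" and c: "iso_check m s c d"
  shows "val f c = (if s then 1 else -1) * val f d"
  using val_map_chain[OF f iso_check_eqv(1)[OF c]] val_eqv[OF iso_check_eqv(2)[OF c], of f] val_neg_chain[OF f, of d]
  by auto

text \<open>
  A vertex of the sphere, the known value of its link (\<open>None\<close>: the link is reversible; otherwise the
  position of an isomorphic complex in a list, and the sign), and the isomorphism that shows it.
\<close>

type_synonym entry = "nat \<times> (nat \<times> bool) option \<times> (nat \<times> nat) list"

definition entry_ok :: "ochain list \<Rightarrow> ochain \<Rightarrow> entry \<Rightarrow> bool" where
  "entry_ok reps c e = (case e of (v, k, m) \<Rightarrow> (case k of
     None \<Rightarrow> iso_check m False (lk v c) (lk v c) | Some (j, s) \<Rightarrow> iso_check m s (lk v c) (reps ! j)))"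

definition entry_val :: "(ocomplex \<Rightarrow> rat) \<Rightarrow> ochain list \<Rightarrow> entry \<Rightarrow> rat" where
  "entry_val f reps e = (case e of (v, k, m) \<Rightarrow> (case k of
     None \<Rightarrow> 0 | Some (j, s) \<Rightarrow> (if s then 1 else -1) * val f (reps ! j)))"

lemma entry_val:
  assumes f: "f \<in> local_cochains n" and e: "entry_ok reps c e"
  shows "val f (lk (fst e) c) = entry_val f reps e"
proof -
  obtain v k m where p: "e = (v, k, m)" by (cases e)
  show ?thesis
  proof (cases k)
    case None
    then have "iso_check m False (lk v c) (lk v c)" using e by (simp add: entry_ok_def p)
    from val_iso_check[OF f this] show ?thesis by (simp add: entry_val_def p None)
  next
    case (Some a)
    obtain j s where a: "a = (j, s)" by (cases a)
    then have "iso_check m s (lk v c) (reps ! j)" using e by (simp add: entry_ok_def p Some)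
    from val_iso_check[OF f this] show ?thesis by (simp add: entry_val_def p Some a)
  qed
qed

definition links_ok :: "ochain list \<Rightarrow> entry list \<Rightarrow> ochain \<Rightarrow> bool" where
  "links_ok reps es c \<longleftrightarrow> distinct (map fst es) \<and>
     list_all (\<lambda>p. list_all (\<lambda>v. List.member (map fst es) v) (snd p)) c \<and> list_all (entry_ok reps c) es"

definition sphere_ok :: "nat \<Rightarrow> nat \<Rightarrow> nat list \<Rightarrow> (nat list \<times> nat list) list \<Rightarrow> bool" where
  "sphere_ok n z V ms \<longleftrightarrow> distinct V \<and> length V = Suc n \<and> moves_ok z ms (simplex_boundary V) \<and>
     orient_check n (apply_moves ms (simplex_boundary V))"

definition moved :: "nat list \<Rightarrow> (nat list \<times> nat list) list \<Rightarrow> ochain" where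
  "moved V ms = apply_moves ms (simplex_boundary V)"

lemma sph_moved:
  assumes "sphere_ok n z V ms" "1 \<le> n" shows "sph n (moved V ms)"
proof -
  have V: "distinct V" "length V = Suc n" "moves_ok z ms (simplex_boundary V)" "orient_check n (moved V ms)"
    using assms(1) by (auto simp: sphere_ok_def moved_def)
  have "pl_sphere n (faces_of (simplex_boundary V))" using sph_simplex_boundary[OF V(1,2) assms(2)] by (simp add: sph_def oriented_sphere_def)
  from moves_ok_pl_sphere[OF V(3) this]
  have "pl_sphere n (faces_of (moved V ms))" by (simp add: moved_def)
  then show ?thesis using wf_checked[OF V(4)] orientation_checked[OF V(4)] by (simp add: sph_def oriented_sphere_def)
qed

lemma checked_relation:
  assumes f: "f \<in> local_formulae n" and s: "sphere_ok (Suc n) z V ms" and l: "links_ok reps es (moved V ms)"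
  shows "(\<Sum>e\<leftarrow>es. entry_val f reps e) = 0"
proof -
  have fc: "f \<in> local_cochains n" using f by (simp add: local_formulae_def)
  let ?c = "moved V ms"
  have c: "sph (Suc n) ?c" by (rule sph_moved[OF s]) simp
  have d: "distinct (map fst es)" using l by (simp add: links_ok_def)
  have "\<Union>(faces_of ?c) \<subseteq> set (map fst es)"
    unfolding Union_faces_of using l by (fastforce simp: links_ok_def list_all_iff)
  from local_formula_relation_over[OF f c _ this]
  have "(\<Sum>v\<in>set (map fst es). val f (lk v ?c)) = 0" by simp
  also have "(\<Sum>v\<in>set (map fst es). val f (lk v ?c)) = (\<Sum>v\<leftarrow>map fst es. val f (lk v ?c))"
    using sum_list_distinct_conv_sum_set[OF d, of "\<lambda>v. val f (lk v ?c)"] by simp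
  also have "\<dots> = (\<Sum>e\<leftarrow>es. entry_val f reps e)"
  proof -
    have "val f (lk (fst e) ?c) = entry_val f reps e" if "e \<in> set es" for e
      using entry_val[OF fc, of reps ?c e] l that by (simp add: links_ok_def list_all_iff)
    then have "map (\<lambda>e. val f (lk (fst e) ?c)) es = map (entry_val f reps) es" by simp
    then show ?thesis by (simp only: map_map comp_def)
  qed
  finally show ?thesis .
qed

section \<open>Relations from explicit 4-spheres\<close>

text \<open>
  Each of the first four spheres is the join of the boundaries of a triangle and a tetrahedron,
  subdivided four times. The relation of \<open>sphere_C\<close> minus those of the other three is
  \<open>3 \<rho>(2, 3) - \<rho>(1, 4) - f (lk 10 sphere_A) = 0\<close>; all other links cancel.
\<close>

definition sphere_A :: ochain where
  "sphere_A = moved [0, 1, 2, 7, 8, 9]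
    [([0, 1, 2], [10]), ([1, 2, 9, 10], [3]), ([1, 2, 10], [4]), ([2, 4, 10], [5]), ([5, 7, 10], [6])]"

lemma certificate_A:
  fixes f :: "ocomplex \<Rightarrow> rat"
  assumes f: "f \<in> local_formulae 4"
  shows "1 * val f (two_arcs [7] [8, 9, 10, 11]) + 1 * val f (lk 3 sphere_A) + 1 * val f (lk 7 sphere_A)
    + 1 * val f (lk 10 sphere_A) = 0"
proof -
  let ?es = "[(0, None, [(1, 1), (2, 2), (7, 7), (8, 9), (9, 8), (10, 10)]),
    (1, None, [(0, 0), (2, 2), (3, 3), (4, 4), (7, 8), (8, 7), (9, 9), (10, 10)]),
    (2, Some (0, True), [(0, 5), (1, 9), (3, 2), (4, 10), (5, 11), (6, 4), (7, 0), (8, 1), (9, 8), (10, 7)]),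
    (3, Some (1, True), [(1, 1), (2, 2), (4, 4), (5, 5), (6, 6), (7, 7), (8, 8), (9, 9), (10, 10)]),
    (4, None, [(1, 1), (2, 2), (3, 8), (5, 5), (6, 6), (7, 7), (8, 3), (10, 10)]),
    (5, None, [(2, 2), (3, 8), (4, 4), (6, 6), (7, 7), (8, 3), (10, 10)]),
    (6, None, [(2, 2), (3, 3), (4, 4), (5, 7), (7, 5), (8, 8), (10, 10)]),
    (7, Some (2, True), [(0, 0), (1, 1), (2, 2), (3, 3), (4, 4), (5, 5), (6, 6), (8, 8), (9, 9), (10, 10)]),
    (8, None, [(0, 6), (1, 4), (2, 2), (3, 3), (4, 1), (5, 9), (6, 0), (7, 7), (9, 5), (10, 10)]),
    (9, None, [(0, 0), (1, 1), (2, 2), (3, 3), (7, 8), (8, 7), (10, 10)]),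
    (10, Some (3, True), [(0, 0), (1, 1), (2, 2), (3, 3), (4, 4), (5, 5), (6, 6), (7, 7), (8, 8),
      (9, 9)])] :: entry list"
  let ?reps = "[two_arcs [7] [8, 9, 10, 11], lk 3 sphere_A, lk 7 sphere_A, lk 10 sphere_A]"
  have s: "sphere_ok (Suc 4) 60 [0, 1, 2, 7, 8, 9]
    [([0, 1, 2], [10]), ([1, 2, 9, 10], [3]), ([1, 2, 10], [4]), ([2, 4, 10], [5]), ([5, 7, 10], [6])]"
    by code_simp
  have l: "links_ok ?reps ?es sphere_A"
    by code_simp
  show ?thesis
    using checked_relation[OF f s l[unfolded sphere_A_def]] unfolding sphere_A_def[symmetric]
    by (simp add: entry_val_def)
qed

definition sphere_B :: ochain where
  "sphere_B = moved [0, 1, 2, 7, 8, 9]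
    [([0, 1, 2], [10]), ([8, 9, 10], [3]), ([3, 9, 10], [4]), ([0, 7, 8, 9], [5]), ([0, 2, 3, 4, 9], [6])]"

lemma certificate_B:
  fixes f :: "ocomplex \<Rightarrow> rat"
  assumes f: "f \<in> local_formulae 4"
  shows "(-1) * val f (two_arcs [7, 8] [9, 10, 11]) + 1 * val f (lk 0 sphere_B) + 1 * val f (lk 1
    sphere_B) = 0"
proof -
  let ?es = "[(0, Some (1, True), [(1, 1), (2, 2), (3, 3), (4, 4), (5, 5), (6, 6), (7, 7), (8, 8), (9, 9),
    (10, 10)]),
    (1, Some (2, True), [(0, 0), (2, 2), (3, 3), (4, 4), (5, 5), (7, 7), (8, 8), (9, 9), (10, 10)]),
    (2, None, [(0, 0), (1, 1), (3, 8), (4, 7), (5, 6), (6, 5), (7, 4), (8, 3), (9, 9), (10, 10)]),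
    (3, None, [(0, 0), (1, 1), (2, 2), (4, 9), (6, 6), (8, 10), (9, 4), (10, 8)]),
    (4, None, [(0, 0), (1, 1), (2, 2), (3, 9), (6, 6), (9, 3), (10, 10)]),
    (5, None, [(0, 0), (1, 1), (2, 2), (7, 7), (8, 9), (9, 8)]),
    (6, None, [(0, 0), (2, 2), (3, 3), (4, 9), (9, 4)]),
    (7, None, [(0, 0), (1, 1), (2, 2), (5, 5), (8, 9), (9, 8), (10, 10)]),
    (8, None, [(0, 0), (1, 1), (2, 2), (3, 10), (5, 5), (7, 9), (9, 7), (10, 3)]),
    (9, Some (0, False), [(0, 0), (1, 2), (2, 1), (3, 8), (4, 9), (5, 4), (6, 5), (7, 11), (8, 7), (10, 10)]),
    (10, None, [(0, 0), (1, 1), (2, 2), (3, 7), (4, 9), (7, 3), (8, 8), (9, 4)])] :: entry list"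
  let ?reps = "[two_arcs [7, 8] [9, 10, 11], lk 0 sphere_B, lk 1 sphere_B]"
  have s: "sphere_ok (Suc 4) 60 [0, 1, 2, 7, 8, 9]
    [([0, 1, 2], [10]), ([8, 9, 10], [3]), ([3, 9, 10], [4]), ([0, 7, 8, 9], [5]), ([0, 2, 3, 4, 9], [6])]"
    by code_simp
  have l: "links_ok ?reps ?es sphere_B"
    by code_simp
  show ?thesis
    using checked_relation[OF f s l[unfolded sphere_B_def]] unfolding sphere_B_def[symmetric]
    by (simp add: entry_val_def)
qed

definition sphere_C :: ochain where
  "sphere_C = moved [0, 1, 2, 7, 8, 9]
    [([0, 1, 2], [10]), ([0, 1, 7, 9, 10], [3]), ([7, 9, 10], [4]), ([0, 3, 4, 7, 10], [5]),
      ([1, 8, 10], [6])]"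

lemma certificate_C:
  fixes f :: "ocomplex \<Rightarrow> rat"
  assumes f: "f \<in> local_formulae 4"
  shows "1 * val f (two_arcs [7, 8] [9, 10, 11]) + 1 * val f (lk 3 sphere_A) + 1 * val f (lk 0 sphere_B)
    + 1 * val f (lk 7 sphere_C) = 0"
proof -
  let ?es = "[(0, Some (0, True), [(1, 7), (2, 10), (3, 8), (4, 9), (5, 5), (6, 4), (7, 1), (8, 11),
    (9, 2), (10, 0)]),
    (1, None, [(0, 0), (2, 2), (3, 3), (4, 4), (6, 6), (7, 9), (8, 8), (9, 7), (10, 10)]),
    (2, None, [(0, 0), (1, 1), (4, 4), (6, 6), (7, 9), (8, 8), (9, 7), (10, 10)]),
    (3, None, [(0, 0), (1, 1), (4, 4), (5, 5), (7, 10), (9, 9), (10, 7)]),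
    (4, None, [(0, 3), (1, 2), (2, 1), (3, 0), (5, 5), (7, 7), (9, 9), (10, 10)]),
    (5, None, [(0, 0), (3, 3), (4, 4), (7, 10), (10, 7)]),
    (6, None, [(0, 7), (1, 1), (2, 9), (7, 0), (8, 8), (9, 2), (10, 10)]),
    (7, Some (3, True), [(0, 0), (1, 1), (2, 2), (3, 3), (4, 4), (5, 5), (6, 6), (8, 8), (9, 9), (10, 10)]),
    (8, None, [(0, 0), (1, 1), (2, 2), (6, 6), (7, 9), (9, 7), (10, 10)]),
    (9, Some (1, True), [(0, 2), (1, 10), (2, 4), (3, 9), (4, 1), (6, 6), (7, 8), (8, 5), (10, 7)]),
    (10, Some (2, True), [(0, 9), (1, 10), (2, 8), (3, 4), (4, 3), (5, 6), (6, 7), (7, 2), (8, 5),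
      (9, 1)])] :: entry list"
  let ?reps = "[two_arcs [7, 8] [9, 10, 11], lk 3 sphere_A, lk 0 sphere_B, lk 7 sphere_C]"
  have s: "sphere_ok (Suc 4) 60 [0, 1, 2, 7, 8, 9]
    [([0, 1, 2], [10]), ([0, 1, 7, 9, 10], [3]), ([7, 9, 10], [4]), ([0, 3, 4, 7, 10], [5]),
      ([1, 8, 10], [6])]"
    by code_simp
  have l: "links_ok ?reps ?es sphere_C"
    by code_simp
  show ?thesis
    using checked_relation[OF f s l[unfolded sphere_C_def]] unfolding sphere_C_def[symmetric]
    by (simp add: entry_val_def)
qed

definition sphere_D :: ochain where
  "sphere_D = moved [0, 1, 2, 7, 8, 9]
    [([0, 1, 2], [10]), ([8, 9], [3]), ([7, 8, 10], [4]), ([1, 4, 7, 8], [5]), ([1, 2, 9, 10], [6])]"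

lemma certificate_D:
  fixes f :: "ocomplex \<Rightarrow> rat"
  assumes f: "f \<in> local_formulae 4"
  shows "(-1) * val f (two_arcs [7, 8] [9, 10, 11]) + (-1) * val f (lk 7 sphere_A) + (-1) * val f (lk 1
    sphere_B) + 1 * val f (lk 7 sphere_C) = 0"
proof -
  let ?es = "[(0, Some (2, False), [(1, 0), (2, 2), (3, 3), (4, 7), (5, 5), (7, 9), (8, 8), (9, 4),
    (10, 10)]),
    (1, Some (1, False), [(0, 3), (2, 8), (3, 1), (4, 6), (5, 5), (6, 0), (7, 2), (8, 4), (9, 9), (10, 10)]),
    (2, Some (3, True), [(0, 9), (1, 10), (3, 2), (4, 3), (5, 5), (6, 6), (7, 0), (8, 4), (9, 8), (10, 1)]),
    (3, None, [(0, 0), (1, 2), (2, 1), (6, 6), (7, 7), (8, 8), (9, 9), (10, 10)]),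
    (4, None, [(0, 0), (1, 1), (2, 2), (5, 5), (7, 8), (8, 7), (10, 10)]),
    (5, None, [(0, 0), (1, 1), (2, 2), (4, 4), (7, 8), (8, 7)]),
    (6, None, [(1, 1), (2, 9), (3, 3), (7, 7), (9, 2), (10, 10)]),
    (7, Some (0, False), [(0, 2), (1, 0), (2, 1), (3, 10), (4, 7), (5, 4), (6, 5), (8, 11), (9, 9), (10, 8)]),
    (8, None, [(0, 2), (1, 1), (2, 0), (3, 3), (4, 4), (5, 5), (7, 7), (10, 10)]),
    (9, None, [(0, 0), (1, 1), (2, 2), (3, 7), (6, 6), (7, 3), (10, 10)]),
    (10, None, [(0, 0), (1, 2), (2, 1), (3, 3), (4, 4), (6, 6), (7, 7), (8, 8), (9, 9)])] :: entry list"
  let ?reps = "[two_arcs [7, 8] [9, 10, 11], lk 7 sphere_A, lk 1 sphere_B, lk 7 sphere_C]"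
  have s: "sphere_ok (Suc 4) 60 [0, 1, 2, 7, 8, 9]
    [([0, 1, 2], [10]), ([8, 9], [3]), ([7, 8, 10], [4]), ([1, 4, 7, 8], [5]), ([1, 2, 9, 10], [6])]"
    by code_simp
  have l: "links_ok ?reps ?es sphere_D"
    by code_simp
  show ?thesis
    using checked_relation[OF f s l[unfolded sphere_D_def]] unfolding sphere_D_def[symmetric]
    by (simp add: entry_val_def)
qed

text \<open>
  This sphere and the following ones have nine vertices. They connect \<open>lk 10 sphere_A\<close>, through
  links with at most eight vertices, to the vertex link of the projective plane.
\<close>

definition sphere_E :: ochain where
  "sphere_E = moved [0, 1, 2, 7, 8, 9]
    [([0, 1, 2], [10]), ([2, 0], [3]), ([3, 0], [4]), ([2, 8, 9], [5]), ([4, 7, 9], [6])]"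

lemma certificate_E:
  fixes f :: "ocomplex \<Rightarrow> rat"
  assumes f: "f \<in> local_formulae 4"
  shows "(-4) * val f (lk 10 sphere_A) + 1 * val f (lk 3 sphere_E) = 0"
proof -
  let ?es = "[(0, None, [(1, 1), (4, 4), (6, 6), (7, 9), (8, 8), (9, 7), (10, 10)]),
    (1, None, [(0, 0), (2, 2), (5, 5), (7, 7), (8, 9), (9, 8), (10, 10)]),
    (2, None, [(1, 1), (3, 3), (5, 7), (7, 5), (8, 8), (9, 9), (10, 10)]),
    (3, Some (1, True), [(2, 2), (4, 4), (5, 5), (6, 6), (7, 7), (8, 8), (9, 9), (10, 10)]),
    (4, None, [(0, 0), (3, 3), (6, 8), (7, 7), (8, 6), (9, 9), (10, 10)]),
    (5, None, [(1, 1), (2, 2), (3, 3), (7, 7), (8, 9), (9, 8), (10, 10)]),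
    (6, None, [(0, 0), (3, 3), (4, 4), (7, 9), (8, 8), (9, 7), (10, 10)]),
    (7, Some (0, False), [(0, 1), (1, 4), (2, 6), (3, 2), (4, 0), (5, 5), (6, 9), (8, 8), (9, 3), (10, 7)]),
    (8, Some (0, False), [(0, 4), (1, 1), (2, 0), (3, 2), (4, 6), (5, 9), (6, 5), (7, 8), (9, 3), (10, 7)]),
    (9, Some (0, False), [(0, 4), (1, 1), (2, 0), (3, 2), (4, 5), (5, 9), (6, 6), (7, 7), (8, 3), (10, 8)]),
    (10, Some (0, False), [(0, 1), (1, 4), (2, 6), (3, 2), (4, 9), (5, 5), (6, 0), (7, 7), (8, 3),
      (9, 8)])] :: entry list"
  let ?reps = "[lk 10 sphere_A, lk 3 sphere_E]"
  have s: "sphere_ok (Suc 4) 60 [0, 1, 2, 7, 8, 9]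
    [([0, 1, 2], [10]), ([2, 0], [3]), ([3, 0], [4]), ([2, 8, 9], [5]), ([4, 7, 9], [6])]"
    by code_simp
  have l: "links_ok ?reps ?es sphere_E"
    by code_simp
  show ?thesis
    using checked_relation[OF f s l[unfolded sphere_E_def]] unfolding sphere_E_def[symmetric]
    by (simp add: entry_val_def)
qed

definition sphere_F :: ochain where
  "sphere_F = moved [0, 1, 4, 5, 6, 8]
    [([1, 4, 5, 6, 8], [2]), ([0, 1, 4, 5, 6], [7]), ([1, 4, 5, 6], [2, 7]), ([4, 5, 6, 8], [0, 2]),
      ([1, 2, 5, 6], [7, 8]), ([0, 1, 4, 5, 8], [3]), ([0, 1, 5, 8], [3, 6]), ([4, 5, 6], [0, 2, 7])]"

lemma certificate_F:
  fixes f :: "ocomplex \<Rightarrow> rat"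
  assumes f: "f \<in> local_formulae 4"
  shows "1 * val f (lk 1 sphere_F) + 1 * val f (lk 5 sphere_F) = 0"
proof -
  let ?es = "[(0, None, [(1, 1), (2, 2), (3, 3), (4, 6), (5, 5), (6, 4), (7, 7), (8, 8)]),
    (1, Some (1, True), [(0, 0), (2, 2), (3, 3), (4, 4), (5, 5), (6, 6), (7, 7), (8, 8)]),
    (2, None, [(0, 0), (1, 1), (4, 4), (5, 6), (6, 5), (7, 7), (8, 8)]),
    (3, None, [(0, 0), (1, 1), (4, 4), (5, 8), (6, 6), (8, 5)]),
    (4, None, [(0, 0), (1, 1), (2, 2), (3, 3), (5, 8), (6, 7), (7, 6), (8, 5)]),
    (5, Some (2, True), [(0, 0), (1, 1), (2, 2), (3, 3), (4, 4), (6, 6), (7, 7), (8, 8)]),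
    (6, Some (0, False), [(0, 0), (1, 7), (2, 9), (3, 5), (4, 4), (5, 8), (7, 2), (8, 1)]),
    (7, None, [(0, 0), (1, 1), (2, 2), (4, 4), (5, 6), (6, 5), (8, 8)]),
    (8, Some (0, True), [(0, 9), (1, 7), (2, 8), (3, 4), (4, 2), (5, 0), (6, 1), (7, 5)])] :: entry list"
  let ?reps = "[two_arcs [7] [8, 9], lk 1 sphere_F, lk 5 sphere_F]"
  have s: "sphere_ok (Suc 4) 58 [0, 1, 4, 5, 6, 8]
    [([1, 4, 5, 6, 8], [2]), ([0, 1, 4, 5, 6], [7]), ([1, 4, 5, 6], [2, 7]), ([4, 5, 6, 8], [0, 2]),
      ([1, 2, 5, 6], [7, 8]), ([0, 1, 4, 5, 8], [3]), ([0, 1, 5, 8], [3, 6]), ([4, 5, 6], [0, 2, 7])]"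
    by code_simp
  have l: "links_ok ?reps ?es sphere_F"
    by code_simp
  show ?thesis
    using checked_relation[OF f s l[unfolded sphere_F_def]] unfolding sphere_F_def[symmetric]
    by (simp add: entry_val_def)
qed

definition sphere_G :: ochain where
  "sphere_G = moved [1, 2, 3, 4, 6, 7]
    [([1, 2, 3, 4, 6], [5]), ([1, 2, 3, 6], [5, 7]), ([1, 2, 3, 4, 7], [8]), ([1, 2, 3, 7, 8], [0]),
      ([1, 2, 3, 7], [0, 5]), ([2, 3, 5, 7], [0, 6]), ([1, 2, 7, 8], [0, 4])]"

lemma certificate_G:
  fixes f :: "ocomplex \<Rightarrow> rat"
  assumes f: "f \<in> local_formulae 4"
  shows "(-2) * val f (lk 1 sphere_F) + 1 * val f (lk 5 sphere_F) + 1 * val f (lk 2 sphere_G) = 0"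
proof -
  let ?es = "[(0, None, [(1, 1), (2, 7), (3, 3), (4, 4), (5, 5), (6, 6), (7, 2), (8, 8)]),
    (1, Some (0, False), [(0, 0), (2, 6), (3, 5), (4, 8), (5, 7), (6, 2), (7, 4), (8, 3)]),
    (2, Some (2, True), [(0, 0), (1, 1), (3, 3), (4, 4), (5, 5), (6, 6), (7, 7), (8, 8)]),
    (3, Some (1, True), [(0, 4), (1, 8), (2, 0), (4, 6), (5, 2), (6, 7), (7, 1), (8, 3)]),
    (4, None, [(0, 0), (1, 2), (2, 1), (3, 3), (5, 5), (6, 6), (7, 7), (8, 8)]),
    (5, None, [(0, 0), (1, 1), (2, 3), (3, 2), (4, 4), (6, 6), (7, 7)]),
    (6, None, [(0, 0), (1, 1), (2, 3), (3, 2), (4, 4), (5, 5), (7, 7)]),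
    (7, Some (0, False), [(0, 8), (1, 4), (2, 6), (3, 5), (4, 0), (5, 2), (6, 7), (8, 3)]),
    (8, None, [(0, 0), (1, 1), (2, 2), (3, 4), (4, 3), (7, 7)])] :: entry list"
  let ?reps = "[lk 1 sphere_F, lk 5 sphere_F, lk 2 sphere_G]"
  have s: "sphere_ok (Suc 4) 58 [1, 2, 3, 4, 6, 7]
    [([1, 2, 3, 4, 6], [5]), ([1, 2, 3, 6], [5, 7]), ([1, 2, 3, 4, 7], [8]), ([1, 2, 3, 7, 8], [0]),
      ([1, 2, 3, 7], [0, 5]), ([2, 3, 5, 7], [0, 6]), ([1, 2, 7, 8], [0, 4])]"
    by code_simp
  have l: "links_ok ?reps ?es sphere_G"
    by code_simp
  show ?thesis
    using checked_relation[OF f s l[unfolded sphere_G_def]] unfolding sphere_G_def[symmetric]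
    by (simp add: entry_val_def)
qed

definition sphere_H :: ochain where
  "sphere_H = moved [0, 2, 4, 5, 6, 8]
    [([2, 4, 5, 6, 8], [7]), ([2, 5, 6, 8], [0, 7]), ([0, 2, 4, 5, 8], [3]), ([0, 4, 5, 8], [3, 6]),
      ([0, 2, 4, 5, 6], [1]), ([0, 2, 4, 6], [1, 8]), ([0, 2, 5, 6], [1, 7]), ([2, 4, 5, 8], [3, 7]),
      ([2, 5, 8], [0, 3, 7]), ([0, 4, 6, 8], [1, 3])]"

lemma certificate_H:
  fixes f :: "ocomplex \<Rightarrow> rat"
  assumes f: "f \<in> local_formulae 4"
  shows "1 * val f (lk 1 sphere_F) + 1 * val f (lk 5 sphere_F) + 2 * val f (lk 2 sphere_G) + 1 * val f (lk
    0 sphere_H) = 0"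
proof -
  let ?es = "[(0, Some (3, True), [(1, 1), (2, 2), (3, 3), (4, 4), (5, 5), (6, 6), (7, 7), (8, 8)]),
    (1, None, [(0, 6), (2, 2), (3, 3), (4, 4), (5, 5), (6, 0), (7, 7), (8, 8)]),
    (2, Some (1, True), [(0, 8), (1, 2), (3, 3), (4, 0), (5, 4), (6, 7), (7, 1), (8, 6)]),
    (3, None, [(0, 4), (1, 1), (2, 2), (4, 0), (5, 5), (6, 6), (7, 7), (8, 8)]),
    (4, Some (2, True), [(0, 5), (1, 6), (2, 3), (3, 1), (5, 0), (6, 7), (7, 8), (8, 4)]),
    (5, Some (0, True), [(0, 5), (1, 3), (2, 0), (3, 7), (4, 6), (6, 8), (7, 4), (8, 2)]),
    (6, Some (2, True), [(0, 0), (1, 7), (2, 6), (3, 8), (4, 4), (5, 1), (7, 5), (8, 3)]),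
    (7, None, [(0, 0), (1, 1), (2, 5), (3, 3), (4, 4), (5, 2), (6, 6), (8, 8)]),
    (8, None, [(0, 4), (1, 1), (2, 2), (3, 3), (4, 0), (5, 5), (6, 6), (7, 7)])] :: entry list"
  let ?reps = "[lk 1 sphere_F, lk 5 sphere_F, lk 2 sphere_G, lk 0 sphere_H]"
  have s: "sphere_ok (Suc 4) 58 [0, 2, 4, 5, 6, 8]
    [([2, 4, 5, 6, 8], [7]), ([2, 5, 6, 8], [0, 7]), ([0, 2, 4, 5, 8], [3]), ([0, 4, 5, 8], [3, 6]),
      ([0, 2, 4, 5, 6], [1]), ([0, 2, 4, 6], [1, 8]), ([0, 2, 5, 6], [1, 7]), ([2, 4, 5, 8], [3, 7]),
      ([2, 5, 8], [0, 3, 7]), ([0, 4, 6, 8], [1, 3])]"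
    by code_simp
  have l: "links_ok ?reps ?es sphere_H"
    by code_simp
  show ?thesis
    using checked_relation[OF f s l[unfolded sphere_H_def]] unfolding sphere_H_def[symmetric]
    by (simp add: entry_val_def)
qed

definition sphere_I :: ochain where
  "sphere_I = moved [0, 1, 3, 4, 5, 7]
    [([0, 3, 4, 5, 7], [2]), ([0, 4, 5, 7], [1, 2]), ([0, 1, 3, 4, 5], [8]), ([0, 1, 4, 5], [2, 8]),
      ([0, 1, 2, 5], [7, 8]), ([0, 1, 2, 7, 8], [6]), ([0, 1, 2, 7], [4, 6]), ([0, 1, 7, 8], [5, 6]),
      ([0, 1, 5, 8], [3, 6])]"

lemma certificate_I:
  fixes f :: "ocomplex \<Rightarrow> rat"
  assumes f: "f \<in> local_formulae 4"
  shows "1 * val f (lk 1 sphere_F) + 1 * val f (lk 2 sphere_G) + (-1) * val f (lk 0 sphere_H) + 1 * val f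
    (lk 0 sphere_I) = 0"
proof -
  let ?es = "[(0, Some (4, True), [(1, 1), (2, 2), (3, 3), (4, 4), (5, 5), (6, 6), (7, 7), (8, 8)]),
    (1, Some (3, False), [(0, 1), (2, 7), (3, 4), (4, 2), (5, 3), (6, 6), (7, 8), (8, 5)]),
    (2, Some (0, False), [(0, 7), (1, 9), (3, 5), (4, 1), (5, 8), (6, 4), (7, 0), (8, 2)]),
    (3, None, [(0, 5), (1, 1), (2, 2), (4, 4), (5, 0), (6, 6), (7, 7), (8, 8)]),
    (4, Some (0, True), [(0, 7), (1, 0), (2, 1), (3, 2), (5, 9), (6, 5), (7, 8), (8, 4)]),
    (5, Some (2, True), [(0, 0), (1, 4), (2, 5), (3, 7), (4, 6), (6, 8), (7, 1), (8, 3)]),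
    (6, None, [(0, 1), (1, 0), (2, 2), (3, 3), (4, 4), (5, 5), (7, 7), (8, 8)]),
    (7, Some (1, True), [(0, 4), (1, 6), (2, 5), (3, 2), (4, 7), (5, 8), (6, 0), (8, 3)]),
    (8, None, [(0, 0), (1, 1), (2, 6), (3, 4), (4, 3), (5, 5), (6, 2), (7, 7)])] :: entry list"
  let ?reps = "[two_arcs [7] [8, 9], lk 1 sphere_F, lk 2 sphere_G, lk 0 sphere_H, lk 0 sphere_I]"
  have s: "sphere_ok (Suc 4) 58 [0, 1, 3, 4, 5, 7]
    [([0, 3, 4, 5, 7], [2]), ([0, 4, 5, 7], [1, 2]), ([0, 1, 3, 4, 5], [8]), ([0, 1, 4, 5], [2, 8]),
      ([0, 1, 2, 5], [7, 8]), ([0, 1, 2, 7, 8], [6]), ([0, 1, 2, 7], [4, 6]), ([0, 1, 7, 8], [5, 6]),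
      ([0, 1, 5, 8], [3, 6])]"
    by code_simp
  have l: "links_ok ?reps ?es sphere_I"
    by code_simp
  show ?thesis
    using checked_relation[OF f s l[unfolded sphere_I_def]] unfolding sphere_I_def[symmetric]
    by (simp add: entry_val_def)
qed

definition sphere_J :: ochain where
  "sphere_J = moved [1, 3, 4, 5, 6, 7]
    [([1, 4, 5, 6, 7], [2]), ([3, 4, 5, 6, 7], [0]), ([4, 5, 6, 7], [0, 2]), ([0, 4, 5, 6], [2, 3]),
      ([4, 5, 6], [1, 2, 3]), ([2, 5, 6, 7], [0, 1]), ([0, 3, 4, 5, 7], [8])]"

lemma certificate_J:
  fixes f :: "ocomplex \<Rightarrow> rat"
  assumes f: "f \<in> local_formulae 4"
  shows "(-2) * val f (two_arcs [7] [8, 9]) + 1 * val f (lk 0 sphere_J) = 0"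
proof -
  let ?es = "[(0, Some (1, True), [(1, 1), (2, 2), (3, 3), (4, 4), (5, 5), (6, 6), (7, 7), (8, 8)]),
    (1, None, [(0, 0), (2, 7), (3, 3), (4, 4), (5, 5), (6, 6), (7, 2)]),
    (2, None, [(0, 0), (1, 1), (3, 3), (4, 4), (5, 6), (6, 5), (7, 7)]),
    (3, None, [(0, 7), (1, 2), (2, 1), (4, 4), (5, 5), (6, 6), (7, 0), (8, 8)]),
    (4, None, [(0, 0), (1, 1), (2, 2), (3, 7), (5, 5), (6, 6), (7, 3), (8, 8)]),
    (5, Some (0, False), [(0, 7), (1, 9), (2, 2), (3, 0), (4, 8), (6, 4), (7, 1), (8, 5)]),
    (6, None, [(0, 1), (1, 0), (2, 2), (3, 3), (4, 4), (5, 5), (7, 7)]),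
    (7, Some (0, False), [(0, 7), (1, 9), (2, 4), (3, 8), (4, 0), (5, 1), (6, 2), (8, 5)]),
    (8, None, [(0, 0), (3, 3), (4, 4), (5, 7), (7, 5)])] :: entry list"
  let ?reps = "[two_arcs [7] [8, 9], lk 0 sphere_J]"
  have s: "sphere_ok (Suc 4) 58 [1, 3, 4, 5, 6, 7]
    [([1, 4, 5, 6, 7], [2]), ([3, 4, 5, 6, 7], [0]), ([4, 5, 6, 7], [0, 2]), ([0, 4, 5, 6], [2, 3]),
      ([4, 5, 6], [1, 2, 3]), ([2, 5, 6, 7], [0, 1]), ([0, 3, 4, 5, 7], [8])]"
    by code_simp
  have l: "links_ok ?reps ?es sphere_J"
    by code_simp
  show ?thesis
    using checked_relation[OF f s l[unfolded sphere_J_def]] unfolding sphere_J_def[symmetric]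
    by (simp add: entry_val_def)
qed

definition sphere_K :: ochain where
  "sphere_K = moved [0, 3, 4, 6, 7, 8]
    [([0, 3, 6, 7, 8], [5]), ([0, 3, 6, 7], [4, 5]), ([3, 5, 6, 7, 8], [1]), ([3, 5, 7, 8], [0, 1]),
      ([0, 3, 4, 5, 7], [2]), ([0, 4, 5, 7], [2, 6])]"

lemma certificate_K:
  fixes f :: "ocomplex \<Rightarrow> rat"
  assumes f: "f \<in> local_formulae 4"
  shows "2 * val f (two_arcs [7] [8, 9]) + 1 * val f (lk 3 sphere_E) + (-1) * val f (lk 1 sphere_F)
    + 1 * val f (lk 0 sphere_J) = 0"
proof -
  let ?es = "[(0, Some (0, True), [(1, 5), (2, 4), (3, 1), (4, 9), (5, 7), (6, 2), (7, 0), (8, 8)]),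
    (1, None, [(0, 0), (3, 3), (5, 5), (6, 6), (7, 8), (8, 7)]),
    (2, None, [(0, 0), (3, 3), (4, 4), (5, 7), (6, 6), (7, 5)]),
    (3, Some (0, True), [(0, 1), (1, 4), (2, 5), (4, 8), (5, 7), (6, 2), (7, 0), (8, 9)]),
    (4, None, [(0, 0), (2, 2), (3, 6), (5, 5), (6, 3), (7, 7), (8, 8)]),
    (5, Some (1, True), [(0, 9), (1, 2), (2, 6), (3, 10), (4, 4), (6, 8), (7, 7), (8, 5)]),
    (6, Some (3, True), [(0, 2), (1, 8), (2, 1), (3, 3), (4, 6), (5, 5), (7, 7), (8, 4)]),
    (7, Some (2, False), [(0, 4), (1, 3), (2, 2), (3, 5), (4, 7), (5, 8), (6, 6), (8, 0)]),
    (8, None, [(0, 0), (1, 1), (3, 7), (4, 4), (5, 5), (6, 6), (7, 3)])] :: entry list"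
  let ?reps = "[two_arcs [7] [8, 9], lk 3 sphere_E, lk 1 sphere_F, lk 0 sphere_J]"
  have s: "sphere_ok (Suc 4) 58 [0, 3, 4, 6, 7, 8]
    [([0, 3, 6, 7, 8], [5]), ([0, 3, 6, 7], [4, 5]), ([3, 5, 6, 7, 8], [1]), ([3, 5, 7, 8], [0, 1]),
      ([0, 3, 4, 5, 7], [2]), ([0, 4, 5, 7], [2, 6])]"
    by code_simp
  have l: "links_ok ?reps ?es sphere_K"
    by code_simp
  show ?thesis
    using checked_relation[OF f s l[unfolded sphere_K_def]] unfolding sphere_K_def[symmetric]
    by (simp add: entry_val_def)
qed

section \<open>Dual cells of a closed oriented 4-manifold\<close>

text \<open>
  The source of all cancellations below.
\<close>

lemma involution_cancel:
  fixes F :: "'a \<Rightarrow> rat"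
  assumes i: "\<And>y. y \<in> S \<Longrightarrow> i y \<in> S" "\<And>y. y \<in> S \<Longrightarrow> i (i y) = y" "\<And>y. y \<in> S \<Longrightarrow> F (i y) = - F y"
  shows "sum F S = 0"
proof -
  have "sum F S = (\<Sum>y\<in>S. - F y)"
  proof (rule sum.reindex_bij_witness[of S i i])
    fix y assume y: "y \<in> S"
    show "i (i y) = y" "i (i y) = y" "i y \<in> S" "i y \<in> S" by (rule i(2)[OF y] i(1)[OF y])+
    show "- F (i y) = F y" unfolding i(3)[OF y] by simp
  qed
  then show ?thesis by (simp add: sum_negf)
qed

text \<open>
  A closed oriented 4-dimensional pseudomanifold. Orderings of its facets serve as flags: the
  ordering \<open>y\<close> stands for the chain of faces spanned by its initial segments, a simplex of the
  barycentric subdivision.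
\<close>

locale closed_oriented =
  fixes K :: "nat set set" and \<omega> :: orient
  assumes K: "finite_complex K" and orient: "orientation 5 K \<omega>"
    and closed: "\<And>a xs. \<omega> (a # xs) \<noteq> 0 \<Longrightarrow> \<exists>b. b \<noteq> a \<and> \<omega> (b # xs) \<noteq> 0"
begin

definition orderings :: "nat list set" where
  "orderings = {y. \<omega> y \<noteq> 0}"

lemma orderings_iff: "y \<in> orderings \<longleftrightarrow> length y = 5 \<and> distinct y \<and> set y \<in> K"
  using orient unfolding orderings_def orientation_def by blast

lemma swap: "\<omega> (xs @ a # b # ys) = - \<omega> (xs @ b # a # ys)"
  using orient unfolding orientation_def by blast

lemma coherent: "a \<noteq> b \<Longrightarrow> \<omega> (a # xs) \<noteq> 0 \<Longrightarrow> \<omega> (b # xs) \<noteq> 0 \<Longrightarrow> \<omega> (b # xs) = - \<omega> (a # xs)"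
  using orient unfolding orientation_def by blast

lemma move_right: "\<omega> (xs @ a # us @ ys) = (-1) ^ length us * \<omega> (xs @ us @ a # ys)"
proof (induction us arbitrary: xs)
  case (Cons u us)
  have "\<omega> (xs @ a # (u # us) @ ys) = - \<omega> ((xs @ [u]) @ a # us @ ys)"
    using swap[of xs a u "us @ ys"] by simp
  also have "\<dots> = - ((-1) ^ length us * \<omega> ((xs @ [u]) @ us @ a # ys))" unfolding Cons.IH ..
  finally show ?case by simp
qed simp

lemma finite_orderings: "finite orderings"
proof (rule finite_subset)
  show "orderings \<subseteq> {xs. set xs \<subseteq> \<Union>K \<and> length xs = 5}" using orderings_iff by auto
  show "finite {xs. set xs \<subseteq> \<Union>K \<and> length xs = 5}"
    by (rule finite_lists_length_eq) (rule finite_complexD(5)[OF K])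
qed

lemma five: "y \<in> orderings \<Longrightarrow> \<exists>a b c d e. y = [a, b, c, d, e]"
  unfolding orderings_iff by (auto simp: numeral_eq_Suc length_Suc_conv)

text \<open>
  The \<open>j\<close>-dimensional face of the flag; its barycenter is a vertex of the barycentric subdivision.
\<close>

definition initial :: "nat list \<Rightarrow> nat \<Rightarrow> nat set" where
  "initial y j = set (take (Suc j) y)"

text \<open>
  Changes only the \<open>i\<close>-th face of a flag, for \<open>i < 4\<close>.
\<close>

definition swap_at :: "nat \<Rightarrow> nat list \<Rightarrow> nat list" where
  "swap_at i y = take i y @ [y ! Suc i, y ! i] @ drop (Suc (Suc i)) y"

lemma list_split2: "Suc i < length y \<Longrightarrow> y = take i y @ y ! i # y ! Suc i # drop (Suc (Suc i)) y"
  by (metis Cons_nth_drop_Suc Suc_lessD append_take_drop_id)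

lemma swap_at_props:
  assumes y: "y \<in> orderings" and i: "i < 4"
  shows "swap_at i y \<in> orderings" "swap_at i (swap_at i y) = y" "\<omega> (swap_at i y) = - \<omega> y" "j \<noteq> i \<Longrightarrow> initial (swap_at i y) j = initial y j"
    "m \<le> i \<Longrightarrow> take m (swap_at i y) = take m y"
proof -
  have l: "length y = 5" using y by (simp add: orderings_iff)
  have s: "y = take i y @ y ! i # y ! Suc i # drop (Suc (Suc i)) y" using l i by (intro list_split2) simp
  have t: "swap_at i y = take i y @ y ! Suc i # y ! i # drop (Suc (Suc i)) y" by (simp add: swap_at_def)
  have len: "length (take i y) = i" using l i by simp
  show w: "\<omega> (swap_at i y) = - \<omega> y" using swap[of "take i y" "y ! Suc i" "y ! i"] s t by simp
  show "swap_at i y \<in> orderings" using w y by (simp add: orderings_def)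
  obtain xs a b ys where p: "y = xs @ a # b # ys" "length xs = i" using s len by blast
  have q: "swap_at i y = xs @ b # a # ys" unfolding p(1) swap_at_def p(2)[symmetric] by (simp add: nth_append)
  show "swap_at i (swap_at i y) = y" unfolding q p(1) swap_at_def p(2)[symmetric] by (simp add: nth_append)
  show "initial (swap_at i y) j = initial y j" if "j \<noteq> i"
  proof (cases "j < i")
    case True
    have e: "take k y = take k (xs @ a # b # ys)" for k using p(1) by simp
    show ?thesis unfolding initial_def q e using True p(2) by simp
  next
    case False
    define k where "k = j - Suc i"
    have k: "Suc j = length xs + Suc (Suc k)" using False that p(2) by (simp add: k_def)
    have e: "take k y = take k (xs @ a # b # ys)" for k using p(1) by simp
    show ?thesis unfolding initial_def q e k by (simp add: insert_commute)
  qed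
  have e: "take k y = take k (xs @ a # b # ys)" for k using p(1) by simp
  show "take m (swap_at i y) = take m y" if "m \<le> i" unfolding q e using that p(2) by simp
qed

text \<open>
  Changes only the top face of a flag, by passing to the other facet at the ridge.
\<close>

definition across :: "nat list \<Rightarrow> nat list" where
  "across y = butlast y @ [SOME b. b \<noteq> last y \<and> butlast y @ [b] \<in> orderings]"

lemma across_props:
  assumes y: "y \<in> orderings"
  shows "across y \<in> orderings" "across (across y) = y" "\<omega> (across y) = - \<omega> y" "j < 4 \<Longrightarrow> initial (across y) j = initial y j"
    "m \<le> 4 \<Longrightarrow> take m (across y) = take m y"
proof -
  have l: "length y = 5" "y \<noteq> []" using y by (auto simp: orderings_iff)
  let ?xs = "butlast y"
  have lx: "length ?xs = 4" using l by simp
  have rot: "\<omega> (?xs @ [b]) = \<omega> (b # ?xs)" for b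
    using move_right[of "[]" b ?xs "[]"] lx by simp
  have yy: "?xs @ [last y] = y" using l(2) by simp
  have "\<omega> (last y # ?xs) \<noteq> 0" using y rot[of "last y"] yy by (simp add: orderings_def)
  then obtain b where b: "b \<noteq> last y" "\<omega> (b # ?xs) \<noteq> 0" using closed by blast
  then have "b \<noteq> last y \<and> ?xs @ [b] \<in> orderings" using rot[of b] by (simp add: orderings_def)
  then have ex: "(SOME b. b \<noteq> last y \<and> ?xs @ [b] \<in> orderings) \<noteq> last y \<and> ?xs @ [SOME b. b \<noteq> last y \<and> ?xs @ [b] \<in> orderings] \<in> orderings"
    by (rule someI)
  then obtain b where o: "across y = ?xs @ [b]" and b: "b \<noteq> last y" "?xs @ [b] \<in> orderings" by (auto simp: across_def)
  show "across y \<in> orderings" using o b by simp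
  have nz: "\<omega> (last y # ?xs) \<noteq> 0" "\<omega> (b # ?xs) \<noteq> 0"
    using y b(2) rot[of "last y"] rot[of b] yy by (auto simp: orderings_def)
  have "\<omega> (b # ?xs) = - \<omega> (last y # ?xs)" by (rule coherent[OF b(1)[symmetric] nz])
  then show w: "\<omega> (across y) = - \<omega> y" using rot[of "last y"] rot[of b] yy o by simp
  have un: "b' = last y" if "b' \<noteq> b" "?xs @ [b'] \<in> orderings" for b'
  proof (rule ccontr)
    assume n: "b' \<noteq> last y"
    have nz': "\<omega> (b' # ?xs) \<noteq> 0" using that(2) rot[of b'] by (simp add: orderings_def)
    have "\<omega> (b' # ?xs) = - \<omega> (last y # ?xs)" by (rule coherent[OF n[symmetric] nz(1) nz'])
    moreover have "\<omega> (b' # ?xs) = - \<omega> (b # ?xs)" by (rule coherent[OF that(1)[symmetric] nz(2) nz'])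
    moreover have "\<omega> (b # ?xs) = - \<omega> (last y # ?xs)" by (rule coherent[OF b(1)[symmetric] nz])
    ultimately show False using nz by simp
  qed
  have "(SOME b'. b' \<noteq> b \<and> ?xs @ [b'] \<in> orderings) = last y"
  proof (rule some_equality)
    show "last y \<noteq> b \<and> ?xs @ [last y] \<in> orderings" using b(1) y yy by simp
  qed (use un in blast)
  moreover have "butlast (across y) = ?xs" "last (across y) = b" using o by simp_all
  ultimately show "across (across y) = y" unfolding across_def[of "across y"] using yy by simp
  show "initial (across y) j = initial y j" if "j < 4"
    unfolding o initial_def using that lx yy by (metis Suc_leI take_append diff_is_0_eq take_0 append_Nil2)
  show "take m (across y) = take m y" if "m \<le> 4"
    unfolding o using that lx yy by (metis take_append diff_is_0_eq take_0 append_Nil2)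
qed

lemma take_prefix: "y = p @ q \<Longrightarrow> length p = k \<Longrightarrow> take k y = p"
  by simp

text \<open>
  If the summand does not see the \<open>i\<close>-th face, the neighbour across that face cancels the flag. The
  prefix of length \<open>m \<le> i\<close> may be used freely, since it is left unchanged.
\<close>

lemma flag_sum_zero:
  fixes F :: "nat list \<Rightarrow> rat"
  assumes i: "i < 5" "m \<le> i"
    and F: "\<And>y y'. y \<in> orderings \<Longrightarrow> y' \<in> orderings \<Longrightarrow> (\<And>j. j < 5 \<Longrightarrow> j \<noteq> i \<Longrightarrow> initial y j = initial y' j) \<Longrightarrow> take m y = take m y' \<Longrightarrow> F y = F y'"
  shows "(\<Sum>y\<in>orderings. of_int (\<omega> y) * F y) = 0"
proof (cases "i = 4")
  case True
  show ?thesis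
  proof (rule involution_cancel[of orderings across])
    fix y assume y: "y \<in> orderings"
    have "F (across y) = F y"
      by (rule F) (use across_props[OF y] y i True in auto)
    then show "of_int (\<omega> (across y)) * F (across y) = - (of_int (\<omega> y) * F y)" using across_props(3)[OF y] by simp
  qed (use across_props in auto)
next
  case False
  then have i4: "i < 4" using i by simp
  show ?thesis
  proof (rule involution_cancel[of orderings "swap_at i"])
    fix y assume y: "y \<in> orderings"
    have "F (swap_at i y) = F y"
      by (rule F) (use swap_at_props[OF y i4] y i in auto)
    then show "of_int (\<omega> (swap_at i y)) * F (swap_at i y) = - (of_int (\<omega> y) * F y)" using swap_at_props(3)[OF y i4] by simp
  qed (use swap_at_props i4 in auto)
qed

definition move_to :: "nat \<Rightarrow> nat \<Rightarrow> nat list \<Rightarrow> nat list" where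
  "move_to m i y = take i y @ take (m - i) (drop (Suc i) y) @ y ! i # drop (Suc m) y"

definition sorted_up_to :: "nat \<Rightarrow> nat list set" where
  "sorted_up_to m = {y \<in> orderings. sorted_wrt (<) (take m y)}"

lemma move_to_split:
  assumes "i \<le> m" "m < length y"
  obtains xs a us ys where "y = xs @ a # us @ ys" "length xs = i" "length us = m - i" "move_to m i y = xs @ us @ a # ys"
proof -
  let ?xs = "take i y" and ?us = "take (m - i) (drop (Suc i) y)" and ?ys = "drop (Suc m) y"
  have "y = ?xs @ y ! i # drop (Suc i) y" using assms by (simp add: id_take_nth_drop)
  moreover have "drop (Suc i) y = ?us @ drop (m - i) (drop (Suc i) y)" by (rule append_take_drop_id[symmetric])
  moreover have "drop (m - i) (drop (Suc i) y) = ?ys" using assms by simp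
  ultimately have e: "y = ?xs @ y ! i # ?us @ ?ys" by metis
  have l: "length ?xs = i" "length ?us = m - i" using assms by auto
  show ?thesis by (rule that[OF e l]) (simp only: move_to_def)
qed

lemma move_to_props:
  assumes y: "y \<in> orderings" and i: "i \<le> m" "m < 5"
  shows "move_to m i y \<in> orderings" "\<omega> y = (-1) ^ (m - i) * \<omega> (move_to m i y)" "m \<le> j \<Longrightarrow> initial (move_to m i y) j = initial y j"
proof -
  have "m < length y" using y i by (simp add: orderings_iff)
  then obtain xs a us ys where s: "y = xs @ a # us @ ys" "length xs = i" "length us = m - i" "move_to m i y = xs @ us @ a # ys"
    using move_to_split[OF i(1)] by blast
  show w: "\<omega> y = (-1) ^ (m - i) * \<omega> (move_to m i y)" using move_right[of xs a us ys] s by simp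
  then show "move_to m i y \<in> orderings" using y by (auto simp: orderings_def)
  show "initial (move_to m i y) j = initial y j" if "m \<le> j"
  proof -
    have l: "Suc j = length xs + (Suc (length us) + (j - m))" using s i that by simp
    have 1: "take (Suc j) y = xs @ a # us @ take (j - m) ys" unfolding s(1) l by simp
    have 2: "take (Suc j) (move_to m i y) = xs @ us @ a # take (j - m) ys" unfolding s(4) l by simp
    show ?thesis unfolding initial_def 1 2 by auto
  qed
qed

text \<open>
  An ordering with \<open>m\<close> sorted entries arises in exactly one way by moving one of \<open>m + 1\<close> sorted
  entries to position \<open>m\<close>.
\<close>

lemma insertion_sum:
  fixes F :: "nat list \<Rightarrow> rat"
  assumes m: "m < 5"
  shows "(\<Sum>y\<in>sorted_up_to (Suc m). \<Sum>i\<le>m. F (move_to m i y)) = (\<Sum>z\<in>sorted_up_to m. F z)"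
proof -
  have fin: "finite (sorted_up_to k)" for k unfolding sorted_up_to_def using finite_orderings by simp
  have "(\<Sum>y\<in>sorted_up_to (Suc m). \<Sum>i\<le>m. F (move_to m i y)) = (\<Sum>(y, i)\<in>sorted_up_to (Suc m) \<times> {..m}. F (move_to m i y))"
    by (rule sum.cartesian_product)
  also have "\<dots> = (\<Sum>p\<in>sorted_up_to (Suc m) \<times> {..m}. F (move_to m (snd p) (fst p)))"
    by (simp add: case_prod_beta)
  also have "\<dots> = (\<Sum>z\<in>sorted_up_to m. F z)"
  proof (rule sum.reindex_bij_betw)
    have sY: "y \<in> orderings" "m < length y" "distinct y" "sorted_wrt (<) (take k y)" if "y \<in> sorted_up_to k" for y k
      using that m by (auto simp: sorted_up_to_def orderings_iff)
    have unique: "p = q" if "sorted_wrt (<) p" "sorted_wrt (<) q" "set p = set q" for p q :: "nat list"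
      using strict_sorted_equal[OF that(2,1,3)] .
    show "bij_betw (\<lambda>p. move_to m (snd p) (fst p)) (sorted_up_to (Suc m) \<times> {..m}) (sorted_up_to m)"
      unfolding bij_betw_def
    proof (intro conjI inj_onI subset_antisym image_subsetI subsetI)
      fix p p' assume p: "p \<in> sorted_up_to (Suc m) \<times> {..m}" "p' \<in> sorted_up_to (Suc m) \<times> {..m}"
        and eq: "move_to m (snd p) (fst p) = move_to m (snd p') (fst p')"
      obtain y i y' i' where pp: "p = (y, i)" "p' = (y', i')" by (cases p, cases p')
      have y: "y \<in> sorted_up_to (Suc m)" "i \<le> m" "y' \<in> sorted_up_to (Suc m)" "i' \<le> m" using p pp by auto
      obtain xs a us ys where s: "y = xs @ a # us @ ys" "length xs = i" "length us = m - i" "move_to m i y = xs @ us @ a # ys"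
        using move_to_split[OF y(2) sY(2)[OF y(1)]] .
      obtain xs' a' us' ys' where s': "y' = xs' @ a' # us' @ ys'" "length xs' = i'" "length us' = m - i'" "move_to m i' y' = xs' @ us' @ a' # ys'"
        using move_to_split[OF y(4) sY(2)[OF y(3)]] .
      have l: "length (xs @ us) = length (xs' @ us')" using s(2,3) s'(2,3) y(2,4) by simp
      have "(xs @ us) @ a # ys = (xs' @ us') @ a' # ys'" using eq pp s(4) s'(4) by simp
      then have e: "xs @ us = xs' @ us'" "a = a'" "ys = ys'"
        unfolding append_eq_append_conv[OF disjI1[OF l]] by auto
      have t: "take (Suc m) y = xs @ a # us" "take (Suc m) y' = xs' @ a' # us'"
        using s(1-3) s'(1-3) y by (intro take_prefix[of _ _ ys] take_prefix[of _ _ ys']; simp)+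
      have "set (xs @ a # us) = insert a (set (xs @ us))" "set (xs' @ a' # us') = insert a' (set (xs' @ us'))" by auto
      then have "set (xs @ a # us) = set (xs' @ a' # us')" using e by simp
      then have f: "xs @ a # us = xs' @ a' # us'"
        using unique sY(4)[OF y(1)] sY(4)[OF y(3)] unfolding t by blast
      have "y = (xs @ a # us) @ ys" using s(1) by simp
      then have d: "distinct (xs @ a # us)" using sY(3)[OF y(1)] by (simp only: distinct_append)
      have "(xs @ a # us) ! i = a" "(xs @ a # us) ! i' = a"
        using s(2) s'(2) e(2) by (simp_all only: nth_append_length f) (metis nth_append_length f)+
      then have "i = i'" using d y(2,4) s(2,3) nth_eq_iff_index_eq[OF d, of i i'] by simp
      then show "p = p'" using pp f s(1) s'(1) e by (metis append.assoc append_Cons)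
    next
      fix p assume "p \<in> sorted_up_to (Suc m) \<times> {..m}"
      then obtain y i where p: "p = (y, i)" "y \<in> sorted_up_to (Suc m)" "i \<le> m" by auto
      obtain xs a us ys where s: "y = xs @ a # us @ ys" "length xs = i" "length us = m - i" "move_to m i y = xs @ us @ a # ys"
        using move_to_split[OF p(3) sY(2)[OF p(2)]] .
      have "take (Suc m) y = xs @ a # us" using s(1-3) p by (intro take_prefix[of _ _ ys]) simp_all
      then have "sorted_wrt (<) (xs @ us)" using sY(4)[OF p(2)] by (auto simp: sorted_wrt_append)
      moreover have "take m (move_to m i y) = xs @ us" using s(2-4) p by (intro take_prefix[of _ _ "a # ys"]) simp_all
      ultimately show "move_to m (snd p) (fst p) \<in> sorted_up_to m"
        using move_to_props(1)[OF sY(1)[OF p(2)] p(3) m] p(1) by (simp add: sorted_up_to_def)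
    next
      fix z assume z: "z \<in> sorted_up_to m"
      note zz = sY[OF z]
      let ?q = "take m z" and ?x = "z ! m" and ?t = "drop (Suc m) z"
      have zs: "z = ?q @ ?x # ?t" using zz(2) by (simp add: id_take_nth_drop)
      define p where "p = sorted_list_of_set (insert ?x (set ?q))"
      have ps: "sorted_wrt (<) p" "set p = insert ?x (set ?q)"
        unfolding p_def by (rule strict_sorted_list_of_set, rule set_sorted_list_of_set, simp)
      obtain xs us where p: "p = xs @ ?x # us" using ps(2) by (metis insertI1 split_list)
      have dz: "?x \<notin> set ?q" using zz(3) zs by (metis distinct_append disjoint_iff list.set_intros(1))
      have so: "sorted_wrt (<) (xs @ us)" "?x \<notin> set (xs @ us)" using ps(1) unfolding p by (auto simp: sorted_wrt_append)
      have "insert ?x (set (xs @ us)) = insert ?x (set ?q)" using ps(2) unfolding p by auto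
      then have "set (xs @ us) = set ?q" using dz so(2) by (metis insert_ident)
      then have q: "xs @ us = ?q" using unique[OF so(1) zz(4)] by simp
      have lm: "length xs + length us = m" using q zz(2) by (metis length_append length_take min.absorb4)
      let ?y = "xs @ ?x # us @ ?t"
      have w: "\<omega> ?y = (-1) ^ length us * \<omega> z" using move_right[of xs ?x us ?t] q zs by (metis append.assoc)
      have y: "?y \<in> orderings" using w zz(1) by (auto simp: orderings_def)
      have "take (Suc m) ?y = p" using lm p by (intro take_prefix[of _ _ ?t]) simp_all
      then have yS: "?y \<in> sorted_up_to (Suc m)" using y ps(1) by (simp add: sorted_up_to_def)
      have "m - length xs = length us" "drop (Suc m) ?y = ?t" using lm by (simp_all flip: lm)
      then have "move_to m (length xs) ?y = xs @ us @ ?x # ?t" unfolding move_to_def by simp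
      also have "\<dots> = z" using q zs by (metis append.assoc)
      finally have "move_to m (length xs) ?y = z" .
      then show "z \<in> (\<lambda>p. move_to m (snd p) (fst p)) ` (sorted_up_to (Suc m) \<times> {..m})"
        using yS lm by (intro image_eqI[of _ _ "(?y, length xs)"]) auto
    qed
  qed
  finally show ?thesis .
qed

context
  fixes \<Phi> :: "nat set list \<Rightarrow> rat"
  assumes cocycle: "\<And>Ss \<sigma>. \<sigma> \<in> K \<Longrightarrow> length Ss = 6 \<Longrightarrow> (\<forall>S\<in>set Ss. S \<noteq> {} \<and> S \<subseteq> \<sigma>) \<Longrightarrow>
    (\<Sum>k<6. (-1) ^ k * \<Phi> (take k Ss @ drop (Suc k) Ss)) = 0"
begin

text \<open>
  \<open>js\<close> lists the dimensions of the faces of the flag whose barycenters are the vertices of a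
  singular 4-simplex, in this order; repetitions are allowed.
\<close>

definition flags :: "nat list \<Rightarrow> rat" where
  "flags js = (\<Sum>y\<in>orderings. of_int (\<omega> y) * \<Phi> (map (initial y) js))"

lemma initial_bound: "y \<in> orderings \<Longrightarrow> initial y j \<noteq> {} \<and> initial y j \<subseteq> set y"
  using five[of y] by (auto simp: initial_def dest: in_set_takeD)

lemma flags_zero: "i < 5 \<Longrightarrow> i \<notin> set js \<Longrightarrow> set js \<subseteq> {..<5} \<Longrightarrow> flags js = 0"
  unfolding flags_def
proof (rule flag_sum_zero[of i 0])
  fix y y' assume js: "i \<notin> set js" "set js \<subseteq> {..<5}" and e: "\<And>j. j < 5 \<Longrightarrow> j \<noteq> i \<Longrightarrow> initial y j = initial y' j"
  have "map (initial y) js = map (initial y') js" using e js by (intro map_cong) auto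
  then show "\<Phi> (map (initial y) js) = \<Phi> (map (initial y') js)" by (simp only:)
qed simp_all

lemma flags_cocycle:
  assumes "length js = 6"
  shows "(\<Sum>k<6. (-1) ^ k * flags (take k js @ drop (Suc k) js)) = 0"
proof -
  have "(\<Sum>k<6. (-1) ^ k * flags (take k js @ drop (Suc k) js))
      = (\<Sum>y\<in>orderings. of_int (\<omega> y) * (\<Sum>k<6. (-1) ^ k * \<Phi> (take k (map (initial y) js) @ drop (Suc k) (map (initial y) js))))"
    unfolding flags_def sum_distrib_left
    by (subst sum.swap) (simp add: take_map drop_map ac_simps)
  also have "\<dots> = 0"
  proof (rule sum.neutral, rule ballI)
    fix y assume y: "y \<in> orderings"
    have "(\<Sum>k<6. (-1) ^ k * \<Phi> (take k (map (initial y) js) @ drop (Suc k) (map (initial y) js))) = 0"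
      by (rule cocycle[of "set y"]) (use y assms initial_bound[OF y] in \<open>auto simp: orderings_iff\<close>)
    then show "of_int (\<omega> y) * (\<Sum>k<6. (-1) ^ k * \<Phi> (take k (map (initial y) js) @ drop (Suc k) (map (initial y) js))) = 0" by simp
  qed
  finally show ?thesis .
qed

lemma sum_six: "(\<Sum>k<6::nat. g k) = g 0 + g 1 + g 2 + g 3 + g 4 + (g 5 :: rat)"
  by (simp add: eval_nat_numeral)

text \<open>
  The order of the barycenters is reversed in four steps. In each step the first index is inserted
  once more further back, and the cocycle condition for the resulting 5-simplex is applied: all
  faces that miss one of the indices \<open>0, \<dots>, 4\<close> cancel, and two faces remain.
\<close>

lemma flags_reverse: "flags [4, 3, 2, 1, 0] = flags [0, 1, 2, 3, 4]"
proof -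
  have z: "flags js = 0" if "set js \<subseteq> {..<5}" "\<not> {..<5} \<subseteq> set js" for js
    using flags_zero[of _ js] that by auto
  have "flags [1, 2, 3, 4, 0] - flags [0, 1, 2, 3, 4] = 0"
    using flags_cocycle[of "[0, 1, 2, 3, 4, 0]"] flags_zero[of 1 "[0, 2, 3, 4, 0]"] flags_zero[of 2 "[0, 1, 3, 4, 0]"]
      flags_zero[of 3 "[0, 1, 2, 4, 0]"] flags_zero[of 4 "[0, 1, 2, 3, 0]"] unfolding sum_six by simp
  moreover have "flags [2, 3, 4, 1, 0] + flags [1, 2, 3, 4, 0] = 0"
    using flags_cocycle[of "[1, 2, 3, 4, 1, 0]"] flags_zero[of 2 "[1, 3, 4, 1, 0]"] flags_zero[of 3 "[1, 2, 4, 1, 0]"]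
      flags_zero[of 4 "[1, 2, 3, 1, 0]"] flags_zero[of 0 "[1, 2, 3, 4, 1]"] unfolding sum_six by simp
  moreover have "flags [3, 4, 2, 1, 0] - flags [2, 3, 4, 1, 0] = 0"
    using flags_cocycle[of "[2, 3, 4, 2, 1, 0]"] flags_zero[of 3 "[2, 4, 2, 1, 0]"] flags_zero[of 4 "[2, 3, 2, 1, 0]"]
      flags_zero[of 1 "[2, 3, 4, 2, 0]"] flags_zero[of 0 "[2, 3, 4, 2, 1]"] unfolding sum_six by simp
  moreover have "flags [4, 3, 2, 1, 0] + flags [3, 4, 2, 1, 0] = 0"
    using flags_cocycle[of "[3, 4, 3, 2, 1, 0]"] flags_zero[of 4 "[3, 3, 2, 1, 0]"] flags_zero[of 2 "[3, 4, 3, 1, 0]"]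
      flags_zero[of 1 "[3, 4, 3, 2, 0]"] flags_zero[of 0 "[3, 4, 3, 2, 1]"] unfolding sum_six by simp
  ultimately show ?thesis by linarith
qed

definition cone :: "nat \<Rightarrow> nat list \<Rightarrow> nat set list" where
  "cone m y = map (initial y) (rev [m..<5]) @ map (\<lambda>v. {v}) (take m y)"

text \<open>
  Sums over simplices that use barycenters of the faces of dimension at least \<open>m\<close> and, instead of
  the smaller faces, the vertices of the face of dimension \<open>m - 1\<close> in increasing order. From
  \<open>m = 1\<close>, the barycentric subdivision, to \<open>m = 5\<close>, the facets themselves.
\<close>

definition mixed_sum :: "nat \<Rightarrow> rat" where
  "mixed_sum m = (\<Sum>y\<in>sorted_up_to m. of_int (\<omega> y) * \<Phi> (cone m y))"

lemma sorted_up_to_sum: "(\<Sum>y\<in>sorted_up_to m. h y) = (\<Sum>y\<in>orderings. if sorted_wrt (<) (take m y) then h y else (0::rat))"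
  unfolding sorted_up_to_def using finite_orderings by (simp add: sum.inter_filter)

text \<open>
  The cocycle condition for the 5-simplices that use both the barycenter of the face of dimension
  \<open>m\<close> and all its vertices. Omitting a larger barycenter gives a sum that cancels; omitting this
  barycenter gives \<open>mixed_sum (Suc m)\<close>; omitting one of the vertices gives, over all choices,
  \<open>- mixed_sum m\<close>.
\<close>

lemma mixed_sum_step:
  assumes m: "1 \<le> m" "m < 5"
  shows "(-1) ^ (4 - m) * mixed_sum (Suc m) = mixed_sum m"
proof -
  define C where "C y = map (initial y) (rev [m..<5]) @ map (\<lambda>v. {v}) (take (Suc m) y)" for y
  have lC: "length (C y) = 6" if "y \<in> orderings" for y using that m by (simp add: C_def orderings_iff)
  have bd: "(\<Sum>k<6. (-1) ^ k * \<Phi> (take k (C y) @ drop (Suc k) (C y))) = 0" if y: "y \<in> orderings" for y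
  proof (rule cocycle[of "set y"])
    show "\<forall>S\<in>set (C y). S \<noteq> {} \<and> S \<subseteq> set y"
      unfolding C_def using initial_bound[OF y] by (auto dest: in_set_takeD)
  qed (use y lC in \<open>auto simp: orderings_iff\<close>)
  define R where "R k = (\<Sum>y\<in>sorted_up_to (Suc m). of_int (\<omega> y) * \<Phi> (take k (C y) @ drop (Suc k) (C y)))" for k
  have SY: "y \<in> orderings" if "y \<in> sorted_up_to k" for y k using that by (simp add: sorted_up_to_def)
  have "(\<Sum>k<6. (-1) ^ k * R k) = (\<Sum>y\<in>sorted_up_to (Suc m). of_int (\<omega> y) * (\<Sum>k<6. (-1) ^ k * \<Phi> (take k (C y) @ drop (Suc k) (C y))))"
    unfolding R_def sum_distrib_left by (subst sum.swap) (simp add: ac_simps)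
  also have "\<dots> = 0" by (rule sum.neutral) (simp add: bd SY)
  finally have total: "(\<Sum>k<6. (-1) ^ k * R k) = 0" .
  have early: "R k = 0" if k: "k < 4 - m" for k
    unfolding R_def sorted_up_to_sum
  proof -
    let ?F = "\<lambda>y. if sorted_wrt (<) (take (Suc m) y) then \<Phi> (take k (C y) @ drop (Suc k) (C y)) else 0"
    have "(\<Sum>y\<in>orderings. of_int (\<omega> y) * ?F y) = 0"
    proof (rule flag_sum_zero[of "4 - k" "Suc m"])
      fix y y' assume y: "y \<in> orderings" "y' \<in> orderings" and e: "\<And>j. j < 5 \<Longrightarrow> j \<noteq> 4 - k \<Longrightarrow> initial y j = initial y' j"
        and t: "take (Suc m) y = take (Suc m) y'"
      have r: "rev [m..<5] = rev [5 - k..<5] @ (4 - k) # rev [m..<4 - k]"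
      proof -
        have "[m..<5] = [m..<4 - k] @ [4 - k..<5]" using k upt_add_eq_append[of m "4 - k" "Suc k"] by simp
        also have "[4 - k..<5] = (4 - k) # [5 - k..<5]" proof -
          have "Suc (4 - k) = 5 - k" "4 - k < 5" using k by arith+
          then show ?thesis by (metis upt_conv_Cons)
        qed
        finally show ?thesis by simp
      qed
      have c: "take k (C y) @ drop (Suc k) (C y) =
          map (initial y) (rev [5 - k..<5] @ rev [m..<4 - k]) @ map (\<lambda>v. {v}) (take (Suc m) y)" for y
        using k unfolding C_def r by simp
      have "map (initial y) (rev [5 - k..<5] @ rev [m..<4 - k]) = map (initial y') (rev [5 - k..<5] @ rev [m..<4 - k])"
        using e k by (intro map_cong) auto
      then show "?F y = ?F y'" unfolding c t by (simp only:)
    qed (use k in auto)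
    moreover have "of_int (\<omega> y) * ?F y = (if sorted_wrt (<) (take (Suc m) y) then of_int (\<omega> y) * \<Phi> (take k (C y) @ drop (Suc k) (C y)) else 0)" for y
      by simp
    ultimately show "(\<Sum>y\<in>orderings. if sorted_wrt (<) (take (Suc m) y) then of_int (\<omega> y) * \<Phi> (take k (C y) @ drop (Suc k) (C y)) else 0) = 0"
      by simp
  qed
  have mid: "R (4 - m) = mixed_sum (Suc m)"
  proof -
    have r: "[m..<5] = m # [Suc m..<5]" using m by (simp add: upt_conv_Cons)
    have "take (4 - m) (C y) @ drop (Suc (4 - m)) (C y) = cone (Suc m) y" for y
      using m unfolding C_def cone_def r by (simp add: Suc_diff_le)
    then show ?thesis by (simp add: R_def mixed_sum_def)
  qed
  have late: "(\<Sum>i\<le>m. (-1) ^ (5 - m + i) * R (5 - m + i)) = - mixed_sum m"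
  proof -
    have c: "take (5 - m + i) (C y) @ drop (Suc (5 - m + i)) (C y) = cone m (move_to m i y)"
      if y: "y \<in> orderings" and i: "i \<le> m" for y i
    proof -
      have ly: "m < length y" using y m by (simp add: orderings_iff)
      obtain xs a us ys where s: "y = xs @ a # us @ ys" "length xs = i" "length us = m - i" "move_to m i y = xs @ us @ a # ys"
        using move_to_split[OF i ly] .
      have t: "take (Suc m) y = xs @ a # us" "take m (move_to m i y) = xs @ us"
        using s i by (intro take_prefix[of _ _ ys] take_prefix[of _ _ "a # ys"]; simp)+
      have b: "map (initial (move_to m i y)) (rev [m..<5]) = map (initial y) (rev [m..<5])"
        using move_to_props(3)[OF y i m(2)] by (intro map_cong) auto
      show ?thesis unfolding C_def cone_def b t using s(2) m by simp
    qed
    have "(\<Sum>i\<le>m. (-1) ^ (5 - m + i) * R (5 - m + i)) =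
        (\<Sum>i\<le>m. \<Sum>y\<in>sorted_up_to (Suc m). - (of_int (\<omega> (move_to m i y)) * \<Phi> (cone m (move_to m i y))))"
    proof (rule sum.cong[OF refl])
      fix i assume "i \<in> {..m}"
      then have i: "i \<le> m" by simp
      have sg: "(-1 :: rat) ^ (5 - m + i) * (-1) ^ (m - i) = -1"
      proof -
        have "5 - m + i + (m - i) = 5" using i m by simp
        then have "(-1 :: rat) ^ (5 - m + i) * (-1) ^ (m - i) = (-1) ^ 5" by (metis power_add)
        then show ?thesis by simp
      qed
      have "(-1) ^ (5 - m + i) * (of_int (\<omega> y) * \<Phi> (take (5 - m + i) (C y) @ drop (Suc (5 - m + i)) (C y)))
          = - (of_int (\<omega> (move_to m i y)) * \<Phi> (cone m (move_to m i y)))" if y: "y \<in> sorted_up_to (Suc m)" for y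
      proof -
        have "of_int (\<omega> y) = (-1 :: rat) ^ (m - i) * of_int (\<omega> (move_to m i y))"
          using move_to_props(2)[OF SY[OF y] i m(2)] by simp
        then have "(-1) ^ (5 - m + i) * (of_int (\<omega> y) * \<Phi> (cone m (move_to m i y)))
          = ((-1 :: rat) ^ (5 - m + i) * (-1) ^ (m - i)) * (of_int (\<omega> (move_to m i y)) * \<Phi> (cone m (move_to m i y)))"
          by (simp only: mult.assoc)
        then show ?thesis unfolding sg c[OF SY[OF y] i] by simp
      qed
      then show "(-1) ^ (5 - m + i) * R (5 - m + i) = (\<Sum>y\<in>sorted_up_to (Suc m). - (of_int (\<omega> (move_to m i y)) * \<Phi> (cone m (move_to m i y))))"
        unfolding R_def sum_distrib_left by (intro sum.cong) simp_all
    qed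
    also have "\<dots> = - (\<Sum>y\<in>sorted_up_to (Suc m). \<Sum>i\<le>m. of_int (\<omega> (move_to m i y)) * \<Phi> (cone m (move_to m i y)))"
      by (subst sum.swap) (simp add: sum_negf)
    also have "\<dots> = - mixed_sum m" unfolding mixed_sum_def insertion_sum[OF m(2), of "\<lambda>z. of_int (\<omega> z) * \<Phi> (cone m z)"] ..
    finally show ?thesis .
  qed
  have "(\<Sum>k<6. (-1) ^ k * R k) = (\<Sum>k<4 - m. (-1) ^ k * R k) + (-1) ^ (4 - m) * R (4 - m) + (\<Sum>i\<le>m. (-1) ^ (5 - m + i) * R (5 - m + i))"
  proof -
    have s6: "{..<6} = {..<5 - m} \<union> {5 - m..<6}" using m by auto
    have "(\<Sum>k<6. (-1) ^ k * R k) = (\<Sum>k<5 - m. (-1) ^ k * R k) + (\<Sum>k=5 - m..<6. (-1) ^ k * R k)"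
      unfolding s6 by (rule sum.union_disjoint) auto
    also have "5 - m = Suc (4 - m)" using m by simp
    then have "(\<Sum>k<5 - m. (-1) ^ k * R k) = (\<Sum>k<4 - m. (-1) ^ k * R k) + (-1) ^ (4 - m) * R (4 - m)" by simp
    also have "(\<Sum>k=5 - m..<6. (-1) ^ k * R k) = (\<Sum>i\<le>m. (-1) ^ (5 - m + i) * R (5 - m + i))"
      by (rule sum.reindex_bij_witness[of _ "\<lambda>i. 5 - m + i" "\<lambda>k. k - (5 - m)"]) (use m in auto)
    finally show ?thesis .
  qed
  then show ?thesis using total early mid late by simp
qed

lemma flags_to_facets: "flags [0, 1, 2, 3, 4] = (\<Sum>y\<in>sorted_up_to 5. of_int (\<omega> y) * \<Phi> (map (\<lambda>v. {v}) y))"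
proof -
  have "mixed_sum 1 = flags [4, 3, 2, 1, 0]"
  proof -
    have "cone 1 y = map (initial y) [4, 3, 2, 1, 0]" "sorted_wrt (<) (take 1 y)" if "y \<in> orderings" for y
      using five[OF that] by (auto simp: cone_def initial_def upt_rec)
    then show ?thesis unfolding mixed_sum_def flags_def sorted_up_to_sum by (intro sum.cong) simp_all
  qed
  moreover have "mixed_sum 5 = (\<Sum>y\<in>sorted_up_to 5. of_int (\<omega> y) * \<Phi> (map (\<lambda>v. {v}) y))"
    unfolding mixed_sum_def by (intro sum.cong) (auto simp: cone_def sorted_up_to_def orderings_iff)
  moreover have "mixed_sum 1 = mixed_sum 5"
    using mixed_sum_step[of 1] mixed_sum_step[of 2] mixed_sum_step[of 3] mixed_sum_step[of 4] by (simp add: eval_nat_numeral)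
  ultimately show ?thesis using flags_reverse by simp
qed

end

end

section \<open>The sum over the vertices and the signature\<close>

lemma eval_cochain_superset:
  assumes "finite A" "Poly_Mapping.keys x \<subseteq> A"
  shows "eval_cochain c x = (\<Sum>s\<in>A. of_int (Poly_Mapping.lookup x s) * c s)"
  unfolding eval_cochain_def
  by (rule sum.mono_neutral_left[OF assms]) (auto simp: in_keys_iff)

lemma eval_cochain_add: "eval_cochain c (x + y) = eval_cochain c x + eval_cochain c y"
proof -
  let ?A = "Poly_Mapping.keys x \<union> Poly_Mapping.keys y"
  have "eval_cochain c (x + y) = (\<Sum>s\<in>?A. of_int (Poly_Mapping.lookup (x + y) s) * c s)"
    by (rule eval_cochain_superset) (auto dest: keys_add[THEN subsetD])
  also have "\<dots> = (\<Sum>s\<in>?A. of_int (Poly_Mapping.lookup x s) * c s) + (\<Sum>s\<in>?A. of_int (Poly_Mapping.lookup y s) * c s)"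
    by (simp add: lookup_add algebra_simps sum.distrib)
  also have "\<dots> = eval_cochain c x + eval_cochain c y"
    by (subst (1 2) eval_cochain_superset[symmetric]) auto
  finally show ?thesis .
qed

lemma eval_cochain_0: "eval_cochain c 0 = 0"
  by (simp add: eval_cochain_def)

lemma eval_cochain_sum: "eval_cochain c (\<Sum>i\<in>I. x i) = (\<Sum>i\<in>I. eval_cochain c (x i))"
  by (induction I rule: infinite_finite_induct) (simp_all add: eval_cochain_0 eval_cochain_add)

lemma eval_cochain_cmul: "eval_cochain c (frag_cmul k (frag_of s)) = of_int k * c s"
proof -
  have "eval_cochain c (frag_cmul k (frag_of s)) = (\<Sum>t\<in>{s}. of_int (Poly_Mapping.lookup (frag_cmul k (frag_of s)) t) * c t)"
    by (rule eval_cochain_superset) (auto simp: keys_cmul)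
  then show ?thesis by simp
qed

lemma vertex_point_barycenter: "vertex_point v = barycenter {v}"
  by (auto simp: vertex_point_def barycenter_def)

lemma barycenter_props:
  assumes "finite S" "S \<noteq> {}"
  shows "barycenter S v \<ge> 0" "v \<notin> S \<Longrightarrow> barycenter S v = 0" "finite A \<Longrightarrow> S \<subseteq> A \<Longrightarrow> (\<Sum>v\<in>A. barycenter S v) = 1"
proof -
  show "barycenter S v \<ge> 0" "v \<notin> S \<Longrightarrow> barycenter S v = 0" by (auto simp: barycenter_def)
  assume A: "finite A" "S \<subseteq> A"
  have "(\<Sum>v\<in>A. barycenter S v) = (\<Sum>v\<in>S. 1 / real (card S))"
    by (rule sum.mono_neutral_cong_right) (use A in \<open>auto simp: barycenter_def\<close>)
  also have "\<dots> = 1" using assms by simp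
  finally show "(\<Sum>v\<in>A. barycenter S v) = 1" .
qed

lemma barycentric_simplex:
  assumes K: "finite_complex K" and s: "\<sigma> \<in> K" and S: "\<And>j. j \<le> p \<Longrightarrow> l j \<noteq> {} \<and> l j \<subseteq> \<sigma>"
  shows "singular_simplex p (polyhedron K) (oriented_simplex p (\<lambda>j. barycenter (l j)))"
  unfolding polyhedron_def
proof (rule simplicial_imp_singular_simplex, unfold simplicial_simplex_oriented_simplex, rule image_subsetI)
  fix x assume x: "x \<in> standard_simplex p"
  have fin: "finite \<sigma>" using finite_complexD(3)[OF K s] .
  have x0: "0 \<le> x j" and x1: "(\<Sum>j\<le>p. x j) = 1" for j using x by (auto simp: standard_simplex_def)
  have fl: "finite (l j)" if "j \<le> p" for j using S[OF that] fin finite_subset by blast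
  note b = barycenter_props[OF fl conjunct1[OF S]]
  show "(\<lambda>i. \<Sum>j\<le>p. barycenter (l j) i * x j) \<in> realization K"
  proof (rule realizationI[OF K s])
    show "{v. (\<Sum>j\<le>p. barycenter (l j) v * x j) \<noteq> 0} \<subseteq> \<sigma>"
    proof
      fix v assume "v \<in> {v. (\<Sum>j\<le>p. barycenter (l j) v * x j) \<noteq> 0}"
      then obtain j where "j \<le> p" "barycenter (l j) v \<noteq> 0" by (metis (mono_tags, lifting) atMost_iff mem_Collect_eq mult_zero_left sum.neutral)
      then show "v \<in> \<sigma>" using b(2)[of j v] S[of j] by blast
    qed
    show "0 \<le> (\<Sum>j\<le>p. barycenter (l j) v * x j)" for v
      by (rule sum_nonneg) (use b(1) x0 in auto)
    have "(\<Sum>v\<in>\<sigma>. \<Sum>j\<le>p. barycenter (l j) v * x j) = (\<Sum>j\<le>p. (\<Sum>v\<in>\<sigma>. barycenter (l j) v) * x j)"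
      by (subst sum.swap) (simp add: sum_distrib_right)
    also have "\<dots> = (\<Sum>j\<le>p. x j)" using b(3)[OF _ _ fin] S by (intro sum.cong) auto
    finally show "(\<Sum>v\<in>\<sigma>. \<Sum>j\<le>p. barycenter (l j) v * x j) = 1" using x1 by simp
  qed
qed

text \<open>
  A singular cochain evaluated on the affine simplex spanned by barycenters.
\<close>

definition flag_cochain :: "(nat \<Rightarrow> real) scochain \<Rightarrow> nat set list \<Rightarrow> rat" where
  "flag_cochain c Ss = c (oriented_simplex 4 (\<lambda>j. barycenter (Ss ! j)))"

lemma flag_cocycle:
  assumes K: "finite_complex K" and c: "c \<in> singular_cocycles 4 (polyhedron K)"
    and s: "\<sigma> \<in> K" and S: "length Ss = 6" "\<forall>S\<in>set Ss. S \<noteq> {} \<and> S \<subseteq> \<sigma>"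
  shows "(\<Sum>k<6. (-1) ^ k * flag_cochain c (take k Ss @ drop (Suc k) Ss)) = 0"
proof -
  let ?o = "oriented_simplex 5 (\<lambda>j. barycenter (Ss ! j))"
  have ss: "singular_simplex 5 (polyhedron K) ?o"
    by (rule barycentric_simplex[OF K s]) (use S in auto)
  have "Suc 4 = (5 :: nat)" by simp
  then have "eval_cochain c (chain_boundary 5 (frag_of ?o)) = 0"
    using c ss unfolding singular_cocycles_def by (metis (mono_tags, lifting) mem_Collect_eq)
  also have "chain_boundary 5 (frag_of ?o) = (\<Sum>k\<le>5. frag_cmul ((-1) ^ k) (frag_of (singular_face 5 k ?o)))"
    by (simp add: chain_boundary_of)
  also have "eval_cochain c \<dots> = (\<Sum>k\<le>5. (-1) ^ k * c (singular_face 5 k ?o))"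
    by (simp add: eval_cochain_sum eval_cochain_cmul)
  also have "\<dots> = (\<Sum>k<6. (-1) ^ k * flag_cochain c (take k Ss @ drop (Suc k) Ss))"
  proof (rule sum.cong)
    show "{..5} = {..<6::nat}" by auto
    fix k :: nat assume "k \<in> {..<6}"
    then have k: "k \<le> 5" by simp
    have "singular_face 5 k ?o = oriented_simplex 4 (\<lambda>j. barycenter ((take k Ss @ drop (Suc k) Ss) ! j))"
    proof -
      have "singular_face 5 k ?o = oriented_simplex 4 (\<lambda>j. if j < k then barycenter (Ss ! j) else barycenter (Ss ! Suc j))"
        using singular_face_oriented_simplex[of 5 k] k by simp
      also have "\<dots> = oriented_simplex 4 (\<lambda>j. barycenter ((take k Ss @ drop (Suc k) Ss) ! j))"
        unfolding oriented_simplex_eq using k S(1) by (auto simp: nth_append)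
      finally show ?thesis .
    qed
    then show "(-1) ^ k * c (singular_face 5 k ?o) = (-1) ^ k * flag_cochain c (take k Ss @ drop (Suc k) Ss)"
      by (simp add: flag_cochain_def)
  qed
  finally show ?thesis by simp
qed

lemma orientation_induced:
  assumes "orientation (Suc n) K \<omega>"
  shows "orientation n (link K {v}) (induced \<omega> v)"
proof -
  note o = assms[unfolded orientation_def]
  note o1 = conjunct1[OF o, rule_format]
    and o2 = conjunct1[OF conjunct2[OF o], rule_format]
    and o3 = conjunct1[OF conjunct2[OF conjunct2[OF o]], rule_format]
    and o4 = conjunct2[OF conjunct2[OF conjunct2[OF o]], rule_format]
  show ?thesis
    unfolding orientation_def induced_def
  proof (intro conjI allI impI)
    show "\<omega> (v # xs) \<in> {-1, 0, 1}" for xs by (rule o1)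
    show "(\<omega> (v # xs) \<noteq> 0) = (length xs = n \<and> distinct xs \<and> set xs \<in> link K {v})" for xs
      unfolding o2 by (auto simp: link_def)
    show "\<omega> (v # xs @ a # b # ys) = - \<omega> (v # xs @ b # a # ys)" for xs a b ys
      using o3[of "v # xs" a b ys] by simp
    fix a b xs assume ab: "a \<noteq> b" "\<omega> (v # a # xs) \<noteq> 0" "\<omega> (v # b # xs) \<noteq> 0"
    have s: "\<omega> (v # d # xs) = - \<omega> (d # v # xs)" for d using o3[of "[]" v d xs] by simp
    have "\<omega> (b # v # xs) = - \<omega> (a # v # xs)"
      by (rule o4) (use ab s[of a] s[of b] in auto)
    then show "\<omega> (v # b # xs) = - \<omega> (v # a # xs)" using s[of a] s[of b] by simp
  qed
qed

context closed_oriented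
begin

text \<open>
  The dual cells of the vertices consist of the simplices of the barycentric subdivision, one for
  each flag, and the cocycle takes the same value on the subdivision and on the facets.
\<close>

lemma dual_cells_sum:
  assumes c: "c \<in> singular_cocycles 4 (polyhedron K)"
  shows "(\<Sum>v\<in>\<Union>K. eval_cochain c (dual_cell 4 ({v}, induced \<omega> v))) = eval_cochain c (fundamental_cycle 4 K \<omega>)"
proof -
  let ?F = "flag_cochain c"
  have coc: "\<And>Ss \<sigma>. \<sigma> \<in> K \<Longrightarrow> length Ss = 6 \<Longrightarrow> (\<forall>S\<in>set Ss. S \<noteq> {} \<and> S \<subseteq> \<sigma>) \<Longrightarrow>
    (\<Sum>k<6. (-1) ^ k * ?F (take k Ss @ drop (Suc k) Ss)) = 0"
    by (rule flag_cocycle[OF K c])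
  let ?I = "\<lambda>v. {xs. \<omega> (v # xs) \<noteq> 0}"
  have finI: "finite (?I v)" for v
  proof -
    have "(\<lambda>xs. v # xs) ` ?I v \<subseteq> orderings" by (auto simp: orderings_def)
    then have "finite ((\<lambda>xs. v # xs) ` ?I v)" using finite_orderings finite_subset by blast
    then show ?thesis by (rule finite_imageD) (simp add: inj_on_def)
  qed
  have "eval_cochain c (dual_cell 4 ({v}, induced \<omega> v)) =
      (\<Sum>xs\<in>?I v. of_int (\<omega> (v # xs)) * ?F (map (initial (v # xs)) [0, 1, 2, 3, 4]))" for v
  proof -
    have "oriented_simplex 4 (\<lambda>j. barycenter ({v} \<union> set (take j xs))) =
        oriented_simplex 4 (\<lambda>j. barycenter (map (initial (v # xs)) [0, 1, 2, 3, 4] ! j))" for xs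
      unfolding oriented_simplex_eq
    proof (intro allI impI)
      fix i :: nat assume "i \<le> 4"
      then have "i = 0 \<or> i = 1 \<or> i = 2 \<or> i = 3 \<or> i = 4" by auto
      then have "map (initial (v # xs)) [0, 1, 2, 3, 4] ! i = initial (v # xs) i" by auto
      then show "barycenter ({v} \<union> set (take i xs)) = barycenter (map (initial (v # xs)) [0, 1, 2, 3, 4] ! i)" by (simp add: initial_def)
    qed
    then show ?thesis
      unfolding dual_cell_def eval_cochain_sum eval_cochain_cmul by (simp add: induced_def flag_cochain_def)
  qed
  then have "(\<Sum>v\<in>\<Union>K. eval_cochain c (dual_cell 4 ({v}, induced \<omega> v))) =
      (\<Sum>v\<in>\<Union>K. \<Sum>xs\<in>?I v. of_int (\<omega> (v # xs)) * ?F (map (initial (v # xs)) [0, 1, 2, 3, 4]))" by simp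
  also have "\<dots> = (\<Sum>(v, xs)\<in>Sigma (\<Union>K) ?I. of_int (\<omega> (v # xs)) * ?F (map (initial (v # xs)) [0, 1, 2, 3, 4]))"
    by (rule sum.Sigma) (use finI finite_complexD(5)[OF K] in auto)
  also have "\<dots> = (\<Sum>y\<in>orderings. of_int (\<omega> y) * ?F (map (initial y) [0, 1, 2, 3, 4]))"
  proof (rule sum.reindex_bij_witness[of _ "\<lambda>y. (hd y, tl y)" "\<lambda>p. fst p # snd p"])
    fix y assume y: "y \<in> orderings"
    then have "y \<noteq> []" "set y \<in> K" by (auto simp: orderings_iff)
    then show "(hd y, tl y) \<in> Sigma (\<Union>K) ?I" "fst (hd y, tl y) # snd (hd y, tl y) = y"
      using y UnionI[OF \<open>set y \<in> K\<close> hd_in_set[OF \<open>y \<noteq> []\<close>]] by (auto simp: orderings_def)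
  qed (auto simp: orderings_def)
  also have "\<dots> = flags ?F [0, 1, 2, 3, 4]" by (simp only: flags_def[OF coc])
  also have "\<dots> = (\<Sum>y\<in>sorted_up_to 5. of_int (\<omega> y) * ?F (map (\<lambda>v. {v}) y))" by (rule flags_to_facets[OF coc])
  also have "\<dots> = eval_cochain c (fundamental_cycle 4 K \<omega>)"
  proof -
    have Z: "{xs. length xs = Suc 4 \<and> sorted_wrt (<) xs \<and> set xs \<in> K} = sorted_up_to 5"
      by (auto simp: sorted_up_to_def orderings_iff strict_sorted_iff)
    have "c (oriented_simplex 4 (\<lambda>j. vertex_point (y ! j))) = ?F (map (\<lambda>v. {v}) y)" if "y \<in> sorted_up_to 5" for y
    proof -
      have "length y = 5" using that by (simp add: sorted_up_to_def orderings_iff)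
      then have "oriented_simplex 4 (\<lambda>j. vertex_point (y ! j)) = oriented_simplex 4 (\<lambda>j. barycenter (map (\<lambda>v. {v}) y ! j))"
        by (simp add: oriented_simplex_eq vertex_point_barycenter)
      then show ?thesis by (simp add: flag_cochain_def)
    qed
    then show ?thesis
      unfolding fundamental_cycle_def Z eval_cochain_sum eval_cochain_cmul by simp
  qed
  finally show ?thesis .
qed

text \<open>
  Each edge contributes twice, once for either end, and the induced coorientations are opposite.
\<close>

lemma boundary_total:
  fixes b :: "nat set \<times> orient \<Rightarrow> rat"
  assumes b: "b \<in> cooriented_chains 4 K 3"
  shows "(\<Sum>v\<in>\<Union>K. cooriented_boundary 4 K 3 b ({v}, induced \<omega> v)) = 0"
proof -
  have cell: "cooriented_cell 4 K (Suc 3) ({v}, induced \<omega> v)" if "v \<in> \<Union>K" for v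
  proof -
    have "{v} \<in> K" using that finite_complexD(4)[OF K] by (metis Union_iff empty_subsetI insert_subset)
    moreover have "orientation 4 (link K {v}) (induced \<omega> v)" using orientation_induced[of 4 K \<omega> v] orient by simp
    ultimately show ?thesis by (simp add: cooriented_cell_def)
  qed
  let ?h = "\<lambda>v w. b ({w, v}, induced (induced \<omega> v) w)"
  have across: "orientation n L (opposite o') \<longleftrightarrow> orientation n L o'" for n L o'
    using orientation_opposite[of n L o'] orientation_opposite[of n L "opposite o'"] by (auto simp: opposite_def)
  have anti: "?h v w = - ?h w v" for v w
  proof -
    have "induced (induced \<omega> v) w = opposite (induced (induced \<omega> w) v)"
    proof
      fix xs show "induced (induced \<omega> v) w xs = opposite (induced (induced \<omega> w) v) xs"
        using swap[of "[]" v w xs] by (simp add: induced_def opposite_def)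
    qed
    moreover have "b (\<sigma>, opposite o') = - b (\<sigma>, o')" for \<sigma> o'
    proof (cases "cooriented_cell 4 K 3 (\<sigma>, o')")
      case True
      then show ?thesis using b by (simp add: cooriented_chains_def)
    next
      case False
      then have "\<not> cooriented_cell 4 K 3 (\<sigma>, opposite o')" by (simp add: cooriented_cell_def across)
      then show ?thesis using False b by (simp add: cooriented_chains_def)
    qed
    ultimately show ?thesis by (simp add: insert_commute)
  qed
  have zero: "?h v w = 0" if "w \<notin> \<Union>(link K {v})" for v w
  proof -
    have "\<not> cooriented_cell 4 K 3 ({w, v}, induced (induced \<omega> v) w)"
    proof
      assume "cooriented_cell 4 K 3 ({w, v}, induced (induced \<omega> v) w)"
      then have a: "{w, v} \<in> K" "card {w, v} = 2" by (auto simp: cooriented_cell_def)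
      then have "w \<noteq> v" by auto
      then have "{w} \<in> link K {v}" using a(1) by (auto simp: link_def insert_commute)
      then show False using that by blast
    qed
    then show ?thesis using b by (simp add: cooriented_chains_def)
  qed
  have sub: "\<Union>(link K {v}) \<subseteq> \<Union>K" for v by (auto simp: link_def)
  have finU: "finite (\<Union>K)" by (rule finite_complexD(5)[OF K])
  have "(\<Sum>v\<in>\<Union>K. cooriented_boundary 4 K 3 b ({v}, induced \<omega> v)) = (\<Sum>v\<in>\<Union>K. \<Sum>w\<in>\<Union>(link K {v}). ?h v w)"
    using cell by (simp add: cooriented_boundary_def)
  also have "\<dots> = (\<Sum>v\<in>\<Union>K. \<Sum>w\<in>\<Union>K. ?h v w)"
    by (intro sum.cong refl sum.mono_neutral_left[OF finU sub]) (use zero in auto)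
  finally have e: "(\<Sum>v\<in>\<Union>K. cooriented_boundary 4 K 3 b ({v}, induced \<omega> v)) = (\<Sum>v\<in>\<Union>K. \<Sum>w\<in>\<Union>K. ?h v w)" .
  have "(\<Sum>v\<in>\<Union>K. \<Sum>w\<in>\<Union>K. ?h v w) = (\<Sum>v\<in>\<Union>K. \<Sum>w\<in>\<Union>K. ?h w v)" by (rule sum.swap)
  also have "\<dots> = (\<Sum>v\<in>\<Union>K. \<Sum>w\<in>\<Union>K. - ?h v w)" by (intro sum.cong refl) (rule anti)
  also have "\<dots> = - (\<Sum>v\<in>\<Union>K. \<Sum>w\<in>\<Union>K. ?h v w)" by (simp add: sum_negf)
  finally show ?thesis using e by simp
qed

lemma singular_cohomology_mem:
  assumes "u \<in> singular_cohomology n Z"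
  obtains c where "c \<in> u" "c \<in> singular_cocycles n Z"
proof -
  obtain c where c: "c \<in> singular_cocycles n Z" "u = {(c, c'). c \<in> singular_cocycles n Z \<and> c' \<in> singular_cocycles n Z \<and>
                 (\<lambda>s. c' s - c s) \<in> singular_coboundaries n Z} `` {c}"
    using assms unfolding singular_cohomology_def by (elim quotientE) blast
  have "(\<lambda>s. c s - c s) \<in> singular_coboundaries n Z"
    unfolding singular_coboundaries_def by (auto intro!: exI[of _ "\<lambda>_. 0"] simp: eval_cochain_def)
  then have "c \<in> u" unfolding c(2) using c(1) by blast
  then show ?thesis using that c(1) by blast
qed

lemma sharp_cycle:
  fixes f :: "ocomplex \<Rightarrow> rat"
  assumes f: "f \<in> local_cochains 4" and M: "combinatorial_manifold 4 K"
  shows "sharp 4 K 4 f \<in> cooriented_cycles 4 K 4"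
proof -
  have anti: "sharp 4 K 4 f (\<sigma>, opposite o') = - sharp 4 K 4 f (\<sigma>, o')" if c: "cooriented_cell 4 K 4 (\<sigma>, o')" for \<sigma> o'
  proof -
    have s: "\<sigma> \<in> K" "\<sigma> \<noteq> {}" "card \<sigma> = 1" "orientation 4 (link K \<sigma>) o'" using c by (auto simp: cooriented_cell_def)
    have "pl_sphere 4 (link K \<sigma>)" using M s(1-3) by (auto simp: combinatorial_manifold_def)
    then have "oriented_sphere 4 (link K \<sigma>, o')" using s(4) by (simp add: oriented_sphere_def)
    then have "f (link K \<sigma>, opposite o') = - f (link K \<sigma>, o')" using f by (auto simp: local_cochains_def)
    moreover have "cooriented_cell 4 K 4 (\<sigma>, opposite o')"
      using c orientation_opposite[OF s(4)] by (simp add: cooriented_cell_def)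
    ultimately show ?thesis using c by (simp add: sharp_def)
  qed
  have "cooriented_boundary 4 K 4 (sharp 4 K 4 f) = (\<lambda>_. 0)"
  proof
    fix d show "cooriented_boundary 4 K 4 (sharp 4 K 4 f) d = 0"
    proof -
      have "finite (fst d)" if "fst d \<in> K" using finite_complexD(3)[OF K that] .
      then have "\<not> cooriented_cell 4 K (Suc 4) d" by (auto simp: cooriented_cell_def card_eq_0_iff)
      then show ?thesis by (simp add: cooriented_boundary_def)
    qed
  qed
  then show ?thesis using anti by (auto simp: cooriented_cycles_def cooriented_chains_def sharp_def)
qed

text \<open>
  The manifold in itself, without normal directions and without a Euclidean factor.
\<close>

lemma framed_identity:
  "framed_embedding 4 K 0 K 0 (\<lambda>x. x)"
proof -
  have u: "unit_cube 0 = {\<lambda>_. 0}" by (auto simp: unit_cube_def real_space_def)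
  have r: "real_space 0 = {\<lambda>_. 0}" by (auto simp: real_space_def)
  let ?i = "\<lambda>x :: nat \<Rightarrow> real. case_sum x (\<lambda>_::nat. 0::real)"
  have p: "product_space Z {\<lambda>_. 0} = ?i ` Z" for Z by (auto simp: product_space_def)
  have com: "combination (?i ` P) t (\<lambda>p. p) = ?i (combination P (\<lambda>p. t (?i p)) (\<lambda>p. p))" if "finite P" for P t
  proof
    have inj: "inj_on ?i P" by (rule inj_onI, rule ext) (metis sum.case(1))
    fix k show "combination (?i ` P) t (\<lambda>p. p) k = ?i (combination P (\<lambda>p. t (?i p)) (\<lambda>p. p)) k"
      unfolding combination_def by (simp add: sum.reindex[OF inj] split: sum.split)
  qed
  have hull: "{combination (?i ` P) t (\<lambda>p. p) | t. t \<in> weights (?i ` P)} = ?i ` hull_of P" if P: "finite P" for P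
  proof -
    have inj: "inj_on ?i P" by (rule inj_onI, rule ext) (metis sum.case(1))
    have w: "t \<in> weights (?i ` P) \<longleftrightarrow> (\<lambda>p. t (?i p)) \<in> weights P" for t
      by (simp add: weights_def sum.reindex[OF inj])
    show ?thesis
    proof (intro subset_antisym subsetI)
      fix x assume "x \<in> {combination (?i ` P) t (\<lambda>p. p) | t. t \<in> weights (?i ` P)}"
      then show "x \<in> ?i ` hull_of P" using com[OF P] w by (auto simp: hull_of_def)
    next
      fix x assume "x \<in> ?i ` hull_of P"
      then obtain t where t: "t \<in> weights P" "x = ?i (combination P t (\<lambda>p. p))" by (auto simp: hull_of_def)
      let ?t = "\<lambda>q. t (\<lambda>k. q (Inl k))"
      have "(\<lambda>p. ?t (?i p)) = t" by simp
      then have "?t \<in> weights (?i ` P)" "x = combination (?i ` P) ?t (\<lambda>p. p)"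
        using w[of ?t] com[OF P, of ?t] t by simp_all
      then show "x \<in> {combination (?i ` P) t (\<lambda>p. p) | t. t \<in> weights (?i ` P)}" by blast
    qed
  qed
  let ?P = "(\<lambda>\<sigma>. ?i ` vertex_point ` \<sigma>) ` K"
  have fin: "finite (vertex_point ` \<sigma>)" if "\<sigma> \<in> K" for \<sigma> using finite_complexD(3)[OF K that] by simp
  have "pl_map (?i ` realization K) (\<lambda>x. x)"
    unfolding pl_map_def
  proof (intro exI[of _ ?P] conjI ballI)
    show "finite ?P" using finite_complexD(1)[OF K] by simp
    show "finite P" if "P \<in> ?P" for P using that finite_complexD(3)[OF K] by auto
    have "(\<Union>P\<in>?P. {combination P t (\<lambda>p. p) | t. t \<in> weights P}) = (\<Union>\<sigma>\<in>K. ?i ` hull_of (vertex_point ` \<sigma>))"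
      using hull[OF fin] by simp
    then show "?i ` realization K = (\<Union>P\<in>?P. {combination P t (\<lambda>p. p) | t. t \<in> weights P})"
      by (simp add: realization_hulls[OF K] image_UN)
  qed simp
  then show ?thesis unfolding framed_embedding_def u r p by simp
qed

lemma chain_map_core_identity:
  "chain_map 4 (core_map (\<lambda>x. x)) (fundamental_cycle 4 K \<omega>) = fundamental_cycle 4 K \<omega>"
proof -
  have "core_map (\<lambda>x. x) = (\<lambda>x. x)" by (intro ext) (simp add: core_map_def)
  moreover have "simplex_map 4 (\<lambda>x. x) (oriented_simplex 4 l) = oriented_simplex 4 l" for l :: "nat \<Rightarrow> nat \<Rightarrow> real"
    by (auto simp: simplex_map_def oriented_simplex_def restrict_def)
  moreover have "finite {xs. length xs = Suc 4 \<and> sorted_wrt (<) xs \<and> set xs \<in> K}"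
    by (rule finite_subset[OF _ finite_lists_length_eq[OF finite_complexD(5)[OF K], of "Suc 4"]]) auto
  ultimately show ?thesis
    unfolding fundamental_cycle_def by (simp add: chain_map_sum)
qed

text \<open>
  The cycle of \<open>f\<close> and the restriction of a cocycle \<open>c\<close> representing \<open>p\<^sub>1\<close> to dual cells differ by a
  boundary, hence have the same sum over the vertices, and for \<open>c\<close> this sum is its value on the
  fundamental cycle.
\<close>

theorem sum_over_vertices_signature:
  fixes f :: "ocomplex \<Rightarrow> rat"
  assumes \<phi>: "\<phi> \<in> local_cohomology 4" "f \<in> \<phi>" and M: "combinatorial_manifold 4 K"
    and u: "poincare_dual 4 K 4 u (sharp_class 4 K 4 \<phi>)" "first_pontrjagin_class 4 K u"
  shows "(\<Sum>v\<in>\<Union>K. f (link K {v}, induced \<omega> v)) = 3 * of_int (signature K \<omega>)"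
proof -
  have ff: "f \<in> local_formulae 4" using \<phi> unfolding local_cohomology_def by (elim quotientE) auto
  then have fc: "f \<in> local_cochains 4" by (simp add: local_formulae_def)
  obtain c where c: "c \<in> u" "c \<in> singular_cocycles 4 (polyhedron K)"
    using singular_cohomology_mem u(1) unfolding poincare_dual_def by blast
  have "sharp 4 K 4 f \<in> cooriented_class 4 K 4 (sharp 4 K 4 f)"
    using sharp_cycle[OF fc M] by (simp add: cooriented_class_def cooriented_boundaries_def)
  then have "sharp 4 K 4 f \<in> sharp_class 4 K 4 \<phi>" using \<phi>(2) by (auto simp: sharp_class_def)
  then have "sharp 4 K 4 f \<in> cooriented_class 4 K 4 (dual_restriction 4 K 4 c)"
    using u(1) c(1) by (simp add: poincare_dual_def)
  then have bd: "(\<lambda>d. sharp 4 K 4 f d - dual_restriction 4 K 4 c d) \<in> cooriented_boundaries 4 K 4"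
    by (simp add: cooriented_class_def)
  let ?d = "\<lambda>v. ({v}, induced \<omega> v)"
  have cell: "cooriented_cell 4 K 4 (?d v)" if "v \<in> \<Union>K" for v
  proof -
    have "{v} \<in> K" using that finite_complexD(4)[OF K] by (metis Union_iff empty_subsetI insert_subset)
    moreover have "orientation 4 (link K {v}) (induced \<omega> v)" using orientation_induced[of 4 K \<omega> v] orient by simp
    ultimately show ?thesis by (simp add: cooriented_cell_def)
  qed
  have "(\<Sum>v\<in>\<Union>K. sharp 4 K 4 f (?d v) - dual_restriction 4 K 4 c (?d v)) = 0"
  proof -
    consider "(\<lambda>d. sharp 4 K 4 f d - dual_restriction 4 K 4 c d) = (\<lambda>_. 0)"
      | b where "b \<in> cooriented_chains 4 K 3" "(\<lambda>d. sharp 4 K 4 f d - dual_restriction 4 K 4 c d) = cooriented_boundary 4 K 3 b"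
      using bd unfolding cooriented_boundaries_def by auto
    then show ?thesis
    proof cases
      case 1
      then show ?thesis by (intro sum.neutral) (meson fun_cong)
    next
      case (2 b)
      have "sharp 4 K 4 f (?d v) - dual_restriction 4 K 4 c (?d v) = cooriented_boundary 4 K 3 b (?d v)" for v
        using 2(2) by (rule fun_cong)
      then show ?thesis using boundary_total[OF 2(1)] by simp
    qed
  qed
  then have "(\<Sum>v\<in>\<Union>K. sharp 4 K 4 f (?d v)) = (\<Sum>v\<in>\<Union>K. dual_restriction 4 K 4 c (?d v))"
    by (simp add: sum_subtractf)
  also have "\<dots> = (\<Sum>v\<in>\<Union>K. eval_cochain c (dual_cell 4 (?d v)))"
    using cell by (simp add: dual_restriction_def)
  also have "\<dots> = eval_cochain c (fundamental_cycle 4 K \<omega>)" by (rule dual_cells_sum[OF c(2)])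
  also have "\<dots> = eval_cochain c (chain_map 4 (core_map (\<lambda>x. x)) (fundamental_cycle 4 K \<omega>))"
    by (simp only: chain_map_core_identity)
  also have "\<dots> = 3 * of_int (signature K \<omega>)"
    using u(2) M orient framed_identity c(1) unfolding first_pontrjagin_class_def by blast
  finally show ?thesis using cell by (simp add: sharp_def)
qed

end

section \<open>Manifolds and signatures verified by computation\<close>

text \<open>
  The condition includes the empty simplex, whose link is the whole complex.
\<close>

definition all_links :: "nat \<Rightarrow> ochain \<Rightarrow> bool" where
  "all_links n c \<longleftrightarrow> (\<forall>\<sigma>\<in>faces_of c. card \<sigma> \<le> n \<and> pl_sphere (n - card \<sigma>) (link (faces_of c) \<sigma>))"

lemma link_link: "v \<in> \<sigma> \<Longrightarrow> link K \<sigma> = link (link K {v}) (\<sigma> - {v})"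
proof -
  assume v: "v \<in> \<sigma>"
  have "\<tau> \<inter> \<sigma> = {} \<longleftrightarrow> \<tau> \<inter> (\<sigma> - {v}) = {} \<and> (\<tau> \<union> (\<sigma> - {v})) \<inter> {v} = {}" for \<tau> using v by auto
  moreover have "\<tau> \<union> \<sigma> = \<tau> \<union> (\<sigma> - {v}) \<union> {v}" for \<tau> using v by auto
  ultimately show ?thesis by (auto simp: link_def)
qed

text \<open>
  Links of larger simplices are links inside vertex links.
\<close>

lemma link_faces_nonempty:
  assumes d: "\<And>s F. (s, F) \<in> set c \<Longrightarrow> distinct F"
    and L: "\<And>v. v \<in> \<Union>(faces_of c) \<Longrightarrow> all_links n (lk v c)"
    and s: "\<sigma> \<in> faces_of c" "\<sigma> \<noteq> {}"
  shows "card \<sigma> \<le> Suc n \<and> pl_sphere (Suc n - card \<sigma>) (link (faces_of c) \<sigma>)"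
proof -
  obtain v where v: "v \<in> \<sigma>" using s(2) by blast
  then have A: "all_links n (lk v c)" using L s(1) by blast
  have e: "link (faces_of c) {v} = faces_of (lk v c)" by (rule link_faces_of[OF d])
  have "\<sigma> - {v} \<in> link (faces_of c) {v}" using s(1) v by (auto simp: link_def insert_absorb)
  then have m: "card (\<sigma> - {v}) \<le> n" "pl_sphere (n - card (\<sigma> - {v})) (link (faces_of (lk v c)) (\<sigma> - {v}))"
    using A unfolding e all_links_def by blast+
  have "finite \<sigma>" using s(1) by (auto simp: faces_of_iff intro: finite_subset)
  then have "card \<sigma> = Suc (card (\<sigma> - {v}))" using v by (metis card.remove)
  then show ?thesis using m link_link[OF v, of "faces_of c"] unfolding e by simp
qed

lemma all_links_Suc:
  assumes d: "\<And>s F. (s, F) \<in> set c \<Longrightarrow> distinct F" and p: "pl_sphere (Suc n) (faces_of c)"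
    and L: "\<And>v. v \<in> \<Union>(faces_of c) \<Longrightarrow> all_links n (lk v c)"
  shows "all_links (Suc n) c"
  unfolding all_links_def
proof
  fix \<sigma> assume s: "\<sigma> \<in> faces_of c"
  show "card \<sigma> \<le> Suc n \<and> pl_sphere (Suc n - card \<sigma>) (link (faces_of c) \<sigma>)"
  proof (cases "\<sigma> = {}")
    case True
    then show ?thesis using p by (simp add: link_def)
  next
    case False
    show ?thesis
    proof (rule link_faces_nonempty)
      show "distinct F" if "(s, F) \<in> set c" for s F using d that .
      show "all_links n (lk v c)" if "v \<in> \<Union>(faces_of c)" for v using L that .
    qed (use s False in auto)
  qed
qed

lemma all_links_map:
  assumes A: "all_links n c" and g: "inj_on g (\<Union>(faces_of c))"
  shows "all_links n (map_chain g c)"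
  unfolding all_links_def faces_of_map_chain
proof
  let ?K = "faces_of c"
  fix \<rho> assume "\<rho> \<in> (`) g ` ?K"
  then obtain \<sigma> where s: "\<sigma> \<in> ?K" "\<rho> = g ` \<sigma>" by blast
  have inj: "inj_on g \<sigma>" using s(1) g by (auto intro: inj_on_subset)
  have "card \<rho> = card \<sigma>" using s(2) inj by (simp add: card_image)
  moreover have "link ((`) g ` ?K) \<rho> = (`) g ` link ?K \<sigma>"
  proof (intro subset_antisym subsetI)
    fix \<tau> assume t: "\<tau> \<in> link ((`) g ` ?K) \<rho>"
    then obtain \<upsilon> where u: "\<upsilon> \<in> ?K" "\<tau> \<union> \<rho> = g ` \<upsilon>" "\<tau> \<inter> \<rho> = {}" by (auto simp: link_def)
    have sv: "\<sigma> \<subseteq> \<upsilon>"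
    proof
      fix v assume v: "v \<in> \<sigma>"
      then have "g v \<in> g ` \<upsilon>" using u(2) s(2) by blast
      then obtain w where "w \<in> \<upsilon>" "g v = g w" by blast
      then show "v \<in> \<upsilon>" using g v s(1) u(1) by (metis UnionI inj_onD)
    qed
    have gi: "inj_on g \<upsilon>" using u(1) g by (auto intro: inj_on_subset)
    have "\<tau> = g ` (\<upsilon> - \<sigma>)" using u(2,3) s(2) sv inj_on_image_set_diff[OF gi, of \<upsilon> \<sigma>] by blast
    moreover have "\<upsilon> - \<sigma> \<in> link ?K \<sigma>" using sv u(1) by (auto simp: link_def Un_absorb2)
    ultimately show "\<tau> \<in> (`) g ` link ?K \<sigma>" by blast
  next
    fix \<tau> assume "\<tau> \<in> (`) g ` link ?K \<sigma>"
    then obtain \<upsilon> where u: "\<upsilon> \<inter> \<sigma> = {}" "\<upsilon> \<union> \<sigma> \<in> ?K" "\<tau> = g ` \<upsilon>" by (auto simp: link_def)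
    have gi: "inj_on g (\<upsilon> \<union> \<sigma>)" using u(2) g by (auto intro: inj_on_subset)
    have "\<tau> \<inter> \<rho> = {}" using u(1,3) s(2) gi by (auto simp: inj_on_def)
    moreover have "g ` (\<upsilon> \<union> \<sigma>) \<in> (`) g ` ?K" using u(2) by (rule imageI)
    then have "\<tau> \<union> \<rho> \<in> (`) g ` ?K" by (simp only: u(3) s(2) image_Un)
    ultimately show "\<tau> \<in> link ((`) g ` ?K) \<rho>" by (simp add: link_def)
  qed
  moreover have "card \<sigma> \<le> n" "pl_sphere (n - card \<sigma>) (link ?K \<sigma>)" using A s(1) by (auto simp: all_links_def)
  moreover have "inj_on g (\<Union>(link ?K \<sigma>))" by (rule inj_on_subset[OF g]) (auto simp: link_def)
  ultimately show "card \<rho> \<le> n \<and> pl_sphere (n - card \<rho>) (link ((`) g ` ?K) \<rho>)"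
    using pl_sphere_image[of "n - card \<sigma>" "link ?K \<sigma>" g] by simp
qed

definition sph_faces :: "nat \<Rightarrow> nat \<Rightarrow> nat list \<Rightarrow> (nat list \<times> nat list) list \<Rightarrow> ochain \<Rightarrow> bool" where
  "sph_faces n z V ms c \<longleftrightarrow> distinct V \<and> length V = Suc n \<and> moves_ok z ms (simplex_boundary V) \<and>
     faces_eq (apply_moves ms (simplex_boundary V)) c \<and> list_all (\<lambda>p. distinct (snd p)) c"

lemma sph_faces: "sph_faces n z V ms c \<Longrightarrow> 1 \<le> n \<Longrightarrow> pl_sphere n (faces_of c)"
  using moves_ok_pl_sphere[of z ms "simplex_boundary V" n] sph_simplex_boundary[of V n] faces_eqD[of "apply_moves ms (simplex_boundary V)" c]
  by (simp add: sph_faces_def sph_def oriented_sphere_def)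

definition covered :: "nat list \<Rightarrow> ochain \<Rightarrow> bool" where
  "covered vs c \<longleftrightarrow> list_all (\<lambda>p. list_all (\<lambda>v. v \<in> set vs) (snd p)) c"

lemma coveredD: "covered vs c \<Longrightarrow> v \<in> \<Union>(faces_of c) \<Longrightarrow> v \<in> set vs"
  unfolding covered_def Union_faces_of list_all_iff by auto

definition points_ok :: "ochain \<Rightarrow> bool" where
  "points_ok c = (case map snd c of [[a], [b]] \<Rightarrow> a \<noteq> b | _ \<Rightarrow> False)"

lemma pl_sphere_points:
  assumes "points_ok c" shows "all_links 1 c"
proof -
  obtain s t a b where c: "c = [(s, [a]), (t, [b])]" "a \<noteq> b"
    using assms by (auto simp: points_ok_def split: list.splits)
  have f: "faces_of c = {\<sigma>. \<sigma> \<subset> {a, b}}" unfolding c(1) using c(2) by auto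
  have "pl_sphere 1 (faces_of c)"
    unfolding f by (rule pl_sphere_simplex_boundary) (use c(2) in auto)
  moreover have L: "all_links 0 (lk v c)" if "v \<in> \<Union>(faces_of c)" for v
  proof -
    have "v = a \<or> v = b" using that by (auto simp: c(1))
    then have "faces_of (lk v c) = {{}}" using c(2) by (auto simp: c(1) lk_def)
    moreover have "pl_sphere 0 {{} :: nat set}"
    proof -
      have "{\<sigma>. \<sigma> \<subset> {0 :: nat}} = {{}}" by auto
      then show ?thesis using pl_sphere_simplex_boundary[of "{0 :: nat}" 0] by simp
    qed
    ultimately show ?thesis by (simp add: all_links_def link_def)
  qed
  moreover have "distinct F" if "(u, F) \<in> set c" for u F using that c(1) by auto
  ultimately have "all_links (Suc 0) c" by (intro all_links_Suc) auto
  then show ?thesis by simp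
qed

text \<open>
  A circle with vertices \<open>us\<close> arises from a triangle by subdividing, again and again, the edge that
  leads back to the first vertex.
\<close>

definition cycle_ok :: "nat \<Rightarrow> nat list \<Rightarrow> ochain \<Rightarrow> bool" where
  "cycle_ok z us c \<longleftrightarrow>
     sph_faces 2 z (take 3 us) (map (\<lambda>(a, b). ([a, hd us], [b])) (zip (drop 2 us) (drop 3 us))) c \<and>
     covered us c \<and> list_all (\<lambda>u. points_ok (lk u c)) us"

text \<open>
  The data of a 2-dimensional sphere: moves that produce it and, for each vertex, the cyclic order
  of its link.
\<close>

definition sphere3_ok :: "nat \<Rightarrow> nat list \<Rightarrow> (nat list \<times> nat list) list \<Rightarrow> (nat \<times> nat list) list \<Rightarrow> ochain \<Rightarrow> bool" where
  "sphere3_ok z V ms cs c \<longleftrightarrow> sph_faces 3 z V ms c \<and> covered (map fst cs) c \<and>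
     list_all (\<lambda>(u, us). cycle_ok z us (lk u c)) cs"

text \<open>
  The data of a 3-dimensional sphere: moves that produce it and the data for each vertex link.
\<close>

definition sphere4_ok ::
    "nat \<Rightarrow> nat list \<Rightarrow> (nat list \<times> nat list) list \<Rightarrow>
     (nat \<times> nat list \<times> (nat list \<times> nat list) list \<times> (nat \<times> nat list) list) list \<Rightarrow> ochain \<Rightarrow> bool" where
  "sphere4_ok z V ms cs c \<longleftrightarrow> sph_faces 4 z V ms c \<and> covered (map fst cs) c \<and>
     list_all (\<lambda>(u, W, ns, ds). sphere3_ok z W ns ds (lk u c)) cs"

lemma sph_faces_distinct: "sph_faces n z V ms c \<Longrightarrow> (s, F) \<in> set c \<Longrightarrow> distinct F"
  by (auto simp: sph_faces_def list_all_iff)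

lemma all_links_cycle: "cycle_ok z us c \<Longrightarrow> all_links 2 c"
  using all_links_Suc[of c 1] sph_faces[of 2] sph_faces_distinct[of 2] coveredD[of us c] pl_sphere_points
  by (fastforce simp: cycle_ok_def list_all_iff numeral_2_eq_2)

lemma all_links_sphere3: assumes "sphere3_ok z V ms cs c" shows "all_links 3 c"
proof -
  have a: "sph_faces 3 z V ms c" "covered (map fst cs) c" "\<And>u us. (u, us) \<in> set cs \<Longrightarrow> cycle_ok z us (lk u c)"
    using assms by (auto simp: sphere3_ok_def list_all_iff)
  have "all_links (Suc 2) c"
  proof (rule all_links_Suc)
    show "pl_sphere (Suc 2) (faces_of c)" using sph_faces[OF a(1)] by simp
    fix v assume "v \<in> \<Union>(faces_of c)"
    then obtain us where "(v, us) \<in> set cs" using coveredD[OF a(2)] by force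
    then show "all_links 2 (lk v c)" using a(3) all_links_cycle by blast
  qed (rule sph_faces_distinct[OF a(1)])
  then show ?thesis by simp
qed

lemma all_links_sphere4: assumes "sphere4_ok z V ms cs c" shows "all_links 4 c"
proof -
  have a: "sph_faces 4 z V ms c" "covered (map fst cs) c"
    "\<And>u W ns ds. (u, W, ns, ds) \<in> set cs \<Longrightarrow> sphere3_ok z W ns ds (lk u c)"
    using assms by (auto simp: sphere4_ok_def list_all_iff)
  have "all_links (Suc 3) c"
  proof (rule all_links_Suc)
    show "pl_sphere (Suc 3) (faces_of c)" using sph_faces[OF a(1)] by simp
    fix v assume "v \<in> \<Union>(faces_of c)"
    then obtain W ns ds where "(v, W, ns, ds) \<in> set cs" using coveredD[OF a(2)] by force
    then show "all_links 3 (lk v c)" using a(3) all_links_sphere3 by blast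
  qed (rule sph_faces_distinct[OF a(1)])
  then show ?thesis by simp
qed

lemma cup_square_sum:
  assumes c: "orient_check 5 c"
  shows "cup_square (faces_of c) (orient_of c) a = (\<Sum>p\<leftarrow>nrm c. of_int (fst p) * a (set (take 3 (snd p))) * a (set (drop 2 (snd p))))"
proof -
  let ?N = "set (nrm c)"
  have d: "distinct (nrm c)" "inj_on snd ?N" using c by (auto simp: orient_check_def distinct_map)
  have S: "{xs. length xs = 5 \<and> sorted_wrt (<) xs \<and> set xs \<in> faces_of c} = snd ` ?N"
  proof (intro subset_antisym subsetI)
    fix xs assume "xs \<in> {xs. length xs = 5 \<and> sorted_wrt (<) xs \<and> set xs \<in> faces_of c}"
    then have xs: "length xs = 5" "sorted_wrt (<) xs" "set xs \<in> faces_of c" by auto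
    have "orient_of c xs \<noteq> 0" unfolding checked_nonzero_iff[OF c] using xs by (simp add: strict_sorted_iff)
    then obtain s F where F: "(s, F) \<in> ?N" "set xs = set F" using checked_zero[OF c] by blast
    then have "xs = F" using checked_facet[OF c F(1)] xs(2) by (intro sorted_distinct_set_unique) (auto simp: strict_sorted_iff)
    then show "xs \<in> snd ` ?N" using F(1) by force
  next
    fix xs assume "xs \<in> snd ` ?N"
    then obtain s where F: "(s, xs) \<in> ?N" by force
    then show "xs \<in> {xs. length xs = 5 \<and> sorted_wrt (<) xs \<and> set xs \<in> faces_of c}"
      using checked_facet[OF c F] checked_orient(2)[OF c] by (auto simp: strict_sorted_iff faces_of_iff)
  qed
  have v: "orient_of c (snd p) = fst p" if "p \<in> ?N" for p
    using checked_value[OF c, of "fst p" "snd p" "snd p"] that checked_facet[OF c, of "fst p" "snd p"] cell_self by simp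
  have "cup_square (faces_of c) (orient_of c) a = (\<Sum>p\<in>?N. of_int (orient_of c (snd p)) * a (set (take 3 (snd p))) * a (set (drop 2 (snd p))))"
    unfolding cup_square_def S by (simp add: sum.reindex[OF d(2)])
  also have "\<dots> = (\<Sum>p\<in>?N. of_int (fst p) * a (set (take 3 (snd p))) * a (set (drop 2 (snd p))))"
    by (intro sum.cong refl) (simp add: v)
  finally show ?thesis using d(1) by (simp add: sum_list_distinct_conv_sum_set)
qed

text \<open>
  A form that is the square of a nonzero linear functional has rank one: two cocycles have a
  nontrivial combination on which the functional \<open>A\<close>, and hence the form, vanishes.
\<close>

lemma signature_of_square:
  assumes sq: "\<And>a. simplicial_cocycle2 L a \<Longrightarrow> cup_square L \<omega> a = (A a)\<^sup>2"
    and lin: "\<And>(p :: nat) t c. A (\<lambda>\<sigma>. \<Sum>i<p. t i * c i \<sigma>) = (\<Sum>i<p. t i * A (c i))"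
    and x: "simplicial_cocycle2 L x" "A x \<noteq> 0"
  shows "signature L \<omega> = 1"
proof -
  have coc: "simplicial_cocycle2 L (\<lambda>\<sigma>. \<Sum>i<p. t i * c i \<sigma>)" if c: "\<forall>i<p. simplicial_cocycle2 L (c i)" for p :: nat and t c
    unfolding simplicial_cocycle2_def
  proof (intro allI impI)
    fix v0 v1 v2 v3 assume v: "v0 < v1 \<and> v1 < v2 \<and> v2 < v3 \<and> {v0, v1, v2, v3} \<in> L"
    have "(\<Sum>i<p. t i * c i {v1, v2, v3}) - (\<Sum>i<p. t i * c i {v0, v2, v3}) + (\<Sum>i<p. t i * c i {v0, v1, v3}) - (\<Sum>i<p. t i * c i {v0, v1, v2})
      = (\<Sum>i<p. t i * (c i {v1, v2, v3} - c i {v0, v2, v3} + c i {v0, v1, v3} - c i {v0, v1, v2}))"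
      by (simp add: algebra_simps sum.distrib sum_subtractf)
    also have "\<dots> = 0" using c v by (intro sum.neutral) (auto simp: simplicial_cocycle2_def)
    finally show "(\<Sum>i<p. t i * c i {v1, v2, v3}) - (\<Sum>i<p. t i * c i {v0, v2, v3}) + (\<Sum>i<p. t i * c i {v0, v1, v3}) - (\<Sum>i<p. t i * c i {v0, v1, v2}) = 0" .
  qed
  have val: "cup_square L \<omega> (\<lambda>\<sigma>. \<Sum>i<p. t i * c i \<sigma>) = (\<Sum>i<p. t i * A (c i))\<^sup>2"
    if "\<forall>i<p. simplicial_cocycle2 L (c i)" for p :: nat and t c
    unfolding sq[OF coc[OF that]] lin ..
  have neg: "cup_square L (opposite \<omega>) a = - cup_square L \<omega> a" for a
    by (simp add: cup_square_def opposite_def sum_negf)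
  let ?P = "\<lambda>\<omega>' (p :: nat). \<exists>c. (\<forall>i<p. simplicial_cocycle2 L (c i)) \<and>
      (\<forall>t. (\<exists>i<p. t i \<noteq> 0) \<longrightarrow> 0 < cup_square L \<omega>' (\<lambda>\<sigma>. \<Sum>i<p. t i * c i \<sigma>))"
  have le1: "p \<le> 1" if asm: "?P \<omega> p" for p
  proof (rule ccontr)
    assume "\<not> p \<le> 1"
    then have p: "0 < p" "1 < p" by auto
    from asm obtain c where "(\<forall>i<p. simplicial_cocycle2 L (c i)) \<and>
      (\<forall>t. (\<exists>i<p. t i \<noteq> 0) \<longrightarrow> 0 < cup_square L \<omega> (\<lambda>\<sigma>. \<Sum>i<p. t i * c i \<sigma>))" by (rule exE)
    note c = conjunct1[OF this] conjunct2[OF this]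
    have pos: "0 < (\<Sum>i<p. t i * A (c i))\<^sup>2" if "\<exists>i<p. t i \<noteq> 0" for t
    proof -
      have "0 < cup_square L \<omega> (\<lambda>\<sigma>. \<Sum>i<p. t i * c i \<sigma>)" using c(2)[rule_format, OF that] .
      then show ?thesis unfolding val[OF c(1)] .
    qed
    \<comment> \<open>A nontrivial combination of \<open>c 0\<close> and \<open>c 1\<close> on which \<open>A\<close> vanishes.\<close>
    define t where "t i = (if A (c 0) = 0 then (if i = 0 then 1 else 0) else (if i = 0 then A (c 1) else if i = 1 then - A (c 0) else 0))" for i :: nat
    have "(\<Sum>i<p. t i * A (c i)) = (\<Sum>i\<in>{0, 1}. t i * A (c i))"
      by (rule sum.mono_neutral_right) (use p in \<open>auto simp: t_def\<close>)
    also have "\<dots> = 0" by (simp add: t_def)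
    finally have "(\<Sum>i<p. t i * A (c i))\<^sup>2 = 0" by simp
    moreover have "\<exists>i<p. t i \<noteq> 0"
      using p by (cases "A (c 0) = 0") (auto simp: t_def intro: exI[of _ 0] exI[of _ 1])
    ultimately show False using pos by force
  qed
  have one: "?P \<omega> 1"
  proof (intro exI[of _ "\<lambda>_. x"] conjI allI impI)
    fix t :: "nat \<Rightarrow> rat" assume t: "\<exists>i<1. t i \<noteq> 0"
    have "cup_square L \<omega> (\<lambda>\<sigma>. \<Sum>i<1. t i * x \<sigma>) = (\<Sum>i<1. t i * A x)\<^sup>2" by (rule val) (use x in simp)
    also have "\<dots> > 0" using t x(2) by simp
    finally show "0 < cup_square L \<omega> (\<lambda>\<sigma>. \<Sum>i<1. t i * x \<sigma>)" .
  qed (use x in simp)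
  have zero: "?P \<omega>' 0" for \<omega>' by simp
  have none: "p = 0" if asm: "?P (opposite \<omega>) p" for p
  proof (rule ccontr)
    assume p: "p \<noteq> 0"
    from asm obtain c where "(\<forall>i<p. simplicial_cocycle2 L (c i)) \<and>
      (\<forall>t. (\<exists>i<p. t i \<noteq> 0) \<longrightarrow> 0 < cup_square L (opposite \<omega>) (\<lambda>\<sigma>. \<Sum>i<p. t i * c i \<sigma>))" by (rule exE)
    note c = conjunct1[OF this] conjunct2[OF this]
    have "0 < cup_square L (opposite \<omega>) (\<lambda>\<sigma>. \<Sum>i<p. (\<lambda>_. 1) i * c i \<sigma>)" using c(2)[rule_format, of "\<lambda>_. 1"] p by auto
    then show False unfolding neg val[OF c(1)] by simp
  qed
  have "{p. ?P \<omega> p} = {0, 1}"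
  proof (intro subset_antisym subsetI)
    fix p assume "p \<in> {p. ?P \<omega> p}"
    then have "p \<le> 1" by (intro le1) (rule CollectD)
    then show "p \<in> {0, 1}" by auto
  next
    fix p :: nat assume "p \<in> {0, 1}"
    then consider "p = 0" | "p = 1" by auto
    then show "p \<in> {p. ?P \<omega> p}"
    proof cases
      case 1
      show ?thesis unfolding 1 by (rule CollectI) (rule zero)
    next
      case 2
      show ?thesis unfolding 2 by (rule CollectI) (rule one)
    qed
  qed
  then have "positive_index L \<omega> = 1" unfolding positive_index_def by simp
  moreover have "{p. ?P (opposite \<omega>) p} = {0}"
  proof (intro subset_antisym subsetI)
    fix p assume "p \<in> {p. ?P (opposite \<omega>) p}"
    then have "p = 0" by (intro none) (rule CollectD)
    then show "p \<in> {0}" by simp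
  next
    fix p :: nat assume "p \<in> {0}"
    then have "p = 0" by simp
    show "p \<in> {p. ?P (opposite \<omega>) p}" unfolding \<open>p = 0\<close> by (rule CollectI) (rule zero)
  qed
  then have "positive_index L (opposite \<omega>) = 0" unfolding positive_index_def by simp
  ultimately show ?thesis by (simp add: signature_def)
qed

section \<open>The complex projective plane with nine vertices\<close>

text \<open>
  The triangulation of the complex projective plane by Kuehnel, with vertices \<open>2, \<dots>, 10\<close>, oriented
  so that the signature is positive.
\<close>

definition cp2 :: ochain where
  "cp2 = [(-1, [2, 3, 4, 8, 9]), (1, [2, 3, 4, 8, 10]), (-1, [2, 3, 4, 9, 10]),
    (-1, [2, 3, 5, 6, 7]), (1, [2, 3, 5, 6, 10]), (-1, [2, 3, 5, 7, 8]),
    (-1, [2, 3, 5, 8, 10]), (1, [2, 3, 6, 7, 9]), (1, [2, 3, 6, 9, 10]),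
    (1, [2, 3, 7, 8, 9]), (1, [2, 4, 5, 6, 7]), (-1, [2, 4, 5, 6, 8]),
    (1, [2, 4, 5, 7, 9]), (-1, [2, 4, 5, 8, 9]), (-1, [2, 4, 6, 7, 10]),
    (1, [2, 4, 6, 8, 10]), (-1, [2, 4, 7, 9, 10]), (-1, [2, 5, 6, 8, 10]),
    (-1, [2, 5, 7, 8, 9]), (1, [2, 6, 7, 9, 10]), (-1, [3, 4, 5, 6, 7]),
    (1, [3, 4, 5, 6, 9]), (-1, [3, 4, 5, 7, 10]), (1, [3, 4, 5, 9, 10]),
    (1, [3, 4, 6, 7, 8]), (1, [3, 4, 6, 8, 9]), (-1, [3, 4, 7, 8, 10]),
    (1, [3, 5, 6, 9, 10]), (1, [3, 5, 7, 8, 10]), (1, [3, 6, 7, 8, 9]),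
    (1, [4, 5, 6, 8, 9]), (-1, [4, 5, 7, 9, 10]), (-1, [4, 6, 7, 8, 10]),
    (-1, [5, 6, 8, 9, 10]), (1, [5, 7, 8, 9, 10]), (-1, [6, 7, 8, 9, 10])]"

lemma link_certificate: "sphere4_ok 50 [4, 5, 7, 8, 9]
    [([4, 7, 8, 9], [3]), ([4, 7, 8], [3, 5]), ([3, 4, 5, 8], [10]), ([3, 4, 5], [7, 10]),
      ([4, 5, 8, 10], [6]), ([4, 5, 10], [6, 7]), ([5, 7, 10], [3, 6]), ([3, 4, 7], [9, 10]),
      ([3, 7, 10], [6, 9])]
    [(3, [5, 6, 7, 8], [([6, 7, 8], [9]), ([6, 8, 9], [10]), ([6, 8], [5, 10]), ([8, 9, 10], [4])],
       [(4, [8, 9, 10]), (5, [6, 7, 8, 10]), (6, [5, 7, 9, 10]), (7, [5, 6, 9, 8]), (8, [4, 9, 7, 5, 10]),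
         (9, [4, 8, 7, 6, 10]), (10, [4, 8, 5, 6, 9])]),
     (4, [5, 6, 7, 9], [([6, 7, 9], [10]), ([6, 9, 10], [8]), ([6, 9], [5, 8]), ([8, 9, 10], [3])],
       [(3, [8, 9, 10]), (5, [6, 7, 9, 8]), (6, [5, 7, 10, 8]), (7, [5, 6, 10, 9]), (8, [3, 9, 5, 6, 10]),
         (9, [3, 8, 5, 7, 10]), (10, [3, 8, 6, 7, 9])]),
     (5, [3, 6, 8, 10], [([3, 6, 8], [7]), ([6, 7, 8], [4]), ([4, 7, 8], [9])],
       [(3, [6, 7, 8, 10]), (4, [6, 7, 9, 8]), (6, [3, 7, 4, 8, 10]), (7, [3, 6, 4, 9, 8]),
         (8, [3, 7, 9, 4, 6, 10]), (9, [4, 7, 8]), (10, [3, 6, 8])]),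
     (6, [4, 5, 8, 10], [([4, 5, 10], [7]), ([5, 7, 10], [3]), ([3, 7, 10], [9])],
       [(3, [5, 7, 9, 10]), (4, [5, 7, 10, 8]), (5, [3, 7, 4, 8, 10]), (7, [3, 5, 4, 10, 9]),
         (8, [4, 5, 10]), (9, [3, 7, 10]), (10, [3, 5, 8, 4, 7, 9])]),
     (7, [3, 5, 8, 9], [([3, 5, 9], [6]), ([5, 6, 9], [4]), ([4, 6, 9], [10])],
       [(3, [5, 6, 9, 8]), (4, [5, 6, 10, 9]), (5, [3, 6, 4, 9, 8]), (6, [3, 5, 4, 10, 9]),
         (8, [3, 5, 9]), (9, [3, 6, 10, 4, 5, 8]), (10, [4, 6, 9])]),
     (8, [4, 5, 6, 10], [([4, 5, 10], [3]), ([3, 4, 5], [9]), ([3, 5, 9], [7])],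
       [(3, [4, 9, 7, 5, 10]), (4, [3, 9, 5, 6, 10]), (5, [3, 7, 9, 4, 6, 10]), (6, [4, 5, 10]),
         (7, [3, 5, 9]), (9, [3, 4, 5, 7]), (10, [3, 4, 6, 5])]),
     (9, [3, 4, 7, 10], [([3, 4, 7], [8]), ([4, 7, 8], [5]), ([3, 7, 10], [6])],
       [(3, [4, 8, 7, 6, 10]), (4, [3, 8, 5, 7, 10]), (5, [4, 7, 8]), (6, [3, 7, 10]),
         (7, [3, 6, 10, 4, 5, 8]), (8, [3, 4, 5, 7]), (10, [3, 4, 7, 6])]),
     (10, [4, 6, 7, 9], [([4, 6, 9], [3]), ([3, 4, 6], [8]), ([3, 6, 8], [5])],
       [(3, [4, 8, 5, 6, 9]), (4, [3, 8, 6, 7, 9]), (5, [3, 6, 8]), (6, [3, 5, 8, 4, 7, 9]),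
         (7, [4, 6, 9]), (8, [3, 4, 6, 5]), (9, [3, 4, 7, 6])])] (lk 2 cp2)"
  by code_simp

lemma link_isos: "list_all (\<lambda>(v, m). iso_check m True (lk v cp2) (lk 2 cp2))
    [(2, [(3, 3), (4, 4), (5, 5), (6, 6), (7, 7), (8, 8), (9, 9), (10, 10)]),
     (3, [(2, 3), (4, 4), (5, 6), (6, 5), (7, 7), (8, 9), (9, 8), (10, 10)]),
     (4, [(2, 3), (3, 4), (5, 7), (6, 5), (7, 6), (8, 8), (9, 9), (10, 10)]),
     (5, [(2, 8), (3, 9), (4, 10), (6, 3), (7, 4), (8, 5), (9, 6), (10, 7)]),
     (6, [(2, 8), (3, 9), (4, 10), (5, 4), (7, 3), (8, 6), (9, 7), (10, 5)]),
     (7, [(2, 8), (3, 9), (4, 10), (5, 3), (6, 4), (8, 7), (9, 5), (10, 6)]),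
     (8, [(2, 5), (3, 6), (4, 7), (5, 8), (6, 9), (7, 10), (9, 3), (10, 4)]),
     (9, [(2, 5), (3, 7), (4, 6), (5, 10), (6, 9), (7, 8), (8, 3), (10, 4)]),
     (10, [(2, 5), (3, 6), (4, 7), (5, 10), (6, 8), (7, 9), (8, 3), (9, 4)])]"
  by code_simp

lemma link_in_sphere_I: "iso_check [(3, 7), (4, 8), (5, 4), (6, 1), (7, 3), (8, 2), (9, 5), (10, 6)] True
  (lk 2 cp2) (lk 0 sphere_I)"
  by code_simp

text \<open>
  The tetrahedra whose cocycle conditions are used below.
\<close>

definition tets :: "nat list list" where
  "tets = [[2, 3, 4, 8], [2, 3, 4, 9], [2, 3, 4, 10], [2, 3, 5, 6], [2, 3, 5, 7], [2, 3, 5, 8],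
    [2, 3, 5, 10], [2, 3, 6, 7], [2, 3, 6, 9], [2, 3, 6, 10], [2, 3, 7, 8], [2, 3, 7, 9], [2, 3, 8, 9],
    [2, 3, 8, 10], [2, 3, 9, 10], [2, 4, 5, 6], [2, 4, 5, 7], [2, 4, 5, 8], [2, 4, 5, 9], [2, 4, 6, 7],
    [2, 4, 6, 8], [2, 4, 6, 10], [2, 4, 7, 9], [2, 4, 7, 10], [2, 4, 8, 9], [2, 4, 8, 10], [2, 4, 9, 10],
    [2, 5, 6, 7], [2, 5, 6, 8], [2, 5, 6, 10], [2, 5, 7, 8], [2, 5, 7, 9], [2, 5, 8, 9], [2, 5, 8, 10],
    [2, 6, 7, 9], [2, 6, 7, 10], [2, 6, 8, 10], [2, 6, 9, 10], [2, 7, 8, 9], [2, 7, 9, 10], [3, 4, 5, 6],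
    [3, 4, 5, 7], [3, 4, 5, 9], [3, 4, 5, 10], [3, 4, 6, 8], [3, 4, 6, 9], [3, 4, 7, 8], [3, 4, 7, 10],
    [3, 5, 6, 9], [3, 5, 7, 10], [3, 5, 9, 10], [3, 6, 7, 8], [3, 6, 8, 9], [3, 7, 8, 10], [5, 8, 9, 10]]"

lemma tets_ok: "list_all (\<lambda>q. sorted_wrt (<) q \<and> list_ex (\<lambda>p. list_all (\<lambda>v. v \<in> set (snd p)) q) cp2) tets"
  by code_simp

lemma cocycle_equation:
  assumes a: "simplicial_cocycle2 (faces_of cp2) a" and q: "[v0, v1, v2, v3] \<in> set tets"
  shows "a {v1, v2, v3} - a {v0, v2, v3} + a {v0, v1, v3} - a {v0, v1, v2} = 0"
proof -
  have s: "sorted_wrt (<) [v0, v1, v2, v3]"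
    "list_ex (\<lambda>p. list_all (\<lambda>v. v \<in> set (snd p)) [v0, v1, v2, v3]) cp2"
    using tets_ok q by (auto simp only: list_all_iff)
  then have "{v0, v1, v2, v3} \<in> faces_of cp2" by (auto simp only: list_ex_iff list_all_iff faces_of_iff) force
  then show ?thesis using a s(1) unfolding simplicial_cocycle2_def by simp
qed

lemma orient_check_cp2: "orient_check 5 cp2"
  by code_simp

lemma nrm_cp2: "nrm cp2 = cp2"
  by code_simp

lemmas cup_square_cp2_sum = cup_square_sum[OF orient_check_cp2, unfolded nrm_cp2]

text \<open>
  On cocycles this is the value on the 2-cycle that bounds the tetrahedron \<open>2, 3, 4, 5\<close>, which is
  not a face.
\<close>

definition area :: "(nat set \<Rightarrow> rat) \<Rightarrow> rat" where
  "area a = a {3, 4, 5} - (a {2, 4, 5} - a {2, 3, 5} + a {2, 3, 4})"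

text \<open>
  Any two vertices are joined by an edge, any three span a triangle, so that subtracting the
  coboundary of \<open>{i, j} \<mapsto> a {2, i, j}\<close> makes the cocycle vanish on all triangles that contain \<open>2\<close> or
  lie in its link. The cocycle conditions propagate the value \<open>t\<close> on \<open>{3, 4, 5}\<close>, up to sign, to the
  fifteen remaining triangles. Substitution into the cup square leaves \<open>t\<^sup>2\<close>.
\<close>

lemma cup_square_cp2:
  assumes a: "simplicial_cocycle2 (faces_of cp2) a"
  shows "cup_square (faces_of cp2) (orient_of cp2) a = (area a)\<^sup>2"
proof -
  define t where "t = area a"
  have t0: "a {3, 4, 5} = a {2, 4, 5} - a {2, 3, 5} + a {2, 3, 4} + t" by (simp add: t_def area_def)
  note q = cocycle_equation[OF a]
  have e0: "a {3, 4, 8} = a {2, 4, 8} - a {2, 3, 8} + a {2, 3, 4}"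
    using q[of 2 3 4 8] by (simp add: tets_def)
  have e1: "a {3, 4, 9} = a {2, 4, 9} - a {2, 3, 9} + a {2, 3, 4}"
    using q[of 2 3 4 9] by (simp add: tets_def)
  have e2: "a {3, 4, 10} = a {2, 4, 10} - a {2, 3, 10} + a {2, 3, 4}"
    using q[of 2 3 4 10] by (simp add: tets_def)
  have e3: "a {3, 5, 6} = a {2, 5, 6} - a {2, 3, 6} + a {2, 3, 5}"
    using q[of 2 3 5 6] by (simp add: tets_def)
  have e4: "a {3, 5, 7} = a {2, 5, 7} - a {2, 3, 7} + a {2, 3, 5}"
    using q[of 2 3 5 7] by (simp add: tets_def)
  have e5: "a {3, 5, 8} = a {2, 5, 8} - a {2, 3, 8} + a {2, 3, 5}"
    using q[of 2 3 5 8] by (simp add: tets_def)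
  have e6: "a {3, 5, 10} = a {2, 5, 10} - a {2, 3, 10} + a {2, 3, 5}"
    using q[of 2 3 5 10] by (simp add: tets_def)
  have e7: "a {3, 6, 7} = a {2, 6, 7} - a {2, 3, 7} + a {2, 3, 6}"
    using q[of 2 3 6 7] by (simp add: tets_def)
  have e8: "a {3, 6, 9} = a {2, 6, 9} - a {2, 3, 9} + a {2, 3, 6}"
    using q[of 2 3 6 9] by (simp add: tets_def)
  have e9: "a {3, 6, 10} = a {2, 6, 10} - a {2, 3, 10} + a {2, 3, 6}"
    using q[of 2 3 6 10] by (simp add: tets_def)
  have e10: "a {3, 7, 8} = a {2, 7, 8} - a {2, 3, 8} + a {2, 3, 7}"
    using q[of 2 3 7 8] by (simp add: tets_def)
  have e11: "a {3, 7, 9} = a {2, 7, 9} - a {2, 3, 9} + a {2, 3, 7}"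
    using q[of 2 3 7 9] by (simp add: tets_def)
  have e12: "a {3, 8, 9} = a {2, 8, 9} - a {2, 3, 9} + a {2, 3, 8}"
    using q[of 2 3 8 9] by (simp add: tets_def)
  have e13: "a {3, 8, 10} = a {2, 8, 10} - a {2, 3, 10} + a {2, 3, 8}"
    using q[of 2 3 8 10] by (simp add: tets_def)
  have e14: "a {3, 9, 10} = a {2, 9, 10} - a {2, 3, 10} + a {2, 3, 9}"
    using q[of 2 3 9 10] by (simp add: tets_def)
  have e15: "a {4, 5, 6} = a {2, 5, 6} - a {2, 4, 6} + a {2, 4, 5}"
    using q[of 2 4 5 6] by (simp add: tets_def)
  have e16: "a {4, 5, 7} = a {2, 5, 7} - a {2, 4, 7} + a {2, 4, 5}"
    using q[of 2 4 5 7] by (simp add: tets_def)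
  have e17: "a {4, 5, 8} = a {2, 5, 8} - a {2, 4, 8} + a {2, 4, 5}"
    using q[of 2 4 5 8] by (simp add: tets_def)
  have e18: "a {4, 5, 9} = a {2, 5, 9} - a {2, 4, 9} + a {2, 4, 5}"
    using q[of 2 4 5 9] by (simp add: tets_def)
  have e19: "a {4, 6, 7} = a {2, 6, 7} - a {2, 4, 7} + a {2, 4, 6}"
    using q[of 2 4 6 7] by (simp add: tets_def)
  have e20: "a {4, 6, 8} = a {2, 6, 8} - a {2, 4, 8} + a {2, 4, 6}"
    using q[of 2 4 6 8] by (simp add: tets_def)
  have e21: "a {4, 6, 10} = a {2, 6, 10} - a {2, 4, 10} + a {2, 4, 6}"
    using q[of 2 4 6 10] by (simp add: tets_def)
  have e22: "a {4, 7, 9} = a {2, 7, 9} - a {2, 4, 9} + a {2, 4, 7}"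
    using q[of 2 4 7 9] by (simp add: tets_def)
  have e23: "a {4, 7, 10} = a {2, 7, 10} - a {2, 4, 10} + a {2, 4, 7}"
    using q[of 2 4 7 10] by (simp add: tets_def)
  have e24: "a {4, 8, 9} = a {2, 8, 9} - a {2, 4, 9} + a {2, 4, 8}"
    using q[of 2 4 8 9] by (simp add: tets_def)
  have e25: "a {4, 8, 10} = a {2, 8, 10} - a {2, 4, 10} + a {2, 4, 8}"
    using q[of 2 4 8 10] by (simp add: tets_def)
  have e26: "a {4, 9, 10} = a {2, 9, 10} - a {2, 4, 10} + a {2, 4, 9}"
    using q[of 2 4 9 10] by (simp add: tets_def)
  have e27: "a {5, 6, 7} = a {2, 6, 7} - a {2, 5, 7} + a {2, 5, 6}"
    using q[of 2 5 6 7] by (simp add: tets_def)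
  have e28: "a {5, 6, 8} = a {2, 6, 8} - a {2, 5, 8} + a {2, 5, 6}"
    using q[of 2 5 6 8] by (simp add: tets_def)
  have e29: "a {5, 6, 10} = a {2, 6, 10} - a {2, 5, 10} + a {2, 5, 6}"
    using q[of 2 5 6 10] by (simp add: tets_def)
  have e30: "a {5, 7, 8} = a {2, 7, 8} - a {2, 5, 8} + a {2, 5, 7}"
    using q[of 2 5 7 8] by (simp add: tets_def)
  have e31: "a {5, 7, 9} = a {2, 7, 9} - a {2, 5, 9} + a {2, 5, 7}"
    using q[of 2 5 7 9] by (simp add: tets_def)
  have e32: "a {5, 8, 9} = a {2, 8, 9} - a {2, 5, 9} + a {2, 5, 8}"
    using q[of 2 5 8 9] by (simp add: tets_def)
  have e33: "a {5, 8, 10} = a {2, 8, 10} - a {2, 5, 10} + a {2, 5, 8}"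
    using q[of 2 5 8 10] by (simp add: tets_def)
  have e34: "a {6, 7, 9} = a {2, 7, 9} - a {2, 6, 9} + a {2, 6, 7}"
    using q[of 2 6 7 9] by (simp add: tets_def)
  have e35: "a {6, 7, 10} = a {2, 7, 10} - a {2, 6, 10} + a {2, 6, 7}"
    using q[of 2 6 7 10] by (simp add: tets_def)
  have e36: "a {6, 8, 10} = a {2, 8, 10} - a {2, 6, 10} + a {2, 6, 8}"
    using q[of 2 6 8 10] by (simp add: tets_def)
  have e37: "a {6, 9, 10} = a {2, 9, 10} - a {2, 6, 10} + a {2, 6, 9}"
    using q[of 2 6 9 10] by (simp add: tets_def)
  have e38: "a {7, 8, 9} = a {2, 8, 9} - a {2, 7, 9} + a {2, 7, 8}"
    using q[of 2 7 8 9] by (simp add: tets_def)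
  have e39: "a {7, 9, 10} = a {2, 9, 10} - a {2, 7, 10} + a {2, 7, 9}"
    using q[of 2 7 9 10] by (simp add: tets_def)
  have e40: "a {3, 4, 6} = a {2, 4, 6} - a {2, 3, 6} + a {2, 3, 4} + t"
    using q[of 3 4 5 6] e15 e3 t0 by (simp add: tets_def)
  have e41: "a {3, 4, 7} = a {2, 4, 7} - a {2, 3, 7} + a {2, 3, 4} + t"
    using q[of 3 4 5 7] e16 e4 t0 by (simp add: tets_def)
  have e42: "a {3, 5, 9} = a {2, 5, 9} - a {2, 3, 9} + a {2, 3, 5} - t"
    using q[of 3 4 5 9] e18 e1 t0 by (simp add: tets_def)
  have e43: "a {4, 5, 10} = a {2, 5, 10} - a {2, 4, 10} + a {2, 4, 5} + t"
    using q[of 3 4 5 10] e6 e2 t0 by (simp add: tets_def)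
  have e44: "a {3, 6, 8} = a {2, 6, 8} - a {2, 3, 8} + a {2, 3, 6} - t"
    using q[of 3 4 6 8] e20 e0 e40 by (simp add: tets_def)
  have e45: "a {4, 6, 9} = a {2, 6, 9} - a {2, 4, 9} + a {2, 4, 6} + t"
    using q[of 3 4 6 9] e8 e1 e40 by (simp add: tets_def)
  have e46: "a {4, 7, 8} = a {2, 7, 8} - a {2, 4, 8} + a {2, 4, 7} + t"
    using q[of 3 4 7 8] e10 e0 e41 by (simp add: tets_def)
  have e47: "a {3, 7, 10} = a {2, 7, 10} - a {2, 3, 10} + a {2, 3, 7} - t"
    using q[of 3 4 7 10] e23 e2 e41 by (simp add: tets_def)
  have e48: "a {5, 6, 9} = a {2, 6, 9} - a {2, 5, 9} + a {2, 5, 6} + t"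
    using q[of 3 5 6 9] e8 e42 e3 by (simp add: tets_def)
  have e49: "a {5, 7, 10} = a {2, 7, 10} - a {2, 5, 10} + a {2, 5, 7} - t"
    using q[of 3 5 7 10] e47 e6 e4 by (simp add: tets_def)
  have e50: "a {5, 9, 10} = a {2, 9, 10} - a {2, 5, 10} + a {2, 5, 9} - t"
    using q[of 3 5 9 10] e14 e6 e42 by (simp add: tets_def)
  have e51: "a {6, 7, 8} = a {2, 7, 8} - a {2, 6, 8} + a {2, 6, 7} + t"
    using q[of 3 6 7 8] e10 e44 e7 by (simp add: tets_def)
  have e52: "a {6, 8, 9} = a {2, 8, 9} - a {2, 6, 9} + a {2, 6, 8} - t"
    using q[of 3 6 8 9] e12 e8 e44 by (simp add: tets_def)
  have e53: "a {7, 8, 10} = a {2, 8, 10} - a {2, 7, 10} + a {2, 7, 8} + t"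
    using q[of 3 7 8 10] e13 e47 e10 by (simp add: tets_def)
  have e54: "a {8, 9, 10} = a {2, 9, 10} - a {2, 8, 10} + a {2, 8, 9} - t"
    using q[of 5 8 9 10] e50 e33 e32 by (simp add: tets_def)
  have "cup_square (faces_of cp2) (orient_of cp2) a = (-1) * a {2, 3, 4} * a {4, 8, 9}
    + a {2, 3, 4} * a {4, 8, 10} + (-1) * a {2, 3, 4} * a {4, 9, 10} + (-1) * a {2, 3, 5} * a {5, 6, 7}
    + a {2, 3, 5} * a {5, 6, 10} + (-1) * a {2, 3, 5} * a {5, 7, 8} + (-1) * a {2, 3, 5} * a {5, 8, 10}
    + a {2, 3, 6} * a {6, 7, 9} + a {2, 3, 6} * a {6, 9, 10} + a {2, 3, 7} * a {7, 8, 9}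
    + a {2, 4, 5} * a {5, 6, 7} + (-1) * a {2, 4, 5} * a {5, 6, 8} + a {2, 4, 5} * a {5, 7, 9}
    + (-1) * a {2, 4, 5} * a {5, 8, 9} + (-1) * a {2, 4, 6} * a {6, 7, 10} + a {2, 4, 6} * a {6, 8, 10}
    + (-1) * a {2, 4, 7} * a {7, 9, 10} + (-1) * a {2, 5, 6} * a {6, 8, 10}
    + (-1) * a {2, 5, 7} * a {7, 8, 9} + a {2, 6, 7} * a {7, 9, 10} + (-1) * a {3, 4, 5} * a {5, 6, 7}
    + a {3, 4, 5} * a {5, 6, 9} + (-1) * a {3, 4, 5} * a {5, 7, 10} + a {3, 4, 5} * a {5, 9, 10}
    + a {3, 4, 6} * a {6, 7, 8} + a {3, 4, 6} * a {6, 8, 9} + (-1) * a {3, 4, 7} * a {7, 8, 10}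
    + a {3, 5, 6} * a {6, 9, 10} + a {3, 5, 7} * a {7, 8, 10} + a {3, 6, 7} * a {7, 8, 9}
    + a {4, 5, 6} * a {6, 8, 9} + (-1) * a {4, 5, 7} * a {7, 9, 10} + (-1) * a {4, 6, 7} * a {7, 8, 10}
    + (-1) * a {5, 6, 8} * a {8, 9, 10} + a {5, 7, 8} * a {8, 9, 10} + (-1) * a {6, 7, 8} * a {8, 9, 10}"
    unfolding cup_square_cp2_sum by (simp add: cp2_def)
  also have "\<dots> = t\<^sup>2"
    unfolding t0 e0 e1 e2 e3 e4 e5 e6 e7 e8 e9 e10 e11 e12 e13 e14 e15 e16 e17 e18 e19 e20 e21 e22 e23 e24
      e25 e26 e27 e28 e29 e30 e31 e32 e33 e34 e35 e36 e37 e38 e39 e40 e41 e42 e43 e44 e45 e46 e47 e48 e49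
      e50 e51 e52 e53 e54 by (simp add: algebra_simps power2_eq_square)
  finally show ?thesis by (simp add: t_def)
qed

text \<open>
  A generator of the second cohomology: the values \<open>\<plusminus> t\<close> of the previous proof for \<open>t = 1\<close>.
\<close>

definition chi :: "nat list \<Rightarrow> int" where
  "chi l = (if l \<in> set [[3, 4, 5], [3, 4, 6], [3, 4, 7], [4, 5, 10], [4, 6, 9], [4, 7, 8], [5, 6, 9],
    [6, 7, 8], [7, 8, 10]] then 1
    else if l \<in> set [[3, 5, 9], [3, 6, 8], [3, 7, 10], [5, 7, 10], [5, 9, 10], [6, 8, 9], [8, 9, 10]] then
      -1 else 0)"

definition chi_closed :: "nat list \<Rightarrow> bool" where
  "chi_closed l = (case l of [v0, v1, v2, v3] \<Rightarrow>
     chi [v1, v2, v3] - chi [v0, v2, v3] + chi [v0, v1, v3] - chi [v0, v1, v2] = 0 | _ \<Rightarrow> True)"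

lemma chi_closed_cp2: "list_all (\<lambda>p. list_all chi_closed (subseqs (snd p))) cp2"
  by code_simp

lemma sorted_cp2: "list_all (\<lambda>p. sorted_wrt (<) (snd p)) cp2"
  by code_simp

lemma sorted_subseqs: "sorted_wrt (<) F \<Longrightarrow> l \<in> set (subseqs F) \<Longrightarrow> sorted_wrt (<) l"
proof (induction F arbitrary: l)
  case (Cons x F)
  have sub: "v \<in> set F" if "l' \<in> set (subseqs F)" "v \<in> set l'" for l' v
    using that subseqs_powset[of F] by blast
  show ?case using Cons sub by (auto simp: Let_def)
qed simp

lemma cocycle_chi: "simplicial_cocycle2 (faces_of cp2) (\<lambda>\<sigma>. of_int (chi (sorted_list_of_set \<sigma>)))"
  unfolding simplicial_cocycle2_def
proof (intro allI impI)
  fix v0 v1 v2 v3 assume v: "v0 < v1 \<and> v1 < v2 \<and> v2 < v3 \<and> {v0, v1, v2, v3} \<in> faces_of cp2"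
  then obtain s F where F: "(s, F) \<in> set cp2" "{v0, v1, v2, v3} \<subseteq> set F" by (auto simp: faces_of_iff)
  have "{v0, v1, v2, v3} \<in> set ` set (subseqs F)" unfolding subseqs_powset using F(2) by simp
  then obtain l where l: "l \<in> set (subseqs F)" "set l = {v0, v1, v2, v3}" by auto
  have "sorted_wrt (<) F" using sorted_cp2 F(1) by (auto simp: list_all_iff)
  then have "sorted_wrt (<) l" by (rule sorted_subseqs[OF _ l(1)])
  then have "l = [v0, v1, v2, v3]" using l(2) v by (intro strict_sorted_equal) auto
  moreover have "chi_closed l" using chi_closed_cp2 F(1) l(1) by (force simp: list_all_iff)
  ultimately have c: "chi [v1, v2, v3] - chi [v0, v2, v3] + chi [v0, v1, v3] - chi [v0, v1, v2] = 0"
    by (simp add: chi_closed_def)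
  have s: "sorted_list_of_set {a, b, d} = [a, b, d]" if "a < b" "b < d" for a b d :: nat
    using that by (auto simp: insort_remove1 sorted_list_of_set_insert)
  have "(of_int (chi [v1, v2, v3] - chi [v0, v2, v3] + chi [v0, v1, v3] - chi [v0, v1, v2]) :: rat) = 0"
    unfolding c by simp
  then show "(of_int (chi (sorted_list_of_set {v1, v2, v3})) :: rat) - of_int (chi (sorted_list_of_set
    {v0, v2, v3}))
      + of_int (chi (sorted_list_of_set {v0, v1, v3})) - of_int (chi (sorted_list_of_set {v0, v1, v2})) = 0"
    using s v by simp
qed

lemma signature_cp2: "signature (faces_of cp2) (orient_of cp2) = 1"
proof (rule signature_of_square[of _ _ area])
  show "cup_square (faces_of cp2) (orient_of cp2) a = (area a)\<^sup>2" if "simplicial_cocycle2 (faces_of cp2)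
    a" for a
    using cup_square_cp2[OF that] .
  show "area (\<lambda>\<sigma>. \<Sum>i<p. t i * c i \<sigma>) = (\<Sum>i<p. t i * area (c i))" for p :: nat and t c
    unfolding area_def by (simp add: algebra_simps sum.distrib sum_subtractf)
  show "simplicial_cocycle2 (faces_of cp2) (\<lambda>\<sigma>. of_int (chi (sorted_list_of_set \<sigma>)))" by (rule cocycle_chi)
  show "area (\<lambda>\<sigma>. of_int (chi (sorted_list_of_set \<sigma>))) \<noteq> 0" unfolding area_def by (simp add: chi_def)
qed

lemma closed_oriented_cp2: "closed_oriented (faces_of cp2) (orient_of cp2)"
proof
  show "finite_complex (faces_of cp2)" by (rule finite_complex_faces_of) (simp add: cp2_def)
  show "orientation 5 (faces_of cp2) (orient_of cp2)" by (rule orientation_checked[OF orient_check_cp2])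
  show "\<exists>b. b \<noteq> a \<and> orient_of cp2 (b # xs) \<noteq> 0" if "orient_of cp2 (a # xs) \<noteq> 0" for a xs
    by (rule ridge_opposite[OF orient_check_cp2 that])
qed

lemma vertices_cp2: "\<Union>(faces_of cp2) = {2, 3, 4, 5, 6, 7, 8, 9, 10}"
  unfolding Union_faces_of by (simp add: cp2_def) auto

lemma link_iso:
  assumes "v \<in> \<Union>(faces_of cp2)"
  shows "\<exists>m. iso_check m True (lk v cp2) (lk 2 cp2)"
  using assms link_isos unfolding vertices_cp2 by auto

lemma manifold_cp2: "combinatorial_manifold 4 (faces_of cp2)"
  unfolding combinatorial_manifold_def
proof (intro conjI ballI impI)
  show "finite_complex (faces_of cp2)" by (rule closed_oriented.K[OF closed_oriented_cp2])
  have d: "distinct F" if "(s, F) \<in> set cp2" for s F using checked_distinct[OF orient_check_cp2 that] .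
  have L: "all_links 4 (lk v cp2)" if v: "v \<in> \<Union>(faces_of cp2)" for v
  proof -
    obtain m where m: "iso_check m True (lk v cp2) (lk 2 cp2)" using link_iso[OF v] by blast
    let ?g = "\<lambda>v. the (map_of m v)"
    note i = iso_check_eqv[OF m]
    have f: "faces_of (map_chain ?g (lk v cp2)) = faces_of (lk 2 cp2)" using i(2) by (simp add: eqv_def)
    have A: "all_links 4 (map_chain ?g (lk v cp2))"
      using all_links_sphere4[OF link_certificate] unfolding all_links_def f .
    let ?h = "inv_into (\<Union>(faces_of (lk v cp2))) ?g"
    have "map_chain ?h (map_chain ?g (lk v cp2)) = lk v cp2" by (rule map_chain_inverse[OF i(1)]) simp
    moreover have "inj_on ?h (\<Union>(faces_of (map_chain ?g (lk v cp2))))"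
      unfolding faces_of_map_chain by (rule inj_on_subset[OF inj_on_inv_into[OF subset_refl]]) auto
    ultimately show ?thesis using all_links_map[OF A, of ?h] by simp
  qed
  fix \<sigma> assume s: "\<sigma> \<in> faces_of cp2" "\<sigma> \<noteq> {}"
  have "card \<sigma> \<le> Suc 4 \<and> pl_sphere (Suc 4 - card \<sigma>) (link (faces_of cp2) \<sigma>)"
    by (rule link_faces_nonempty) (use d L s in auto)
  then show "card \<sigma> \<le> 4 + 1" "pl_sphere (4 + 1 - card \<sigma>) (link (faces_of cp2) \<sigma>)" by simp_all
qed

text \<open>
  Nine isomorphic links share the value \<open>3\<close>.
\<close>

theorem value_of_link:
  fixes f :: "ocomplex \<Rightarrow> rat"
  assumes \<phi>: "\<phi> \<in> local_cohomology 4" "f \<in> \<phi>"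
    and u: "poincare_dual 4 (faces_of cp2) 4 u (sharp_class 4 (faces_of cp2) 4 \<phi>)"
      "first_pontrjagin_class 4 (faces_of cp2) u"
  shows "val f (lk 2 cp2) = 1 / 3"
proof -
  have ff: "f \<in> local_formulae 4" using \<phi> unfolding local_cohomology_def by (elim quotientE) auto
  then have fc: "f \<in> local_cochains 4" by (simp add: local_formulae_def)
  have d: "\<And>s F. (s, F) \<in> set cp2 \<Longrightarrow> distinct F" using checked_distinct[OF orient_check_cp2] .
  have "(\<Sum>v\<in>\<Union>(faces_of cp2). f (link (faces_of cp2) {v}, induced (orient_of cp2) v)) = 3"
    using closed_oriented.sum_over_vertices_signature[OF closed_oriented_cp2 \<phi> manifold_cp2 u]
      signature_cp2 by simp
  also have "(\<Sum>v\<in>\<Union>(faces_of cp2). f (link (faces_of cp2) {v}, induced (orient_of cp2) v)) = (\<Sum>v\<in>\<Union>(faces_of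
    cp2). val f (lk 2 cp2))"
  proof (rule sum.cong[OF refl])
    fix v assume "v \<in> \<Union>(faces_of cp2)"
    then obtain m where "iso_check m True (lk v cp2) (lk 2 cp2)" using link_iso by blast
    from val_iso_check[OF fc this] have "val f (lk v cp2) = val f (lk 2 cp2)" by simp
    moreover have "val f (lk v cp2) = f (link (faces_of cp2) {v}, induced (orient_of cp2) v)"
      using link_faces_of[of cp2 v] induced_orient_of[of cp2 v] d by (simp add: val_def)
    ultimately show "f (link (faces_of cp2) {v}, induced (orient_of cp2) v) = val f (lk 2 cp2)" by simp
  qed
  finally show ?thesis unfolding vertices_cp2 by simp
qed

section \<open>The denominators\<close>

text \<open>
  Linear algebra in the values of the links: with \<open>y = f (lk 1 sphere_F)\<close> the relations yield
  \<open>14 \<rho>(2, 3) = y\<close> and \<open>f (lk 0 sphere_I) = - 10 y\<close>, while the links of \<open>cp2\<close> are isomorphic to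
  \<open>lk 0 sphere_I\<close>.
\<close>

lemma value_of_rho:
  fixes f :: "ocomplex \<Rightarrow> rat"
  assumes f: "f \<in> local_formulae 4" and L: "val f (lk 2 cp2) = 1 / 3"
  shows "rho f 2 3 = 1 / 420 \<or> rho f 2 3 = - 1 / 420"
proof -
  have fc: "f \<in> local_cochains 4" using f by (simp add: local_formulae_def)
  have r: "val f (two_arcs [7, 8] [9, 10, 11]) = rho f 2 3" "val f (two_arcs [7] [8, 9, 10, 11]) = rho f 1 4"
    "val f (two_arcs [7] [8, 9, 10]) = rho f 1 3" "val f (two_arcs [7] [8, 9]) = rho f 1 2"
    using val_two_arcs[OF fc, of "[7, 8]" "[9, 10, 11]"] val_two_arcs[OF fc, of "[7]" "[8, 9, 10, 11]"]
      val_two_arcs[OF fc, of "[7]" "[8, 9, 10]"] val_two_arcs[OF fc, of "[7]" "[8, 9]"]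
    by (simp_all add: circle_def numeral_eq_Suc)
  note c = val_iso_check[OF fc link_in_sphere_I]
  show ?thesis
    using certificate_A[OF f] certificate_B[OF f] certificate_C[OF f] certificate_D[OF f] certificate_E[OF f] certificate_F[OF f]
      certificate_G[OF f] certificate_H[OF f] certificate_I[OF f] certificate_J[OF f] certificate_K[OF f]
      rho_small[OF f] c L unfolding r by simp
qed

lemma vertices_two_arcs:
  assumes "P \<noteq> []" "Q \<noteq> []" "circle (P @ Q)"
  shows "card (\<Union>(faces_of (two_arcs P Q))) \<le> length P + length Q + 5"
proof -
  have "\<Union>(faces_of (two_arcs P Q)) \<subseteq> {0, 1, 2, 4, 5} \<union> set (P @ Q)"
    unfolding two_arcs_def by (rule Union_faces_near[OF near_starred3[OF assms(3)]])
  then have "card (\<Union>(faces_of (two_arcs P Q))) \<le> card ({0, 1, 2, 4, 5} \<union> set (P @ Q))" by (intro card_mono) auto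
  also have "\<dots> \<le> card {0, 1, 2, 4, 5 :: nat} + card (set (P @ Q))" by (rule card_Un_le)
  also have "\<dots> \<le> 5 + length (P @ Q)" using card_length[of "P @ Q"] by simp
  finally show ?thesis by simp
qed

text \<open>
  The sphere has \<open>p + q + 5\<close> vertices.
\<close>

lemma den_rho:
  assumes "1 \<le> p" "1 \<le> q" "3 \<le> p + q" "p + q + 5 \<le> l"
  shows "snd (quotient_of (rho f p q)) dvd den 4 l f"
proof -
  let ?P = "[7..<7 + p]" and ?Q = "[7 + p..<7 + p + q]"
  have ne: "?P \<noteq> []" "?Q \<noteq> []" and c: "circle (?P @ ?Q)" using assms by (auto simp: circle_def)
  have "sph 4 (two_arcs ?P ?Q)" unfolding two_arcs_def by (rule sph_starred3[OF c two_arcs_edges[OF ne c]])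
  then have "oriented_sphere 4 (faces_of (two_arcs ?P ?Q), orient_of (two_arcs ?P ?Q))" by (simp add: sph_def)
  moreover have "card (\<Union>(faces_of (two_arcs ?P ?Q))) \<le> l" using vertices_two_arcs[OF ne c] assms by simp
  ultimately show ?thesis unfolding den_def rho_def val_def by (intro dvd_Lcm) force
qed

lemma unit_fraction_den:
  fixes k :: int
  assumes "x = 1 / of_int k \<or> x = - 1 / of_int k" "0 < k"
  shows "snd (quotient_of x) = k"
proof -
  have "1 / of_int k = Fract 1 k" "- 1 / of_int k = Fract (- 1) k"
    by (simp_all add: Fract_of_int_quotient)
  then show ?thesis using assms by (auto simp: quotient_of_Fract Rat.normalize_def)
qed

theorem proposition3p17:
  fixes \<phi> :: "(ocomplex \<Rightarrow> rat) set" and f :: "ocomplex \<Rightarrow> rat" and l :: nat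
  assumes "\<phi> \<in> local_cohomology 4"
    and "\<And>m K. combinatorial_manifold m K \<Longrightarrow>
           \<exists>u. poincare_dual m K 4 u (sharp_class m K 4 \<phi>) \<and> first_pontrjagin_class m K u"
    and "f \<in> \<phi>"
    and "even l" and "l \<ge> 10"
  shows "Lcm {1..int l - 3} dvd den 4 l f"
proof -
  have f: "f \<in> local_formulae 4" using assms(1,3) unfolding local_cohomology_def by (elim quotientE) auto
  obtain u where u: "poincare_dual 4 (faces_of cp2) 4 u (sharp_class 4 (faces_of cp2) 4 \<phi>)"
    "first_pontrjagin_class 4 (faces_of cp2) u"
    using assms(2)[OF manifold_cp2] by blast
  have r: "rho f 2 3 = 1 / 420 \<or> rho f 2 3 = - 1 / 420"
    by (rule value_of_rho[OF f value_of_link[OF assms(1,3) u]])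
  have key: "2 * int n * (int n + 1) * (int n + 2) dvd den 4 l f" if n: "odd n" "5 \<le> n" "n + 5 \<le> l" for n
  proof -
    obtain p where p: "n = 2 * p + 1" using n(1) by (elim oddE)
    let ?k = "2 * int n * (int n + 1) * (int n + 2)"
    have p2: "2 \<le> p" "p + 2 \<le> n" "n - p = p + 1" using p n(2) by auto
    have "rho f p (p + 1) = 210 * rho f 2 3 / (of_nat n * (of_nat n + 1) * (of_nat n + 2))"
      using rho_formula[OF f n(2) p2(1,2)] p2(3) p by simp
    moreover have "210 * rho f 2 3 = 1 / 2 \<or> 210 * rho f 2 3 = - 1 / 2" using r by auto
    ultimately have "rho f p (p + 1) = 1 / 2 / (of_nat n * (of_nat n + 1) * (of_nat n + 2)) \<or>
      rho f p (p + 1) = - 1 / 2 / (of_nat n * (of_nat n + 1) * (of_nat n + 2))" by (elim disjE) simp_all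
    moreover have "(of_int ?k :: rat) = 2 * (of_nat n * (of_nat n + 1) * (of_nat n + 2))" by simp
    ultimately have "rho f p (p + 1) = 1 / of_int ?k \<or> rho f p (p + 1) = - 1 / of_int ?k"
      unfolding divide_divide_eq_left by (simp only:)
    then have "snd (quotient_of (rho f p (p + 1))) = ?k"
      by (rule unit_fraction_den) (use n(2) in simp)
    moreover have "snd (quotient_of (rho f p (p + 1))) dvd den 4 l f"
      by (rule den_rho) (use p n in auto)
    ultimately show ?thesis by simp
  qed
  show ?thesis
  proof (rule Lcm_least)
    fix k assume "k \<in> {1..int l - 3}"
    then have k: "1 \<le> k" "k \<le> int l - 3" by auto
    define m where "m = nat k"
    have m: "k = int m" "1 \<le> m" "m + 3 \<le> l" using k by (auto simp: m_def)
    \<comment> \<open>The numbers up to \<open>5\<close> divide \<open>420\<close>, the value at \<open>n = 5\<close>. Otherwise \<open>n\<close> is the odd one of \<open>m - 1\<close> and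
      \<open>m - 2\<close>; since \<open>l - 3\<close> is odd, an even \<open>m\<close> is at most \<open>l - 4\<close> and \<open>n \<le> l - 5\<close> in both cases.\<close>
    consider "m \<le> 5" | "5 < m" "even m" | "5 < m" "odd m" by linarith
    then show "k dvd den 4 l f"
    proof cases
      case 1
      then have "m = 1 \<or> m = 2 \<or> m = 3 \<or> m = 4 \<or> m = 5" using m(2) by auto
      then have "k dvd 2 * int 5 * (int 5 + 1) * (int 5 + 2)" using m(1) by auto
      then show ?thesis using key[of 5] assms(5) by (rule_tac dvd_trans) simp_all
    next
      case 2
      define n where "n = m - 1"
      have "m + 3 \<noteq> l" using 2(2) assms(4) by auto
      then have n: "odd n" "5 \<le> n" "n + 5 \<le> l" "m = n + 1" using 2 m by (simp_all add: n_def)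
      have "k = int n + 1" using m(1) n(4) by simp
      then have "k dvd 2 * int n * (int n + 1) * (int n + 2)" by (metis dvd_mult2 dvd_triv_right)
      then show ?thesis using key[OF n(1-3)] by (rule dvd_trans)
    next
      case 3
      define n where "n = m - 2"
      have n: "odd n" "5 \<le> n" "n + 5 \<le> l" "m = n + 2" using 3 m by (auto simp: n_def elim!: oddE)
      have "k = int n + 2" using m(1) n(4) by simp
      then have "k dvd 2 * int n * (int n + 1) * (int n + 2)" by simp
      then show ?thesis using key[OF n(1-3)] by (rule dvd_trans)
    qed
  qed
qed

end
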